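(* Let $d\ge 2$, $I=[0,1]$, let $\gamma:I\to\mathbb R^d$ be of class $C^\infty(I)$, and let $0<\alpha\le d$. Suppose that $\mu$ is a positive Borel measure on $\mathbb R^d$ for which there is a constant $C_\mu$ with $\mu(B(x,\rho))\le C_\mu\rho^\alpha$ for all $x\in\mathbb R^d$, $\rho>0$, and suppose that $\gamma$ is of finite type. Let $1\le p,q\le\infty$ satisfy \[ \frac dq\le 1-\frac1p,\qquad q\ge 2d,\qquad \frac{\beta(\alpha)}{q}+\frac1p<1,\qquad q>\beta(\alpha)+1 . \] Then there exists a constant $C$ such that \[ \|T_\lambda^\gamma[w_\gamma^\alpha,f]\|_{L^q(d\mu)}\le C\lambda^{-\frac{\alpha}{q}}\|f\|_{L^p(w_\gamma^\alpha dt)} \] for all $\lambda\ge1$ and all $f\in L^p(I,w_\gamma^\alpha dt)$.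
   Context: $B(x,\rho)$ is the ball in $\mathbb R^d$ of radius $\rho$ centred at $x$. For $0<\alpha\le d$, $\beta(\alpha)=(j+1)\alpha+\frac{(d-j-1)(d-j)}{2}$ if $d-j-1<\alpha\le d-j$, $j=0,\dots,d-1$. For a weight $w$ on $I$, $T_\lambda^\gamma[w,f](x)=\int_I e^{i\lambda x\cdot\gamma(t)}f(t)w(t)\,dt$, $x\in\mathbb R^d$. The weight $w_\gamma^\alpha$ is $w_\gamma^\alpha(t)=|\det(\gamma'(t),\gamma''(t),\dots,\gamma^{(d)}(t))|^{1/\beta(\alpha)}$. A smooth curve $\gamma:I\to\mathbb R^d$ is of finite type at $t\in I$ if there exist positive integers $a_1<a_2<\dots<a_d$ such that $\det(\gamma^{(a_1)}(t),\gamma^{(a_2)}(t),\dots,\gamma^{(a_d)}(t))\ne0$; $\gamma$ is of finite type if it is of finite type at every $t\in I$. *)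

theory Defs
  imports "HOL-Analysis.Analysis" "HOL-Probability.Essential_Supremum"
begin

definition beta_exp :: "nat \<Rightarrow> real \<Rightarrow> real" where
  "beta_exp d \<alpha> =
    (let j = (THE j::nat. j < d \<and> real d - real j - 1 < \<alpha> \<and> \<alpha> \<le> real d - real j)
     in (real j + 1) * \<alpha> + (real d - real j - 1) * (real d - real j) / 2)"

text \<open>Derivatives are taken within [0,1], hence one-sided at the endpoints; on [0,1] they
  depend only on the restriction of the curve to [0,1].\<close>

definition curve_deriv :: "nat \<Rightarrow> (real \<Rightarrow> 'a::real_normed_vector) \<Rightarrow> real \<Rightarrow> 'a" where
  "curve_deriv k \<gamma> = ((\<lambda>g t. vector_derivative g (at t within {0..1})) ^^ k) \<gamma>"

definition smooth_curve :: "(real \<Rightarrow> 'a::real_normed_vector) \<Rightarrow> bool" where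
  "smooth_curve \<gamma> \<longleftrightarrow> (\<forall>k. curve_deriv k \<gamma> differentiable_on {0..1})"

text \<open>The determinant of the matrix whose columns are the derivatives of orders
  \<open>a 1, \<dots>, a d\<close>, where \<open>d = CARD('n)\<close>. The columns are indexed by \<open>'n\<close>, which is identified
  with \<open>{1..d}\<close> through a fixed enumeration. Another enumeration could only change the sign,
  and below the determinant occurs only in an absolute value or in a nonvanishing condition.\<close>

definition curve_det :: "(nat \<Rightarrow> nat) \<Rightarrow> (real \<Rightarrow> real ^ 'n) \<Rightarrow> real \<Rightarrow> real" where
  "curve_det a \<gamma> t =
    det (\<chi> i j. curve_deriv (a (Suc (to_nat_on (UNIV :: 'n set) j))) \<gamma> t $ i)"

definition finite_type_at :: "(real \<Rightarrow> real ^ 'n) \<Rightarrow> real \<Rightarrow> bool" where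
  "finite_type_at \<gamma> t \<longleftrightarrow>
    (\<exists>a :: nat \<Rightarrow> nat. (\<forall>i\<in>{1..CARD('n)}. 0 < a i) \<and> strict_mono_on {1..CARD('n)} a \<and>
      curve_det a \<gamma> t \<noteq> 0)"

definition finite_type :: "(real \<Rightarrow> real ^ 'n) \<Rightarrow> bool" where
  "finite_type \<gamma> \<longleftrightarrow> (\<forall>t\<in>{0..1}. finite_type_at \<gamma> t)"

definition curve_weight :: "(real \<Rightarrow> real ^ 'n) \<Rightarrow> real \<Rightarrow> real \<Rightarrow> real" where
  "curve_weight \<gamma> \<alpha> t = \<bar>curve_det (\<lambda>i. i) \<gamma> t\<bar> powr (1 / beta_exp CARD('n) \<alpha>)"

definition osc_op ::
    "(real \<Rightarrow> real ^ 'n) \<Rightarrow> real \<Rightarrow> (real \<Rightarrow> real) \<Rightarrow> (real \<Rightarrow> complex) \<Rightarrow> real ^ 'n \<Rightarrow> complex" where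
  "osc_op \<gamma> lam w f x =
    (LINT t:{0..1}|lebesgue. exp (\<i> * of_real (lam * (x \<bullet> \<gamma> t))) * f t * of_real (w t))"

definition weighted_measure :: "(real \<Rightarrow> real) \<Rightarrow> real measure" where
  "weighted_measure w = density (lebesgue_on {0..1}) (\<lambda>t. ennreal (w t))"

text \<open>Exponents \<open>1 \<le> p \<le> \<infinity>\<close> are extended reals.\<close>

definition Lp_norm :: "ereal \<Rightarrow> 'a measure \<Rightarrow> ('a \<Rightarrow> complex) \<Rightarrow> ennreal" where
  "Lp_norm p M f =
    (if p = \<infinity> then esssup M (\<lambda>x. ennreal (norm (f x)))
     else let J = (\<integral>\<^sup>+x. ennreal (norm (f x) powr real_of_ereal p) \<partial>M)
          in if J = \<infinity> then \<infinity> else ennreal (enn2real J powr (1 / real_of_ereal p)))"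

definition Lp_space :: "ereal \<Rightarrow> 'a measure \<Rightarrow> ('a \<Rightarrow> complex) set" where
  "Lp_space p M = {f \<in> borel_measurable M. Lp_norm p M f < \<infinity>}"

end

theory Submission
  imports Defs "HOL-Probability.Probability"
begin

text \<open>Let \<open>E\<^sub>J f\<close> be the oscillatory integral over an arc \<open>J\<close>. For \<open>d\<close> separated arcs of a nondegenerate curve the product
  of the \<open>E\<^sub>J f\<close> is a Fourier transform on the whole space, because \<open>t \<mapsto> \<gamma>(t\<^sub>1) + \<dots> + \<gamma>(t\<^sub>d)\<close> is injective with
  nonvanishing Jacobian. Such a transform is bounded from \<open>L\<^sup>2\<close> to \<open>L\<^sup>2\<close> of a measure whose unit balls have bounded mass
  (duality with a Gaussian), and interpolation with the trivial \<open>L\<^sup>1\<close> bound gives a multilinear estimate. Rescaling a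
  short arc of length \<open>h\<close> turns the measure into one whose \<open>\<alpha>\<close>-dimensional constant grows like \<open>h\<close> to the power
  \<open>-\<beta>(\<alpha>)\<close>, since an anisotropic box is covered by cubes of a suitable side length. As \<open>\<beta>(\<alpha>)/q + 1/p < 1\<close>, the
  induction on scales of Bourgain and Guth then deduces the linear estimate from the multilinear one.

  Near a point of finite type the coordinates of the curve, in a suitable basis, behave like \<open>h ^ a i\<close> with
  distinct \<open>a i\<close>. On the dyadic arc at distance \<open>h\<close> the loss from rescaling is compensated by the weight, with a
  positive power of \<open>h\<close> to spare, so that the dyadic estimates can be summed. Finally the parameter \<open>\<lambda>\<close> is
  removed by dilating the measure, and exponents \<open>p > q\<close> are reduced to \<open>p = q\<close> by Hoelder's inequality.\<close>

section \<open>Determinants and sums along curves\<close>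

text \<open>The exponents shape the proof. The product estimate is made in \<open>L^(q/d)\<close>:
  \<open>2 * d \<le> q\<close> places this exponent at or beyond 2, where interpolation with the
  trivial bound starts, and \<open>d / q \<le> 1 - 1 / p\<close> makes the dual exponent at most
  \<open>p\<close>. The linear estimate further needs \<open>p \<le> q\<close>, so that the norms of
  \<open>f\<close> on the pieces of a partition can be added up. An induction on scales has to end
  with a trivial bound, and this bound sees the total mass of the measure. Therefore all measures
  are finite until the last section, and the constants must depend on the growth bound alone;
  restriction to balls and monotone convergence then give the general case. Constants must also be
  uniform over a class of curves, since each dyadic arc at a point of finite type yields a rescaled
  curve of its own. This is why nondegeneracy is quantitative and lower bounds are drawn from
  compactness. Arcs are joined by a geometric summation that treats the two sides of a point, and
  the signs of \<open>h\<close>, alike.\<close>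

definition moment_deriv :: "('m::finite \<Rightarrow> nat) \<Rightarrow> real \<Rightarrow> real ^ 'm" where
  "moment_deriv rk s = (\<chi> i. s ^ (rk i - 1) / fact (rk i - 1))"

text \<open>\<open>moment_deriv rk s\<close> is the velocity of the curve with coordinates
  \<open>s^k / k!\<close>, \<open>k = rk i\<close>, so this is a Vandermonde determinant up to
  factorials: a kernel vector yields a polynomial of degree below \<open>d\<close> that vanishes at
  the \<open>d\<close> distinct numbers \<open>t $ j\<close>.\<close>

lemma det_moment_deriv_nonzero:
  fixes t :: "real ^ 'm::finite"
  assumes rk: "bij_betw rk (UNIV :: 'm set) {1..CARD('m)}"
    and inj: "\<And>i j. i \<noteq> j \<Longrightarrow> t $ i \<noteq> t $ j"
  shows "det ((\<chi> j. moment_deriv rk (t $ j)) :: real ^ 'm ^ 'm) \<noteq> 0"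
proof
  let ?A = "(\<chi> j. moment_deriv rk (t $ j)) :: real ^ 'm ^ 'm"
  assume "det ?A = 0"
  then have "\<not> (\<exists>B. B ** ?A = mat 1)"
    using invertible_det_nz invertible_left_inverse by blast
  then have "\<not> (\<forall>x. ?A *v x = 0 \<longrightarrow> x = 0)"
    by (simp add: matrix_left_invertible_ker)
  then obtain v where v: "?A *v v = 0" "v \<noteq> 0" by auto
  define p where "p = (\<Sum>i\<in>UNIV. monom (v $ i / fact (rk i - 1)) (rk i - 1))"
  have rk1: "1 \<le> rk i" "rk i \<le> CARD('m)" for i
    using bij_betwE[OF rk] by auto
  have root: "poly p (t $ j) = 0" for j
  proof -
    have "poly p (t $ j) = (?A *v v) $ j"
      by (simp add: p_def poly_sum poly_monom matrix_vector_mult_def moment_deriv_def mult.commute)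
    then show ?thesis using v by simp
  qed
  have deg: "degree p < CARD('m)"
  proof -
    have "degree p \<le> CARD('m) - 1" unfolding p_def
    proof (rule degree_sum_le)
      fix i :: 'm
      show "degree (monom (v $ i / fact (rk i - 1)) (rk i - 1)) \<le> CARD('m) - 1"
        using rk1[of i] degree_monom_le[of "v $ i / fact (rk i - 1)" "rk i - 1"] by linarith
    qed auto
    then show ?thesis using zero_less_card_finite[where 'a='m] by linarith
  qed
  have "p = 0"
  proof (rule ccontr)
    assume "p \<noteq> 0"
    have "CARD('m) = card (range (\<lambda>j. t $ j))"
      by (rule card_image[symmetric]) (metis inj injI)
    also have "\<dots> \<le> card {x. poly p x = 0}"
      by (rule card_mono[OF poly_roots_finite[OF \<open>p \<noteq> 0\<close>]]) (auto simp: root)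
    also have "\<dots> \<le> degree p" by (rule card_poly_roots_bound[OF \<open>p \<noteq> 0\<close>])
    finally show False using deg by simp
  qed
  have "v $ k = 0" for k
  proof -
    \<comment> \<open>\<open>rk \<ge> 1\<close> keeps the truncated subtraction injective, so each
      coefficient of \<open>p\<close> comes from a single coordinate of \<open>v\<close>.\<close>
    have eq: "rk i - Suc 0 = rk k - Suc 0 \<longleftrightarrow> i = k" for i
      using rk1[of i] rk1[of k] bij_betw_imp_inj_on[OF rk] by (auto simp: inj_on_def) 
    have "coeff p (rk k - 1) = v $ k / fact (rk k - 1)"
      by (simp add: p_def coeff_sum eq)
    then show ?thesis using \<open>p = 0\<close> by simp
  qed
  then show False using v by (simp add: vec_eq_iff)
qed

lemma norm_le_sum_rows:
  fixes M :: "real ^ 'm ^ 'k"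
  shows "norm M \<le> (\<Sum>j\<in>UNIV. norm (M $ j))"
  unfolding norm_vec_def[of M] by (rule L2_set_le_sum) auto

lemma continuous_on_det [continuous_intros]:
  fixes f :: "'a::topological_space \<Rightarrow> real ^ 'm ^ 'm"
  assumes "continuous_on S f"
  shows "continuous_on S (\<lambda>x. det (f x))"
  unfolding det_def by (intro continuous_intros assms)

text \<open>Compactness turns nonvanishing into a uniform margin. It serves for the moment matrices
  and again for the limits of rescaled arcs at a point of finite type.\<close>

lemma det_bound_near_compact:
  fixes Z :: "(real ^ 'n::finite ^ 'n) set"
  assumes Z: "compact Z" and nz: "\<And>X. X \<in> Z \<Longrightarrow> det X \<noteq> 0"
  obtains e c where "0 < e" "0 < c" "\<And>X M. X \<in> Z \<Longrightarrow> norm (M - X) < e \<Longrightarrow> c \<le> \<bar>det M\<bar>"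
proof -
  obtain c where c: "0 < c" "\<And>M. M \<in> Z \<Longrightarrow> c < \<bar>det M\<bar>"
  proof (cases "Z = {}")
    case False
    have "continuous_on Z (\<lambda>M. \<bar>det M\<bar>)" by (intro continuous_intros)
    from continuous_attains_inf[OF Z False this] obtain M0
      where "M0 \<in> Z" "\<And>M. M \<in> Z \<Longrightarrow> \<bar>det M0\<bar> \<le> \<bar>det M\<bar>" by auto
    \<comment> \<open>Half of the minimum leaves a strict inequality, hence an open neighbourhood of
      \<open>Z\<close>.\<close>
    with nz[of M0] show ?thesis by (intro that[of "\<bar>det M0\<bar> / 2"]) force+
  qed (use that[of 1] in auto)
  have "open {M :: real ^ 'n ^ 'n. c < \<bar>det M\<bar>}"
    by (intro open_Collect_less continuous_intros)
  from compact_subset_open_imp_ball_epsilon_subset[OF Z this] c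
  obtain e where e: "0 < e" "(\<Union>x\<in>Z. ball x e) \<subseteq> {M. c < \<bar>det M\<bar>}" by blast
  have "c \<le> \<bar>det M\<bar>" if "X \<in> Z" "norm (M - X) < e" for X M
  proof -
    have "M \<in> ball X e" using that(2) by (simp add: dist_norm norm_minus_commute)
    with e(2) that(1) have "M \<in> {M. c < \<bar>det M\<bar>}" by blast
    then show ?thesis by simp
  qed
  with e(1) c(1) show ?thesis by (rule that)
qed

text \<open>The separation \<open>\<delta>\<close> confines \<open>t\<close> to a compact set on
  which the Vandermonde determinant has no zero. The tolerance is measured row by row because each
  row of \<open>M\<close> will be the velocity of a curve at its own parameter.\<close>

lemma det_near_moment_deriv:
  fixes rk :: "'m::finite \<Rightarrow> nat"
  assumes rk: "bij_betw rk (UNIV :: 'm set) {1..CARD('m)}" and "0 < \<delta>"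
  obtains \<eta> c where "0 < \<eta>" "0 < c"
    "\<And>(t :: real ^ 'm) (M :: real ^ 'm ^ 'm). \<lbrakk>\<And>i. t $ i \<in> {0..1}; \<And>i j. i \<noteq> j \<Longrightarrow> \<delta> \<le> \<bar>t $ i - t $ j\<bar>;
       \<And>j. norm (M $ j - moment_deriv rk (t $ j)) \<le> \<eta>\<rbrakk> \<Longrightarrow> c \<le> \<bar>det M\<bar>"
proof -
  define K where "K = {t :: real ^ 'm. (\<forall>i. t $ i \<in> {0..1}) \<and> (\<forall>i j. i \<noteq> j \<longrightarrow> \<delta> \<le> \<bar>t $ i - t $ j\<bar>)}"
  define V where "V = (\<lambda>t :: real ^ 'm. (\<chi> j. moment_deriv rk (t $ j)) :: real ^ 'm ^ 'm)"
  have contV: "continuous_on UNIV V"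
    unfolding V_def moment_deriv_def by (intro continuous_intros) auto
  have "K = (cbox 0 1 \<inter> (\<Inter>i. \<Inter>j. {t. i \<noteq> j \<longrightarrow> \<delta> \<le> \<bar>t $ i - t $ j\<bar>}))"
    by (auto simp: K_def mem_box_cart)
  moreover have "closed {t :: real ^ 'm. i \<noteq> j \<longrightarrow> \<delta> \<le> \<bar>t $ i - t $ j\<bar>}" for i j
    by (cases "i = j") (auto intro!: closed_Collect_le continuous_intros)
  ultimately have "compact K"
    by (auto intro!: compact_Int_closed closed_INT)
  then have cV: "compact (V ` K)"
    by (rule compact_continuous_image[OF continuous_on_subset[OF contV], rotated]) auto
  have nz: "det M \<noteq> 0" if "M \<in> V ` K" for M
    using that \<open>0 < \<delta>\<close> by (auto simp: V_def K_def intro!: det_moment_deriv_nonzero[OF rk]) fastforce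
  obtain e c where e: "0 < e" and c: "0 < c"
    and near: "\<And>X M. X \<in> V ` K \<Longrightarrow> norm (M - X) < e \<Longrightarrow> c \<le> \<bar>det M\<bar>"
    using det_bound_near_compact[OF cV nz] by metis
  \<comment> \<open>The row errors add up to at most
    \<open>CARD('m) * \<eta> = e / 2\<close>.\<close>
  define \<eta> where "\<eta> = e / (2 * CARD('m))"
  have "0 < \<eta>" using e by (simp add: \<eta>_def)
  moreover have "c \<le> \<bar>det M\<bar>" if t: "\<And>i. t $ i \<in> {0..1}" "\<And>i j. i \<noteq> j \<Longrightarrow> \<delta> \<le> \<bar>t $ i - t $ j\<bar>"
    and M: "\<And>j. norm (M $ j - moment_deriv rk (t $ j)) \<le> \<eta>" for t :: "real ^ 'm" and M :: "real ^ 'm ^ 'm"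
  proof -
    have "t \<in> K" using t by (auto simp: K_def)
    have "norm (M - V t) \<le> (\<Sum>j\<in>UNIV. norm ((M - V t) $ j))" by (rule norm_le_sum_rows)
    also have "\<dots> \<le> (\<Sum>j\<in>(UNIV::'m set). \<eta>)" by (intro sum_mono) (use M in \<open>simp add: V_def\<close>)
    also have "\<dots> < e" using e by (simp add: \<eta>_def)
    finally show ?thesis using \<open>t \<in> K\<close> by (intro near[of "V t"]) auto
  qed
  ultimately show ?thesis using that[of \<eta> c] \<open>0 < c\<close> by blast
qed

section \<open>Injectivity of sums of points on a curve\<close>

lemma bounded_linear_det_row:
  fixes w :: "'m::finite \<Rightarrow> real ^ 'm"
  shows "bounded_linear (\<lambda>v. det ((\<chi> j. if j = k then v else w j) :: real ^ 'm ^ 'm))"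
proof (rule linear_conv_bounded_linear[THEN iffD1], rule linearI)
  fix x y :: "real ^ 'm" and c :: real
  show "det ((\<chi> j. if j = k then x + y else w j) :: real ^ 'm ^ 'm)
    = det ((\<chi> j. if j = k then x else w j) :: real ^ 'm ^ 'm) + det ((\<chi> j. if j = k then y else w j) :: real ^ 'm ^ 'm)"
    using det_row_add[of k "\<lambda>_. x" "\<lambda>_. y" w] by simp
  show "det ((\<chi> j. if j = k then c *\<^sub>R x else w j) :: real ^ 'm ^ 'm)
    = c *\<^sub>R det ((\<chi> j. if j = k then x else w j) :: real ^ 'm ^ 'm)"
    using det_row_mul[of k c "\<lambda>_. x" w] unfolding real_scaleR_def
    by (simp only: scalar_mult_eq_scaleR)
qed

text \<open>For vector-valued functions the mean value theorem holds after a linear functional is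
  applied; below, \<open>L\<close> is the determinant as a function of one row. Derivatives are
  taken within \<open>T\<close>, so that the end points of \<open>{0..1}\<close> are
  allowed.\<close>

lemma vector_derivative_mvt:
  fixes h :: "real \<Rightarrow> 'a::real_normed_vector" and L :: "'a \<Rightarrow> real"
  assumes L: "bounded_linear L" and J: "convex J" "s \<in> J" "t \<in> J"
    and h: "\<And>u. u \<in> J \<Longrightarrow> (h has_vector_derivative h' u) (at u within T)" and "J \<subseteq> T"
  obtains \<xi> where "\<xi> \<in> J" "L (h t - h s) = (t - s) * L (h' \<xi>)"
proof -
  interpret L: bounded_linear L by fact
  have main: "\<exists>\<xi>\<in>J. L (h b - h a) = (b - a) * L (h' \<xi>)" if ab: "a \<in> J" "b \<in> J" "a < b" for a b
  proof -
    have sub: "{a..b} \<subseteq> J"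
      using that J(1) by (metis atLeastAtMost_iff closed_segment_eq_real_ivl convex_contains_segment less_imp_le)
    have d: "((\<lambda>u. L (h u)) has_derivative (\<lambda>y. L (y *\<^sub>R h' u))) (at u within {a..b})" if "a \<le> u" "u \<le> b" for u
    proof -
      have "(h has_derivative (\<lambda>y. y *\<^sub>R h' u)) (at u within {a..b})"
        using h[of u] sub that \<open>J \<subseteq> T\<close> unfolding has_vector_derivative_def
        by (intro has_derivative_subset[where t="{a..b}" and s=T]) auto
      from bounded_linear.has_derivative[OF L this] show ?thesis .
    qed
    from mvt_simple[OF \<open>a < b\<close> d] obtain \<xi> where "\<xi> \<in> {a<..<b}" "L (h b) - L (h a) = L ((b - a) *\<^sub>R h' \<xi>)"
      by auto
    then show ?thesis using sub by (intro bexI[of _ \<xi>]) (auto simp: L.diff L.scaleR)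
  qed
  consider "s = t" | "s < t" | "t < s" by linarith
  then show ?thesis
  proof cases
    case 1 then show ?thesis using that[of s] J by (simp add: L.zero)
  next
    case 2 then show ?thesis using main[of s t] J that by blast
  next
    case 3
    from main[of t s] 3 J obtain \<xi> where \<xi>: "\<xi> \<in> J" "L (h s - h t) = (s - t) * L (h' \<xi>)" by blast
    have "L (h t - h s) = - L (h s - h t)" by (simp add: L.diff)
    then show ?thesis using that[of \<xi>] \<xi> by (simp add: algebra_simps)
  qed
qed

text \<open>One application of the real mean value theorem per row of the determinant.\<close>

lemma det_increments_mvt:
  fixes h :: "real \<Rightarrow> real ^ 'm::finite"
  assumes "finite I"
    and J: "\<And>j. convex (J j)" "\<And>j. s j \<in> J j" "\<And>j. t j \<in> J j" "\<And>j. J j \<subseteq> T"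
    and h: "\<And>u. u \<in> T \<Longrightarrow> (h has_vector_derivative h' u) (at u within T)"
  shows "\<exists>\<xi>. (\<forall>j. \<xi> j \<in> J j) \<and>
    det ((\<chi> j. if j \<in> I then h (t j) - h (s j) else w j) :: real ^ 'm ^ 'm) =
    (\<Prod>j\<in>I. t j - s j) * det ((\<chi> j. if j \<in> I then h' (\<xi> j) else w j) :: real ^ 'm ^ 'm)"
  using \<open>finite I\<close>
proof (induction I arbitrary: w rule: finite_induct)
  case empty then show ?case using J by auto
next
  case (insert k I)
  let ?v = "\<lambda>j. h (t j) - h (s j)"
  \<comment> \<open>The increment in row \<open>k\<close> is kept as a constant row while the rows
    in \<open>I\<close> are treated; only then is it replaced by a derivative.\<close>
  from insert.IH[of "\<lambda>j. if j = k then ?v k else w j"] obtain \<xi> where \<xi>: "\<And>j. \<xi> j \<in> J j"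
    and eq: "det ((\<chi> j. if j \<in> I then ?v j else if j = k then ?v k else w j) :: real ^ 'm ^ 'm) =
    (\<Prod>j\<in>I. t j - s j) * det ((\<chi> j. if j \<in> I then h' (\<xi> j) else if j = k then ?v k else w j) :: real ^ 'm ^ 'm)"
    by blast
  define w' where "w' = (\<lambda>j. if j \<in> I then h' (\<xi> j) else w j)"
  have r1: "(\<lambda>j. if j \<in> I then ?v j else if j = k then ?v k else w j) = (\<lambda>j. if j \<in> insert k I then ?v j else w j)"
    using insert.hyps by auto
  have r2: "(\<lambda>j. if j \<in> I then h' (\<xi> j) else if j = k then x else w j) = (\<lambda>j. if j = k then x else w' j)" for x
    using insert.hyps by (auto simp: w'_def)
  have h2: "(h has_vector_derivative h' u) (at u within T)" if "u \<in> J k" for u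
    using h J(4) that by blast
  obtain z where z: "z \<in> J k" "det ((\<chi> j. if j = k then ?v k else w' j) :: real ^ 'm ^ 'm) =
     (t k - s k) * det ((\<chi> j. if j = k then h' z else w' j) :: real ^ 'm ^ 'm)"
    by (rule vector_derivative_mvt[OF bounded_linear_det_row J(1) J(2) J(3) h2 J(4)])
  have r3: "(\<lambda>j. if j = k then h' z else w' j) = (\<lambda>j. if j \<in> insert k I then h' ((\<xi>(k := z)) j) else w j)"
    using insert.hyps by (auto simp: w'_def)
  show ?case
    using eq z \<xi> insert.hyps unfolding r1 r2 r3
    by (intro exI[of _ "\<xi>(k := z)"]) (auto simp: algebra_simps)
qed

text \<open>If two parameters had the same image, the increments in the coordinates where they
  differ would sum to zero, so a matrix with these rows would be singular. The mean value theorem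
  writes its determinant as nonzero differences times a determinant of velocities at intermediate
  parameters, which convexity keeps in the intervals \<open>J j\<close>.\<close>

lemma curve_sum_inj:
  fixes h :: "real \<Rightarrow> real ^ 'm::finite"
  assumes J: "\<And>j. convex (J j)" "\<And>j. J j \<subseteq> T"
    and h: "\<And>u. u \<in> T \<Longrightarrow> (h has_vector_derivative h' u) (at u within T)"
    and nz: "\<And>t :: real ^ 'm. (\<And>j. t $ j \<in> J j) \<Longrightarrow> det ((\<chi> j. h' (t $ j)) :: real ^ 'm ^ 'm) \<noteq> 0"
  shows "inj_on (\<lambda>t :: real ^ 'm. \<Sum>j\<in>UNIV. h (t $ j)) {t. \<forall>j. t $ j \<in> J j}"
proof (rule inj_onI, rule ccontr)
  fix t s :: "real ^ 'm"
  assume t: "t \<in> {t. \<forall>j. t $ j \<in> J j}" and s: "s \<in> {t. \<forall>j. t $ j \<in> J j}"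
    and eq: "(\<Sum>j\<in>UNIV. h (t $ j)) = (\<Sum>j\<in>UNIV. h (s $ j))" and "t \<noteq> s"
  define I where "I = {j. t $ j \<noteq> s $ j}"
  \<comment> \<open>Velocities fill the rows whose coordinates agree, where the increment would be a
    zero row.\<close>
  define D where "D = ((\<chi> j. if j \<in> I then h (t $ j) - h (s $ j) else h' (t $ j)) :: real ^ 'm ^ 'm)"
  \<comment> \<open>\<open>transpose D *v e\<close> is the sum of the increments.\<close>
  define e where "e = ((\<chi> j. if j \<in> I then 1 else 0) :: real ^ 'm)"
  obtain \<xi> where \<xi>: "\<And>j. \<xi> j \<in> J j"
    and "det D = (\<Prod>j\<in>I. t $ j - s $ j) * det ((\<chi> j. if j \<in> I then h' (\<xi> j) else h' (t $ j)) :: real ^ 'm ^ 'm)"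
    using det_increments_mvt[where I=I and J=J and s="\<lambda>j. s $ j" and t="\<lambda>j. t $ j" and T=T and h=h and h'=h'
        and w="\<lambda>j. h' (t $ j)"] t s J h
    unfolding D_def by auto
  moreover have "det ((\<chi> j. if j \<in> I then h' (\<xi> j) else h' (t $ j)) :: real ^ 'm ^ 'm) \<noteq> 0"
  proof -
    have "(\<chi> j. if j \<in> I then h' (\<xi> j) else h' (t $ j)) = (\<chi> j. h' ((\<chi> j. if j \<in> I then \<xi> j else t $ j) $ j))"
      by (auto simp: vec_eq_iff)
    then show ?thesis using nz[of "\<chi> j. if j \<in> I then \<xi> j else t $ j"] \<xi> t by auto
  qed
  ultimately have "det D \<noteq> 0" by (auto simp: I_def)
  then have "det (transpose D) \<noteq> 0" by (simp add: det_transpose)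
  moreover have "transpose D *v e = 0"
  proof -
    have "(transpose D *v e) $ i = (\<Sum>j\<in>UNIV. h (t $ j) - h (s $ j)) $ i" for i
      by (auto simp: matrix_vector_mult_def transpose_def D_def e_def I_def intro!: sum.cong)
    then show ?thesis using eq by (simp add: vec_eq_iff sum_subtractf)
  qed
  moreover have "e \<noteq> 0"
    using \<open>t \<noteq> s\<close> by (auto simp: e_def I_def vec_eq_iff)
  ultimately show False
    by (metis invertible_det_nz invertible_left_inverse matrix_left_invertible_ker)
qed

section \<open>Fourier transforms of measures\<close>

lemma borel_measurable_cis [measurable]: "cis \<in> borel_measurable borel"
  by (intro borel_measurable_continuous_onI continuous_intros)

lemma measurable_vec_lambda_PiM [measurable]:
  "(\<lambda>f. \<chi> i. f i) \<in> (\<Pi>\<^sub>M i\<in>(UNIV :: 'm::finite set). (lborel :: real measure)) \<rightarrow>\<^sub>M (borel :: (real ^ 'm) measure)"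
  by (subst borel_measurable_euclidean_space) (auto simp: Basis_vec_def inner_axis)

text \<open>Gives access to the product structure of Lebesgue measure, so that integrals of products
  of one-variable functions factor.\<close>

lemma lborel_vec_eq_distr_PiM:
  "(lborel :: (real ^ 'm::finite) measure)
    = distr (\<Pi>\<^sub>M i\<in>(UNIV :: 'm set). lborel) borel (\<lambda>f. \<chi> i. f i)"
proof (rule lborel_eqI)
  interpret product_sigma_finite "\<lambda>_ :: 'm. (lborel :: real measure)" ..
  let ?P = "\<Pi>\<^sub>M i\<in>(UNIV :: 'm set). (lborel :: real measure)"
  fix l u :: "real ^ 'm"
  assume *: "\<And>b. b \<in> Basis \<Longrightarrow> l \<bullet> b \<le> u \<bullet> b"
  have lu: "l $ i \<le> u $ i" for i
    using *[of "axis i 1"] by (simp add: inner_axis)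
  have "(\<lambda>f. \<chi> i. f i) -` box l u \<inter> space ?P = Pi\<^sub>E UNIV (\<lambda>i. {l $ i <..< u $ i})"
    by (auto simp: space_PiM box_def Basis_vec_def inner_axis PiE_def Pi_def extensional_def)
  then have "emeasure (distr ?P borel (\<lambda>f. \<chi> i. f i)) (box l u) = emeasure ?P (Pi\<^sub>E UNIV (\<lambda>i. {l $ i <..< u $ i}))"
    by (subst emeasure_distr) auto
  also have "\<dots> = (\<Prod>i\<in>UNIV. ennreal (u $ i - l $ i))"
    by (subst emeasure_PiM) (auto simp: lu)
  also have "\<dots> = ennreal (\<Prod>i\<in>UNIV. (u - l) $ i)"
    by (subst prod_ennreal) (auto simp: lu)
  also have "(\<Prod>i\<in>UNIV. (u - l) $ i) = (\<Prod>b\<in>Basis. (u - l) \<bullet> b)"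
  proof -
    have "inj (\<lambda>i :: 'm. axis i (1::real))" by (auto simp: inj_def axis_eq_axis)
    from prod.reindex[OF this, of "\<lambda>b. (u - l) \<bullet> b"]
    have "(\<Prod>b\<in>range (\<lambda>i :: 'm. axis i 1). (u - l) \<bullet> b) = (\<Prod>i\<in>UNIV. (u - l) $ i)"
      by (simp add: inner_axis)
    moreover have "(Basis :: (real ^ 'm) set) = range (\<lambda>i. axis i 1)" by (auto simp: Basis_vec_def)
    ultimately show ?thesis by simp
  qed
  finally show "emeasure (distr ?P borel (\<lambda>f. \<chi> i. f i)) (box l u) = ennreal (\<Prod>b\<in>Basis. (u - l) \<bullet> b)" .
qed simp

lemma nn_integral_lborel_vec_prod:
  fixes f :: "'m::finite \<Rightarrow> real \<Rightarrow> ennreal"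
  assumes [measurable]: "\<And>i. f i \<in> borel_measurable borel"
  shows "(\<integral>\<^sup>+y. (\<Prod>i\<in>UNIV. f i (y $ i)) \<partial>(lborel :: (real ^ 'm) measure)) = (\<Prod>i\<in>UNIV. (\<integral>\<^sup>+u. f i u \<partial>lborel))"
proof -
  interpret product_sigma_finite "\<lambda>_ :: 'm. (lborel :: real measure)" ..
  show ?thesis
    unfolding lborel_vec_eq_distr_PiM
    by (subst nn_integral_distr, measurable) (simp add: product_nn_integral_prod)
qed

lemma
  fixes f :: "'m::finite \<Rightarrow> real \<Rightarrow> complex"
  assumes f: "\<And>i. integrable lborel (f i)"
  shows integral_lborel_vec_prod:
      "(LINT y|(lborel :: (real ^ 'm) measure). (\<Prod>i\<in>UNIV. f i (y $ i))) = (\<Prod>i\<in>UNIV. (LINT u|lborel. f i u))"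
    and integrable_lborel_vec_prod:
      "integrable (lborel :: (real ^ 'm) measure) (\<lambda>y. \<Prod>i\<in>UNIV. f i (y $ i))"
proof -
  interpret product_sigma_finite "\<lambda>_ :: 'm. (lborel :: real measure)" ..
  have [measurable]: "f i \<in> borel_measurable borel" for i using f[of i] by simp
  show "(LINT y|(lborel :: (real ^ 'm) measure). (\<Prod>i\<in>UNIV. f i (y $ i))) = (\<Prod>i\<in>UNIV. (LINT u|lborel. f i u))"
    unfolding lborel_vec_eq_distr_PiM
    by (subst integral_distr, measurable) (simp add: product_integral_prod f)
  show "integrable (lborel :: (real ^ 'm) measure) (\<lambda>y. \<Prod>i\<in>UNIV. f i (y $ i))"
    unfolding lborel_vec_eq_distr_PiM
    by (subst integrable_distr_eq, measurable) (simp add: product_integrable_prod f)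
qed

text \<open>This is the characteristic function of the standard normal law, with the normalising
  factor \<open>sqrt (2 * pi)\<close> restored.\<close>

lemma fourier_gauss_real:
  fixes z :: real
  shows "integrable lborel (\<lambda>u. cis (z * u) * complex_of_real (exp (- u\<^sup>2 / 2)))"
    and "(LINT u|lborel. cis (z * u) * complex_of_real (exp (- u\<^sup>2 / 2))) = complex_of_real (sqrt (2 * pi) * exp (- z\<^sup>2 / 2))"
proof -
  have e: "exp (- u\<^sup>2 / 2) = sqrt (2 * pi) * std_normal_density u" for u :: real
    by (simp add: std_normal_density_def)
  have "integrable lborel std_normal_density"
    using prob_space_normal_density[of 1 0] by (simp add: integrable_normal_density)
  then have i: "integrable lborel (\<lambda>u :: real. exp (- u\<^sup>2 / 2))" unfolding e by simp
  show "integrable lborel (\<lambda>u. cis (z * u) * complex_of_real (exp (- u\<^sup>2 / 2)))"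
    by (rule Bochner_Integration.integrable_bound[OF i]) (auto simp: norm_mult)
  have "complex_of_real (exp (- z\<^sup>2 / 2)) = (LINT u|std_normal_distribution. iexp (z * u))"
    using char_std_normal_distribution by (simp add: char_def fun_eq_iff)
  also have "\<dots> = (LINT u|lborel. std_normal_density u *\<^sub>R iexp (z * u))"
    by (rule integral_density) auto
  finally have eq: "(LINT u|lborel. std_normal_density u *\<^sub>R iexp (z * u)) = complex_of_real (exp (- z\<^sup>2 / 2))" ..
  have "(LINT u|lborel. cis (z * u) * complex_of_real (exp (- u\<^sup>2 / 2))) =
     (LINT u|lborel. complex_of_real (sqrt (2 * pi)) * (std_normal_density u *\<^sub>R iexp (z * u)))"
    unfolding e by (intro Bochner_Integration.integral_cong) (auto simp: cis_conv_exp scaleR_conv_of_real)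
  also have "\<dots> = complex_of_real (sqrt (2 * pi)) * (LINT u|lborel. std_normal_density u *\<^sub>R iexp (z * u))"
    by (rule integral_mult_right_zero)
  finally show "(LINT u|lborel. cis (z * u) * complex_of_real (exp (- u\<^sup>2 / 2))) = complex_of_real (sqrt (2 * pi) * exp (- z\<^sup>2 / 2))"
    unfolding eq by simp
qed

section \<open>Duality with a Gaussian\<close>

definition gauss :: "real ^ 'm::finite \<Rightarrow> real" where
  "gauss y = exp (- (norm y)\<^sup>2 / 2)"

lemma borel_measurable_gauss [measurable]: "gauss \<in> borel_measurable borel"
  unfolding gauss_def by measurable

lemma gauss_nonneg: "0 \<le> gauss y"
  by (auto simp: gauss_def)

lemma gauss_eq_prod: "gauss y = (\<Prod>i\<in>UNIV. exp (- (y $ i)\<^sup>2 / 2))"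
proof -
  have "(norm y)\<^sup>2 = (\<Sum>i\<in>UNIV. (y $ i)\<^sup>2)"
    unfolding power2_norm_eq_inner inner_vec_def by (simp add: power2_eq_square)
  then show ?thesis
    by (simp add: gauss_def exp_sum[symmetric] sum_negf sum_divide_distrib)
qed

lemma fourier_gauss:
  fixes z :: "real ^ 'm::finite"
  shows "integrable lborel (\<lambda>y. cis (z \<bullet> y) * complex_of_real (gauss y))"
    and "(LINT y|lborel. cis (z \<bullet> y) * complex_of_real (gauss y)) = complex_of_real (sqrt (2 * pi) ^ CARD('m) * gauss z)"
proof -
  have c: "cis (\<Sum>i\<in>A. a i) = (\<Prod>i\<in>A. cis (a i))" if "finite A" for A :: "'m set" and a
    using that by (induction A) (auto simp: cis_mult[symmetric])
  have eq: "cis (z \<bullet> y) * complex_of_real (gauss y) = (\<Prod>i\<in>UNIV. cis (z $ i * y $ i) * complex_of_real (exp (- (y $ i)\<^sup>2 / 2)))" for y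
    by (simp add: gauss_eq_prod prod.distrib c[symmetric] inner_vec_def)
  show "integrable lborel (\<lambda>y. cis (z \<bullet> y) * complex_of_real (gauss y))"
    unfolding eq by (rule integrable_lborel_vec_prod[OF fourier_gauss_real(1)])
  show "(LINT y|lborel. cis (z \<bullet> y) * complex_of_real (gauss y)) = complex_of_real (sqrt (2 * pi) ^ CARD('m) * gauss z)"
    unfolding eq integral_lborel_vec_prod[OF fourier_gauss_real(1)] fourier_gauss_real(2)
    by (simp add: prod.distrib gauss_eq_prod)
qed

lemma gauss_integrable: "integrable lborel (gauss :: real ^ 'm::finite \<Rightarrow> real)"
  using integrable_norm[OF fourier_gauss(1)[of "0 :: real ^ 'm"]]
  by (simp add: norm_mult gauss_nonneg)

text \<open>This wider Gaussian dominates, up to a factor, the values of \<open>gauss\<close> at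
  distance less than 1; it is \<open>gauss\<close> dilated by \<open>sqrt 2\<close>.\<close>

lemma gauss_scaled_nn_integral_finite:
  "(\<integral>\<^sup>+u. ennreal (exp (- (norm u)\<^sup>2 / 4)) \<partial>(lborel :: (real ^ 'm::finite) measure)) < \<infinity>"
proof -
  have "(\<integral>\<^sup>+u. ennreal (exp (- (norm u)\<^sup>2 / 4)) \<partial>(lborel :: (real ^ 'm::finite) measure))
    = (\<integral>\<^sup>+u. ennreal (gauss (u /\<^sub>R sqrt 2)) \<partial>(lborel :: (real ^ 'm::finite) measure))"
    by (intro nn_integral_cong) (auto simp: gauss_def power_mult_distrib power_inverse)
  also have "\<dots> < \<infinity>"
  proof -
    define c where "c = inverse (sqrt 2)"
    have c: "0 < c" by (simp add: c_def)
    have "\<infinity> > (\<integral>\<^sup>+u. ennreal (gauss u) \<partial>(lborel :: (real ^ 'm) measure))"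
      using gauss_integrable[where 'm='m] by (simp add: integrable_iff_bounded gauss_nonneg)
    also have "(\<integral>\<^sup>+u. ennreal (gauss u) \<partial>(lborel :: (real ^ 'm) measure))
      = ennreal (c ^ CARD('m)) * (\<integral>\<^sup>+u. ennreal (gauss (c *\<^sub>R u)) \<partial>(lborel :: (real ^ 'm) measure))"
      using c by (subst lborel_affine[of c 0]) (auto simp: nn_integral_density nn_integral_distr nn_integral_cmult)
    finally show ?thesis using c by (auto simp: c_def ennreal_mult_less_top)
  qed
  finally show ?thesis .
qed

text \<open>A covering argument carried out by averaging: \<open>gauss z\<close> is controlled by
  the mean of a wider Gaussian over the unit ball about \<open>z\<close>, and after exchanging the
  integrals only masses of unit balls remain.\<close>

lemma gauss_mass:
  obtains C where "0 < C"
    "\<And>(\<nu> :: (real ^ 'm::finite) measure) B x. \<lbrakk>sets \<nu> = sets borel; finite_measure \<nu>; 0 \<le> B;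
       \<And>x. emeasure \<nu> (ball x 1) \<le> ennreal B\<rbrakk> \<Longrightarrow> (\<integral>\<^sup>+x'. ennreal (gauss (x - x')) \<partial>\<nu>) \<le> ennreal (C * B)"
proof -
  define D where "D = enn2real (\<integral>\<^sup>+u. ennreal (exp (- (norm u)\<^sup>2 / 4)) \<partial>(lborel :: (real ^ 'm::finite) measure))"
  define V where "V = measure lborel (ball (0 :: real ^ 'm) 1)"
  have D: "(\<integral>\<^sup>+u. ennreal (exp (- (norm u)\<^sup>2 / 4)) \<partial>(lborel :: (real ^ 'm::finite) measure)) = ennreal D" "0 \<le> D"
    using gauss_scaled_nn_integral_finite[where 'm='m] by (auto simp: D_def)
  have V: "emeasure lborel (ball (z :: real ^ 'm) 1) = ennreal V" for z
  proof -
    have "emeasure lborel (ball z 1) = emeasure (distr lborel borel ((+) z)) (ball z 1)"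
      by (simp only: lborel_distr_plus)
    also have "\<dots> = emeasure lborel (ball (0 :: real ^ 'm) 1)"
      by (subst emeasure_distr) (auto intro!: arg_cong[where f="emeasure lborel"] simp: dist_norm)
    finally show ?thesis
      using emeasure_lborel_ball_finite[of "0 :: real ^ 'm" 1]
      unfolding V_def by (subst (asm) emeasure_eq_ennreal_measure) auto
  qed
  have "0 < V" unfolding V_def by (rule content_ball_pos) simp
  \<comment> \<open>\<open>D / V\<close> is the mass of the wider Gaussian divided by the volume of
    a unit ball; adding 1 makes the constant visibly positive.\<close>
  define C where "C = exp (1/2) * D / V + 1"
  have C: "0 < C" using D \<open>0 < V\<close> by (auto simp: C_def intro!: add_nonneg_pos)
  have "(\<integral>\<^sup>+x'. ennreal (gauss (x - x')) \<partial>\<nu>) \<le> ennreal (C * B)"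
    if nu[simp, measurable_cong]: "sets \<nu> = sets borel" and fin: "finite_measure \<nu>" and B: "0 \<le> B"
      "\<And>x. emeasure \<nu> (ball x 1) \<le> ennreal B" for \<nu> :: "(real ^ 'm) measure" and B x
  proof -
    interpret finite_measure \<nu> by fact
    interpret pair_sigma_finite lborel \<nu> ..
    \<comment> \<open>From \<open>norm u \<le> norm z + 1\<close> follows
      \<open>(norm u)^2 \<le> 2 * (norm z)^2 + 2\<close>; this costs the factor
      \<open>exp (1/2)\<close> and doubles the variance.\<close>
    have pt: "ennreal (gauss z) * ennreal V \<le> ennreal (exp (1/2)) * (\<integral>\<^sup>+u. ennreal (exp (- (norm u)\<^sup>2 / 4)) * indicator (ball z 1) u \<partial>lborel)" for z :: "real ^ 'm"
    proof -
      have le: "gauss z \<le> exp (1/2) * exp (- (norm u)\<^sup>2 / 4)" if "u \<in> ball z 1" for u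
      proof -
        have "norm u \<le> norm z + norm (u - z)" by (rule norm_triangle_sub)
        also have "\<dots> \<le> norm z + 1" using that by (simp add: dist_norm norm_minus_commute)
        finally have "(norm u)\<^sup>2 \<le> (norm z + 1)\<^sup>2" by (simp add: power_mono)
        also have "\<dots> \<le> 2 * (norm z)\<^sup>2 + 2"
          using zero_le_power2[of "norm z - 1"] by (simp add: power2_eq_square algebra_simps)
        finally show ?thesis unfolding gauss_def exp_add[symmetric] by (simp add: field_simps)
      qed
      have "ennreal (gauss z) * ennreal V = (\<integral>\<^sup>+u. ennreal (gauss z) * indicator (ball z 1) u \<partial>lborel)"
        by (simp add: nn_integral_cmult_indicator V)
      also have "\<dots> \<le> (\<integral>\<^sup>+u. ennreal (exp (1/2)) * (ennreal (exp (- (norm u)\<^sup>2 / 4)) * indicator (ball z 1) u) \<partial>lborel)"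
        using le by (intro nn_integral_mono) (auto simp: indicator_def ennreal_mult[symmetric] intro!: ennreal_leI)
      also have "\<dots> = ennreal (exp (1/2)) * (\<integral>\<^sup>+u. ennreal (exp (- (norm u)\<^sup>2 / 4)) * indicator (ball z 1) u \<partial>lborel)"
        by (rule nn_integral_cmult, intro borel_measurable_times_ennreal borel_measurable_indicator) auto
      finally show ?thesis .
    qed
    have "ennreal V * (\<integral>\<^sup>+x'. ennreal (gauss (x - x')) \<partial>\<nu>) = (\<integral>\<^sup>+x'. ennreal (gauss (x - x')) * ennreal V \<partial>\<nu>)"
      by (subst nn_integral_cmult[symmetric]) (auto simp: mult.commute)
    also have "\<dots> \<le> (\<integral>\<^sup>+x'. ennreal (exp (1/2)) * (\<integral>\<^sup>+u. ennreal (exp (- (norm u)\<^sup>2 / 4)) * indicator (ball (x - x') 1) u \<partial>lborel) \<partial>\<nu>)"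
      by (intro nn_integral_mono pt)
    also have "\<dots> = ennreal (exp (1/2)) * (\<integral>\<^sup>+x'. (\<integral>\<^sup>+u. ennreal (exp (- (norm u)\<^sup>2 / 4)) * indicator {(x', u). dist (x - x') u < 1} (x', u) \<partial>lborel) \<partial>\<nu>)"
      by (subst nn_integral_cmult[symmetric]) (auto simp: indicator_def intro!: nn_integral_cong)
    also have "(\<integral>\<^sup>+x'. (\<integral>\<^sup>+u. ennreal (exp (- (norm u)\<^sup>2 / 4)) * indicator {(x', u). dist (x - x') u < 1} (x', u) \<partial>lborel) \<partial>\<nu>)
      = (\<integral>\<^sup>+u. (\<integral>\<^sup>+x'. ennreal (exp (- (norm u)\<^sup>2 / 4)) * indicator {(x', u). dist (x - x') u < 1} (x', u) \<partial>\<nu>) \<partial>lborel)"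
      by (rule Fubini') simp
    also have "\<dots> \<le> (\<integral>\<^sup>+u. ennreal (exp (- (norm u)\<^sup>2 / 4)) * ennreal B \<partial>(lborel :: (real ^ 'm) measure))"
    proof (intro nn_integral_mono)
      fix u :: "real ^ 'm"
      have "(\<integral>\<^sup>+x'. ennreal (exp (- (norm u)\<^sup>2 / 4)) * indicator {(x', u). dist (x - x') u < 1} (x', u) \<partial>\<nu>)
        = (\<integral>\<^sup>+x'. ennreal (exp (- (norm u)\<^sup>2 / 4)) * indicator (ball (x - u) 1) x' \<partial>\<nu>)"
        by (intro nn_integral_cong) (auto simp: indicator_def dist_norm norm_minus_commute algebra_simps)
      also have "\<dots> = ennreal (exp (- (norm u)\<^sup>2 / 4)) * emeasure \<nu> (ball (x - u) 1)"
        by (rule nn_integral_cmult_indicator) simp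
      also have "\<dots> \<le> ennreal (exp (- (norm u)\<^sup>2 / 4)) * ennreal B"
        by (intro mult_left_mono B) auto
      finally show "(\<integral>\<^sup>+x'. ennreal (exp (- (norm u)\<^sup>2 / 4)) * indicator {(x', u). dist (x - x') u < 1} (x', u) \<partial>\<nu>) \<le> ennreal (exp (- (norm u)\<^sup>2 / 4)) * ennreal B" .
    qed
    also have "\<dots> = ennreal (D * B)"
      using B D by (simp add: nn_integral_multc ennreal_mult)
    finally have 1: "ennreal V * (\<integral>\<^sup>+x'. ennreal (gauss (x - x')) \<partial>\<nu>) \<le> ennreal (exp (1/2) * (D * B))"
      using B D by (simp add: mult_left_mono ennreal_mult)
    have "(\<integral>\<^sup>+x'. ennreal (gauss (x - x')) \<partial>\<nu>) = ennreal (1 / V) * (ennreal V * (\<integral>\<^sup>+x'. ennreal (gauss (x - x')) \<partial>\<nu>))"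
      using \<open>0 < V\<close> by (simp add: mult.assoc[symmetric] ennreal_mult[symmetric])
    also have "\<dots> \<le> ennreal (1 / V) * ennreal (exp (1/2) * (D * B))"
      by (intro mult_left_mono 1) auto
    also have "\<dots> = ennreal (exp (1/2) * D / V * B)"
      using \<open>0 < V\<close> B D by (simp add: ennreal_mult[symmetric])
    also have "\<dots> \<le> ennreal (C * B)"
      using B by (intro ennreal_leI mult_right_mono) (auto simp: C_def)
    finally show ?thesis .
  qed
  with C show ?thesis using that by blast
qed

lemma borel_measurable_cnj [measurable]: "cnj \<in> borel_measurable borel"
  by (intro borel_measurable_continuous_onI continuous_intros)

text \<open>Expanding the square and integrating in \<open>y\<close> first replaces the oscillation
  by the positive kernel \<open>gauss (x - x')\<close>; Schur's test with \<open>gauss_mass\<close>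
  finishes. The bound \<open>K\<close> and the finiteness of \<open>\<nu>\<close> justify Fubini and
  leave no trace in the constant.\<close>

lemma gauss_dual_bound:
  obtains C where "0 < C"
    "\<And>(\<nu> :: (real ^ 'm::finite) measure) B h K. \<lbrakk>sets \<nu> = sets borel; finite_measure \<nu>; 0 \<le> B;
       \<And>x. emeasure \<nu> (ball x 1) \<le> ennreal B; h \<in> borel_measurable borel; \<And>x. cmod (h x) \<le> K\<rbrakk> \<Longrightarrow>
       (\<integral>\<^sup>+y. ennreal (gauss y * (cmod (LINT x|\<nu>. cis (x \<bullet> y) * h x))\<^sup>2) \<partial>lborel)
         \<le> ennreal (C * B) * (\<integral>\<^sup>+x. ennreal ((cmod (h x))\<^sup>2) \<partial>\<nu>)"
proof -
  obtain C0 where C0: "0 < C0"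
    "\<And>(\<nu> :: (real ^ 'm::finite) measure) B x. \<lbrakk>sets \<nu> = sets borel; finite_measure \<nu>; 0 \<le> B;
       \<And>x. emeasure \<nu> (ball x 1) \<le> ennreal B\<rbrakk> \<Longrightarrow> (\<integral>\<^sup>+x'. ennreal (gauss (x - x')) \<partial>\<nu>) \<le> ennreal (C0 * B)"
    using gauss_mass[where 'm='m] by blast
  define c where "c = sqrt (2 * pi) ^ CARD('m)"
  have "0 < c" by (simp add: c_def)
  have main: "(\<integral>\<^sup>+y. ennreal (gauss y * (cmod (LINT x|\<nu>. cis (x \<bullet> y) * h x))\<^sup>2) \<partial>lborel)
         \<le> ennreal (c * C0 * B) * (\<integral>\<^sup>+x. ennreal ((cmod (h x))\<^sup>2) \<partial>\<nu>)"
    if nu[simp, measurable_cong]: "sets \<nu> = sets borel" and fin: "finite_measure \<nu>" and B: "0 \<le> B"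
      "\<And>x. emeasure \<nu> (ball x 1) \<le> ennreal B" and h[measurable]: "h \<in> borel_measurable borel" and K: "\<And>x. cmod (h x) \<le> K"
    for \<nu> :: "(real ^ 'm) measure" and B h K
  proof -
    interpret finite_measure \<nu> by fact
    interpret nn: pair_sigma_finite \<nu> \<nu> ..
    interpret n2: finite_measure "\<nu> \<Otimes>\<^sub>M \<nu>" by (rule finite_measure_pair_measure) unfold_locales
    interpret ln: pair_sigma_finite lborel "\<nu> \<Otimes>\<^sub>M \<nu>" ..
    define H where "H = (\<lambda>y. LINT x|\<nu>. cis (x \<bullet> y) * h x)"
    have K0: "0 \<le> K" using K[of 0] norm_ge_zero order_trans by blast
    have Hm[measurable]: "H \<in> borel_measurable borel" unfolding H_def by measurable
    have int1: "integrable \<nu> (\<lambda>x. cis (x \<bullet> y) * h x)" for y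
      by (rule integrable_const_bound[where B=K]) (auto simp: norm_mult K)
    have Hb: "cmod (H y) \<le> K * measure \<nu> (space \<nu>)" for y
    proof -
      have "cmod (H y) \<le> (LINT x|\<nu>. cmod (cis (x \<bullet> y) * h x))" unfolding H_def
        by (rule integral_norm_bound)
      also have "\<dots> \<le> (LINT x|\<nu>. K)"
        by (rule integral_mono[OF integrable_norm[OF int1] integrable_const]) (simp add: norm_mult K)
      finally show ?thesis by (simp add: mult.commute)
    qed
    \<comment> \<open>The integrand of \<open>H y\<close> times its conjugate, written as a double
      integral.\<close>
    define F where "F = (\<lambda>y xx. cis ((fst xx - snd xx) \<bullet> y) * (h (fst xx) * cnj (h (snd xx))))"
    have Fm[measurable]: "(\<lambda>(y, xx). F y xx) \<in> borel_measurable (lborel \<Otimes>\<^sub>M (\<nu> \<Otimes>\<^sub>M \<nu>))"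
      unfolding F_def by measurable
    have Fm2[measurable]: "F y \<in> borel_measurable (\<nu> \<Otimes>\<^sub>M \<nu>)" for y
      unfolding F_def by measurable
    have FK: "cmod (F y xx) \<le> K * K" for y xx
      unfolding F_def by (auto simp: norm_mult intro!: mult_mono K K0)
    have HH: "H y * cnj (H y) = (LINT xx|(\<nu> \<Otimes>\<^sub>M \<nu>). F y xx)" for y
    proof -
      have "(LINT xx|(\<nu> \<Otimes>\<^sub>M \<nu>). F y xx) = (LINT x|\<nu>. LINT x'|\<nu>. F y (x, x'))"
        by (rule nn.integral_fst'[symmetric], rule n2.integrable_const_bound[where B="K*K"]) (auto simp: FK)
      also have "\<dots> = (LINT x|\<nu>. (cis (x \<bullet> y) * h x) * cnj (H y))"
      proof (rule Bochner_Integration.integral_cong[OF refl])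
        fix x
        have "(LINT x'|\<nu>. F y (x, x')) = (LINT x'|\<nu>. (cis (x \<bullet> y) * h x) * cnj (cis (x' \<bullet> y) * h x'))"
          by (intro Bochner_Integration.integral_cong refl)
             (simp add: F_def inner_diff_left cis_divide[symmetric] cis_cnj divide_inverse)
        also have "\<dots> = (cis (x \<bullet> y) * h x) * cnj (H y)"
          unfolding H_def by (simp only: integral_mult_right_zero Bochner_Integration.integral_cnj)
        finally show "(LINT x'|\<nu>. F y (x, x')) = (cis (x \<bullet> y) * h x) * cnj (H y)" .
      qed
      also have "\<dots> = H y * cnj (H y)"
        unfolding H_def by (simp only: integral_mult_left_zero)
      finally show ?thesis ..
    qed
    have intF: "integrable (lborel \<Otimes>\<^sub>M (\<nu> \<Otimes>\<^sub>M \<nu>)) (\<lambda>(y, xx). of_real (gauss y) * F y xx)"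
    proof (rule Bochner_Integration.integrable_bound)
      show "integrable (lborel \<Otimes>\<^sub>M (\<nu> \<Otimes>\<^sub>M \<nu>)) (\<lambda>(y, xx). gauss y * (K * K))"
        by (rule ln.Fubini_integrable) (auto intro!: gauss_integrable simp: n2.integrable_const)
      show "AE x in lborel \<Otimes>\<^sub>M \<nu> \<Otimes>\<^sub>M \<nu>.
          norm (case x of (y, xx) \<Rightarrow> complex_of_real (gauss y) * F y xx) \<le> norm (case x of (y, xx) \<Rightarrow> gauss y * (K * K))"
        using FK K0 by (auto simp: norm_mult gauss_nonneg intro!: mult_left_mono AE_I2)
    qed measurable
    have intH: "integrable lborel (\<lambda>y. gauss y * (cmod (H y))\<^sup>2)"
    proof (rule Bochner_Integration.integrable_bound)
      show "integrable lborel (\<lambda>y :: real ^ 'm. gauss y * (K * measure \<nu> (space \<nu>))\<^sup>2)"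
        by (intro integrable_mult_left gauss_integrable)
      show "AE y in lborel. norm (gauss y * (cmod (H y))\<^sup>2) \<le> norm (gauss y * (K * measure \<nu> (space \<nu>))\<^sup>2)"
        by (auto simp: abs_mult gauss_nonneg intro!: AE_I2 mult_left_mono power_mono Hb)
    qed measurable
    define I1 where "I1 = (LINT y|lborel. gauss y * (cmod (H y))\<^sup>2)"
    have "complex_of_real I1 = (LINT y|lborel. of_real (gauss y * (cmod (H y))\<^sup>2))"
      unfolding I1_def by (rule integral_complex_of_real[symmetric])
    also have "\<dots> = (LINT y|lborel. LINT xx|(\<nu> \<Otimes>\<^sub>M \<nu>). of_real (gauss y) * F y xx)"
    proof (rule Bochner_Integration.integral_cong[OF refl])
      fix y
      have "of_real ((cmod (H y))\<^sup>2) = H y * cnj (H y)" by (rule complex_norm_square)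
      then show "complex_of_real (gauss y * (cmod (H y))\<^sup>2) = (LINT xx|(\<nu> \<Otimes>\<^sub>M \<nu>). of_real (gauss y) * F y xx)"
        by (simp add: HH)
    qed
    also have "\<dots> = (LINT xx|(\<nu> \<Otimes>\<^sub>M \<nu>). LINT y|lborel. of_real (gauss y) * F y xx)"
      using ln.Fubini_integral[OF intF] by simp
    also have "\<dots> = (LINT xx|(\<nu> \<Otimes>\<^sub>M \<nu>). of_real (c * gauss (fst xx - snd xx)) * (h (fst xx) * cnj (h (snd xx))))"
    proof (rule Bochner_Integration.integral_cong[OF refl])
      fix xx :: "(real ^ 'm) \<times> (real ^ 'm)"
      have "(LINT y|lborel. of_real (gauss y) * F y xx) = (LINT y|lborel. (cis ((fst xx - snd xx) \<bullet> y) * of_real (gauss y)) * (h (fst xx) * cnj (h (snd xx))))"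
        by (intro Bochner_Integration.integral_cong refl) (simp add: F_def mult_ac)
      also have "\<dots> = (LINT y|lborel. cis ((fst xx - snd xx) \<bullet> y) * of_real (gauss y)) * (h (fst xx) * cnj (h (snd xx)))"
        by (rule integral_mult_left_zero)
      finally show "(LINT y|lborel. of_real (gauss y) * F y xx) = of_real (c * gauss (fst xx - snd xx)) * (h (fst xx) * cnj (h (snd xx)))"
        by (simp add: fourier_gauss(2) c_def)
    qed
    finally have I1: "complex_of_real I1 = (LINT xx|(\<nu> \<Otimes>\<^sub>M \<nu>). of_real (c * gauss (fst xx - snd xx)) * (h (fst xx) * cnj (h (snd xx))))" .
    have I1n: "0 \<le> I1" unfolding I1_def by (intro integral_nonneg_AE) (auto simp: gauss_nonneg)
    have g1: "gauss z \<le> 1" for z :: "real ^ 'm" by (simp add: gauss_def)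
    have gsym: "gauss (z - z') = gauss (z' - z)" for z z' :: "real ^ 'm"
      by (simp add: gauss_def norm_minus_commute)
    let ?N = "\<lambda>x. (cmod (h x))\<^sup>2"
    \<comment> \<open>The two halves of \<open>2 * a * b \<le> a^2 + b^2\<close>: in each, the
      kernel is integrated in the variable that the square does not contain.\<close>
    have first: "(\<integral>\<^sup>+x. \<integral>\<^sup>+x'. ennreal (gauss (x - x')) * ennreal (?N x) \<partial>\<nu> \<partial>\<nu>) \<le> ennreal (C0 * B) * (\<integral>\<^sup>+x. ennreal (?N x) \<partial>\<nu>)"
    proof -
      have "(\<integral>\<^sup>+x. \<integral>\<^sup>+x'. ennreal (gauss (x - x')) * ennreal (?N x) \<partial>\<nu> \<partial>\<nu>) \<le> (\<integral>\<^sup>+x. ennreal (C0 * B) * ennreal (?N x) \<partial>\<nu>)"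
        using C0(2)[OF nu fin B] by (intro nn_integral_mono) (auto simp: nn_integral_multc intro!: mult_right_mono)
      then show ?thesis by (simp add: nn_integral_cmult)
    qed
    have second: "(\<integral>\<^sup>+x. \<integral>\<^sup>+x'. ennreal (gauss (x - x')) * ennreal (?N x') \<partial>\<nu> \<partial>\<nu>) \<le> ennreal (C0 * B) * (\<integral>\<^sup>+x. ennreal (?N x) \<partial>\<nu>)"
    proof -
      have "(\<integral>\<^sup>+x. \<integral>\<^sup>+x'. ennreal (gauss (x - x')) * ennreal (?N x') \<partial>\<nu> \<partial>\<nu>)
          = (\<integral>\<^sup>+x'. \<integral>\<^sup>+x. ennreal (gauss (x - x')) * ennreal (?N x') \<partial>\<nu> \<partial>\<nu>)"
        by (rule nn.Fubini'[symmetric]) measurable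
      also have "\<dots> = (\<integral>\<^sup>+x'. \<integral>\<^sup>+x. ennreal (gauss (x' - x)) * ennreal (?N x') \<partial>\<nu> \<partial>\<nu>)"
        by (simp add: gsym)
      also note first
      finally show ?thesis .
    qed
    have "ennreal I1 = ennreal (cmod (complex_of_real I1))" using I1n by simp
    also have "\<dots> \<le> (\<integral>\<^sup>+xx. ennreal (cmod (of_real (c * gauss (fst xx - snd xx)) * (h (fst xx) * cnj (h (snd xx))))) \<partial>(\<nu> \<Otimes>\<^sub>M \<nu>))"
      unfolding I1
    proof (rule integral_norm_bound_ennreal, rule n2.integrable_const_bound[where B="c * (K * K)"])
      show "AE xx in \<nu> \<Otimes>\<^sub>M \<nu>. cmod (of_real (c * gauss (fst xx - snd xx)) * (h (fst xx) * cnj (h (snd xx)))) \<le> c * (K * K)"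
      proof (rule AE_I2)
        fix xx :: "(real ^ 'm) \<times> (real ^ 'm)"
        have "gauss (fst xx - snd xx) * (cmod (h (fst xx)) * cmod (h (snd xx))) \<le> 1 * (K * K)"
          by (intro mult_mono g1 K K0 mult_nonneg_nonneg) (auto simp: gauss_nonneg)
        then show "cmod (of_real (c * gauss (fst xx - snd xx)) * (h (fst xx) * cnj (h (snd xx)))) \<le> c * (K * K)"
          using \<open>0 < c\<close> by (simp add: norm_mult gauss_nonneg abs_mult mult.assoc)
      qed
    qed measurable
    also have "\<dots> \<le> (\<integral>\<^sup>+xx. ennreal (c / 2) * (ennreal (gauss (fst xx - snd xx)) * ennreal (?N (fst xx)) + ennreal (gauss (fst xx - snd xx)) * ennreal (?N (snd xx))) \<partial>(\<nu> \<Otimes>\<^sub>M \<nu>))"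
    proof (rule nn_integral_mono)
      fix xx :: "(real ^ 'm) \<times> (real ^ 'm)"
      let ?a = "cmod (h (fst xx))" and ?b = "cmod (h (snd xx))" and ?g = "gauss (fst xx - snd xx)"
      have ab: "?a * ?b \<le> (?a\<^sup>2 + ?b\<^sup>2) / 2" using sum_squares_bound[of ?a ?b] by (simp add: field_simps)
      have "cmod (of_real (c * ?g) * (h (fst xx) * cnj (h (snd xx)))) = c * ?g * (?a * ?b)"
        using \<open>0 < c\<close> by (simp add: norm_mult gauss_nonneg)
      also have "\<dots> \<le> c * ?g * ((?a\<^sup>2 + ?b\<^sup>2) / 2)"
        using \<open>0 < c\<close> by (intro mult_left_mono ab) (auto simp: gauss_nonneg)
      also have "\<dots> = c / 2 * (?g * ?a\<^sup>2 + ?g * ?b\<^sup>2)" by (simp add: field_simps)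
      finally show "ennreal (cmod (of_real (c * ?g) * (h (fst xx) * cnj (h (snd xx)))))
        \<le> ennreal (c / 2) * (ennreal ?g * ennreal (?a\<^sup>2) + ennreal ?g * ennreal (?b\<^sup>2))"
        using \<open>0 < c\<close> by (simp add: ennreal_mult[symmetric] gauss_nonneg ennreal_plus[symmetric] ennreal_leI del: ennreal_plus)
    qed
    also have "\<dots> = ennreal (c / 2) * ((\<integral>\<^sup>+xx. ennreal (gauss (fst xx - snd xx)) * ennreal (?N (fst xx)) \<partial>(\<nu> \<Otimes>\<^sub>M \<nu>)) + (\<integral>\<^sup>+xx. ennreal (gauss (fst xx - snd xx)) * ennreal (?N (snd xx)) \<partial>(\<nu> \<Otimes>\<^sub>M \<nu>)))"
      by (subst nn_integral_cmult, measurable) (subst nn_integral_add, auto)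
    also have "\<dots> \<le> ennreal (c / 2) * (ennreal (C0 * B) * (\<integral>\<^sup>+x. ennreal (?N x) \<partial>\<nu>) + ennreal (C0 * B) * (\<integral>\<^sup>+x. ennreal (?N x) \<partial>\<nu>))"
      using first second
      by (intro mult_left_mono add_mono) (auto simp: nn_integral_fst[symmetric])
    also have "\<dots> = ennreal (c * C0 * B) * (\<integral>\<^sup>+x. ennreal (?N x) \<partial>\<nu>)"
    proof -
      have "ennreal (c / 2) * (x + x) = ennreal c * x" for x
      proof -
        have "ennreal (c / 2) * (x + x) = (ennreal (c / 2) * ennreal 2) * x" by (simp add: mult.assoc mult_2)
        also have "ennreal (c / 2) * ennreal 2 = ennreal c" using \<open>0 < c\<close> by (subst ennreal_mult[symmetric]) auto
        finally show ?thesis .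
      qed
      then show ?thesis using \<open>0 < c\<close> C0 B by (simp add: mult.assoc ennreal_mult)
    qed
    finally have "ennreal I1 \<le> ennreal (c * C0 * B) * (\<integral>\<^sup>+x. ennreal (?N x) \<partial>\<nu>)" .
    moreover have "(\<integral>\<^sup>+y. ennreal (gauss y * (cmod (H y))\<^sup>2) \<partial>lborel) = ennreal I1"
      unfolding I1_def by (intro nn_integral_eq_integral intH) (auto simp: gauss_nonneg)
    ultimately show ?thesis by (simp add: H_def)
  qed
  have "0 < c * C0" using \<open>0 < c\<close> C0(1) by simp
  then show ?thesis by (rule that) (rule main, assumption+)
qed

text \<open>Means that the image under \<open>\<Phi>\<close> of Lebesgue measure on \<open>S\<close>
  has density at most \<open>A\<close>. In this form the duality argument need not speak of
  derivatives of \<open>\<Phi>\<close>.\<close>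

definition image_density_le :: "real \<Rightarrow> (real ^ 'm::finite) set \<Rightarrow> (real ^ 'm \<Rightarrow> real ^ 'm) \<Rightarrow> bool" where
  "image_density_le A S \<Phi> \<longleftrightarrow> (\<forall>H :: real ^ 'm \<Rightarrow> real. H \<in> borel_measurable borel \<longrightarrow> (\<forall>y. 0 \<le> H y) \<longrightarrow>
    (\<integral>\<^sup>+t. ennreal (H (\<Phi> t)) * indicator S t \<partial>lborel) \<le> ennreal A * (\<integral>\<^sup>+y. ennreal (H y) \<partial>lborel))"

text \<open>Duality: with \<open>h\<close> the conjugate of \<open>T G\<close>, Fubini turns the square of the norm of \<open>T G\<close> into a pairing
  of \<open>G\<close> with the Fourier transform of \<open>h \<nu>\<close>, to which the preceding bound applies.\<close>

lemma L2_extension_bound: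
  fixes R :: real
  obtains C where "0 < C"
    "\<And>(\<nu> :: (real ^ 'm::finite) measure) B (\<Phi> :: real ^ 'm \<Rightarrow> real ^ 'm) S A G. \<lbrakk>sets \<nu> = sets borel; finite_measure \<nu>; 0 \<le> B;
       \<And>x. emeasure \<nu> (ball x 1) \<le> ennreal B; \<Phi> \<in> borel_measurable borel; S \<in> sets borel;
       \<And>t. t \<in> S \<Longrightarrow> norm (\<Phi> t) \<le> R; 0 \<le> A;
       image_density_le A S \<Phi>;
       G \<in> borel_measurable borel; set_integrable lborel S G\<rbrakk> \<Longrightarrow>
       (\<integral>\<^sup>+x. ennreal ((cmod (LINT t:S|lborel. cis (x \<bullet> \<Phi> t) * G t))\<^sup>2) \<partial>\<nu>)
         \<le> ennreal (C * A * B) * (\<integral>\<^sup>+t. ennreal ((cmod (G t))\<^sup>2) * indicator S t \<partial>lborel)"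
proof -
  obtain C0 where C0: "0 < C0"
    "\<And>(\<nu> :: (real ^ 'm::finite) measure) B h K. \<lbrakk>sets \<nu> = sets borel; finite_measure \<nu>; 0 \<le> B;
       \<And>x. emeasure \<nu> (ball x 1) \<le> ennreal B; h \<in> borel_measurable borel; \<And>x. cmod (h x) \<le> K\<rbrakk> \<Longrightarrow>
       (\<integral>\<^sup>+y. ennreal (gauss y * (cmod (LINT x|\<nu>. cis (x \<bullet> y) * h x))\<^sup>2) \<partial>lborel)
         \<le> ennreal (C0 * B) * (\<integral>\<^sup>+x. ennreal ((cmod (h x))\<^sup>2) \<partial>\<nu>)"
    using gauss_dual_bound[where 'm='m] by blast
  \<comment> \<open>\<open>gauss \<ge> exp (- R^2 / 2)\<close> on the ball of radius
    \<open>R\<close>, which contains the image of \<open>S\<close>.\<close>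
  define C where "C = exp (R\<^sup>2 / 2) * C0"
  have "(\<integral>\<^sup>+x. ennreal ((cmod (LINT t:S|lborel. cis (x \<bullet> \<Phi> t) * G t))\<^sup>2) \<partial>\<nu>)
         \<le> ennreal (C * A * B) * (\<integral>\<^sup>+t. ennreal ((cmod (G t))\<^sup>2) * indicator S t \<partial>lborel)"
    if nu[simp, measurable_cong]: "sets \<nu> = sets borel" and fin: "finite_measure \<nu>" and B: "0 \<le> B"
      "\<And>x. emeasure \<nu> (ball x 1) \<le> ennreal B" and \<Phi>[measurable]: "\<Phi> \<in> borel_measurable borel" and S[measurable]: "S \<in> sets borel"
      and R: "\<And>t. t \<in> S \<Longrightarrow> norm (\<Phi> t) \<le> R" and A: "0 \<le> A" "image_density_le A S \<Phi>"
      and G[measurable]: "G \<in> borel_measurable borel" and Gi: "set_integrable lborel S G"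
    for \<nu> :: "(real ^ 'm) measure" and B A and \<Phi> :: "real ^ 'm \<Rightarrow> real ^ 'm" and S G
  proof -
    interpret finite_measure \<nu> by fact
    interpret ln: pair_sigma_finite lborel \<nu> ..
    define G' where "G' = (\<lambda>t. indicat_real S t *\<^sub>R G t)"
    have G'm[measurable]: "G' \<in> borel_measurable borel" unfolding G'_def by measurable
    have G'i: "integrable lborel G'" using Gi by (simp add: set_integrable_def G'_def)
    define TG where "TG = (\<lambda>x. LINT t|lborel. cis (x \<bullet> \<Phi> t) * G' t)"
    have TG: "(LINT t:S|lborel. cis (x \<bullet> \<Phi> t) * G t) = TG x" for x
      unfolding TG_def set_lebesgue_integral_def G'_def by (simp add: mult.commute mult.left_commute)
    have TGm[measurable]: "TG \<in> borel_measurable borel" unfolding TG_def by measurable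
    define K where "K = (LINT t|lborel. cmod (G' t))"
    have int1: "integrable lborel (\<lambda>t. cis (x \<bullet> \<Phi> t) * G' t)" for x
      by (rule Bochner_Integration.integrable_bound[OF G'i]) (auto simp: norm_mult)
    have TGK: "cmod (TG x) \<le> K" for x
    proof -
      have "cmod (TG x) \<le> (LINT t|lborel. cmod (cis (x \<bullet> \<Phi> t) * G' t))"
        unfolding TG_def by (rule integral_norm_bound)
      then show ?thesis by (simp add: K_def norm_mult)
    qed
    \<comment> \<open>Paired with \<open>G'\<close> along \<open>\<Phi>\<close>, this transform
      returns the squared norm of \<open>TG\<close>.\<close>
    define H where "H = (\<lambda>y. LINT x|\<nu>. cis (x \<bullet> y) * cnj (TG x))"
    have cnjTG[measurable]: "(\<lambda>x. cnj (TG x)) \<in> borel_measurable borel" by measurable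
    have Hm[measurable]: "H \<in> borel_measurable borel" unfolding H_def by measurable
    define I where "I = (LINT x|\<nu>. (cmod (TG x))\<^sup>2)"
    have intI: "integrable \<nu> (\<lambda>x. (cmod (TG x))\<^sup>2)"
      by (rule integrable_const_bound[where B="K\<^sup>2"]) (auto intro!: power_mono TGK)
    have I0: "0 \<le> I" unfolding I_def by (intro integral_nonneg_AE) auto
    have II: "(\<integral>\<^sup>+x. ennreal ((cmod (TG x))\<^sup>2) \<partial>\<nu>) = ennreal I"
      unfolding I_def by (intro nn_integral_eq_integral intI) auto
    have Hg: "(\<integral>\<^sup>+y. ennreal (gauss y * (cmod (H y))\<^sup>2) \<partial>lborel) \<le> ennreal (C0 * B) * ennreal I"
      using C0(2)[OF nu fin B cnjTG, of K] TGK II by (simp add: H_def)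
    define P where "P = (\<lambda>t x. cis (x \<bullet> \<Phi> t) * cnj (TG x) * G' t)"
    have Pm: "(\<lambda>(t, x). P t x) \<in> borel_measurable (lborel \<Otimes>\<^sub>M \<nu>)" unfolding P_def by measurable
    have K0: "0 \<le> K" using TGK[of 0] norm_ge_zero order_trans by blast
    have intP: "integrable (lborel \<Otimes>\<^sub>M \<nu>) (\<lambda>(t, x). P t x)"
    proof (rule Bochner_Integration.integrable_bound)
      show "integrable (lborel \<Otimes>\<^sub>M \<nu>) (\<lambda>(t, x). K * cmod (G' t))"
        by (rule ln.Fubini_integrable) (auto intro!: integrable_norm G'i simp: integrable_const)
      show "AE z in lborel \<Otimes>\<^sub>M \<nu>. norm (case z of (t, x) \<Rightarrow> P t x) \<le> norm (case z of (t, x) \<Rightarrow> K * cmod (G' t))"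
        using TGK K0 by (auto simp: P_def norm_mult intro!: AE_I2 mult_right_mono)
    qed (rule Pm)
    have "complex_of_real I = (LINT x|\<nu>. complex_of_real ((cmod (TG x))\<^sup>2))"
      unfolding I_def by (rule integral_complex_of_real[symmetric])
    also have "\<dots> = (LINT x|\<nu>. LINT t|lborel. P t x)"
    proof (rule Bochner_Integration.integral_cong[OF refl])
      fix x
      have "(LINT t|lborel. P t x) = (LINT t|lborel. cnj (TG x) * (cis (x \<bullet> \<Phi> t) * G' t))"
        by (simp add: P_def mult_ac)
      also have "\<dots> = cnj (TG x) * TG x" unfolding TG_def by (rule integral_mult_right_zero)
      finally show "complex_of_real ((cmod (TG x))\<^sup>2) = (LINT t|lborel. P t x)"
        by (simp only: complex_norm_square mult.commute[of "TG x"])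
    qed
    also have "\<dots> = (LINT t|lborel. LINT x|\<nu>. P t x)" by (rule ln.Fubini_integral[OF intP])
    also have "\<dots> = (LINT t|lborel. H (\<Phi> t) * G' t)"
      unfolding P_def H_def by simp
    finally have "complex_of_real I = (LINT t|lborel. H (\<Phi> t) * G' t)" .
    then have "ennreal I = ennreal (cmod (LINT t|lborel. H (\<Phi> t) * G' t))"
      using I0 by (metis abs_of_nonneg norm_of_real)
    also have "\<dots> \<le> (\<integral>\<^sup>+t. ennreal (cmod (H (\<Phi> t) * G' t)) \<partial>lborel)"
    \<comment> \<open>A function that is not integrable has integral 0 by convention, so the bound
      is then trivial.\<close>
    proof (cases "integrable lborel (\<lambda>t. H (\<Phi> t) * G' t)")
      case True then show ?thesis by (rule integral_norm_bound_ennreal)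
    qed (simp add: not_integrable_integral_eq)
    also have "\<dots> = (\<integral>\<^sup>+t. ennreal (cmod (H (\<Phi> t)) * indicator S t) * ennreal (cmod (G t) * indicator S t) \<partial>lborel)"
      by (intro nn_integral_cong) (auto simp: G'_def norm_mult indicator_def ennreal_mult)
    finally have "(ennreal I)\<^sup>2 \<le> (\<integral>\<^sup>+t. ennreal (cmod (H (\<Phi> t)) * indicator S t) * ennreal (cmod (G t) * indicator S t) \<partial>lborel)\<^sup>2"
      by (intro power_mono) auto
    also have "\<dots> \<le> (\<integral>\<^sup>+t. (ennreal (cmod (H (\<Phi> t)) * indicator S t))\<^sup>2 \<partial>lborel) * (\<integral>\<^sup>+t. (ennreal (cmod (G t) * indicator S t))\<^sup>2 \<partial>lborel)"
      by (rule Cauchy_Schwarz_nn_integral) measurable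
    also have "(\<integral>\<^sup>+t. (ennreal (cmod (G t) * indicator S t))\<^sup>2 \<partial>lborel) = (\<integral>\<^sup>+t. ennreal ((cmod (G t))\<^sup>2) * indicator S t \<partial>lborel)"
      by (intro nn_integral_cong) (auto simp: indicator_def ennreal_power)
    also have "(\<integral>\<^sup>+t. (ennreal (cmod (H (\<Phi> t)) * indicator S t))\<^sup>2 \<partial>lborel)
      \<le> (\<integral>\<^sup>+t. ennreal (exp (R\<^sup>2 / 2)) * (ennreal (gauss (\<Phi> t) * (cmod (H (\<Phi> t)))\<^sup>2) * indicator S t) \<partial>lborel)"
    proof (rule nn_integral_mono)
      fix t :: "real ^ 'm"
      have "1 \<le> exp (R\<^sup>2 / 2) * gauss (\<Phi> t)" if "t \<in> S"
      proof -
        have "(norm (\<Phi> t))\<^sup>2 \<le> R\<^sup>2" using R[OF that] by (simp add: power_mono)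
        then show ?thesis by (simp add: gauss_def exp_add[symmetric])
      qed
      then have "(cmod (H (\<Phi> t)))\<^sup>2 \<le> exp (R\<^sup>2 / 2) * (gauss (\<Phi> t) * (cmod (H (\<Phi> t)))\<^sup>2)" if "t \<in> S"
        using mult_right_mono[of 1 "exp (R\<^sup>2 / 2) * gauss (\<Phi> t)" "(cmod (H (\<Phi> t)))\<^sup>2"] that by (simp add: mult.assoc)
      then show "(ennreal (cmod (H (\<Phi> t)) * indicator S t))\<^sup>2 \<le> ennreal (exp (R\<^sup>2 / 2)) * (ennreal (gauss (\<Phi> t) * (cmod (H (\<Phi> t)))\<^sup>2) * indicator S t)"
        by (auto simp: indicator_def ennreal_power ennreal_mult[symmetric] gauss_nonneg intro!: ennreal_leI)
    qed
    also have "\<dots> = ennreal (exp (R\<^sup>2 / 2)) * (\<integral>\<^sup>+t. ennreal (gauss (\<Phi> t) * (cmod (H (\<Phi> t)))\<^sup>2) * indicator S t \<partial>lborel)"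
      by (rule nn_integral_cmult) measurable
    also have "\<dots> \<le> ennreal (exp (R\<^sup>2 / 2)) * (ennreal A * (\<integral>\<^sup>+y. ennreal (gauss y * (cmod (H y))\<^sup>2) \<partial>lborel))"
      by (intro mult_left_mono A(2)[unfolded image_density_le_def, rule_format, of "\<lambda>y. gauss y * (cmod (H y))\<^sup>2"]) (auto simp: gauss_nonneg)
    also have "\<dots> \<le> ennreal (exp (R\<^sup>2 / 2)) * (ennreal A * (ennreal (C0 * B) * ennreal I))"
      by (intro mult_left_mono Hg) auto
    also have "\<dots> = ennreal (C * A * B) * ennreal I"
      using A B C0 I0 by (simp add: ennreal_mult[symmetric] C_def mult_ac)
    finally have fin: "(ennreal I)\<^sup>2 \<le> (ennreal (C * A * B) * (\<integral>\<^sup>+t. ennreal ((cmod (G t))\<^sup>2) * indicator S t \<partial>lborel)) * ennreal I"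
      by (auto simp: mult_ac mult_right_mono)
    have "ennreal I \<le> ennreal (C * A * B) * (\<integral>\<^sup>+t. ennreal ((cmod (G t))\<^sup>2) * indicator S t \<partial>lborel)"
    \<comment> \<open>The factor \<open>I\<close> common to both sides is cancelled; it is finite
      since \<open>TG\<close> is bounded and \<open>\<nu>\<close> has finite mass.\<close>
    proof (cases "I = 0")
      case False
      then have "ennreal I \<noteq> 0" "ennreal I \<noteq> \<top>" using I0 by auto
      moreover have "ennreal I * ennreal I \<le> ennreal I * (ennreal (C * A * B) * (\<integral>\<^sup>+t. ennreal ((cmod (G t))\<^sup>2) * indicator S t \<partial>lborel))"
        using fin unfolding power2_eq_square by (subst (asm) mult.commute[of _ "ennreal I"])
      ultimately show ?thesis using ennreal_mult_le_mult_iff by blast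
    qed simp
    then show ?thesis by (simp add: TG II)
  qed
  moreover have "0 < C" using C0 by (simp add: C_def)
  ultimately show ?thesis using that by blast
qed

section \<open>The multilinear estimate\<close>

text \<open>Injectivity prevents the image from overlapping itself, and the lower bound
  \<open>c\<close> of the Jacobian bounds the density of the image measure by
  \<open>1 / c\<close>.\<close>

lemma change_of_variables_le:
  fixes \<Phi> :: "real ^ 'm::{finite,wellorder} \<Rightarrow> real ^ 'm::_"
  assumes S[measurable]: "S \<in> sets borel" and \<Phi>[measurable]: "\<Phi> \<in> borel_measurable borel"
    and der: "\<And>t. t \<in> S \<Longrightarrow> (\<Phi> has_derivative \<Phi>' t) (at t within S)"
    and inj: "inj_on \<Phi> S" and c: "0 < c" "\<And>t. t \<in> S \<Longrightarrow> c \<le> \<bar>det (matrix (\<Phi>' t))\<bar>"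
  shows "image_density_le (1 / c) S \<Phi>"
  unfolding image_density_le_def
proof (intro allI impI)
  fix H :: "(real, 'm) vec \<Rightarrow> real"
  assume H[measurable]: "H \<in> borel_measurable borel" and "\<forall>y. 0 \<le> H y"
  then have H0: "\<And>y. 0 \<le> H y" by blast
  show "(\<integral>\<^sup>+t. ennreal (H (\<Phi> t)) * indicator S t \<partial>lborel) \<le> ennreal (1 / c) * (\<integral>\<^sup>+y. ennreal (H y) \<partial>lborel)"
  \<comment> \<open>An infinite right-hand side is trivial. Otherwise \<open>H\<close> is
    integrable, and the formula for absolutely integrable functions applies, with the scalar
    \<open>H\<close> passed as a function into \<open>real ^ 1\<close>.\<close>
  proof (cases "(\<integral>\<^sup>+y. ennreal (H y) \<partial>lborel) = \<infinity>")
    case True then show ?thesis using c by (simp add: ennreal_mult_top)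
  next
    case False
    then have iH: "integrable lborel H"
      using H0 by (intro integrableI_bounded) (auto simp: top.not_eq_extremum)
    let ?J = "\<lambda>t. \<bar>det (matrix (\<Phi>' t))\<bar>"
    have SL: "S \<in> sets lebesgue" using S by (rule sets_completionI_sets[of _ lborel, simplified])
    have diff: "\<Phi> differentiable_on S"
      unfolding differentiable_on_def differentiable_def using der by blast
    have imL: "\<Phi> ` S \<in> sets lebesgue"
      by (rule differentiable_image_in_sets_lebesgue[OF SL _ diff]) simp
    have "(\<lambda>y. ((\<chi> i. H y) :: real ^ 1)) absolutely_integrable_on (\<Phi> ` S)"
    proof -
      have "integrable lebesgue H" using iH by (rule integrable_completion[THEN iffD2, rotated]) simp
      then have "integrable lebesgue (\<lambda>y. H y *\<^sub>R ((\<chi> i. 1) :: real ^ 1))" by simp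
      moreover have "(\<lambda>y. H y *\<^sub>R ((\<chi> i. 1) :: real ^ 1)) = (\<lambda>y. ((\<chi> i. H y) :: real ^ 1))"
        by (auto simp: vec_eq_iff)
      ultimately show ?thesis
        unfolding set_integrable_def by (intro integrable_mult_indicator imL) simp
    qed
    then have *: "(\<lambda>t. ?J t *\<^sub>R ((\<chi> i. H (\<Phi> t)) :: real ^ 1)) absolutely_integrable_on S \<and>
       integral S (\<lambda>t. ?J t *\<^sub>R ((\<chi> i. H (\<Phi> t)) :: real ^ 1)) = integral (\<Phi> ` S) (\<lambda>y. ((\<chi> i. H y) :: real ^ 1))"
      using has_absolute_integral_change_of_variables[OF SL der inj, of "\<lambda>y. ((\<chi> i. H y) :: real ^ 1)"] by blast
    have aiD: "(\<lambda>t. ?J t * H (\<Phi> t)) absolutely_integrable_on S"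
    proof -
      have "(\<lambda>t. (?J t *\<^sub>R ((\<chi> i. H (\<Phi> t)) :: real ^ 1)) \<bullet> axis 1 1) absolutely_integrable_on S"
        by (rule absolutely_integrable_component) (use * in blast)
      then show ?thesis by (simp add: inner_axis)
    qed
    have aiH: "H absolutely_integrable_on (\<Phi> ` S)"
      unfolding set_integrable_def
      by (intro integrable_mult_indicator imL integrable_completion[THEN iffD2] iH) simp
    have eqD: "integral S (\<lambda>t. ?J t * H (\<Phi> t)) = integral (\<Phi> ` S) H"
    proof -
      have "integral S (\<lambda>t. (?J t *\<^sub>R ((\<chi> i. H (\<Phi> t)) :: real ^ 1)) $ 1) = integral S (\<lambda>t. ?J t *\<^sub>R ((\<chi> i. H (\<Phi> t)) :: real ^ 1)) $ 1"
        by (rule integral_component_eq_cart) (use * set_lebesgue_integral_eq_integral(1) in blast)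
      moreover have "integral (\<Phi> ` S) (\<lambda>y. ((\<chi> i. H y) :: real ^ 1) $ 1) = integral (\<Phi> ` S) (\<lambda>y. ((\<chi> i. H y) :: real ^ 1)) $ 1"
        by (rule integral_component_eq_cart)
           (use \<open>(\<lambda>y. ((\<chi> i. H y) :: real ^ 1)) absolutely_integrable_on (\<Phi> ` S)\<close> set_lebesgue_integral_eq_integral(1) in blast)
      ultimately show ?thesis using * by simp
    qed
    have "(\<integral>\<^sup>+t. ennreal (H (\<Phi> t)) * indicator S t \<partial>lborel) = (\<integral>\<^sup>+t. ennreal (H (\<Phi> t)) * indicator S t \<partial>lebesgue)"
      by (simp add: nn_integral_completion)
    also have "\<dots> \<le> (\<integral>\<^sup>+t. ennreal (1 / c) * ennreal (indicator S t *\<^sub>R (?J t * H (\<Phi> t))) \<partial>lebesgue)"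
    proof (rule nn_integral_mono)
      fix t
      have "H (\<Phi> t) \<le> 1 / c * (?J t * H (\<Phi> t))" if "t \<in> S"
        using mult_right_mono[OF c(2)[OF that] H0[of "\<Phi> t"]] c(1) by (simp add: field_simps)
      then show "ennreal (H (\<Phi> t)) * indicator S t \<le> ennreal (1 / c) * ennreal (indicator S t *\<^sub>R (?J t * H (\<Phi> t)))"
        using c(1) H0 by (auto simp: indicator_def ennreal_mult[symmetric] intro!: ennreal_leI)
    qed
    also have "\<dots> = ennreal (1 / c) * (\<integral>\<^sup>+t. ennreal (indicator S t *\<^sub>R (?J t * H (\<Phi> t))) \<partial>lebesgue)"
      using borel_measurable_integrable[OF aiD[unfolded set_integrable_def]]
      by (intro nn_integral_cmult) simp
    also have "(\<integral>\<^sup>+t. ennreal (indicator S t *\<^sub>R (?J t * H (\<Phi> t))) \<partial>lebesgue) = ennreal (LINT t|lebesgue. indicator S t *\<^sub>R (?J t * H (\<Phi> t)))"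
      using aiD by (intro nn_integral_eq_integral) (auto simp: set_integrable_def indicator_def H0)
    also have "(LINT t|lebesgue. indicator S t *\<^sub>R (?J t * H (\<Phi> t))) = integral S (\<lambda>t. ?J t * H (\<Phi> t))"
      using set_lebesgue_integral_eq_integral(2)[OF aiD] by (simp add: set_lebesgue_integral_def)
    also have "\<dots> = (LINT y:\<Phi> ` S|lebesgue. H y)"
      unfolding eqD by (rule set_lebesgue_integral_eq_integral(2)[OF aiH, symmetric])
    also have "ennreal (1 / c) * ennreal (LINT y:\<Phi> ` S|lebesgue. H y) \<le> ennreal (1 / c) * ennreal (LINT y|lebesgue. H y)"
    proof (intro mult_left_mono ennreal_leI)
      show "(LINT y:\<Phi> ` S|lebesgue. H y) \<le> (LINT y|lebesgue. H y)"
        unfolding set_lebesgue_integral_def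
        by (intro integral_mono) (use aiH iH H0 in \<open>auto simp: set_integrable_def indicator_def integrable_completion\<close>)
    qed simp
    also have "(LINT y|lebesgue. H y) = (LINT y|lborel. H y)" by (simp add: integral_completion)
    also have "ennreal (LINT y|lborel. H y) = (\<integral>\<^sup>+y. ennreal (H y) \<partial>lborel)"
      by (intro nn_integral_eq_integral[symmetric] iH) (simp add: H0)
    finally show ?thesis .
  qed
qed

text \<open>Marcinkiewicz interpolation between \<open>L\<^sup>1 \<rightarrow> L\<^sup>\<infinity>\<close> (norm 1) and \<open>L\<^sup>2 \<rightarrow> L\<^sup>2\<close>: at height \<open>\<tau>\<close> the function is
  cut at the level \<open>s(\<tau>)\<close> for which the large part contributes at most \<open>\<tau> / 2\<close>.\<close>

lemma interpolation_L1_L2: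
  fixes M :: "'a measure" and \<nu> :: "'b measure" and r r' :: real and T :: "('a \<Rightarrow> complex) \<Rightarrow> 'b \<Rightarrow> complex"
  assumes fm: "finite_measure \<nu>" and sf: "sigma_finite_measure M"
    and T_meas: "\<And>G. integrable M G \<Longrightarrow> T G \<in> borel_measurable \<nu>"
    and T_add: "\<And>G1 G2 x. integrable M G1 \<Longrightarrow> integrable M G2 \<Longrightarrow> T (\<lambda>t. G1 t + G2 t) x = T G1 x + T G2 x"
    and T_1: "\<And>G x. integrable M G \<Longrightarrow> cmod (T G x) \<le> (LINT t|M. cmod (G t))"
    and T_2: "\<And>G. integrable M G \<Longrightarrow> (\<integral>\<^sup>+x. ennreal ((cmod (T G x))\<^sup>2) \<partial>\<nu>) \<le> ennreal A * (\<integral>\<^sup>+t. ennreal ((cmod (G t))\<^sup>2) \<partial>M)"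
    and "0 \<le> A" and r: "1 < r" "r < 2" and r': "1 / r + 1 / r' = 1"
    and G: "integrable M G" and Gr: "integrable M (\<lambda>t. cmod (G t) powr r)"
  shows "(\<integral>\<^sup>+x. ennreal (cmod (T G x) powr r') \<partial>\<nu>)
     \<le> ennreal (4 * r' * 2 powr (r' - 2) / (r' - 2) * A * (LINT t|M. cmod (G t) powr r) powr (r' - 1))"
proof -
  interpret finite_measure \<nu> by fact
  interpret M: sigma_finite_measure M by fact
  interpret n1: pair_sigma_finite \<nu> lborel ..
  interpret n2: pair_sigma_finite lborel M ..
  have [measurable]: "G \<in> borel_measurable M" using G by simp
  have [measurable]: "T G \<in> borel_measurable \<nu>" by (rule T_meas[OF G])
  have r'_gt: "2 < r'"
  proof -
    have "1 / r' = 1 - 1 / r" using r' by simp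
    moreover have "0 < 1 - 1 / r" "1 - 1 / r < 1 / 2" using r by (auto simp: field_simps)
    ultimately have a: "0 < 1 / r'" "1 / r' < 1 / 2" by simp_all
    then have "0 < r'" by simp
    with a(2) show ?thesis by (simp add: field_simps)
  qed
  have rr: "r * r' = r + r'" using r' r r'_gt by (simp add: field_simps)
  define N where "N = (LINT t|M. cmod (G t) powr r)"
  have N0: "0 \<le> N" unfolding N_def by simp
  show ?thesis
  \<comment> \<open>The cutting level defined below is positive for \<open>N > 0\<close>. If
    \<open>N = 0\<close>, then \<open>G\<close> vanishes almost everywhere and \<open>T_1\<close>
    gives \<open>T G = 0\<close>.\<close>
  proof (cases "N = 0")
    case True
    then have "AE t in M. cmod (G t) powr r = 0"
      using integral_nonneg_eq_0_iff_AE[OF Gr] by (simp add: N_def)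
    then have "AE t in M. cmod (G t) = 0" by auto
    then have "(LINT t|M. cmod (G t)) = 0" by (simp add: integral_eq_zero_AE)
    then have "T G x = 0" for x using T_1[OF G, of x] by simp
    then show ?thesis by simp
  next
    case False
    then have N: "0 < N" using N0 by simp
    \<comment> \<open>Solves \<open>s \<tau> powr (r - 1) = 2 * N / \<tau>\<close>. Where
      \<open>cmod (G t)\<close> exceeds this level it is at most
      \<open>\<tau> / (2 * N) * cmod (G t) powr r\<close>, which has integral
      \<open>\<tau> / 2\<close>.\<close>
    define s where "s = (\<lambda>\<tau>::real. (2 * N / \<tau>) powr (1 / (r - 1)))"
    define L where "L = (\<lambda>\<tau> t. if cmod (G t) \<le> s \<tau> then G t else 0)"
    have Lm[measurable]: "(\<lambda>(\<tau>, t). L \<tau> t) \<in> borel_measurable (lborel \<Otimes>\<^sub>M M)"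
      unfolding L_def s_def by measurable
    have Li: "integrable M (L \<tau>)" for \<tau>
      by (rule Bochner_Integration.integrable_bound[OF G]) (auto simp: L_def)
    \<comment> \<open>Chebyshev's inequality in \<open>L^2\<close>: where
      \<open>cmod (T G x) \<ge> \<tau>\<close>, the image of the truncated function has size at
      least \<open>\<tau> / 2\<close>.\<close>
    have level: "emeasure \<nu> {x \<in> space \<nu>. \<tau> \<le> cmod (T G x)} \<le> ennreal (4 * A / \<tau>\<^sup>2) * (\<integral>\<^sup>+t. ennreal ((cmod (L \<tau> t))\<^sup>2) \<partial>M)"
      if \<tau>: "0 < \<tau>" for \<tau>
    proof -
      have Ui: "integrable M (\<lambda>t. G t - L \<tau> t)" by (intro Bochner_Integration.integrable_diff G Li)
      have s0: "0 < s \<tau>" using N \<tau> by (simp add: s_def)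
      have sr: "s \<tau> powr (r - 1) = 2 * N / \<tau>" using N \<tau> r by (simp add: s_def powr_powr)
      have "(LINT t|M. cmod (G t - L \<tau> t)) \<le> (LINT t|M. \<tau> / (2 * N) * cmod (G t) powr r)"
      proof (rule integral_mono)
        fix t
        show "cmod (G t - L \<tau> t) \<le> \<tau> / (2 * N) * cmod (G t) powr r"
        proof (cases "cmod (G t) \<le> s \<tau>")
          case False
          then have "s \<tau> powr (r - 1) \<le> cmod (G t) powr (r - 1)"
            using s0 r by (intro powr_mono2) auto
          then have "1 \<le> \<tau> / (2 * N) * cmod (G t) powr (r - 1)"
            using N \<tau> unfolding sr by (simp add: field_simps)
          then have "cmod (G t) * 1 \<le> cmod (G t) * (\<tau> / (2 * N) * cmod (G t) powr (r - 1))"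
            by (intro mult_left_mono) auto
          moreover have "cmod (G t) powr r = cmod (G t) * cmod (G t) powr (r - 1)"
            using False s0 by (simp add: powr_diff)
          ultimately show ?thesis using False by (simp add: L_def mult_ac)
        qed (use N \<tau> in \<open>auto simp: L_def\<close>)
      qed (use Ui Gr in auto)
      also have "\<dots> = \<tau> / 2" using N by (simp add: N_def[symmetric])
      finally have U: "cmod (T (\<lambda>t. G t - L \<tau> t) x) \<le> \<tau> / 2" for x
        using T_1[OF Ui, of x] by linarith
      have split: "T G x = T (L \<tau>) x + T (\<lambda>t. G t - L \<tau> t) x" for x
        using T_add[OF Li Ui, of \<tau> x] by simp
      have [measurable]: "T (L \<tau>) \<in> borel_measurable \<nu>" by (rule T_meas[OF Li])
      have "emeasure \<nu> {x \<in> space \<nu>. \<tau> \<le> cmod (T G x)} = (\<integral>\<^sup>+x. indicator {x \<in> space \<nu>. \<tau> \<le> cmod (T G x)} x \<partial>\<nu>)"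
        by simp
      also have "\<dots> \<le> (\<integral>\<^sup>+x. ennreal (4 / \<tau>\<^sup>2) * ennreal ((cmod (T (L \<tau>) x))\<^sup>2) \<partial>\<nu>)"
      proof (rule nn_integral_mono)
        fix x
        have "1 \<le> 4 / \<tau>\<^sup>2 * (cmod (T (L \<tau>) x))\<^sup>2" if "\<tau> \<le> cmod (T G x)"
        proof -
          have "cmod (T G x) \<le> cmod (T (L \<tau>) x) + \<tau> / 2"
            using norm_triangle_ineq[of "T (L \<tau>) x" "T (\<lambda>t. G t - L \<tau> t) x"] U[of x] split[of x] by simp
          then have "\<tau> / 2 \<le> cmod (T (L \<tau>) x)" using that by linarith
          then have "(\<tau> / 2)\<^sup>2 \<le> (cmod (T (L \<tau>) x))\<^sup>2" using \<tau> by (intro power_mono) auto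
          then show ?thesis using \<tau> by (simp add: field_simps power2_eq_square)
        qed
        then show "indicator {x \<in> space \<nu>. \<tau> \<le> cmod (T G x)} x \<le> ennreal (4 / \<tau>\<^sup>2) * ennreal ((cmod (T (L \<tau>) x))\<^sup>2)"
          by (auto simp: indicator_def ennreal_mult[symmetric] simp flip: ennreal_1 intro!: ennreal_leI)
      qed
      also have "\<dots> = ennreal (4 / \<tau>\<^sup>2) * (\<integral>\<^sup>+x. ennreal ((cmod (T (L \<tau>) x))\<^sup>2) \<partial>\<nu>)"
        by (rule nn_integral_cmult) measurable
      also have "\<dots> \<le> ennreal (4 / \<tau>\<^sup>2) * (ennreal A * (\<integral>\<^sup>+t. ennreal ((cmod (L \<tau> t))\<^sup>2) \<partial>M))"
        by (intro mult_left_mono T_2 Li) auto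
      also have "\<dots> = ennreal (4 * A / \<tau>\<^sup>2) * (\<integral>\<^sup>+t. ennreal ((cmod (L \<tau> t))\<^sup>2) \<partial>M)"
        using \<open>0 \<le> A\<close> by (simp add: mult.assoc[symmetric] ennreal_mult[symmetric])
      finally show ?thesis .
    qed
    have power_int: "(\<integral>\<^sup>+\<tau>. ennreal (e * \<tau> powr (e - 1)) * indicator {0<..a} \<tau> \<partial>lborel) = ennreal (a powr e)"
      if e: "0 < e" "0 \<le> a" for e a :: real
    proof -
      have "((\<lambda>\<tau>. e * \<tau> powr (e - 1)) has_integral (a powr e)) {0..a}"
        using has_integral_mult_right[OF has_integral_powr_from_0[of "e - 1" a], of e] e by simp
      then have "((\<lambda>\<tau>. if \<tau> \<in> {0..a} then e * \<tau> powr (e - 1) else 0) has_integral (a powr e)) UNIV"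
        by (simp only: has_integral_restrict_UNIV)
      then have "(\<integral>\<^sup>+\<tau>. ennreal (if \<tau> \<in> {0..a} then e * \<tau> powr (e - 1) else 0) \<partial>lborel) = ennreal (a powr e)"
        by (rule nn_integral_has_integral_lborel[rotated 2]) (use e in auto)
      moreover have "(\<integral>\<^sup>+\<tau>. ennreal (if \<tau> \<in> {0..a} then e * \<tau> powr (e - 1) else 0) \<partial>lborel)
        = (\<integral>\<^sup>+\<tau>. ennreal (e * \<tau> powr (e - 1)) * indicator {0<..a} \<tau> \<partial>lborel)"
        by (intro nn_integral_cong) (auto simp: indicator_def)
      ultimately show ?thesis by simp
    qed
    \<comment> \<open>\<open>4 * A\<close> comes from the level estimate, \<open>r'\<close> from the
      layer-cake formula and \<open>1 / (r' - 2)\<close> from integrating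
      \<open>\<tau> powr (r' - 3)\<close>.\<close>
    define Q where "Q = 4 * A * r' / (r' - 2)"
    have Q0: "0 \<le> Q" using \<open>0 \<le> A\<close> r'_gt by (simp add: Q_def)
    have "(\<integral>\<^sup>+x. ennreal (cmod (T G x) powr r') \<partial>\<nu>)
      = (\<integral>\<^sup>+x. (\<integral>\<^sup>+\<tau>. ennreal (r' * \<tau> powr (r' - 1)) * indicator {0<..cmod (T G x)} \<tau> \<partial>lborel) \<partial>\<nu>)"
      using r'_gt by (intro nn_integral_cong) (subst power_int, auto)
    also have "\<dots> = (\<integral>\<^sup>+x. (\<integral>\<^sup>+\<tau>. ennreal (r' * \<tau> powr (r' - 1)) * indicator {0<..} \<tau> * indicator {(x, \<tau>). \<tau> \<le> cmod (T G x)} (x, \<tau>) \<partial>lborel) \<partial>\<nu>)"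
      by (intro nn_integral_cong) (auto simp: indicator_def)
    also have "\<dots> = (\<integral>\<^sup>+\<tau>. (\<integral>\<^sup>+x. ennreal (r' * \<tau> powr (r' - 1)) * indicator {0<..} \<tau> * indicator {(x, \<tau>). \<tau> \<le> cmod (T G x)} (x, \<tau>) \<partial>\<nu>) \<partial>lborel)"
    proof (rule n1.Fubini'[symmetric])
      have [measurable]: "Measurable.pred (\<nu> \<Otimes>\<^sub>M lborel) (\<lambda>z. snd z \<le> cmod (T G (fst z)))" by measurable
      show "(\<lambda>(x, \<tau>). ennreal (r' * \<tau> powr (r' - 1)) * indicator {0<..} \<tau> * indicator {(x, \<tau>). \<tau> \<le> cmod (T G x)} (x, \<tau>)) \<in> borel_measurable (\<nu> \<Otimes>\<^sub>M lborel)"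
        unfolding indicator_def case_prod_unfold mem_Collect_eq fst_conv snd_conv by measurable
    qed
    also have "\<dots> = (\<integral>\<^sup>+\<tau>. ennreal (r' * \<tau> powr (r' - 1)) * indicator {0<..} \<tau> * emeasure \<nu> {x \<in> space \<nu>. \<tau> \<le> cmod (T G x)} \<partial>lborel)"
    proof (rule nn_integral_cong)
      fix \<tau> :: real
      have "(\<integral>\<^sup>+x. ennreal (r' * \<tau> powr (r' - 1)) * indicator {0<..} \<tau> * indicator {(x, \<tau>). \<tau> \<le> cmod (T G x)} (x, \<tau>) \<partial>\<nu>)
        = (\<integral>\<^sup>+x. ennreal (r' * \<tau> powr (r' - 1)) * indicator {0<..} \<tau> * indicator {x \<in> space \<nu>. \<tau> \<le> cmod (T G x)} x \<partial>\<nu>)"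
        by (intro nn_integral_cong) (auto simp: indicator_def)
      then show "(\<integral>\<^sup>+x. ennreal (r' * \<tau> powr (r' - 1)) * indicator {0<..} \<tau> * indicator {(x, \<tau>). \<tau> \<le> cmod (T G x)} (x, \<tau>) \<partial>\<nu>)
        = ennreal (r' * \<tau> powr (r' - 1)) * indicator {0<..} \<tau> * emeasure \<nu> {x \<in> space \<nu>. \<tau> \<le> cmod (T G x)}"
        by (simp add: nn_integral_cmult_indicator)
    qed
    also have "\<dots> \<le> (\<integral>\<^sup>+\<tau>. (\<integral>\<^sup>+t. ennreal (4 * A * r' * \<tau> powr (r' - 3)) * indicator {0<..} \<tau> * ennreal ((cmod (L \<tau> t))\<^sup>2) \<partial>M) \<partial>lborel)"
    proof (rule nn_integral_mono)
      fix \<tau> :: real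
      show "ennreal (r' * \<tau> powr (r' - 1)) * indicator {0<..} \<tau> * emeasure \<nu> {x \<in> space \<nu>. \<tau> \<le> cmod (T G x)}
        \<le> (\<integral>\<^sup>+t. ennreal (4 * A * r' * \<tau> powr (r' - 3)) * indicator {0<..} \<tau> * ennreal ((cmod (L \<tau> t))\<^sup>2) \<partial>M)"
      proof (cases "0 < \<tau>")
        case True
        have [measurable]: "L \<tau> \<in> borel_measurable M" using Li by simp
        have pw: "\<tau> powr (r' - 1) / \<tau>\<^sup>2 = \<tau> powr (r' - 3)"
          using True by (simp add: powr_diff powr_numeral power2_eq_square power3_eq_cube field_simps)
        have "ennreal (r' * \<tau> powr (r' - 1)) * emeasure \<nu> {x \<in> space \<nu>. \<tau> \<le> cmod (T G x)}
          \<le> ennreal (r' * \<tau> powr (r' - 1)) * (ennreal (4 * A / \<tau>\<^sup>2) * (\<integral>\<^sup>+t. ennreal ((cmod (L \<tau> t))\<^sup>2) \<partial>M))"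
          by (intro mult_left_mono level True) simp
        also have "\<dots> = ennreal (4 * A * r' * (\<tau> powr (r' - 1) / \<tau>\<^sup>2)) * (\<integral>\<^sup>+t. ennreal ((cmod (L \<tau> t))\<^sup>2) \<partial>M)"
        proof -
          have "ennreal (r' * \<tau> powr (r' - 1)) * (ennreal (4 * A / \<tau>\<^sup>2) * X) = ennreal (r' * \<tau> powr (r' - 1) * (4 * A / \<tau>\<^sup>2)) * X" for X
            using r'_gt \<open>0 \<le> A\<close> by (subst ennreal_mult) (auto simp: mult.assoc)
          moreover have "r' * \<tau> powr (r' - 1) * (4 * A / \<tau>\<^sup>2) = 4 * A * r' * (\<tau> powr (r' - 1) / \<tau>\<^sup>2)" by simp
          ultimately show ?thesis by (simp only:)
        qed
        also have "\<dots> = (\<integral>\<^sup>+t. ennreal (4 * A * r' * \<tau> powr (r' - 3)) * ennreal ((cmod (L \<tau> t))\<^sup>2) \<partial>M)"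
          unfolding pw by (rule nn_integral_cmult[symmetric]) measurable
        finally show ?thesis using True by simp
      qed simp
    qed
    also have "\<dots> = (\<integral>\<^sup>+t. (\<integral>\<^sup>+\<tau>. ennreal (4 * A * r' * \<tau> powr (r' - 3)) * indicator {0<..} \<tau> * ennreal ((cmod (L \<tau> t))\<^sup>2) \<partial>lborel) \<partial>M)"
    proof (rule n2.Fubini'[symmetric])
      show "(\<lambda>(\<tau>, t). ennreal (4 * A * r' * \<tau> powr (r' - 3)) * indicator {0<..} \<tau> * ennreal ((cmod (L \<tau> t))\<^sup>2)) \<in> borel_measurable (lborel \<Otimes>\<^sub>M M)"
        using Lm unfolding case_prod_unfold by measurable
    qed
    also have "\<dots> \<le> (\<integral>\<^sup>+t. ennreal (Q * (2 * N) powr (r' - 2)) * ennreal (cmod (G t) powr r) \<partial>M)"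
    proof (rule nn_integral_mono)
      fix t
      define g where "g = cmod (G t)"
      show "(\<integral>\<^sup>+\<tau>. ennreal (4 * A * r' * \<tau> powr (r' - 3)) * indicator {0<..} \<tau> * ennreal ((cmod (L \<tau> t))\<^sup>2) \<partial>lborel)
        \<le> ennreal (Q * (2 * N) powr (r' - 2)) * ennreal (cmod (G t) powr r)"
      proof (cases "g = 0")
        case True
        then have "L \<tau> t = 0" for \<tau> by (auto simp: g_def L_def)
        then show ?thesis by simp
      next
        case False
        then have g: "0 < g" by (simp add: g_def)
        \<comment> \<open>The value \<open>g\<close> survives the truncation at height
          \<open>\<tau>\<close> only if \<open>\<tau> \<le> b\<close>, which bounds the inner
          integral.\<close>
        define b where "b = 2 * N * g powr (1 - r)"
        have b: "0 < b" using N g by (simp add: b_def)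
        have small: "\<tau> \<le> b" if "g \<le> s \<tau>" "0 < \<tau>" for \<tau>
        proof -
          have "g powr (r - 1) \<le> s \<tau> powr (r - 1)" using that g r by (intro powr_mono2) auto
          also have "\<dots> = 2 * N / \<tau>" using N that r by (simp add: s_def powr_powr)
          finally have "\<tau> * g powr (r - 1) \<le> 2 * N" using that by (simp add: field_simps)
          then have "\<tau> * g powr (r - 1) * g powr (1 - r) \<le> b" unfolding b_def by (rule mult_right_mono) simp
          moreover have "g powr (r - 1) * g powr (1 - r) = 1" using g by (simp add: powr_add[symmetric])
          ultimately show ?thesis by (simp add: mult.assoc)
        qed
        have "(\<integral>\<^sup>+\<tau>. ennreal (4 * A * r' * \<tau> powr (r' - 3)) * indicator {0<..} \<tau> * ennreal ((cmod (L \<tau> t))\<^sup>2) \<partial>lborel)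
          \<le> (\<integral>\<^sup>+\<tau>. ennreal (Q * g\<^sup>2) * (ennreal ((r' - 2) * \<tau> powr ((r' - 2) - 1)) * indicator {0<..b} \<tau>) \<partial>lborel)"
        proof (rule nn_integral_mono)
          fix \<tau> :: real
          have "4 * A * r' * \<tau> powr (r' - 3) * g\<^sup>2 = Q * g\<^sup>2 * ((r' - 2) * \<tau> powr ((r' - 2) - 1))"
            using r'_gt by (simp add: Q_def)
          then have eq: "ennreal (4 * A * r' * \<tau> powr (r' - 3)) * ennreal (g\<^sup>2) = ennreal (Q * g\<^sup>2) * ennreal ((r' - 2) * \<tau> powr ((r' - 2) - 1))"
            using \<open>0 \<le> A\<close> r'_gt Q0 by (subst (1 2) ennreal_mult[symmetric]) auto
          show "ennreal (4 * A * r' * \<tau> powr (r' - 3)) * indicator {0<..} \<tau> * ennreal ((cmod (L \<tau> t))\<^sup>2)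
            \<le> ennreal (Q * g\<^sup>2) * (ennreal ((r' - 2) * \<tau> powr ((r' - 2) - 1)) * indicator {0<..b} \<tau>)"
          proof (cases "0 < \<tau> \<and> g \<le> s \<tau>")
            case True
            then have "cmod (L \<tau> t) = g" by (simp add: L_def g_def)
            then show ?thesis using True small[of \<tau>] eq by (simp del: diff_diff_eq)
          qed (auto simp: L_def g_def)
        qed
        also have "\<dots> = ennreal (Q * g\<^sup>2) * ennreal (b powr (r' - 2))"
          using r'_gt b power_int[of "r' - 2" b] by (subst nn_integral_cmult) auto
        also have "\<dots> = ennreal (Q * (2 * N) powr (r' - 2)) * ennreal (g powr r)"
        proof -
          have "g\<^sup>2 * b powr (r' - 2) = (2 * N) powr (r' - 2) * (g powr 2 * g powr ((1 - r) * (r' - 2)))"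
            using N g by (simp add: b_def powr_mult powr_powr)
          also have "g powr 2 * g powr ((1 - r) * (r' - 2)) = g powr (2 + (1 - r) * (r' - 2))"
            by (rule powr_add[symmetric])
          also have "2 + (1 - r) * (r' - 2) = r" using rr by (simp add: algebra_simps)
          finally show ?thesis using Q0 by (simp add: ennreal_mult[symmetric] mult.assoc)
        qed
        finally show ?thesis by (simp add: g_def)
      qed
    qed
    also have "\<dots> = ennreal (Q * (2 * N) powr (r' - 2)) * ennreal N"
      unfolding N_def using Gr by (subst nn_integral_cmult) (auto simp: nn_integral_eq_integral)
    also have "\<dots> = ennreal (4 * r' * 2 powr (r' - 2) / (r' - 2) * A * N powr (r' - 1))"
    proof -
      have "N powr (r' - 2) * N = N powr (r' - 1)"
        using N powr_add[of N "r' - 2" 1] by simp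
      then have "Q * (2 * N) powr (r' - 2) * N = 4 * r' * 2 powr (r' - 2) / (r' - 2) * A * N powr (r' - 1)"
        using N by (simp add: Q_def powr_mult)
      then show ?thesis using Q0 N by (simp add: ennreal_mult[symmetric])
    qed
    finally show ?thesis by (simp add: N_def)
  qed
qed

section \<open>Oscillatory integrals and power means\<close>

definition osc :: "(real \<Rightarrow> real ^ 'm::finite) \<Rightarrow> real set \<Rightarrow> (real \<Rightarrow> complex) \<Rightarrow> real ^ 'm \<Rightarrow> complex" where
  "osc g J f x = (LINT t:J|lborel. cis (x \<bullet> g t) * f t)"

text \<open>Below the level \<open>k\<close> the power of order \<open>r\<close> is at most
  \<open>k powr r\<close>; above it the exponent may be raised to \<open>p\<close>. Later
  \<open>k\<close> will be a mean of order \<open>p\<close>.\<close>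

lemma powr_le_powr_scaled:
  fixes a :: real
  assumes "0 \<le> a" "0 < r" "r \<le> p" "0 < k"
  shows "a powr r \<le> k powr r * (1 + (a / k) powr p)"
proof -
  have "(a / k) powr r \<le> 1 + (a / k) powr p"
  proof (cases "a / k \<le> 1")
    case True
    then have "(a / k) powr r \<le> 1 powr r" using assms by (intro powr_mono2) auto
    then show ?thesis by (simp add: add_increasing2)
  next
    case False
    then have "(a / k) powr r \<le> (a / k) powr p" using assms by (intro powr_mono) auto
    then show ?thesis by simp
  qed
  then have "k powr r * (a / k) powr r \<le> k powr r * (1 + (a / k) powr p)"
    using assms by (intro mult_left_mono) auto
  then show ?thesis using assms by (simp add: powr_divide)
qed

lemma set_integrable_powr_le:
  fixes h :: "real \<Rightarrow> real"
  assumes [measurable]: "J \<in> sets borel" "h \<in> borel_measurable borel" and h0: "\<And>t. 0 \<le> h t"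
    and fin: "emeasure lborel J < \<infinity>" and r: "0 < r" "r \<le> p"
    and hp: "set_integrable lborel J (\<lambda>t. h t powr p)"
  shows "set_integrable lborel J (\<lambda>t. h t powr r)"
proof -
  have i1: "set_integrable lborel J (\<lambda>t. 1 + h t powr p)"
    using hp fin by (intro set_integral_add) (auto simp: set_integrable_def)
  show ?thesis
  proof (rule set_integrable_bound[OF i1])
    show "set_borel_measurable lborel J (\<lambda>t. h t powr r)" by (simp add: set_borel_measurable_def)
    show "AE t in lborel. t \<in> J \<longrightarrow> norm (h t powr r) \<le> norm (1 + h t powr p)"
      using powr_le_powr_scaled[OF h0 r, of 1] by (auto simp: h0 intro!: AE_I2)
  qed
qed

text \<open>A form of Jensen's inequality; the constant 2 is the price for deriving it from the pointwise bound above.\<close>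

lemma set_integral_powr_le:
  fixes h :: "real \<Rightarrow> real"
  assumes J[measurable]: "J \<in> sets borel" and hm[measurable]: "h \<in> borel_measurable borel" and h0: "\<And>t. 0 \<le> h t"
    and l: "emeasure lborel J \<le> ennreal l" "0 < l" and r: "0 < r" "r \<le> p"
    and hp: "set_integrable lborel J (\<lambda>t. h t powr p)"
  shows "(LINT t:J|lborel. h t powr r) \<le> 2 * l powr (1 - r / p) * (LINT t:J|lborel. h t powr p) powr (r / p)"
proof -
  define K where "K = (LINT t:J|lborel. h t powr p)"
  have p: "0 < p" using r by simp
  have fin: "emeasure lborel J < \<infinity>" using l(1) by (rule le_less_trans) simp
  have ml: "measure lborel J \<le> l" using l by (simp add: measure_def enn2real_leI)
  have K0: "0 \<le> K" unfolding K_def set_lebesgue_integral_def by (intro integral_nonneg_AE) (auto simp: h0)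
  have ir: "set_integrable lborel J (\<lambda>t. h t powr r)"
    by (rule set_integrable_powr_le[OF J hm h0 fin r hp])
  show ?thesis
  proof (cases "K = 0")
    case True
    have "AE t in lborel. indicat_real J t *\<^sub>R (h t powr p) = 0"
      using True hp unfolding K_def set_lebesgue_integral_def set_integrable_def
      by (subst (asm) integral_nonneg_eq_0_iff_AE) (auto simp: h0)
    then have "AE t in lborel. indicat_real J t *\<^sub>R (h t powr r) = 0"
      by eventually_elim (auto simp: indicator_def)
    then have "(LINT t:J|lborel. h t powr r) = 0"
      unfolding set_lebesgue_integral_def by (rule integral_eq_zero_AE)
    then show ?thesis using l by simp
  next
    case False
    then have K: "0 < K" using K0 by simp
    \<comment> \<open>With this mean of order \<open>p\<close>, each of the two terms of the
      pointwise bound contributes at most \<open>l\<close>, apart from the factor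
      \<open>k powr r\<close>.\<close>
    define k where "k = (K / l) powr (1 / p)"
    have k: "0 < k" using K l by (simp add: k_def)
    have kp: "k powr p = K / l" using K l p by (simp add: k_def powr_powr)
    have i1: "set_integrable lborel J (\<lambda>t. k powr r * (1 + (h t / k) powr p))"
    proof -
      have "set_integrable lborel J (\<lambda>t. k powr r * (1 + 1 / (k powr p) * (h t powr p)))"
        using hp fin by (intro set_integrable_mult_right set_integral_add) (auto simp: set_integrable_def)
      then show ?thesis using h0 k by (simp add: powr_divide)
    qed
    have "(LINT t:J|lborel. h t powr r) \<le> (LINT t:J|lborel. k powr r * (1 + (h t / k) powr p))"
      by (rule set_integral_mono[OF ir i1]) (rule powr_le_powr_scaled[OF h0 r k])
    also have "\<dots> = k powr r * (LINT t:J|lborel. 1 + 1 / (k powr p) * (h t powr p))"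
      using h0 k by (simp add: powr_divide)
    also have "(LINT t:J|lborel. 1 + 1 / (k powr p) * (h t powr p)) = measure lborel J + 1 / (k powr p) * K"
    proof -
      have "set_integrable lborel J (\<lambda>t. 1 :: real)" using fin by (simp add: set_integrable_def)
      moreover have "(LINT t:J|lborel. (1 :: real)) = measure lborel J"
        by (simp add: set_lebesgue_integral_def)
      ultimately show ?thesis using hp unfolding K_def by (subst set_integral_add) auto
    qed
    also have "k powr r * (measure lborel J + 1 / (k powr p) * K) \<le> k powr r * (2 * l)"
      using ml K l by (intro mult_left_mono) (auto simp: kp)
    also have "k powr r = (K / l) powr (r / p)" using K l by (simp add: k_def powr_powr)
    also have "(K / l) powr (r / p) * (2 * l) = 2 * l powr (1 - r / p) * K powr (r / p)"
      using K l by (simp add: powr_divide powr_diff)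
    finally show ?thesis by (simp add: K_def)
  qed
qed

lemma norm_moment_deriv_le:
  fixes rk :: "'m::finite \<Rightarrow> nat"
  assumes "u \<in> {0..1}"
  shows "norm (moment_deriv rk u) \<le> CARD('m)"
proof -
  have "norm (moment_deriv rk u) \<le> (\<Sum>i\<in>UNIV. \<bar>moment_deriv rk u $ i\<bar>)" by (rule norm_le_l1_cart)
  also have "\<dots> \<le> (\<Sum>i\<in>(UNIV :: 'm set). 1)"
  proof (rule sum_mono)
    fix i
    have "0 \<le> u ^ (rk i - 1)" "u ^ (rk i - 1) \<le> 1" using assms by (auto intro: power_le_one)
    moreover have "(1::real) \<le> fact (rk i - 1)" by (rule fact_ge_1)
    ultimately have "0 \<le> u ^ (rk i - 1)" "u ^ (rk i - 1) \<le> fact (rk i - 1)" by linarith+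
    then show "\<bar>moment_deriv rk u $ i\<bar> \<le> 1" by (simp add: moment_deriv_def)
  qed
  finally show ?thesis by simp
qed

text \<open>Only radius 1 occurs, since the multilinear estimate is applied after an arc has been
  rescaled to unit length.\<close>

definition unit_ball_bound :: "real \<Rightarrow> (real ^ 'm::finite) measure \<Rightarrow> bool" where
  "unit_ball_bound B \<nu> \<longleftrightarrow> sets \<nu> = sets borel \<and> finite_measure \<nu> \<and> 0 \<le> B \<and>
    (\<forall>x. emeasure \<nu> (ball x 1) \<le> ennreal B)"

text \<open>Closeness of velocities controls the determinants; \<open>g 0 = 0\<close> fixes the
  translation, so that the curve stays in a ball of fixed radius.\<close>

definition near_moment_curve :: "('m::finite \<Rightarrow> nat) \<Rightarrow> real \<Rightarrow> (real \<Rightarrow> real ^ 'm) \<Rightarrow> (real \<Rightarrow> real ^ 'm) \<Rightarrow> bool" where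
  "near_moment_curve rk \<eta> g g' \<longleftrightarrow> g \<in> borel_measurable borel \<and> g 0 = 0 \<and>
    (\<forall>u\<in>{0..1}. (g has_vector_derivative g' u) (at u within {0..1}) \<and> norm (g' u - moment_deriv rk u) \<le> \<eta>)"

definition separated_intervals :: "real \<Rightarrow> ('m \<Rightarrow> real set) \<Rightarrow> bool" where
  "separated_intervals \<delta> J \<longleftrightarrow> (\<forall>j. convex (J j) \<and> J j \<in> sets borel \<and> J j \<subseteq> {0..1}) \<and>
    (\<forall>i j. i \<noteq> j \<longrightarrow> (\<forall>a\<in>J i. \<forall>b\<in>J j. \<delta> \<le> \<bar>a - b\<bar>))"

definition Lp_on :: "real \<Rightarrow> real set \<Rightarrow> (real \<Rightarrow> complex) \<Rightarrow> bool" where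
  "Lp_on p J f \<longleftrightarrow> f \<in> borel_measurable borel \<and> set_integrable lborel J (\<lambda>t. cmod (f t) powr p)"

text \<open>Writing a product of \<open>d\<close> oscillatory integrals as one integral over a box turns it, after the change of
  variables \<open>t \<mapsto> g(t\<^sub>1) + \<dots> + g(t\<^sub>d)\<close>, into a Fourier transform on the whole space.\<close>

lemma multilinear_wellorder:
  fixes rk :: "'m::{finite,wellorder} \<Rightarrow> nat" and p q :: real
  assumes rk: "bij_betw rk (UNIV :: 'm set) {1..CARD('m)}" and p: "1 < p"
    and q: "2 * real CARD('m) \<le> q" "real CARD('m) / q \<le> 1 - 1 / p" and "0 < \<delta>"
  obtains \<eta> C where "0 < \<eta>" "0 < C"
    "\<And>(\<nu> :: ((real, 'm) vec) measure) B g g' (J :: 'm \<Rightarrow> real set) f. \<lbrakk>unit_ball_bound B \<nu>; near_moment_curve rk \<eta> g g';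
      separated_intervals \<delta> J; \<And>j. Lp_on p (J j) (f j)\<rbrakk> \<Longrightarrow>
      (\<integral>\<^sup>+x. ennreal (\<Prod>j\<in>UNIV. cmod (osc g (J j) (f j) x) powr (q / CARD('m))) \<partial>\<nu>)
        \<le> ennreal (C * B * (\<Prod>j\<in>UNIV. (LINT t:J j|lborel. cmod (f j t) powr p) powr (q / (CARD('m) * p))))"
proof -
  let ?d = "real CARD('m)"
  have d: "0 < ?d" by simp
  have q0: "0 < q" using q d by linarith
  \<comment> \<open>\<open>r'\<close> is the exponent in which the product is estimated and
    \<open>r\<close> its dual: \<open>2 * d \<le> q\<close> says \<open>r' \<ge> 2\<close>, and
    \<open>d / q \<le> 1 - 1 / p\<close> says \<open>r \<le> p\<close>.\<close>
  define r' where "r' = q / ?d"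
  define r where "r = 1 / (1 - 1 / r')"
  have r'2: "2 \<le> r'" using q d by (simp add: r'_def field_simps)
  have r: "1 < r" "r \<le> 2" using r'2 by (auto simp: r_def field_simps)
  have rr1: "1 / r + 1 / r' = 1" by (simp add: r_def)
  have rr: "r * r' = r + r'" using rr1 r r'2 by (simp add: field_simps)
  have r_less: "r < 2" if "r' \<noteq> 2" using that r'2 by (auto simp: r_def field_simps)
  have r_eq: "r = 2" if "r' = 2" using that by (simp add: r_def)
  have rp: "r \<le> p"
  proof -
    have "1 / p \<le> 1 - 1 / r'" using q(2) by (simp add: r'_def)
    moreover have "0 < 1 - 1 / r'" using r'2 by (simp add: field_simps)
    ultimately show ?thesis using p unfolding r_def by (simp add: field_simps)
  qed
  obtain \<eta> c where \<eta>: "0 < \<eta>" and c: "0 < c" and det: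
    "\<And>(t :: (real, 'm) vec) (M :: ((real, 'm) vec, 'm) vec). \<lbrakk>\<And>i. t $ i \<in> {0..1}; \<And>i j. i \<noteq> j \<Longrightarrow> \<delta> \<le> \<bar>t $ i - t $ j\<bar>;
       \<And>j. norm (M $ j - moment_deriv rk (t $ j)) \<le> \<eta>\<rbrakk> \<Longrightarrow> c \<le> \<bar>det M\<bar>"
  proof (rule det_near_moment_deriv[OF rk \<open>0 < \<delta>\<close>], goal_cases)
    case (1 \<eta> c)
    show ?case by (rule 1(1)[OF 1(2-4)])
  qed
  \<comment> \<open>The velocity is at most \<open>d + \<eta>\<close> on an interval of length 1,
    hence so is \<open>g\<close>, and \<open>\<Phi>\<close> is a sum of \<open>d\<close> such
    values.\<close>
  define R where "R = ?d * (?d + \<eta>)"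
  obtain C0 where C0: "0 < C0" and L2:
    "\<And>(\<nu> :: ((real, 'm) vec) measure) B (\<Phi> :: (real, 'm) vec \<Rightarrow> (real, 'm) vec) S A G. \<lbrakk>sets \<nu> = sets borel; finite_measure \<nu>; 0 \<le> B;
       \<And>x. emeasure \<nu> (ball x 1) \<le> ennreal B; \<Phi> \<in> borel_measurable borel; S \<in> sets borel;
       \<And>t. t \<in> S \<Longrightarrow> norm (\<Phi> t) \<le> R; 0 \<le> A;
       image_density_le A S \<Phi>;
       G \<in> borel_measurable borel; set_integrable lborel S G\<rbrakk> \<Longrightarrow>
       (\<integral>\<^sup>+x. ennreal ((cmod (LINT t:S|lborel. cis (x \<bullet> \<Phi> t) * G t))\<^sup>2) \<partial>\<nu>)
         \<le> ennreal (C0 * A * B) * (\<integral>\<^sup>+t. ennreal ((cmod (G t))\<^sup>2) * indicator S t \<partial>lborel)"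
  proof (rule L2_extension_bound[of R, where 'm='m], goal_cases)
    case (1 C)
    show ?case by (rule 1(1)[OF 1(2-3)])
  qed
  \<comment> \<open>At \<open>r' = 2\<close> the interpolation constant blows up, and the
    \<open>L^2\<close> bound is used as it stands.\<close>
  define C1 where "C1 = (if r' = 2 then 1 else 4 * r' * 2 powr (r' - 2) / (r' - 2))"
  have C1: "0 < C1" using r'2 by (auto simp: C1_def)
  \<comment> \<open>\<open>1 / c\<close> bounds the image density; each of the \<open>d\<close>
    factors contributes \<open>2 powr (r' - 1)\<close> when its norm of order \<open>r\<close> is
    replaced by one of order \<open>p\<close>.\<close>
  define C where "C = C1 * (C0 * (1 / c)) * (2 powr (r' - 1)) ^ CARD('m)"
  have C: "0 < C" using C1 C0 c by (simp add: C_def)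
  show ?thesis
  proof (rule that[OF \<eta> C])
    fix \<nu> :: "((real, 'm) vec) measure" and B and g g' :: "real \<Rightarrow> (real, 'm) vec" and J :: "'m \<Rightarrow> real set" and f :: "'m \<Rightarrow> real \<Rightarrow> complex"
    assume bb: "unit_ball_bound B \<nu>" and nm: "near_moment_curve rk \<eta> g g'" and si: "separated_intervals \<delta> J"
      and Lp: "\<And>j. Lp_on p (J j) (f j)"
    from bb have nu[simp, measurable_cong]: "sets \<nu> = sets borel" and fin: "finite_measure \<nu>" and B: "0 \<le> B" "\<And>x. emeasure \<nu> (ball x 1) \<le> ennreal B"
      by (auto simp: unit_ball_bound_def)
    from nm have g[measurable]: "g \<in> borel_measurable borel" and g0: "g 0 = 0"
      and g': "\<And>u. u \<in> {0..1} \<Longrightarrow> (g has_vector_derivative g' u) (at u within {0..1})"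
      and near: "\<And>u. u \<in> {0..1} \<Longrightarrow> norm (g' u - moment_deriv rk u) \<le> \<eta>"
      unfolding near_moment_curve_def by blast+
    from si have J: "\<And>j. convex (J j)" "\<And>j. J j \<in> sets borel" "\<And>j. J j \<subseteq> {0..1}"
      and sep: "\<And>i j a b. i \<noteq> j \<Longrightarrow> a \<in> J i \<Longrightarrow> b \<in> J j \<Longrightarrow> \<delta> \<le> \<bar>a - b\<bar>"
      unfolding separated_intervals_def by blast+
    from Lp have f[measurable]: "\<And>j. f j \<in> borel_measurable borel" and fp: "\<And>j. set_integrable lborel (J j) (\<lambda>t. cmod (f j t) powr p)"
      by (auto simp: Lp_on_def)
    note [measurable] = J(2)
    interpret finite_measure \<nu> by fact
    define S where "S = {t :: (real, 'm) vec. \<forall>j. t $ j \<in> J j}"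
    define \<Phi> where "\<Phi> = (\<lambda>t :: (real, 'm) vec. \<Sum>j\<in>UNIV. g (t $ j))"
    define \<Phi>' where "\<Phi>' = (\<lambda>(t :: (real, 'm) vec) v. \<Sum>j\<in>UNIV. (v $ j) *\<^sub>R g' (t $ j))"
    have \<Phi>m[measurable]: "\<Phi> \<in> borel_measurable borel" unfolding \<Phi>_def by measurable
    have Sm[measurable]: "S \<in> sets borel"
    proof -
      have "S = (\<Inter>j. (\<lambda>t. t $ j) -` J j)" by (auto simp: S_def)
      moreover have "(\<lambda>t :: (real, 'm) vec. t $ j) -` J j \<in> sets borel" for j
        using measurable_sets[OF borel_measurable_nth J(2)] by simp
      ultimately show ?thesis by simp
    qed
    have S01: "t $ j \<in> {0..1}" if "t \<in> S" for t j using that J(3)[of j] unfolding S_def by blast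
    have detM: "c \<le> \<bar>det ((\<chi> j. g' (t $ j)) :: ((real, 'm) vec, 'm) vec)\<bar>" if "t \<in> S" for t
    proof (rule det[of t])
      show "t $ i \<in> {0..1}" for i by (rule S01[OF that])
      show "\<delta> \<le> \<bar>t $ i - t $ j\<bar>" if "i \<noteq> j" for i j
        using sep[OF that] \<open>t \<in> S\<close> unfolding S_def by blast
      show "norm (((\<chi> j. g' (t $ j)) :: ((real, 'm) vec, 'm) vec) $ j - moment_deriv rk (t $ j)) \<le> \<eta>" for j
        using near[OF S01[OF that, of j]] by simp
    qed
    have inj: "inj_on \<Phi> S"
      unfolding \<Phi>_def S_def
    proof (rule curve_sum_inj[OF J(1) J(3) g'])
      fix t :: "(real, 'm) vec" assume "\<And>j. t $ j \<in> J j"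
      then have "t \<in> S" by (simp add: S_def)
      from detM[OF this] c show "det ((\<chi> j. g' (t $ j)) :: ((real, 'm) vec, 'm) vec) \<noteq> 0" by auto
    qed
    have der: "(\<Phi> has_derivative \<Phi>' t) (at t within S)" if t: "t \<in> S" for t
      unfolding \<Phi>_def \<Phi>'_def
    proof (rule has_derivative_sum)
      fix j :: 'm
      have "(g has_derivative (\<lambda>y. y *\<^sub>R g' (t $ j))) (at (t $ j) within (\<lambda>t. t $ j) ` S)"
        using g'[OF S01[OF t, of j]] unfolding has_vector_derivative_def
        by (rule has_derivative_subset) (use S01 in blast)
      moreover have "((\<lambda>t :: (real, 'm) vec. t $ j) has_derivative (\<lambda>v. v $ j)) (at t within S)"
        by (rule bounded_linear_imp_has_derivative) (rule bounded_linear_vec_nth)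
      ultimately show "((\<lambda>t. g (t $ j)) has_derivative (\<lambda>v. (v $ j) *\<^sub>R g' (t $ j))) (at t within S)"
        using diff_chain_within[of "\<lambda>t. t $ j" "\<lambda>v. v $ j" t S g] by (simp add: o_def)
    qed
    have mat: "matrix (\<Phi>' t) = transpose ((\<chi> j. g' (t $ j)) :: ((real, 'm) vec, 'm) vec)" for t
    proof -
      have "\<Phi>' t (axis k 1) = g' (t $ k)" for k
      proof -
        have "\<Phi>' t (axis k 1) = (\<Sum>j\<in>UNIV. if j = k then g' (t $ j) else 0)"
          unfolding \<Phi>'_def by (rule sum.cong) (auto simp: axis_def)
        then show ?thesis by simp
      qed
      then show ?thesis by (simp add: matrix_def transpose_def vec_eq_iff)
    qed
    have cov: "image_density_le (1 / c) S \<Phi>"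
      by (rule change_of_variables_le[OF Sm \<Phi>m der inj c]) (use detM in \<open>auto simp: mat det_transpose\<close>)
    have gb: "norm (g u) \<le> ?d + \<eta>" if u: "u \<in> {0..1}" for u
    proof -
      have "norm (g u - g 0) \<le> (?d + \<eta>) * norm (u - 0)"
      proof (rule differentiable_bound[of "{0..1}" g "\<lambda>u y. y *\<^sub>R g' u"])
        fix v :: real assume v: "v \<in> {0..1}"
        show "(g has_derivative (\<lambda>y. y *\<^sub>R g' v)) (at v within {0..1})"
          using g'[OF v] by (simp add: has_vector_derivative_def)
        have "norm (g' v) \<le> norm (moment_deriv rk v) + norm (g' v - moment_deriv rk v)" by (rule norm_triangle_sub)
        then have "norm (g' v) \<le> ?d + \<eta>" using near[OF v] norm_moment_deriv_le[OF v, of rk] by linarith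
        then show "onorm (\<lambda>y. y *\<^sub>R g' v) \<le> ?d + \<eta>"
          by (intro onorm_le) (auto simp: mult.commute intro!: mult_left_mono)
      qed (use u in auto)
      also have "\<dots> \<le> (?d + \<eta>) * 1" using u \<eta> by (intro mult_left_mono) auto
      finally show ?thesis by (simp add: g0)
    qed
    have \<Phi>R: "norm (\<Phi> t) \<le> R" if "t \<in> S" for t
    proof -
      have "norm (\<Phi> t) \<le> (\<Sum>j\<in>(UNIV :: 'm set). ?d + \<eta>)"
        unfolding \<Phi>_def by (rule sum_norm_le) (use gb S01 that in auto)
      then show ?thesis by (simp add: R_def)
    qed
    define T where "T = (\<lambda>(G :: (real, 'm) vec \<Rightarrow> complex) x. LINT t:S|lborel. cis (x \<bullet> \<Phi> t) * G t)"
    have Ti: "set_integrable lborel S (\<lambda>t. cis (x \<bullet> \<Phi> t) * G t)" if "integrable lborel G" for x G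
      unfolding set_integrable_def
      by (rule Bochner_Integration.integrable_bound[OF that]) (use that in \<open>auto simp: norm_mult indicator_def\<close>)
    have T2: "(\<integral>\<^sup>+x. ennreal ((cmod (T G x))\<^sup>2) \<partial>\<nu>) \<le> ennreal (C0 * (1 / c) * B) * (\<integral>\<^sup>+t. ennreal ((cmod (G t))\<^sup>2) \<partial>lborel)"
      if G: "integrable lborel G" for G
    proof -
      have "set_integrable lborel S G" unfolding set_integrable_def by (rule integrable_mult_indicator[OF _ G]) simp
      then have "(\<integral>\<^sup>+x. ennreal ((cmod (T G x))\<^sup>2) \<partial>\<nu>)
         \<le> ennreal (C0 * (1 / c) * B) * (\<integral>\<^sup>+t. ennreal ((cmod (G t))\<^sup>2) * indicator S t \<partial>lborel)"
        unfolding T_def using L2[OF nu fin B \<Phi>m Sm \<Phi>R, of "1 / c" G] cov c G by simp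
      also have "\<dots> \<le> ennreal (C0 * (1 / c) * B) * (\<integral>\<^sup>+t. ennreal ((cmod (G t))\<^sup>2) \<partial>lborel)"
        by (intro mult_left_mono nn_integral_mono) (auto simp: indicator_def)
      finally show ?thesis .
    qed
    have T_interp: "(\<integral>\<^sup>+x. ennreal (cmod (T G x) powr r') \<partial>\<nu>)
       \<le> ennreal (C1 * (C0 * (1 / c) * B) * (LINT t|lborel. cmod (G t) powr r) powr (r' - 1))"
      if G: "integrable lborel G" and Gr: "integrable lborel (\<lambda>t. cmod (G t) powr r)" for G
    proof (cases "r' = 2")
      case True
      have "(\<integral>\<^sup>+x. ennreal (cmod (T G x) powr r') \<partial>\<nu>) = (\<integral>\<^sup>+x. ennreal ((cmod (T G x))\<^sup>2) \<partial>\<nu>)"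
        by (simp add: True powr_numeral)
      also have "\<dots> \<le> ennreal (C0 * (1 / c) * B) * (\<integral>\<^sup>+t. ennreal ((cmod (G t))\<^sup>2) \<partial>lborel)" by (rule T2[OF G])
      also have "(\<integral>\<^sup>+t. ennreal ((cmod (G t))\<^sup>2) \<partial>lborel) = ennreal (LINT t|lborel. cmod (G t) powr r)"
        using nn_integral_eq_integral[OF Gr] by (simp add: r_eq[OF True] powr_numeral)
      also have "ennreal (C0 * (1 / c) * B) * ennreal (LINT t|lborel. cmod (G t) powr r) = ennreal (C0 * (1 / c) * B * (LINT t|lborel. cmod (G t) powr r))"
        using C0 c B(1) by (intro ennreal_mult[symmetric]) auto
      finally show ?thesis by (simp add: True C1_def)
    next
      case False
      have "(\<integral>\<^sup>+x. ennreal (cmod (T G x) powr r') \<partial>\<nu>)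
        \<le> ennreal (4 * r' * 2 powr (r' - 2) / (r' - 2) * (C0 * (1 / c) * B) * (LINT t|lborel. cmod (G t) powr r) powr (r' - 1))"
      proof (rule interpolation_L1_L2[where T=T and M=lborel and A="C0 * (1 / c) * B", OF fin _ _ _ _ T2 _ r(1) r_less[OF False] rr1 G Gr])
        show "sigma_finite_measure (lborel :: ((real, 'm) vec) measure)" by unfold_locales
        show "T G \<in> borel_measurable \<nu>" if "integrable lborel G" for G
        proof -
          have [measurable]: "G \<in> borel_measurable borel" using borel_measurable_integrable[OF that] by simp
          show ?thesis unfolding T_def set_lebesgue_integral_def by measurable
        qed
        show "T (\<lambda>t. G1 t + G2 t) x = T G1 x + T G2 x" if "integrable lborel G1" "integrable lborel G2" for G1 G2 x
          unfolding T_def using Ti[OF that(1)] Ti[OF that(2)] by (simp add: distrib_left set_integral_add)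
        show "cmod (T G x) \<le> (LINT t|lborel. cmod (G t))" if "integrable lborel G" for G x
        proof -
          have "cmod (T G x) \<le> (LINT t|lborel. cmod (indicat_real S t *\<^sub>R (cis (x \<bullet> \<Phi> t) * G t)))"
            unfolding T_def set_lebesgue_integral_def by (rule integral_norm_bound)
          also have "\<dots> \<le> (LINT t|lborel. cmod (G t))"
            by (intro integral_mono integrable_norm Ti[OF that, unfolded set_integrable_def] that)
               (auto simp: norm_mult indicator_def)
          finally show ?thesis .
        qed
        show "0 \<le> C0 * (1 / c) * B" using C0 c B by simp
      qed
      then show ?thesis using False by (simp add: C1_def)
    qed
    \<comment> \<open>Extension by zero makes \<open>G\<close> vanish off the box \<open>S\<close>,
      so that its integrals over the whole space factor.\<close>
    define F where "F = (\<lambda>j t. indicat_real (J j) t *\<^sub>R f j t)"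
    have Fm[measurable]: "F j \<in> borel_measurable borel" for j unfolding F_def by measurable
    have Jl: "emeasure lborel (J j) \<le> ennreal 1" for j
      using emeasure_mono[OF J(3)[of j], of lborel] by simp
    have Jf: "emeasure lborel (J j) < \<infinity>" for j using Jl[of j] by (rule le_less_trans) simp
    have fr: "set_integrable lborel (J j) (\<lambda>t. cmod (f j t) powr r)" for j
      by (rule set_integrable_powr_le[OF J(2) _ _ Jf _ rp fp]) (use r in auto)
    have f1: "set_integrable lborel (J j) (\<lambda>t. cmod (f j t) powr 1)" for j
      by (rule set_integrable_powr_le[OF J(2) _ _ Jf _ _ fp]) (use p in auto)
    have Fi: "integrable lborel (F j)" for j
      using f1[of j] unfolding set_integrable_def
      by (rule Bochner_Integration.integrable_bound) (auto simp: F_def indicator_def)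
    \<comment> \<open>The factorisation of integrals is stated for complex functions, so real powers
      are embedded into the complex numbers.\<close>
    have Fr: "integrable lborel (\<lambda>t. complex_of_real (cmod (F j t) powr r))" for j
      using fr[of j] unfolding set_integrable_def
      by (rule Bochner_Integration.integrable_bound) (auto simp: F_def indicator_def)
    define G where "G = (\<lambda>t :: (real, 'm) vec. \<Prod>j\<in>UNIV. F j (t $ j))"
    have Gi: "integrable lborel G" unfolding G_def by (rule integrable_lborel_vec_prod[OF Fi])
    have Gpow: "complex_of_real (cmod (G t) powr r) = (\<Prod>j\<in>UNIV. complex_of_real (cmod (F j (t $ j)) powr r))" for t
      by (simp only: G_def prod_norm[symmetric] prod_powr_distrib of_real_prod)
    have Gr: "integrable lborel (\<lambda>t. cmod (G t) powr r)"
    proof -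
      have "integrable lborel (\<lambda>t. complex_of_real (cmod (G t) powr r))"
        unfolding Gpow by (rule integrable_lborel_vec_prod[OF Fr])
      then show ?thesis by (simp only: complex_of_real_integrable_eq)
    qed
    have GrI: "(LINT t|lborel. cmod (G t) powr r) = (\<Prod>j\<in>UNIV. (LINT t:J j|lborel. cmod (f j t) powr r))"
    proof -
      have "complex_of_real (LINT t|lborel. cmod (G t) powr r) = (\<Prod>j\<in>UNIV. (LINT t|lborel. complex_of_real (cmod (F j t) powr r)))"
        unfolding integral_complex_of_real[symmetric] Gpow by (rule integral_lborel_vec_prod[OF Fr])
      also have "\<dots> = complex_of_real (\<Prod>j\<in>UNIV. (LINT t|lborel. cmod (F j t) powr r))"
        by simp
      finally have "(LINT t|lborel. cmod (G t) powr r) = (\<Prod>j\<in>UNIV. (LINT t|lborel. cmod (F j t) powr r))"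
        by (simp only: of_real_eq_iff)
      moreover have "(LINT t|lborel. cmod (F j t) powr r) = (LINT t:J j|lborel. cmod (f j t) powr r)" for j
        unfolding set_lebesgue_integral_def
        by (intro Bochner_Integration.integral_cong) (use r in \<open>auto simp: F_def indicator_def\<close>)
      ultimately show ?thesis by simp
    qed
    have TG: "T G x = (\<Prod>j\<in>UNIV. osc g (J j) (f j) x)" for x
    proof -
      have ci: "integrable lborel (\<lambda>t. cis (x \<bullet> g t) * F j t)" for j
        by (rule Bochner_Integration.integrable_bound[OF Fi[of j]]) (auto simp: norm_mult)
      have cs: "cis (\<Sum>i\<in>A. a i) = (\<Prod>i\<in>A. cis (a i))" if "finite A" for A :: "'m set" and a
        using that by (induction A) (auto simp: cis_mult[symmetric])
      have "T G x = (LINT t|lborel. (\<Prod>j\<in>UNIV. cis (x \<bullet> g (t $ j)) * F j (t $ j)))"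
        unfolding T_def set_lebesgue_integral_def
      proof (rule Bochner_Integration.integral_cong[OF refl])
        fix t
        have "G t = 0" if "t \<notin> S"
        proof -
          from that obtain j where "t $ j \<notin> J j" by (auto simp: S_def)
          then have "F j (t $ j) = 0" by (simp add: F_def)
          then show ?thesis unfolding G_def by (auto intro!: prod_zero)
        qed
        then have "indicat_real S t *\<^sub>R (cis (x \<bullet> \<Phi> t) * G t) = cis (x \<bullet> \<Phi> t) * G t"
          by (auto simp: indicator_def)
        also have "\<dots> = (\<Prod>j\<in>UNIV. cis (x \<bullet> g (t $ j)) * F j (t $ j))"
          by (simp add: \<Phi>_def G_def inner_sum_right cs prod.distrib)
        finally show "indicat_real S t *\<^sub>R (cis (x \<bullet> \<Phi> t) * G t) = (\<Prod>j\<in>UNIV. cis (x \<bullet> g (t $ j)) * F j (t $ j))" .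
      qed
      also have "\<dots> = (\<Prod>j\<in>UNIV. (LINT t|lborel. cis (x \<bullet> g t) * F j t))"
        by (rule integral_lborel_vec_prod[OF ci])
      also have "(\<lambda>j. LINT t|lborel. cis (x \<bullet> g t) * F j t) = (\<lambda>j. osc g (J j) (f j) x)"
        unfolding osc_def set_lebesgue_integral_def F_def by (auto simp: scaleR_conv_of_real mult_ac)
      finally show ?thesis .
    qed
    have nnr: "0 \<le> (LINT t:J j|lborel. cmod (f j t) powr s)" for j s
      unfolding set_lebesgue_integral_def by (intro integral_nonneg_AE) auto
    have factor: "(LINT t:J j|lborel. cmod (f j t) powr r) powr (r' - 1) \<le> 2 powr (r' - 1) * (LINT t:J j|lborel. cmod (f j t) powr p) powr (r' / p)" for j
    proof -
      have "(LINT t:J j|lborel. cmod (f j t) powr r) \<le> 2 * (LINT t:J j|lborel. cmod (f j t) powr p) powr (r / p)"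
        using set_integral_powr_le[OF J(2) _ _ Jl _ _ rp fp, of j] r by simp
      then have "(LINT t:J j|lborel. cmod (f j t) powr r) powr (r' - 1) \<le> (2 * (LINT t:J j|lborel. cmod (f j t) powr p) powr (r / p)) powr (r' - 1)"
        using r'2 nnr by (intro powr_mono2) auto
      also have "\<dots> = 2 powr (r' - 1) * (LINT t:J j|lborel. cmod (f j t) powr p) powr (r / p * (r' - 1))"
        using nnr by (simp add: powr_mult powr_powr)
      also have "r / p * (r' - 1) = r' / p" using rr by (simp add: algebra_simps diff_divide_distrib[symmetric])
      finally show ?thesis .
    qed
    have "(\<integral>\<^sup>+x. ennreal (\<Prod>j\<in>UNIV. cmod (osc g (J j) (f j) x) powr (q / ?d)) \<partial>\<nu>) = (\<integral>\<^sup>+x. ennreal (cmod (T G x) powr r') \<partial>\<nu>)"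
      by (simp only: TG r'_def prod_norm[symmetric] prod_powr_distrib)
    also have "\<dots> \<le> ennreal (C1 * (C0 * (1 / c) * B) * (\<Prod>j\<in>UNIV. (LINT t:J j|lborel. cmod (f j t) powr r)) powr (r' - 1))"
      using T_interp[OF Gi Gr] by (simp add: GrI)
    also have "\<dots> \<le> ennreal (C * B * (\<Prod>j\<in>UNIV. (LINT t:J j|lborel. cmod (f j t) powr p) powr (q / (?d * p))))"
    proof (rule ennreal_leI)
      have "(\<Prod>j\<in>UNIV. (LINT t:J j|lborel. cmod (f j t) powr r)) powr (r' - 1) = (\<Prod>j\<in>UNIV. (LINT t:J j|lborel. cmod (f j t) powr r) powr (r' - 1))"
        by (rule prod_powr_distrib)
      also have "\<dots> \<le> (\<Prod>j\<in>UNIV. 2 powr (r' - 1) * (LINT t:J j|lborel. cmod (f j t) powr p) powr (r' / p))"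
        by (intro prod_mono) (use factor in auto)
      also have "\<dots> = (2 powr (r' - 1)) ^ CARD('m) * (\<Prod>j\<in>UNIV. (LINT t:J j|lborel. cmod (f j t) powr p) powr (r' / p))"
        by (simp add: prod.distrib)
      finally have "C1 * (C0 * (1 / c) * B) * (\<Prod>j\<in>UNIV. (LINT t:J j|lborel. cmod (f j t) powr r)) powr (r' - 1)
        \<le> C1 * (C0 * (1 / c) * B) * ((2 powr (r' - 1)) ^ CARD('m) * (\<Prod>j\<in>UNIV. (LINT t:J j|lborel. cmod (f j t) powr p) powr (r' / p)))"
        using C1 C0 c B by (intro mult_left_mono) auto
      then show "C1 * (C0 * (1 / c) * B) * (\<Prod>j\<in>UNIV. (LINT t:J j|lborel. cmod (f j t) powr r)) powr (r' - 1)
        \<le> C * B * (\<Prod>j\<in>UNIV. (LINT t:J j|lborel. cmod (f j t) powr p) powr (q / (?d * p)))"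
        by (simp add: C_def r'_def mult_ac)
    qed
    finally show "(\<integral>\<^sup>+x. ennreal (\<Prod>j\<in>UNIV. cmod (osc g (J j) (f j) x) powr (q / ?d)) \<partial>\<nu>)
        \<le> ennreal (C * B * (\<Prod>j\<in>UNIV. (LINT t:J j|lborel. cmod (f j t) powr p) powr (q / (?d * p))))" .
  qed
qed

text \<open>The change of variables formula of the library needs a well-ordered index type. A well-ordered copy of a
  finite type removes this restriction.\<close>

typedef 'a ordered_copy = "UNIV :: 'a set" by simp

lemma bij_Rep_ordered_copy: "bij Rep_ordered_copy"
  by (metis Abs_ordered_copy_inverse Rep_ordered_copy_inverse UNIV_I bij_betw_def inj_def surj_def)

instance ordered_copy :: (finite) finite
proof
  have "(UNIV :: 'a ordered_copy set) = range Abs_ordered_copy"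
    by (metis Rep_ordered_copy_inverse UNIV_eq_I rangeI)
  then show "finite (UNIV :: 'a ordered_copy set)" by (metis finite finite_imageI)
qed

instantiation ordered_copy :: (finite) linorder
begin

definition less_eq_ordered_copy :: "'a ordered_copy \<Rightarrow> 'a ordered_copy \<Rightarrow> bool" where
  "x \<le> y \<longleftrightarrow> to_nat_on (UNIV :: 'a set) (Rep_ordered_copy x) \<le> to_nat_on (UNIV :: 'a set) (Rep_ordered_copy y)"

definition less_ordered_copy :: "'a ordered_copy \<Rightarrow> 'a ordered_copy \<Rightarrow> bool" where
  "x < y \<longleftrightarrow> to_nat_on (UNIV :: 'a set) (Rep_ordered_copy x) < to_nat_on (UNIV :: 'a set) (Rep_ordered_copy y)"

instance
  by standard (auto simp: less_eq_ordered_copy_def less_ordered_copy_def Rep_ordered_copy_inject countable_finite)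

end

instance ordered_copy :: (finite) wellorder
proof
  fix P :: "'a ordered_copy \<Rightarrow> bool" and a
  assume *: "\<And>x. (\<And>y. y < x \<Longrightarrow> P y) \<Longrightarrow> P x"
  show "P a"
    by (induction a rule: measure_induct_rule[of "\<lambda>x. to_nat_on (UNIV :: 'a set) (Rep_ordered_copy x)"])
       (rule *, simp add: less_ordered_copy_def)
qed

lemma CARD_ordered_copy: "CARD('a::finite ordered_copy) = CARD('a)"
  using bij_betw_same_card[OF bij_Rep_ordered_copy] .

lemma borel_measurable_osc [measurable]:
  assumes [measurable]: "g \<in> borel_measurable borel" "f \<in> borel_measurable borel" "J \<in> sets borel"
  shows "osc g J f \<in> borel_measurable borel"
  unfolding osc_def set_lebesgue_integral_def by measurable

text \<open>The renaming of coordinates \<open>E\<close> is a linear isometry: it maps unit balls to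
  unit balls and preserves all phases, so the estimate can be pulled back along it.\<close>

lemma multilinear_estimate:
  fixes rk :: "'n::finite \<Rightarrow> nat" and p q :: real
  assumes rk: "bij_betw rk (UNIV :: 'n set) {1..CARD('n)}" and p: "1 < p"
    and q: "2 * real CARD('n) \<le> q" "real CARD('n) / q \<le> 1 - 1 / p" and "0 < \<delta>"
  obtains \<eta> C where "0 < \<eta>" "0 < C"
    "\<And>(\<nu> :: (real ^ 'n) measure) B g g' (J :: 'n \<Rightarrow> real set) f. \<lbrakk>unit_ball_bound B \<nu>; near_moment_curve rk \<eta> g g';
      separated_intervals \<delta> J; \<And>j. Lp_on p (J j) (f j)\<rbrakk> \<Longrightarrow>
      (\<integral>\<^sup>+x. ennreal (\<Prod>j\<in>UNIV. cmod (osc g (J j) (f j) x) powr (q / CARD('n))) \<partial>\<nu>)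
        \<le> ennreal (C * B * (\<Prod>j\<in>UNIV. (LINT t:J j|lborel. cmod (f j t) powr p) powr (q / (CARD('n) * p))))"
proof -
  let ?R = "Rep_ordered_copy :: 'n ordered_copy \<Rightarrow> 'n"
  define E :: "real ^ 'n \<Rightarrow> (real, 'n ordered_copy) vec" where "E = (\<lambda>v. \<chi> k. v $ ?R k)"
  define E' :: "(real, 'n ordered_copy) vec \<Rightarrow> real ^ 'n" where "E' = (\<lambda>w. \<chi> i. w $ Abs_ordered_copy i)"
  have EE': "E (E' w) = w" for w by (simp add: E_def E'_def vec_eq_iff Rep_ordered_copy_inverse)
  have Einner: "E v \<bullet> E w = v \<bullet> w" for v w
    unfolding E_def inner_vec_def using sum.reindex_bij_betw[OF bij_Rep_ordered_copy, of "\<lambda>i. v $ i \<bullet> w $ i"] by simp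
  have Elin: "linear E" by (rule linearI) (auto simp: E_def vec_eq_iff)
  have Enorm: "norm (E v) = norm v" for v by (simp add: norm_eq_sqrt_inner Einner)
  have Edist: "dist (E v) (E w) = dist v w" for v w
    by (simp add: dist_norm linear_diff[OF Elin, symmetric] Enorm)
  have bE: "bounded_linear E" using Elin by (simp add: linear_conv_bounded_linear)
  have Em[measurable]: "E \<in> borel_measurable borel"
    by (intro borel_measurable_continuous_onI linear_continuous_on bE)
  have rk': "bij_betw (\<lambda>k. rk (?R k)) UNIV {1..CARD('n ordered_copy)}"
    unfolding CARD_ordered_copy using bij_betw_trans[OF bij_Rep_ordered_copy rk] by (simp add: o_def)
  have Em': "E (moment_deriv rk u) = moment_deriv (\<lambda>k. rk (?R k)) u" for u
    by (simp add: E_def moment_deriv_def vec_eq_iff)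
  have reindex: "(\<Prod>k\<in>UNIV. h (?R k)) = (\<Prod>j\<in>UNIV. h j)" for h :: "'n \<Rightarrow> real"
    by (rule prod.reindex_bij_betw[OF bij_Rep_ordered_copy])
  show ?thesis
  proof (rule multilinear_wellorder[OF rk' p _ _ \<open>0 < \<delta>\<close>, of q, unfolded CARD_ordered_copy, OF q], goal_cases)
    case (1 \<eta> C)
    show ?thesis
    proof (rule that[OF 1(1,2)])
      fix \<nu> :: "(real ^ 'n) measure" and B g g' and J :: "'n \<Rightarrow> real set" and f
      assume bb: "unit_ball_bound B \<nu>" and nm: "near_moment_curve rk \<eta> g g'" and si: "separated_intervals \<delta> J"
        and Lp: "\<And>j. Lp_on p (J j) (f j)"
      have nu[simp, measurable_cong]: "sets \<nu> = sets borel" using bb by (simp add: unit_ball_bound_def)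
      have [simp]: "space \<nu> = UNIV" using sets_eq_imp_space_eq[OF nu] by simp
      have [measurable]: "g \<in> borel_measurable borel" "J j \<in> sets borel" "f j \<in> borel_measurable borel" for j
        using nm si Lp by (auto simp: near_moment_curve_def separated_intervals_def Lp_on_def)
      have Em2[measurable]: "E \<in> measurable \<nu> borel" by measurable
      have "unit_ball_bound B (distr \<nu> borel E)"
      proof -
        have "emeasure (distr \<nu> borel E) (ball y 1) \<le> ennreal B" for y
        proof -
          have "E -` ball y 1 = ball (E' y) 1"
            using Edist[of "E' y"] by (auto simp: EE')
          then have "emeasure (distr \<nu> borel E) (ball y 1) = emeasure \<nu> (ball (E' y) 1)"
            by (subst emeasure_distr) auto
          then show ?thesis using bb by (simp add: unit_ball_bound_def)
        qed
        then show ?thesis using bb finite_measure.finite_measure_distr[OF _ Em2]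
          by (simp add: unit_ball_bound_def)
      qed
      moreover have "near_moment_curve (\<lambda>k. rk (?R k)) \<eta> (\<lambda>u. E (g u)) (\<lambda>u. E (g' u))"
        using nm linear_0[OF Elin]
        by (auto simp: near_moment_curve_def Em'[symmetric] linear_diff[OF Elin, symmetric] Enorm
            intro!: bounded_linear.has_vector_derivative[OF bE])
      moreover have "separated_intervals \<delta> (\<lambda>k. J (?R k))"
        using si unfolding separated_intervals_def by (metis Rep_ordered_copy_inject)
      ultimately have *: "(\<integral>\<^sup>+x. ennreal (\<Prod>k\<in>UNIV. cmod (osc (\<lambda>u. E (g u)) (J (?R k)) (f (?R k)) x) powr (q / CARD('n))) \<partial>distr \<nu> borel E)
        \<le> ennreal (C * B * (\<Prod>k\<in>UNIV. (LINT t:J (?R k)|lborel. cmod (f (?R k) t) powr p) powr (q / (CARD('n) * p))))"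
        using Lp by (rule 1(3))
      have [measurable]: "(\<lambda>u. E (g u)) \<in> borel_measurable borel" by measurable
      have "(\<integral>\<^sup>+x. ennreal (\<Prod>k\<in>UNIV. cmod (osc (\<lambda>u. E (g u)) (J (?R k)) (f (?R k)) x) powr (q / CARD('n))) \<partial>distr \<nu> borel E)
         = (\<integral>\<^sup>+x. ennreal (\<Prod>k\<in>UNIV. cmod (osc (\<lambda>u. E (g u)) (J (?R k)) (f (?R k)) (E x)) powr (q / CARD('n))) \<partial>\<nu>)"
        by (rule nn_integral_distr) measurable
      also have "\<dots> = (\<integral>\<^sup>+x. ennreal (\<Prod>k\<in>UNIV. cmod (osc g (J (?R k)) (f (?R k)) x) powr (q / CARD('n))) \<partial>\<nu>)"
        by (simp add: osc_def Einner)
      finally show "(\<integral>\<^sup>+x. ennreal (\<Prod>j\<in>UNIV. cmod (osc g (J j) (f j) x) powr (q / CARD('n))) \<partial>\<nu>)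
        \<le> ennreal (C * B * (\<Prod>j\<in>UNIV. (LINT t:J j|lborel. cmod (f j t) powr p) powr (q / (CARD('n) * p))))"
        using * reindex[of "\<lambda>j. cmod (osc g (J j) (f j) _) powr (q / CARD('n))"]
          reindex[of "\<lambda>j. (LINT t:J j|lborel. cmod (f j t) powr p) powr (q / (CARD('n) * p))"] by simp
    qed
  qed
qed

section \<open>Measures of growth order \<open>\<alpha>\<close>\<close>

text \<open>Finite total mass is included because the induction on scales ends with a bound by it;
  other measures are reached at the end by restriction to balls.\<close>

definition growth :: "real \<Rightarrow> real \<Rightarrow> (real ^ 'n::finite) measure \<Rightarrow> bool" where
  "growth \<alpha> B \<mu> \<longleftrightarrow> sets \<mu> = sets borel \<and> finite_measure \<mu> \<and> 0 \<le> B \<and>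
    (\<forall>x \<rho>. 0 < \<rho> \<longrightarrow> emeasure \<mu> (ball x \<rho>) \<le> ennreal (B * \<rho> powr \<alpha>))"

lemma sets_Collect_all_less:
  fixes f g :: "'n::finite \<Rightarrow> 'a \<Rightarrow> real"
  assumes "\<And>i. f i \<in> borel_measurable M" "\<And>i. g i \<in> borel_measurable M"
  shows "{x \<in> space M. \<forall>i. f i x < g i x} \<in> sets M"
proof -
  have "{x \<in> space M. \<forall>i. f i x < g i x} = (\<Inter>i. {x \<in> space M. f i x < g i x})" by auto
  moreover have "(\<Inter>i. {x \<in> space M. f i x < g i x}) \<in> sets M"
    by (rule sets.finite_INT) (auto intro!: borel_measurable_less assms)
  ultimately show ?thesis by simp
qed

lemma emeasure_lborel_vec_box:
  fixes a s :: "'n::finite \<Rightarrow> real"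
  assumes s: "\<And>i. 0 \<le> s i"
  shows "emeasure lborel {w :: real ^ 'n. \<forall>i. \<bar>w $ i - a i\<bar> < s i} = ennreal (\<Prod>i\<in>UNIV. 2 * s i)"
proof -
  have m: "{w :: real ^ 'n. \<forall>i. \<bar>w $ i - a i\<bar> < s i} \<in> sets borel"
    using sets_Collect_all_less[where M=borel and f="\<lambda>i w :: real ^ 'n. \<bar>w $ i - a i\<bar>" and g="\<lambda>i x. s i"] by simp
  have "emeasure lborel {w :: real ^ 'n. \<forall>i. \<bar>w $ i - a i\<bar> < s i} = (\<integral>\<^sup>+w. indicator {w :: real ^ 'n. \<forall>i. \<bar>w $ i - a i\<bar> < s i} w \<partial>lborel)"
    using m by simp
  also have "\<dots> = (\<integral>\<^sup>+w. (\<Prod>i\<in>UNIV. indicator {a i - s i<..<a i + s i} (w $ i)) \<partial>(lborel :: (real ^ 'n) measure))"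
  proof (rule nn_integral_cong)
    fix w :: "real ^ 'n"
    show "indicator {w :: real ^ 'n. \<forall>i. \<bar>w $ i - a i\<bar> < s i} w = (\<Prod>i\<in>UNIV. indicator {a i - s i<..<a i + s i} (w $ i) :: ennreal)"
    proof (cases "\<forall>i. \<bar>w $ i - a i\<bar> < s i")
      case True
      then have "w $ i \<in> {a i - s i<..<a i + s i}" for i using spec[OF True, of i] by (auto simp: abs_diff_less_iff)
      then show ?thesis using True by simp
    next
      case False
      then obtain i where "\<not> \<bar>w $ i - a i\<bar> < s i" by blast
      then have "indicator {a i - s i<..<a i + s i} (w $ i) = (0 :: ennreal)" by (auto simp: indicator_def abs_diff_less_iff)
      then have "(\<Prod>i\<in>UNIV. indicator {a i - s i<..<a i + s i} (w $ i) :: ennreal) = 0" by (intro prod_zero) auto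
      then show ?thesis using False by simp
    qed
  qed
  also have "\<dots> = (\<Prod>i\<in>UNIV. (\<integral>\<^sup>+u. indicator {a i - s i<..<a i + s i} u \<partial>lborel))"
    by (rule nn_integral_lborel_vec_prod) measurable
  also have "\<dots> = (\<Prod>i\<in>UNIV. ennreal (2 * s i))"
    using s by (intro prod.cong) auto
  also have "\<dots> = ennreal (\<Prod>i\<in>UNIV. 2 * s i)" using s by (intro prod_ennreal) auto
  finally show ?thesis .
qed

text \<open>Covering the anisotropic box of side lengths \<open>\<rho> h\<^bsup>- e i\<^esup>\<close> by cubes of side length \<open>\<rho> h\<^bsup>- m\<^esup>\<close>, carried out by averaging
  over the centres of the cubes.\<close>

lemma growth_anisotropic_box:
  fixes \<mu> :: "(real ^ 'n::finite) measure" and P :: "real ^ 'n \<Rightarrow> real ^ 'n" and e :: "'n \<Rightarrow> nat"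
  assumes gr: "growth \<alpha> B \<mu>" and P: "linear P" and \<kappa>: "0 < \<kappa>" "\<And>x. \<kappa> * norm x \<le> norm (P x)"
    and h: "0 < h" "h \<le> 1" and \<rho>: "0 < \<rho>"
  shows "emeasure \<mu> {x. \<forall>i. \<bar>h ^ e i * P x $ i - y i\<bar> < \<rho>}
    \<le> ennreal ((2 ^ CARD('n) * (CARD('n) / \<kappa>) powr \<alpha>) * B * \<rho> powr \<alpha> * h powr (- (real (\<Sum>i\<in>UNIV. e i - m) + m * \<alpha>)))"
proof -
  let ?n = "real CARD('n)"
  have mu[simp, measurable_cong]: "sets \<mu> = sets borel" and fin: "finite_measure \<mu>" and B0: "0 \<le> B"
    and B: "\<And>x \<rho>. 0 < \<rho> \<Longrightarrow> emeasure \<mu> (ball x \<rho>) \<le> ennreal (B * \<rho> powr \<alpha>)"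
    using gr by (auto simp: growth_def)
  interpret finite_measure \<mu> by fact
  interpret ml: pair_sigma_finite \<mu> lborel ..
  have bP: "bounded_linear P" using P by (simp add: linear_conv_bounded_linear)
  have Pm[measurable]: "P \<in> borel_measurable borel"
    by (intro borel_measurable_continuous_onI linear_continuous_on bP)
  have injP: "inj P"
    unfolding linear_injective_0[OF P]
    using \<kappa> by (metis mult_pos_pos norm_zero not_less zero_less_norm_iff)
  then have surjP: "surj P" by (rule linear_inj_imp_surj[OF P])
  \<comment> \<open>Half the side of the averaging cubes. The integer \<open>m\<close> is free;
    coordinates with \<open>e i \<le> m\<close> will need only boundedly many cubes.\<close>
  define \<rho>' where "\<rho>' = \<rho> * h powr (- real m)"
  have \<rho>': "0 < \<rho>'" using \<rho> h by (simp add: \<rho>'_def)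
  define E where "E = {x. \<forall>i. \<bar>h ^ e i * P x $ i - y i\<bar> < \<rho>}"
  \<comment> \<open>Pairs of a point and the centre of a cube that contains its image under
    \<open>P\<close>.\<close>
  define Q where "Q = {(x, w). \<forall>i. \<bar>w $ i - P x $ i\<bar> < \<rho>'}"
  \<comment> \<open>Contains all centres of cubes that meet the box.\<close>
  define E' where "E' = {w :: real ^ 'n. \<forall>i. \<bar>w $ i - y i / h ^ e i\<bar> < \<rho> / h ^ e i + \<rho>'}"
  have Em[measurable]: "E \<in> sets borel"
    using sets_Collect_all_less[where M=borel and f="\<lambda>i x. \<bar>h ^ e i * P x $ i - y i\<bar>" and g="\<lambda>i x. \<rho>"] by (simp add: E_def)
  have E'm[measurable]: "E' \<in> sets borel"
    using sets_Collect_all_less[where M=borel and f="\<lambda>i w :: real ^ 'n. \<bar>w $ i - y i / h ^ e i\<bar>" and g="\<lambda>i x. \<rho> / h ^ e i + \<rho>'"] by (simp add: E'_def)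
  have Qm: "Q \<in> sets (borel \<Otimes>\<^sub>M borel)"
  proof -
    have "(\<lambda>p. \<bar>snd p $ i - P (fst p) $ i\<bar>) \<in> borel_measurable (borel \<Otimes>\<^sub>M borel)" for i
      by (intro borel_measurable_abs borel_measurable_diff measurable_compose[OF _ borel_measurable_nth]) measurable
    from sets_Collect_all_less[OF this, of "\<lambda>i p. \<rho>'"] show ?thesis
      by (simp add: Q_def case_prod_unfold space_pair_measure)
  qed
  then have [measurable]: "Q \<in> sets (\<mu> \<Otimes>\<^sub>M lborel)" by simp
  have slice1: "(\<integral>\<^sup>+w. indicator Q (x, w) \<partial>lborel) = ennreal ((2 * \<rho>') ^ CARD('n))" for x
  proof -
    have "(\<integral>\<^sup>+w. indicator Q (x, w) \<partial>lborel) = (\<integral>\<^sup>+w. indicator {w :: real ^ 'n. \<forall>i. \<bar>w $ i - P x $ i\<bar> < \<rho>'} w \<partial>lborel)"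
      by (intro nn_integral_cong) (auto simp: Q_def indicator_def)
    also have "\<dots> = emeasure lborel {w :: real ^ 'n. \<forall>i. \<bar>w $ i - P x $ i\<bar> < \<rho>'}"
      using sets_Collect_all_less[where M="borel" and f="\<lambda>i w :: real ^ 'n. \<bar>w $ i - P x $ i\<bar>" and g="\<lambda>i x. \<rho>'"] by simp
    also have "\<dots> = ennreal ((2 * \<rho>') ^ CARD('n))"
      by (subst emeasure_lborel_vec_box) (use \<rho>' in auto)
    finally show ?thesis .
  qed
  have slice2: "emeasure \<mu> {x. (x, w) \<in> Q} \<le> ennreal (B * (?n * \<rho>' / \<kappa>) powr \<alpha>)" for w
  proof -
    obtain v where v: "w = P v" using surjP by (metis surjD)
    have "{x. (x, w) \<in> Q} \<subseteq> ball v (?n * \<rho>' / \<kappa>)"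
    proof
      fix x assume "x \<in> {x. (x, w) \<in> Q}"
      then have *: "\<bar>(P v - P x) $ i\<bar> < \<rho>'" for i by (auto simp: Q_def v)
      have "\<kappa> * norm (v - x) \<le> norm (P v - P x)" using \<kappa>(2)[of "v - x"] by (simp add: linear_diff[OF P])
      also have "\<dots> \<le> (\<Sum>i\<in>UNIV. \<bar>(P v - P x) $ i\<bar>)" by (rule norm_le_l1_cart)
      also have "\<dots> < (\<Sum>i\<in>(UNIV :: 'n set). \<rho>')" by (rule sum_strict_mono) (use * in auto)
      finally have "norm (v - x) < ?n * \<rho>' / \<kappa>" using \<kappa>(1) by (simp add: field_simps)
      then show "x \<in> ball v (?n * \<rho>' / \<kappa>)" by (simp add: dist_norm)
    qed
    then have "emeasure \<mu> {x. (x, w) \<in> Q} \<le> emeasure \<mu> (ball v (?n * \<rho>' / \<kappa>))" by (rule emeasure_mono) simp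
    also have "\<dots> \<le> ennreal (B * (?n * \<rho>' / \<kappa>) powr \<alpha>)" using \<rho>' \<kappa>(1) by (intro B) simp
    finally show ?thesis .
  qed
  have sub: "w \<in> E'" if "x \<in> E" "(x, w) \<in> Q" for x w
  proof -
    have "\<bar>w $ i - y i / h ^ e i\<bar> < \<rho> / h ^ e i + \<rho>'" for i
    proof -
      have "\<bar>w $ i - P x $ i\<bar> < \<rho>'" using that(2) by (auto simp: Q_def)
      moreover have "\<bar>P x $ i - y i / h ^ e i\<bar> < \<rho> / h ^ e i"
      proof -
        have "h ^ e i * \<bar>P x $ i - y i / h ^ e i\<bar> = \<bar>h ^ e i * P x $ i - y i\<bar>"
          using h by (simp add: abs_mult_pos' right_diff_distrib)
        also have "\<dots> < \<rho>" using that(1) by (auto simp: E_def)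
        finally show ?thesis using h by (simp add: field_simps)
      qed
      ultimately show ?thesis by linarith
    qed
    then show ?thesis by (simp add: E'_def)
  qed
  \<comment> \<open>Double counting of pairs in \<open>Q\<close> over \<open>E\<close>: integrated
    in \<open>w\<close> first, it gives the volume of a cube times the mass of \<open>E\<close>; in
    \<open>x\<close> first, at most the volume of \<open>E'\<close> times the mass of a
    ball.\<close>
  have "ennreal ((2 * \<rho>') ^ CARD('n)) * emeasure \<mu> E = (\<integral>\<^sup>+x. indicator E x * (\<integral>\<^sup>+w. indicator Q (x, w) \<partial>lborel) \<partial>\<mu>)"
    unfolding slice1 by (subst nn_integral_multc) (auto simp: mult.commute)
  also have "\<dots> = (\<integral>\<^sup>+x. (\<integral>\<^sup>+w. indicator E x * indicator Q (x, w) \<partial>lborel) \<partial>\<mu>)"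
    by (intro nn_integral_cong nn_integral_cmult[symmetric]) measurable
  also have "\<dots> = (\<integral>\<^sup>+w. (\<integral>\<^sup>+x. indicator E x * indicator Q (x, w) \<partial>\<mu>) \<partial>lborel)"
    by (rule ml.Fubini'[symmetric]) measurable
  also have "\<dots> \<le> (\<integral>\<^sup>+w. ennreal (B * (?n * \<rho>' / \<kappa>) powr \<alpha>) * indicator E' w \<partial>lborel)"
  proof (rule nn_integral_mono)
    fix w
    have [measurable]: "{x. (x, w) \<in> Q} \<in> sets borel"
      using sets_Pair2[OF Qm, of w] by (simp add: vimage_def)
    show "(\<integral>\<^sup>+x. indicator E x * indicator Q (x, w) \<partial>\<mu>) \<le> ennreal (B * (?n * \<rho>' / \<kappa>) powr \<alpha>) * indicator E' w"
    proof (cases "w \<in> E'")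
      case True
      have "(\<integral>\<^sup>+x. indicator E x * indicator Q (x, w) \<partial>\<mu>) \<le> (\<integral>\<^sup>+x. indicator {x. (x, w) \<in> Q} x \<partial>\<mu>)"
        by (intro nn_integral_mono) (auto simp: indicator_def)
      also have "\<dots> = emeasure \<mu> {x. (x, w) \<in> Q}" by simp
      also note slice2[of w]
      finally show ?thesis using True by simp
    next
      case False
      then have "indicator E x * indicator Q (x, w) = (0 :: ennreal)" for x using sub[of x w] by (auto simp: indicator_def)
      then show ?thesis by (simp only: nn_integral_const) simp
    qed
  qed
  also have "\<dots> = ennreal (B * (?n * \<rho>' / \<kappa>) powr \<alpha>) * emeasure lborel E'"
    by (rule nn_integral_cmult_indicator) simp
  also have "emeasure lborel E' = ennreal (\<Prod>i\<in>UNIV. 2 * (\<rho> / h ^ e i + \<rho>'))"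
    unfolding E'_def by (rule emeasure_lborel_vec_box) (use h \<rho> \<rho>' in \<open>simp add: add_nonneg_nonneg\<close>)
  also have "\<dots> \<le> ennreal ((2 * \<rho>') ^ CARD('n) * (2 ^ CARD('n) * h powr (- real (\<Sum>i\<in>UNIV. e i - m))))"
  proof (rule ennreal_leI)
    \<comment> \<open>The truncated difference covers both cases: for \<open>e i \<le> m\<close> the
      box is no wider than the cube in this coordinate.\<close>
    have "\<rho> / h ^ e i + \<rho>' \<le> \<rho>' * (2 * h powr (- real (e i - m)))" for i
    proof -
      have "\<rho> / h ^ e i = \<rho>' * h powr (real m - real (e i))"
        using h by (simp add: \<rho>'_def powr_diff powr_minus powr_realpow divide_simps)
      moreover have "h powr (real m - real (e i)) \<le> h powr (- real (e i - m))"
        using h by (intro powr_mono') auto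
      moreover have "1 \<le> h powr (- real (e i - m))"
        using h powr_mono'[of "- real (e i - m)" 0 h] by simp
      ultimately have "h powr (real m - real (e i)) + 1 \<le> 2 * h powr (- real (e i - m))" by linarith
      then have "\<rho>' * (h powr (real m - real (e i)) + 1) \<le> \<rho>' * (2 * h powr (- real (e i - m)))"
        using \<rho>' by (intro mult_left_mono) auto
      then show ?thesis unfolding \<open>\<rho> / h ^ e i = _\<close> by (simp add: distrib_left)
    qed
    then have "2 * (\<rho> / h ^ e i + \<rho>') \<le> (2 * \<rho>') * (2 * h powr (- real (e i - m)))" for i
      unfolding mult.assoc by (rule mult_left_mono) simp
    moreover have "0 \<le> 2 * (\<rho> / h ^ e i + \<rho>')" for i using h \<rho> \<rho>' by simp
    ultimately have "(\<Prod>i\<in>(UNIV :: 'n set). 2 * (\<rho> / h ^ e i + \<rho>')) \<le> (\<Prod>i\<in>(UNIV :: 'n set). (2 * \<rho>') * (2 * h powr (- real (e i - m))))"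
      by (intro prod_mono) blast
    also have "\<dots> = (2 * \<rho>') ^ CARD('n) * (2 ^ CARD('n) * h powr (- real (\<Sum>i\<in>UNIV. e i - m)))"
      using h by (simp add: prod.distrib powr_sum[symmetric] sum_negf) (simp flip: power_mult_distrib)
    finally show "(\<Prod>i\<in>(UNIV :: 'n set). 2 * (\<rho> / h ^ e i + \<rho>')) \<le> (2 * \<rho>') ^ CARD('n) * (2 ^ CARD('n) * h powr (- real (\<Sum>i\<in>UNIV. e i - m)))" .
  qed
  finally have "ennreal ((2 * \<rho>') ^ CARD('n)) * emeasure \<mu> E
    \<le> ennreal (B * (?n * \<rho>' / \<kappa>) powr \<alpha>) * ennreal ((2 * \<rho>') ^ CARD('n) * (2 ^ CARD('n) * h powr (- real (\<Sum>i\<in>UNIV. e i - m))))"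
    by (simp add: mult_left_mono)
  also have "\<dots> = ennreal ((2 * \<rho>') ^ CARD('n)) * ennreal (B * (?n * \<rho>' / \<kappa>) powr \<alpha> * (2 ^ CARD('n) * h powr (- real (\<Sum>i\<in>UNIV. e i - m))))"
    using \<rho>' B0 by (simp only: ennreal_mult[symmetric] mult_nonneg_nonneg powr_ge_zero zero_le_power zero_le_numeral less_imp_le mult_ac)
  finally have "emeasure \<mu> E \<le> ennreal (B * (?n * \<rho>' / \<kappa>) powr \<alpha> * (2 ^ CARD('n) * h powr (- real (\<Sum>i\<in>UNIV. e i - m))))"
    using \<rho>' by (subst (asm) ennreal_mult_le_mult_iff) auto
  also have "B * (?n * \<rho>' / \<kappa>) powr \<alpha> * (2 ^ CARD('n) * h powr (- real (\<Sum>i\<in>UNIV. e i - m)))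
    = (2 ^ CARD('n) * (?n / \<kappa>) powr \<alpha>) * B * \<rho> powr \<alpha> * h powr (- (real (\<Sum>i\<in>UNIV. e i - m) + m * \<alpha>))"
  proof -
    have "(?n * \<rho>' / \<kappa>) powr \<alpha> = (?n / \<kappa>) powr \<alpha> * \<rho>' powr \<alpha>"
      using \<rho>' \<kappa>(1) by (simp add: powr_mult[symmetric])
    also have "\<rho>' powr \<alpha> = \<rho> powr \<alpha> * h powr (- (m * \<alpha>))"
      using \<rho> h by (simp add: \<rho>'_def powr_mult powr_powr)
    finally show ?thesis using h by (simp add: powr_add[symmetric] mult_ac add.commute)
  qed
  finally show ?thesis by (simp add: E_def)
qed

section \<open>Nondegenerate curves\<close>

text \<open>By compactness \<open>\<kappa>\<close> depends only on the dimension, \<open>K\<close>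
  and \<open>c\<close>, so one constant serves all base points and all curves of a class.\<close>

lemma matrix_lower_bound:
  fixes K c :: real
  assumes "0 < c"
  obtains \<kappa> where "0 < \<kappa>"
    "\<And>(A :: real ^ 'n::finite ^ 'n) x. \<lbrakk>norm A \<le> K; c \<le> \<bar>det A\<bar>\<rbrakk> \<Longrightarrow> \<kappa> * norm x \<le> norm (A *v x)"
proof -
  define Z where "Z = {A :: real ^ 'n ^ 'n. norm A \<le> K \<and> c \<le> \<bar>det A\<bar>} \<times> {x :: real ^ 'n. norm x = 1}"
  have "closed {A :: real ^ 'n ^ 'n. c \<le> \<bar>det A\<bar>}"
    by (intro closed_Collect_le continuous_intros)
  then have "compact (cball 0 K \<inter> {A :: real ^ 'n ^ 'n. c \<le> \<bar>det A\<bar>})"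
    by (intro compact_Int_closed) auto
  moreover have "cball 0 K \<inter> {A :: real ^ 'n ^ 'n. c \<le> \<bar>det A\<bar>} = {A. norm A \<le> K \<and> c \<le> \<bar>det A\<bar>}"
    by auto
  moreover have "compact {x :: real ^ 'n. norm x = 1}"
    using compact_sphere[of "0 :: real ^ 'n" 1] by (simp add: sphere_def)
  ultimately have cZ: "compact Z" unfolding Z_def by (intro compact_Times) auto
  have cont: "continuous_on Z (\<lambda>z. norm (fst z *v snd z))"
    unfolding matrix_vector_mult_def by (intro continuous_intros)
  obtain \<kappa> where \<kappa>: "0 < \<kappa>" "\<And>z. z \<in> Z \<Longrightarrow> \<kappa> \<le> norm (fst z *v snd z)"
  proof (cases "Z = {}")
    case False
    from continuous_attains_inf[OF cZ False cont] obtain z0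
      where z0: "z0 \<in> Z" "\<And>z. z \<in> Z \<Longrightarrow> norm (fst z0 *v snd z0) \<le> norm (fst z *v snd z)" by auto
    have "fst z0 *v snd z0 \<noteq> 0"
    proof
      assume "fst z0 *v snd z0 = 0"
      moreover have "invertible (fst z0)" using z0(1) \<open>0 < c\<close> by (auto simp: Z_def invertible_det_nz)
      ultimately have "snd z0 = 0"
        by (metis invertible_left_inverse matrix_left_invertible_ker)
      then show False using z0(1) by (auto simp: Z_def)
    qed
    then show ?thesis using z0(2) by (intro that[of "norm (fst z0 *v snd z0)"]) auto
  qed (use that[of 1] in auto)
  show ?thesis
  proof (rule that[OF \<kappa>(1)])
    fix A :: "real ^ 'n ^ 'n" and x
    assume A: "norm A \<le> K" "c \<le> \<bar>det A\<bar>"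
    show "\<kappa> * norm x \<le> norm (A *v x)"
    proof (cases "x = 0")
      case False
      then have "(A, x /\<^sub>R norm x) \<in> Z" using A by (auto simp: Z_def)
      from \<kappa>(2)[OF this] have "\<kappa> \<le> norm (A *v x) / norm x"
        using False by (simp add: matrix_vector_mult_scaleR divide_inverse mult.commute)
      then show ?thesis using False by (simp add: field_simps)
    qed simp
  qed
qed

text \<open>\<open>G k\<close> stands for the derivative of order \<open>k\<close>. Explicit bounds
  make the later constants uniform over all such curves. They reach order \<open>d + 1\<close> for
  the Taylor remainder of the velocity, and start at order 1 since a translation only multiplies
  oscillatory integrals by unimodular factors.\<close>

definition nondegenerate_curve :: "('n::finite \<Rightarrow> nat) \<Rightarrow> real \<Rightarrow> real \<Rightarrow> (nat \<Rightarrow> real \<Rightarrow> real ^ 'n) \<Rightarrow> bool" where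
  "nondegenerate_curve rk K c G \<longleftrightarrow> G 0 \<in> borel_measurable borel \<and>
    (\<forall>k \<le> CARD('n). \<forall>t\<in>{0..1}. (G k has_vector_derivative G (Suc k) t) (at t within {0..1})) \<and>
    (\<forall>k \<in> {1..Suc CARD('n)}. \<forall>t\<in>{0..1}. norm (G k t) \<le> K) \<and>
    (\<forall>t\<in>{0..1}. c \<le> \<bar>det ((\<chi> i. G (rk i) t) :: real ^ 'n ^ 'n)\<bar>)"

lemma osc_affine:
  fixes g g' :: "real \<Rightarrow> real ^ 'n::finite"
  assumes "l \<noteq> 0" and eq: "\<And>s. s \<in> J \<Longrightarrow> x \<bullet> g (a + l * s) = b + y \<bullet> g' s"
  shows "osc g ((\<lambda>s. a + l * s) ` J) f x = of_real \<bar>l\<bar> * cis b * osc g' J (\<lambda>s. f (a + l * s)) y"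
proof -
  have ind: "indicat_real ((\<lambda>s. a + l * s) ` J) (a + l * s) = indicat_real J s" for s
    using \<open>l \<noteq> 0\<close> by (auto simp: indicator_def)
  have "osc g ((\<lambda>s. a + l * s) ` J) f x
    = \<bar>l\<bar> *\<^sub>R (LINT s|lborel. indicat_real ((\<lambda>s. a + l * s) ` J) (a + l * s) *\<^sub>R (cis (x \<bullet> g (a + l * s)) * f (a + l * s)))"
    unfolding osc_def set_lebesgue_integral_def using \<open>l \<noteq> 0\<close> by (intro lborel_integral_real_affine) auto
  also have "\<dots> = of_real \<bar>l\<bar> * (LINT s|lborel. cis b * (indicat_real J s *\<^sub>R (cis (y \<bullet> g' s) * f (a + l * s))))"
  proof -
    have e: "indicat_real ((\<lambda>s. a + l * s) ` J) (a + l * s) *\<^sub>R (cis (x \<bullet> g (a + l * s)) * f (a + l * s))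
      = cis b * (indicat_real J s *\<^sub>R (cis (y \<bullet> g' s) * f (a + l * s)))" for s
      by (cases "s \<in> J") (auto simp: ind eq cis_mult[symmetric])
    show ?thesis unfolding e using \<open>l \<noteq> 0\<close> by (simp add: scaleR_conv_of_real)
  qed
  also have "\<dots> = of_real \<bar>l\<bar> * cis b * osc g' J (\<lambda>s. f (a + l * s)) y"
    unfolding osc_def set_lebesgue_integral_def integral_mult_right_zero by simp
  finally show ?thesis .
qed

lemma Lp_on_affine:
  assumes "l \<noteq> 0" "Lp_on p ((\<lambda>s. a + l * s) ` J) f"
  shows "Lp_on p J (\<lambda>s. f (a + l * s))"
    and "(LINT s:J|lborel. cmod (f (a + l * s)) powr p) = (LINT t:(\<lambda>s. a + l * s) ` J|lborel. cmod (f t) powr p) / \<bar>l\<bar>"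
proof -
  have ind: "indicat_real ((\<lambda>s. a + l * s) ` J) (a + l * s) = indicat_real J s" for s
    using \<open>l \<noteq> 0\<close> by (auto simp: indicator_def)
  have [measurable]: "f \<in> borel_measurable borel" using assms by (simp add: Lp_on_def)
  have i: "integrable lborel (\<lambda>t. indicat_real ((\<lambda>s. a + l * s) ` J) t *\<^sub>R (cmod (f t) powr p))"
    using assms by (simp add: Lp_on_def set_integrable_def)
  show "Lp_on p J (\<lambda>s. f (a + l * s))"
    using lborel_integrable_real_affine[OF i, of l a] \<open>l \<noteq> 0\<close>
    by (simp add: Lp_on_def set_integrable_def ind)
  have "(LINT t:(\<lambda>s. a + l * s) ` J|lborel. cmod (f t) powr p) = \<bar>l\<bar> *\<^sub>R (LINT s|lborel. indicat_real ((\<lambda>s. a + l * s) ` J) (a + l * s) *\<^sub>R (cmod (f (a + l * s)) powr p))"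
    unfolding set_lebesgue_integral_def using \<open>l \<noteq> 0\<close> by (intro lborel_integral_real_affine) auto
  then show "(LINT s:J|lborel. cmod (f (a + l * s)) powr p) = (LINT t:(\<lambda>s. a + l * s) ` J|lborel. cmod (f t) powr p) / \<bar>l\<bar>"
    using \<open>l \<noteq> 0\<close> by (simp add: ind set_lebesgue_integral_def)
qed

text \<open>The affine normalisation of a short arc of a nondegenerate curve is close to the moment curve (Taylor's formula).\<close>

lemma rescaled_near_moment_curve:
  fixes rk :: "'n::finite \<Rightarrow> nat" and G :: "nat \<Rightarrow> real \<Rightarrow> real ^ 'n" and K a l \<eta> :: real
  assumes rk: "bij_betw rk (UNIV :: 'n set) {1..CARD('n)}"
    and nd: "nondegenerate_curve rk K c G" and "0 < c" and \<kappa>: "0 < \<kappa>"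
    and low: "\<And>x. \<kappa> * norm x \<le> norm (transpose ((\<chi> i. G (rk i) a) :: real ^ 'n ^ 'n) *v x)"
    and a: "0 \<le> a" "0 < l" "a + l \<le> 1" and l: "CARD('n) * CARD('n) * K * l / \<kappa> \<le> \<eta>"
  obtains g g' where "near_moment_curve rk \<eta> g g'"
    "\<And>x s. x \<bullet> G 0 (a + l * s) = x \<bullet> G 0 a + (\<chi> i. l ^ rk i * (((\<chi> i. G (rk i) a) :: real ^ 'n ^ 'n) *v x) $ i) \<bullet> g s"
proof -
  let ?d = "CARD('n)"
  define A where "A = ((\<chi> i. G (rk i) a) :: real ^ 'n ^ 'n)"
  have d0: "0 < ?d" by simp
  have rk1: "1 \<le> rk i" "rk i \<le> ?d" for i using bij_betwE[OF rk] by auto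
  have Gm[measurable]: "G 0 \<in> borel_measurable borel"
    and Gd: "\<And>k t. k \<le> ?d \<Longrightarrow> t \<in> {0..1} \<Longrightarrow> (G k has_vector_derivative G (Suc k) t) (at t within {0..1})"
    and GK: "\<And>k t. k \<in> {1..Suc ?d} \<Longrightarrow> t \<in> {0..1} \<Longrightarrow> norm (G k t) \<le> K"
    and Gdet: "\<And>t. t \<in> {0..1} \<Longrightarrow> c \<le> \<bar>det ((\<chi> i. G (rk i) t) :: real ^ 'n ^ 'n)\<bar>"
    using nd by (auto simp: nondegenerate_curve_def)
  have a01: "a \<in> {0..1}" using a by simp
  have l1: "l \<le> 1" using a by simp
  have "norm (G 1 a) \<le> K" by (rule GK[OF _ a01]) simp
  then have K0: "0 \<le> K" using norm_ge_zero[of "G 1 a"] by linarith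
  have "det (transpose A) \<noteq> 0" using Gdet[OF a01] \<open>0 < c\<close> by (auto simp: A_def det_transpose)
  then obtain R where R: "transpose A ** R = mat 1" "R ** transpose A = mat 1"
    using invertible_det_nz[of "transpose A"] unfolding invertible_def by blast
  have ATR: "transpose A *v (R *v v) = v" "R *v (transpose A *v v) = v" for v
    by (simp_all only: matrix_vector_mul_assoc R matrix_vector_mul_lid)
  have Rb: "norm (R *v v) \<le> norm v / \<kappa>" for v
  proof -
    have "\<kappa> * norm (R *v v) \<le> norm v"
      using low[of "R *v v"] unfolding A_def[symmetric] ATR .
    then show ?thesis using \<kappa> by (simp add: field_simps)
  qed
  \<comment> \<open>The coordinates of the arc in the basis \<open>G (rk i) a\<close>, each divided
    by its natural size \<open>l ^ rk i\<close>; \<open>R\<close> is the inverse of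
    \<open>transpose A\<close>.\<close>
  define g where "g = (\<lambda>s. \<chi> i. (R *v (G 0 (a + l * s) - G 0 a)) $ i / l ^ rk i)"
  define g' where "g' = (\<lambda>s. \<chi> i. (R *v G 1 (a + l * s)) $ i * l / l ^ rk i)"
  have bR: "bounded_linear (\<lambda>v. R *v v)" by (simp add: matrix_vector_mul_bounded_linear)
  have key: "x \<bullet> G 0 (a + l * s) = x \<bullet> G 0 a + (\<chi> i. l ^ rk i * (A *v x) $ i) \<bullet> g s" for x s
  proof -
    have "(\<chi> i. l ^ rk i * (A *v x) $ i) \<bullet> g s = (A *v x) \<bullet> (R *v (G 0 (a + l * s) - G 0 a))"
      using a by (simp add: inner_vec_def g_def)
    also have "\<dots> = x \<bullet> (transpose A *v (R *v (G 0 (a + l * s) - G 0 a)))"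
      by (metis dot_lmul_matrix inner_commute transpose_matrix_vector)
    finally show ?thesis unfolding ATR by (simp add: inner_diff_right)
  qed
  have pt: "a + l * s \<in> {0..1}" if "s \<in> {0..1}" for s
  proof -
    have "l * s \<le> l * 1" using that a by (intro mult_left_mono) auto
    then have "a + l * s \<le> 1" using a by linarith
    moreover have "0 \<le> l * s" using that a by simp
    ultimately show ?thesis using a by simp
  qed
  have "near_moment_curve rk \<eta> g g'"
    unfolding near_moment_curve_def
  proof (intro conjI ballI)
    have RM: "(\<lambda>v. R *v v) \<in> borel_measurable borel"
      by (intro borel_measurable_continuous_onI linear_continuous_on bR)
    have "(\<lambda>s. G 0 (a + l * s) - G 0 a) \<in> borel_measurable borel" by measurable
    from measurable_compose[OF measurable_compose[OF this RM] borel_measurable_nth]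
    have m1: "(\<lambda>s. (R *v (G 0 (a + l * s) - G 0 a)) $ i / l ^ rk i) \<in> borel_measurable borel" for i
      by (intro borel_measurable_divide borel_measurable_const)
    show "g \<in> borel_measurable borel"
      unfolding g_def by (subst borel_measurable_euclidean_space) (auto simp: Basis_vec_def inner_axis m1)
    show "g 0 = 0" by (simp add: g_def vec_eq_iff)
    fix s :: real assume s: "s \<in> {0..1}"
    show "(g has_vector_derivative g' s) (at s within {0..1})"
    proof -
      have "((\<lambda>s. G 0 (a + l * s)) has_vector_derivative l *\<^sub>R G (Suc 0) (a + l * s)) (at s within {0..1})"
      proof -
        have "((\<lambda>s. a + l * s) has_vector_derivative l) (at s within {0..1})"
          by (auto intro!: derivative_eq_intros)
        moreover have "(G 0 has_vector_derivative G (Suc 0) (a + l * s)) (at (a + l * s) within (\<lambda>s. a + l * s) ` {0..1})"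
          by (rule has_vector_derivative_within_subset[OF Gd[of 0, OF _ pt[OF s]]]) (use pt in auto)
        ultimately show ?thesis
          using vector_diff_chain_within[of "\<lambda>s. a + l * s" l s "{0..1}" "G 0"] by (simp add: o_def)
      qed
      then have "((\<lambda>s. G 0 (a + l * s) - G 0 a) has_vector_derivative l *\<^sub>R G (Suc 0) (a + l * s) - 0) (at s within {0..1})"
        by (intro has_vector_derivative_diff has_vector_derivative_const)
      from bounded_linear.has_vector_derivative[OF bR this]
      have D: "((\<lambda>s. R *v (G 0 (a + l * s) - G 0 a)) has_vector_derivative l *\<^sub>R (R *v G 1 (a + l * s))) (at s within {0..1})"
        by (simp add: matrix_vector_mult_scaleR)
      have "bounded_linear (\<lambda>v :: real ^ 'n. \<chi> i. v $ i / l ^ rk i)"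
        by (intro linear_conv_bounded_linear[THEN iffD1] linearI) (auto simp: vec_eq_iff add_divide_distrib)
      from bounded_linear.has_vector_derivative[OF this D] show ?thesis
        unfolding g_def g'_def by (simp add: mult.commute)
    qed
    \<comment> \<open>By Taylor's formula for the velocity this is of size \<open>l^d\<close>. It
      survives division by \<open>l ^ rk i\<close> because \<open>rk i \<le> d\<close>, and the
      factor \<open>l\<close> from the chain rule makes the error small.\<close>
    define rem where "rem = G 1 (a + l * s) - transpose A *v moment_deriv rk (l * s)"
    have comp: "\<bar>rem $ j\<bar> \<le> K * l ^ ?d" for j
    proof -
      define n where "n = ?d - 1"
      have n: "Suc n = ?d" using d0 by (simp add: n_def)
      have "(transpose A *v moment_deriv rk (l * s)) $ j = (\<Sum>i\<in>UNIV. G (rk i) a $ j * ((l * s) ^ (rk i - 1) / fact (rk i - 1)))"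
        unfolding matrix_vector_mult_def transpose_def A_def moment_deriv_def by simp
      also have "\<dots> = (\<Sum>k\<in>{1..?d}. G k a $ j * ((l * s) ^ (k - 1) / fact (k - 1)))"
        by (rule sum.reindex_bij_betw[OF rk, of "\<lambda>k. G k a $ j * ((l * s) ^ (k - 1) / fact (k - 1))"])
      also have "\<dots> = (\<Sum>k\<le>n. G (Suc k) a $ j * (l * s) ^ k / fact k)"
        by (rule sum.reindex_bij_witness[where i=Suc and j="\<lambda>k. k - 1"]) (use n in auto)
      finally have e: "rem $ j = G (Suc 0) (a + l * s) $ j - (\<Sum>k\<le>n. G (Suc k) a $ j * (a + l * s - a) ^ k / fact k)"
        by (simp add: rem_def)
      have "norm (G (Suc 0) (a + l * s) $ j - (\<Sum>k\<le>n. G (Suc k) a $ j * (a + l * s - a) ^ k / fact k))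
        \<le> K * norm (a + l * s - a) ^ Suc n / fact n"
      proof (rule field_Taylor[where f="\<lambda>k t. G (Suc k) t $ j" and S="{0..1}" and n=n and B=K and w=a and z="a + l * s"])
        fix k t assume "t \<in> {0..1::real}" "k \<le> n"
        then have "(G (Suc k) has_vector_derivative G (Suc (Suc k)) t) (at t within {0..1})"
          using n by (intro Gd) auto
        from bounded_linear.has_vector_derivative[OF bounded_linear_vec_nth this]
        show "((\<lambda>t. G (Suc k) t $ j) has_field_derivative G (Suc (Suc k)) t $ j) (at t within {0..1})"
          by (simp add: has_real_derivative_iff_has_vector_derivative)
      next
        fix t assume "t \<in> {0..1::real}"
        then have "norm (G (Suc (Suc n)) t) \<le> K" using n by (intro GK) auto
        then show "norm (G (Suc (Suc n)) t $ j) \<le> K"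
          using component_le_norm_cart[of "G (Suc (Suc n)) t" j] by simp
      qed (use a01 pt[OF s] in auto)
      also have "\<dots> \<le> K * norm (a + l * s - a) ^ Suc n"
      proof -
        have "x / fact n \<le> x" if "0 \<le> x" for x :: real
          using mult_left_mono[OF fact_ge_1[of n, where 'a=real] that] by (simp add: divide_le_eq)
        then show ?thesis using K0 by simp
      qed
      also have "\<dots> \<le> K * l ^ Suc n"
        using K0 s a by (intro mult_left_mono power_mono) (auto simp: abs_mult mult_left_le)
      finally show ?thesis by (simp add: e n)
    qed
    have remn: "norm rem \<le> ?d * (K * l ^ ?d)"
    proof -
      have "norm rem \<le> (\<Sum>j\<in>UNIV. \<bar>rem $ j\<bar>)" by (rule norm_le_l1_cart)
      also have "\<dots> \<le> (\<Sum>j\<in>(UNIV :: 'n set). K * l ^ ?d)" by (intro sum_mono comp)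
      finally show ?thesis by simp
    qed
    have diff: "\<bar>(g' s - moment_deriv rk s) $ i\<bar> \<le> ?d * K * l / \<kappa>" for i
    proof -
      have "G 1 (a + l * s) = transpose A *v moment_deriv rk (l * s) + rem" by (simp add: rem_def)
      then have "R *v G 1 (a + l * s) = moment_deriv rk (l * s) + R *v rem"
        by (simp only: matrix_vector_right_distrib ATR)
      then have "g' s $ i = moment_deriv rk (l * s) $ i * l / l ^ rk i + (R *v rem) $ i * l / l ^ rk i"
        by (simp add: g'_def algebra_simps add_divide_distrib)
      also have "moment_deriv rk (l * s) $ i * l / l ^ rk i = moment_deriv rk s $ i"
      proof -
        obtain k where "rk i = Suc k" using rk1(1)[of i] by (cases "rk i") auto
        then show ?thesis using a by (simp add: moment_deriv_def power_mult_distrib)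
      qed
      finally have "(g' s - moment_deriv rk s) $ i = (R *v rem) $ i * (l / l ^ rk i)" by simp
      also have "\<bar>\<dots>\<bar> \<le> (?d * (K * l ^ ?d) / \<kappa>) * (l / l ^ rk i)"
      proof -
        have "\<bar>(R *v rem) $ i\<bar> \<le> norm (R *v rem)" by (rule component_le_norm_cart)
        also have "\<dots> \<le> norm rem / \<kappa>" by (rule Rb)
        also have "\<dots> \<le> ?d * (K * l ^ ?d) / \<kappa>" using remn \<kappa> by (simp add: divide_right_mono)
        finally show ?thesis using a unfolding abs_mult by (intro mult_mono) auto
      qed
      also have "\<dots> = ?d * K * l / \<kappa> * (l ^ ?d / l ^ rk i)" by simp
      also have "\<dots> \<le> ?d * K * l / \<kappa> * 1"
      proof (rule mult_left_mono)
        have "l ^ ?d \<le> l ^ rk i" using a l1 rk1(2)[of i] by (intro power_decreasing) auto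
        then show "l ^ ?d / l ^ rk i \<le> 1" using a by simp
      qed (use K0 \<kappa> a in auto)
      finally show ?thesis by simp
    qed
    have "norm (g' s - moment_deriv rk s) \<le> (\<Sum>i\<in>UNIV. \<bar>(g' s - moment_deriv rk s) $ i\<bar>)" by (rule norm_le_l1_cart)
    also have "\<dots> \<le> (\<Sum>i\<in>(UNIV :: 'n set). ?d * K * l / \<kappa>)" by (intro sum_mono diff)
    also have "\<dots> \<le> \<eta>" using l by simp
    finally show "norm (g' s - moment_deriv rk s) \<le> \<eta>" .
  qed
  with key show ?thesis using that unfolding A_def by blast
qed

text \<open>The power of \<open>l\<close> collects \<open>q\<close> from the substitution in the
  \<open>d\<close> integrals, \<open>- q / p\<close> from the norms of \<open>f\<close> on the short
  arc, and minus the growth exponent of the anisotropically rescaled measure. The integer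
  \<open>m\<close> is still arbitrary.\<close>

lemma local_multilinear_estimate:
  fixes rk :: "'n::finite \<Rightarrow> nat" and p q K c :: real
  assumes rk: "bij_betw rk (UNIV :: 'n set) {1..CARD('n)}" and p: "1 < p"
    and q: "2 * real CARD('n) \<le> q" "real CARD('n) / q \<le> 1 - 1 / p" and "0 < \<delta>" "0 < c" "0 \<le> K"
  obtains l0 C where "0 < l0" "0 < C"
    "\<And>(\<mu> :: (real ^ 'n) measure) B G a l (J :: 'n \<Rightarrow> real set) f. \<lbrakk>growth \<alpha> B \<mu>; nondegenerate_curve rk K c G;
      0 \<le> a; 0 < l; l \<le> l0; a + l \<le> 1;
      separated_intervals \<delta> J; \<And>j. Lp_on p ((\<lambda>s. a + l * s) ` J j) f\<rbrakk> \<Longrightarrow>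
      (\<integral>\<^sup>+x. ennreal (\<Prod>j\<in>UNIV. cmod (osc (G 0) ((\<lambda>s. a + l * s) ` J j) f x) powr (q / CARD('n))) \<partial>\<mu>)
        \<le> ennreal (C * B * l powr (q * (1 - 1 / p) - (real (\<Sum>i\<in>UNIV. rk i - m) + m * \<alpha>))
            * (\<Prod>j\<in>UNIV. (LINT t:(\<lambda>s. a + l * s) ` J j|lborel. cmod (f t) powr p) powr (q / (CARD('n) * p))))"
proof (rule multilinear_estimate[OF rk p q \<open>0 < \<delta>\<close>], goal_cases)
  case (1 \<eta> C0)
  note thesisI = 1(1) and \<eta> = 1(2) and C0 = 1(3) and multi = 1(4)
  let ?d = "real CARD('n)"
  let ?\<beta> = "real (\<Sum>i\<in>UNIV. rk i - m) + m * \<alpha>"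
  have q0: "0 < q" using q(1) zero_less_card_finite[where 'a='n] by linarith
  obtain \<kappa> where \<kappa>: "0 < \<kappa>"
    and low: "\<And>(A :: real ^ 'n ^ 'n) x. \<lbrakk>norm A \<le> CARD('n) * CARD('n) * K; c \<le> \<bar>det A\<bar>\<rbrakk> \<Longrightarrow> \<kappa> * norm x \<le> norm (A *v x)"
    using matrix_lower_bound[OF \<open>0 < c\<close>, where 'n='n] by metis
  \<comment> \<open>Small enough for the rescaled arc to be within \<open>\<eta>\<close> of the
    moment curve; the summand 1 guards against \<open>K = 0\<close>.\<close>
  define l0 where "l0 = min 1 (\<eta> * \<kappa> / (?d * ?d * K + 1))"
  have den: "0 < ?d * ?d * K + 1" using \<open>0 \<le> K\<close> by (simp add: add_nonneg_pos)
  have l0: "0 < l0" using \<eta> \<kappa> den by (simp add: l0_def)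
  define C1 where "C1 = 2 ^ CARD('n) * (?d / \<kappa>) powr \<alpha>"
  have C1: "0 < C1" using \<kappa> by (simp add: C1_def)
  show ?thesis
  proof (rule thesisI)
    show "0 < l0" by fact
    show "0 < C0 * C1" using C0 C1 by simp
    fix \<mu> :: "(real ^ 'n) measure" and B G a l and J :: "'n \<Rightarrow> real set" and f
    assume gr: "growth \<alpha> B \<mu>" and nd: "nondegenerate_curve rk K c G"
      and a: "0 \<le> a" "0 < l" and ll0: "l \<le> l0" and al: "a + l \<le> 1"
      and si: "separated_intervals \<delta> J" and Lp: "\<And>j. Lp_on p ((\<lambda>s. a + l * s) ` J j) f"
    have B0: "0 \<le> B" and mu[simp, measurable_cong]: "sets \<mu> = sets borel" and fin: "finite_measure \<mu>"
      using gr by (auto simp: growth_def)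
    have [simp]: "space \<mu> = UNIV" using sets_eq_imp_space_eq[OF mu] by simp
    define A where "A = ((\<chi> i. G (rk i) a) :: real ^ 'n ^ 'n)"
    have a01: "a \<in> {0..1}" using a al by simp
    have l_ne: "l \<noteq> 0" using a by simp
    have rk1: "1 \<le> rk i" "rk i \<le> CARD('n)" for i using bij_betwE[OF rk] by auto
    have rows: "norm (A $ i) \<le> K" for i
      using nd a01 rk1[of i] by (auto simp: A_def nondegenerate_curve_def)
    have entries: "\<bar>A $ i $ j\<bar> \<le> K" for i j
      using component_le_norm_cart[of "A $ i" j] rows[of i] by linarith
    have nrm: "norm M \<le> CARD('n) * CARD('n) * K" if "\<And>i j. \<bar>M $ i $ j\<bar> \<le> K" for M :: "real ^ 'n ^ 'n"
    proof -
      have "norm (M $ i) \<le> CARD('n) * K" for i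
      proof -
        have "norm (M $ i) \<le> (\<Sum>j\<in>UNIV. \<bar>M $ i $ j\<bar>)" by (rule norm_le_l1_cart)
        also have "\<dots> \<le> (\<Sum>j\<in>(UNIV :: 'n set). K)" by (intro sum_mono that)
        finally show ?thesis by simp
      qed
      then have "(\<Sum>i\<in>UNIV. norm (M $ i)) \<le> (\<Sum>i\<in>(UNIV :: 'n set). CARD('n) * K)" by (intro sum_mono)
      then show ?thesis using norm_le_sum_rows[of M] by simp
    qed
    have detA: "c \<le> \<bar>det A\<bar>" using nd a01 by (simp add: A_def nondegenerate_curve_def)
    have lowA: "\<kappa> * norm x \<le> norm (A *v x)" for x
      by (rule low[OF nrm detA]) (rule entries)
    have lowAT: "\<kappa> * norm x \<le> norm (transpose A *v x)" for x
      by (rule low[OF nrm]) (use entries detA in \<open>auto simp: transpose_def det_transpose[unfolded transpose_def]\<close>)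
    have l1: "l \<le> 1" using ll0 by (simp add: l0_def)
    have small: "CARD('n) * CARD('n) * K * l / \<kappa> \<le> \<eta>"
    proof -
      have "l * (?d * ?d * K) \<le> l * (?d * ?d * K + 1)" using a by simp
      also have "\<dots> \<le> \<eta> * \<kappa>" using ll0 den by (simp add: l0_def field_simps)
      finally show ?thesis using \<kappa> by (simp add: field_simps)
    qed
    obtain g g' where nm: "near_moment_curve rk \<eta> g g'"
      and key: "\<And>x s. x \<bullet> G 0 (a + l * s) = x \<bullet> G 0 a + (\<chi> i. l ^ rk i * (A *v x) $ i) \<bullet> g s"
      using rescaled_near_moment_curve[OF rk nd \<open>0 < c\<close> \<kappa> lowAT[unfolded A_def] a al small]
      unfolding A_def by metis
    \<comment> \<open>Up to a term constant in \<open>s\<close>, the phase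
      \<open>x \<bullet> G 0 (a + l * s)\<close> is \<open>L x \<bullet> g s\<close>, so the measure
      is pushed forward under \<open>L\<close>.\<close>
    define L where "L = (\<lambda>x. (\<chi> i. l ^ rk i * (A *v x) $ i) :: real ^ 'n)"
    have "linear L" by (rule linearI) (auto simp: L_def vec_eq_iff matrix_vector_right_distrib matrix_vector_mult_scaleR algebra_simps)
    then have Lm[measurable]: "L \<in> borel_measurable borel"
      by (intro borel_measurable_continuous_onI linear_continuous_on) (simp add: linear_conv_bounded_linear)
    have Lm2[measurable]: "L \<in> measurable \<mu> borel" by measurable
    \<comment> \<open>Bound for unit balls of the image measure, from the covering of anisotropic
      boxes with \<open>\<rho> = 1\<close>.\<close>
    define B' where "B' = C1 * B * l powr (- ?\<beta>)"
    have B'0: "0 \<le> B'" using C1 B0 by (simp add: B'_def)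
    have bb: "unit_ball_bound B' (distr \<mu> borel L)"
    proof -
      have "emeasure (distr \<mu> borel L) (ball y 1) \<le> ennreal B'" for y
      proof -
        have "emeasure (distr \<mu> borel L) (ball y 1) = emeasure \<mu> (L -` ball y 1)"
          by (subst emeasure_distr) auto
        also have "\<dots> \<le> emeasure \<mu> {x. \<forall>i. \<bar>l ^ rk i * (A *v x) $ i - y $ i\<bar> < 1}"
        proof (rule emeasure_mono)
          show "L -` ball y 1 \<subseteq> {x. \<forall>i. \<bar>l ^ rk i * (A *v x) $ i - y $ i\<bar> < 1}"
          proof clarify
            fix x i assume "L x \<in> ball y 1"
            then have "norm (L x - y) < 1" by (simp add: dist_norm norm_minus_commute)
            with component_le_norm_cart[of "L x - y" i] show "\<bar>l ^ rk i * (A *v x) $ i - y $ i\<bar> < 1"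
              by (simp add: L_def)
          qed
          have [measurable]: "(\<lambda>x. A *v x) \<in> borel_measurable borel"
            by (intro borel_measurable_continuous_onI linear_continuous_on matrix_vector_mul_bounded_linear)
          show "{x. \<forall>i. \<bar>l ^ rk i * (A *v x) $ i - y $ i\<bar> < 1} \<in> sets \<mu>"
            using sets_Collect_all_less[where M=borel and f="\<lambda>i x. \<bar>l ^ rk i * (A *v x) $ i - y $ i\<bar>" and g="\<lambda>i x. 1"] by simp
        qed
        also have "\<dots> \<le> ennreal (C1 * B * 1 powr \<alpha> * l powr (- ?\<beta>))"
          unfolding C1_def
          by (rule growth_anisotropic_box[OF gr matrix_vector_mul_linear \<kappa> lowA a(2) l1]) simp
        finally show ?thesis by (simp add: B'_def)
      qed
      then show ?thesis using finite_measure.finite_measure_distr[OF fin Lm2] B'0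
        by (simp add: unit_ball_bound_def)
    qed
    let ?J = "\<lambda>j. (\<lambda>s. a + l * s) ` J j"
    let ?f = "\<lambda>s. f (a + l * s)"
    let ?I = "\<lambda>j. LINT t:?J j|lborel. cmod (f t) powr p"
    have I0: "0 \<le> ?I j" for j unfolding set_lebesgue_integral_def by (intro integral_nonneg_AE) auto
    have [measurable]: "g \<in> borel_measurable borel" "J j \<in> sets borel" "?f \<in> borel_measurable borel" for j
      using nm si Lp_on_affine(1)[OF l_ne Lp] by (auto simp: near_moment_curve_def separated_intervals_def Lp_on_def)
    have "(\<integral>\<^sup>+x. ennreal (\<Prod>j\<in>UNIV. cmod (osc g (J j) ?f x) powr (q / ?d)) \<partial>distr \<mu> borel L)
        \<le> ennreal (C0 * B' * (\<Prod>j\<in>UNIV. (LINT s:J j|lborel. cmod (?f s) powr p) powr (q / (?d * p))))"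
      by (rule multi[OF bb nm si Lp_on_affine(1)[OF l_ne Lp]])
    moreover have "(\<integral>\<^sup>+x. ennreal (\<Prod>j\<in>UNIV. cmod (osc g (J j) ?f x) powr (q / ?d)) \<partial>distr \<mu> borel L)
      = (\<integral>\<^sup>+x. ennreal (\<Prod>j\<in>UNIV. cmod (osc g (J j) ?f (L x)) powr (q / ?d)) \<partial>\<mu>)"
      by (rule nn_integral_distr) measurable
    ultimately have est: "(\<integral>\<^sup>+x. ennreal (\<Prod>j\<in>UNIV. cmod (osc g (J j) ?f (L x)) powr (q / ?d)) \<partial>\<mu>)
        \<le> ennreal (C0 * B' * (\<Prod>j\<in>UNIV. (?I j / l) powr (q / (?d * p))))"
      by (simp add: Lp_on_affine(2)[OF l_ne Lp] abs_of_pos[OF a(2)])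
    have pw: "(\<Prod>j\<in>(UNIV :: 'n set). l powr (z / ?d)) = l powr z" for z
      using a by (simp add: powr_realpow[symmetric] powr_powr)
    have abs_l: "\<bar>l\<bar> = l" using a by simp
    have osc_eq: "(\<Prod>j\<in>UNIV. cmod (osc (G 0) (?J j) f x) powr (q / ?d)) = l powr q * (\<Prod>j\<in>UNIV. cmod (osc g (J j) ?f (L x)) powr (q / ?d))" for x
    proof -
      have "osc (G 0) (?J j) f x = of_real \<bar>l\<bar> * cis (x \<bullet> G 0 a) * osc g (J j) ?f (L x)" for j
        by (rule osc_affine[OF l_ne]) (simp add: key L_def)
      then show ?thesis using a pw[of q] by (simp add: norm_mult powr_mult prod.distrib)
    qed
    have "(\<integral>\<^sup>+x. ennreal (\<Prod>j\<in>UNIV. cmod (osc (G 0) (?J j) f x) powr (q / ?d)) \<partial>\<mu>)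
      = ennreal (l powr q) * (\<integral>\<^sup>+x. ennreal (\<Prod>j\<in>UNIV. cmod (osc g (J j) ?f (L x)) powr (q / ?d)) \<partial>\<mu>)"
      unfolding osc_eq by (subst nn_integral_cmult[symmetric]) (auto simp: ennreal_mult prod_nonneg)
    also have "\<dots> \<le> ennreal (l powr q) * ennreal (C0 * B' * (\<Prod>j\<in>UNIV. (?I j / l) powr (q / (?d * p))))"
      by (intro mult_left_mono est) simp
    also have "\<dots> = ennreal (l powr q * (C0 * B' * (\<Prod>j\<in>UNIV. (?I j / l) powr (q / (?d * p)))))"
      using C0 B'0 by (subst ennreal_mult) (auto intro!: mult_nonneg_nonneg prod_nonneg)
    also have "l powr q * (C0 * B' * (\<Prod>j\<in>UNIV. (?I j / l) powr (q / (?d * p))))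
      = C0 * C1 * B * l powr (q * (1 - 1 / p) - ?\<beta>) * (\<Prod>j\<in>UNIV. ?I j powr (q / (?d * p)))"
    proof -
      have "(\<Prod>j\<in>UNIV. (?I j / l) powr (q / (?d * p))) = (\<Prod>j\<in>UNIV. ?I j powr (q / (?d * p)) * l powr ((- q / p) / ?d))"
      proof (intro prod.cong refl)
        fix j
        have z: "(- q / p) / ?d = - (q / (?d * p))" by simp
        show "(?I j / l) powr (q / (?d * p)) = ?I j powr (q / (?d * p)) * l powr ((- q / p) / ?d)"
          unfolding z powr_minus using powr_divide[of "?I j" l] a I0[of j] by (simp add: divide_inverse)
      qed
      also have "\<dots> = (\<Prod>j\<in>UNIV. ?I j powr (q / (?d * p))) * l powr (- q / p)"
        unfolding prod.distrib pw ..
      finally have e1: "(\<Prod>j\<in>UNIV. (?I j / l) powr (q / (?d * p))) = (\<Prod>j\<in>UNIV. ?I j powr (q / (?d * p))) * l powr (- q / p)" .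
      have "l powr (q * (1 - 1 / p) - ?\<beta>) = l powr q * l powr (- q / p) * l powr (- ?\<beta>)"
        by (simp add: powr_add[symmetric] algebra_simps)
      then show ?thesis unfolding e1 B'_def by (simp add: mult_ac)
    qed
    finally show "(\<integral>\<^sup>+x. ennreal (\<Prod>j\<in>UNIV. cmod (osc (G 0) (?J j) f x) powr (q / ?d)) \<partial>\<mu>)
        \<le> ennreal (C0 * C1 * B * l powr (q * (1 - 1 / p) - ?\<beta>) * (\<Prod>j\<in>UNIV. ?I j powr (q / (?d * p))))" .
  qed
qed

text \<open>Either \<open>d\<close> pairwise non-adjacent terms are comparable to the largest one, or at most \<open>2 d\<close> terms matter.
  Non-adjacency is achieved by taking indices of the same parity.\<close>

lemma sum_le_linear_or_multilinear:
  fixes z :: "nat \<Rightarrow> complex" and q :: real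
  assumes "0 < q" "0 < N"
  defines "\<Sigma> \<equiv> {\<sigma> :: 'n::finite \<Rightarrow> nat. (\<forall>i. \<sigma> i < N) \<and> (\<forall>i j. i \<noteq> j \<longrightarrow> \<sigma> i + 2 \<le> \<sigma> j \<or> \<sigma> j + 2 \<le> \<sigma> i)}"
  shows "cmod (\<Sum>c<N. z c) powr q \<le> (3 * CARD('n)) powr q * (\<Sum>c<N. cmod (z c) powr q)
    + N powr (2 * q) * (\<Sum>\<sigma>\<in>\<Sigma>. \<Prod>i\<in>UNIV. cmod (z (\<sigma> i)) powr (q / CARD('n)))"
proof -
  let ?d = "CARD('n)"
  have d: "0 < ?d" by simp
  have fin\<Sigma>: "finite \<Sigma>"
  proof (rule finite_subset)
    show "\<Sigma> \<subseteq> (UNIV :: 'n set) \<rightarrow>\<^sub>E {..<N}" by (auto simp: \<Sigma>_def)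
  qed (auto intro: finite_PiE)
  define M where "M = Max ((\<lambda>c. cmod (z c)) ` {..<N})"
  have M_ge: "cmod (z c) \<le> M" if "c < N" for c unfolding M_def by (rule Max_ge) (use that in auto)
  obtain c0 where c0: "c0 < N" "M = cmod (z c0)"
    using Max_in[of "(\<lambda>c. cmod (z c)) ` {..<N}"] \<open>0 < N\<close> unfolding M_def by fastforce
  have M0: "0 \<le> M" using c0 by simp
  \<comment> \<open>The terms outside \<open>S\<close> have a sum of modulus at most
    \<open>M\<close>.\<close>
  define S where "S = {c. c < N \<and> M / N \<le> cmod (z c)}"
  have finS: "finite S" by (rule finite_subset[of _ "{..<N}"]) (auto simp: S_def)
  have t1: "0 \<le> (3 * ?d) powr q * (\<Sum>c<N. cmod (z c) powr q)" by (intro mult_nonneg_nonneg sum_nonneg) auto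
  have t2: "0 \<le> N powr (2 * q) * (\<Sum>\<sigma>\<in>\<Sigma>. \<Prod>i\<in>UNIV. cmod (z (\<sigma> i)) powr (q / ?d))"
    by (intro mult_nonneg_nonneg sum_nonneg prod_nonneg) auto
  show ?thesis
  proof (cases "\<exists>\<sigma>\<in>\<Sigma>. \<forall>i. \<sigma> i \<in> S")
    case True
    then obtain \<sigma> where \<sigma>: "\<sigma> \<in> \<Sigma>" "\<And>i. \<sigma> i \<in> S" by blast
    have "cmod (\<Sum>c<N. z c) \<le> (\<Sum>c<N. M)" by (rule sum_norm_le) (use M_ge in auto)
    then have sumM: "cmod (\<Sum>c<N. z c) \<le> N * M" by simp
    \<comment> \<open>One factor \<open>N\<close> comes from the number of terms and one from the
      definition of \<open>S\<close>: the sum is at most \<open>N^2\<close> times each selected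
      term.\<close>
    have "cmod (\<Sum>c<N. z c) powr (q / ?d) \<le> N powr (2 * q / ?d) * cmod (z (\<sigma> i)) powr (q / ?d)" for i
    proof -
      have "M \<le> N * cmod (z (\<sigma> i))" using \<sigma>(2)[of i] \<open>0 < N\<close> by (simp add: S_def field_simps)
      then have "N * M \<le> N * (N * cmod (z (\<sigma> i)))" by (intro mult_left_mono) auto
      from order_trans[OF sumM this] have "cmod (\<Sum>c<N. z c) \<le> real N powr 2 * cmod (z (\<sigma> i))"
        by (simp add: powr_numeral power2_eq_square mult.assoc)
      then have "cmod (\<Sum>c<N. z c) powr (q / ?d) \<le> (real N powr 2 * cmod (z (\<sigma> i))) powr (q / ?d)"
        using assms(1) by (intro powr_mono2) auto
      then show ?thesis by (simp only: powr_mult powr_powr times_divide_eq_right)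
    qed
    then have "(\<Prod>i\<in>(UNIV :: 'n set). cmod (\<Sum>c<N. z c) powr (q / ?d)) \<le> (\<Prod>i\<in>UNIV. N powr (2 * q / ?d) * cmod (z (\<sigma> i)) powr (q / ?d))"
      by (intro prod_mono) auto
    moreover have pw: "(\<Prod>i\<in>(UNIV :: 'n set). x powr (y / ?d)) = x powr y" if "0 \<le> x" for x y :: real
    proof (cases "x = 0")
      case False
      then have "(x powr (y / ?d)) ^ ?d = x powr y" using that by (simp add: powr_realpow[symmetric] powr_powr)
      then show ?thesis by simp
    qed (use d in simp)
    ultimately have "cmod (\<Sum>c<N. z c) powr q \<le> N powr (2 * q) * (\<Prod>i\<in>UNIV. cmod (z (\<sigma> i)) powr (q / ?d))"
      unfolding prod.distrib using pw[of "cmod (\<Sum>c<N. z c)" q] pw[of "real N" "2 * q"] by simp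
    also have "\<dots> \<le> N powr (2 * q) * (\<Sum>\<sigma>\<in>\<Sigma>. \<Prod>i\<in>UNIV. cmod (z (\<sigma> i)) powr (q / ?d))"
      by (intro mult_left_mono member_le_sum[OF \<sigma>(1)] prod_nonneg fin\<Sigma>) auto
    finally show ?thesis using t1 by linarith
  next
    case False
    \<comment> \<open>Distinct indices of equal parity differ by at least 2, so \<open>d\<close>
      large ones among them would form an admissible tuple. Hence at most \<open>2 * d\<close> terms
      are large.\<close>
    have parity: "card (S \<inter> {c. P c}) < ?d" if P: "\<And>x y. P x \<Longrightarrow> P y \<Longrightarrow> x \<noteq> y \<Longrightarrow> x + 2 \<le> y \<or> y + 2 \<le> x" for P
    proof (rule ccontr)
      assume "\<not> card (S \<inter> {c. P c}) < ?d"
      then obtain \<sigma> :: "'n \<Rightarrow> nat" where \<sigma>: "range \<sigma> \<subseteq> S \<inter> {c. P c}" "inj \<sigma>"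
        using card_le_inj[of "UNIV :: 'n set" "S \<inter> {c. P c}"] finS by (auto simp: not_less)
      then have "\<sigma> \<in> \<Sigma>" using P by (auto simp: \<Sigma>_def S_def inj_def image_subset_iff) blast
      then show False using False \<sigma>(1) by auto
    qed
    have "card S = card ((S \<inter> {c. even c}) \<union> (S \<inter> {c. odd c}))" by (rule arg_cong[where f=card]) auto
    also have "\<dots> \<le> card (S \<inter> {c. even c}) + card (S \<inter> {c. odd c})" by (rule card_Un_le)
    also have "\<dots> \<le> 2 * ?d"
      using parity[of even] parity[of odd] by (simp add: less_imp_le) presburger
    finally have cS: "card S \<le> 2 * ?d" .
    have "cmod (\<Sum>c<N. z c) \<le> (\<Sum>c<N. cmod (z c))" by (rule norm_sum)
    also have "\<dots> = (\<Sum>c\<in>S. cmod (z c)) + (\<Sum>c\<in>{..<N} - S. cmod (z c))"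
      by (subst sum.subset_diff[of S "{..<N}"]) (auto simp: S_def)
    also have "\<dots> \<le> (\<Sum>c\<in>S. M) + (\<Sum>c\<in>{..<N} - S. M / N)"
      by (intro add_mono sum_mono) (auto simp: S_def intro: M_ge)
    also have "\<dots> \<le> 2 * ?d * M + N * (M / N)"
    proof (rule add_mono)
      have "real (card S) \<le> real (2 * ?d)" using cS of_nat_le_iff by blast
      then have "real (card S) * M \<le> real (2 * ?d) * M" using M0 by (rule mult_right_mono)
      then show "(\<Sum>c\<in>S. M) \<le> 2 * ?d * M" by simp
      have "card ({..<N} - S) \<le> N" using card_mono[of "{..<N}" "{..<N} - S"] by simp
      then have "real (card ({..<N} - S)) * (M / N) \<le> real N * (M / N)"
        using M0 by (intro mult_right_mono) auto
      then show "(\<Sum>c\<in>{..<N} - S. M / N) \<le> N * (M / N)" by (simp only: sum_constant)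
    qed
    also have "\<dots> = (2 * ?d + 1) * M" using \<open>0 < N\<close> by (simp add: algebra_simps)
    also have "\<dots> \<le> (3 * ?d) * M" using d M0 by (intro mult_right_mono) linarith+
    finally have "cmod (\<Sum>c<N. z c) powr q \<le> ((3 * ?d) * M) powr q"
      using assms(1) by (intro powr_mono2) auto
    also have "\<dots> = (3 * ?d) powr q * cmod (z c0) powr q" using c0 by (simp add: powr_mult)
    also have "\<dots> \<le> (3 * ?d) powr q * (\<Sum>c<N. cmod (z c) powr q)"
      by (intro mult_left_mono member_le_sum) (use c0 in auto)
    finally show ?thesis using t2 by linarith
  qed
qed

text \<open>Norms of sequences decrease in the exponent. It is applied with
  \<open>s = q / p\<close>, whence the condition \<open>p \<le> q\<close>.\<close>

lemma sum_powr_le_powr_sum: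
  fixes x :: "'a \<Rightarrow> real"
  assumes "finite A" "\<And>a. a \<in> A \<Longrightarrow> 0 \<le> x a" "1 \<le> s"
  shows "(\<Sum>a\<in>A. x a powr s) \<le> (\<Sum>a\<in>A. x a) powr s"
proof -
  let ?X = "\<Sum>a\<in>A. x a"
  have X0: "0 \<le> ?X" by (rule sum_nonneg) (use assms in auto)
  have split: "y powr s = y * y powr (s - 1)" if "0 \<le> y" for y
    using that by (cases "y = 0") (auto simp: powr_diff)
  have "(\<Sum>a\<in>A. x a powr s) \<le> (\<Sum>a\<in>A. x a * ?X powr (s - 1))"
  proof (rule sum_mono)
    fix a assume a: "a \<in> A"
    have "x a \<le> ?X" by (rule member_le_sum[OF a]) (use assms in auto)
    then have "x a powr (s - 1) \<le> ?X powr (s - 1)" using assms a by (intro powr_mono2) auto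
    then show "x a powr s \<le> x a * ?X powr (s - 1)" using assms a by (simp add: split mult_left_mono)
  qed
  also have "\<dots> = ?X powr s" using X0 by (simp add: sum_distrib_right[symmetric] split)
  finally show ?thesis .
qed

section \<open>Partitions of the unit interval into equal cells\<close>

definition cell :: "nat \<Rightarrow> nat \<Rightarrow> real set" where
  "cell n l = {real l / n ..< (real l + 1) / n}"

lemma cell_borel [measurable]: "cell n l \<in> sets borel" by (simp add: cell_def)

lemma cell_subset: "l < n \<Longrightarrow> cell n l \<subseteq> {0..<1}"
proof -
  assume "l < n"
  then have "(real l + 1) / n \<le> 1" by simp
  moreover have "0 \<le> real l / n" by simp
  ultimately show ?thesis
    unfolding cell_def by (meson atLeastLessThan_iff order_less_le_trans order_trans subsetI)
qed

lemma emeasure_cell: "0 < n \<Longrightarrow> emeasure lborel (cell n l) = ennreal (1 / n)"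
  by (simp add: cell_def diff_divide_distrib[symmetric] divide_right_mono)

lemma cell_image: "0 < n \<Longrightarrow> 0 < N \<Longrightarrow> cell (n * N) (l * N + c) = (\<lambda>s. l / n + 1 / n * s) ` cell N c"
proof -
  assume n: "0 < n" and N: "0 < N"
  have "t \<in> (\<lambda>s. l / n + 1 / n * s) ` X \<longleftrightarrow> real n * t - real l \<in> X" for t :: real and X
  proof
    assume "real n * t - real l \<in> X"
    moreover have "t = l / n + 1 / n * (real n * t - real l)" using n by (simp add: field_simps)
    ultimately show "t \<in> (\<lambda>s. l / n + 1 / n * s) ` X" by blast
  qed (use n in \<open>auto simp: field_simps\<close>)
  moreover have "real n * t - real l \<in> cell N c \<longleftrightarrow> t \<in> cell (n * N) (l * N + c)" for t
    using n N by (simp add: cell_def field_simps)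
  ultimately show ?thesis by blast
qed

lemma cell_disjoint: "0 < n \<Longrightarrow> l \<noteq> k \<Longrightarrow> cell n l \<inter> cell n k = {}"
proof (rule ccontr)
  assume n: "0 < n" and lk: "l \<noteq> k" and "cell n l \<inter> cell n k \<noteq> {}"
  then obtain t where "t \<in> cell n l" "t \<in> cell n k" by blast
  then have "real l / n \<le> t" "t < (real l + 1) / n" "real k / n \<le> t" "t < (real k + 1) / n"
    by (auto simp: cell_def)
  then have "real l \<le> t * n" "t * n < real l + 1" "real k \<le> t * n" "t * n < real k + 1"
    using n by (auto simp: field_simps)
  then have "real l < real k + 1" "real k < real l + 1" by linarith+
  then show False using lk by linarith
qed

lemma cell_union: "0 < n \<Longrightarrow> 0 < N \<Longrightarrow> (\<Union>c<N. cell (n * N) (l * N + c)) = cell n l"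
proof -
  assume n: "0 < n" and N: "0 < N"
  have "(\<Union>c<N. cell N c) = {0..<1}"
  proof
    show "(\<Union>c<N. cell N c) \<subseteq> {0..<1}" using cell_subset by blast
    show "{0..<1} \<subseteq> (\<Union>c<N. cell N c)"
    proof
      fix t :: real assume t: "t \<in> {0..<1}"
      define c where "c = nat \<lfloor>t * N\<rfloor>"
      have c: "real c \<le> t * N" "t * N < real c + 1" using t by (auto simp: c_def of_nat_nat)
      have "t * N < 1 * real N" using t N by (intro mult_strict_right_mono) auto
      then have "real c < real N" using c by linarith
      then have "c < N" by simp
      moreover have "t \<in> cell N c" using c N by (simp add: cell_def field_simps)
      ultimately show "t \<in> (\<Union>c<N. cell N c)" by blast
    qed
  qed
  then have "(\<Union>c<N. (\<lambda>s. l / n + 1 / n * s) ` cell N c) = (\<lambda>s. l / n + 1 / n * s) ` {0..<1}" by (simp add: image_UN[symmetric])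
  moreover have "{0..<1} = cell 1 0" by (simp add: cell_def)
  ultimately show ?thesis using n N cell_image[of n N l] cell_image[of n 1 l 0] by simp
qed

lemma set_integral_cell_split:
  fixes h :: "real \<Rightarrow> 'a::{banach, second_countable_topology}"
  assumes "0 < n" "0 < N" and h: "set_integrable lborel (cell n l) h"
  shows "(LINT t:cell n l|lborel. h t) = (\<Sum>c<N. LINT t:cell (n * N) (l * N + c)|lborel. h t)"
proof -
  have "(LINT t:(\<Union>c\<in>{..<N}. cell (n * N) (l * N + c))|lborel. h t) = (\<Sum>c<N. LINT t:cell (n * N) (l * N + c)|lborel. h t)"
  proof (rule set_integral_finite_Union)
    show "disjoint_family_on (\<lambda>c. cell (n * N) (l * N + c)) {..<N}"
      using assms by (auto simp: disjoint_family_on_def intro!: cell_disjoint)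
    show "set_integrable lborel (cell (n * N) (l * N + c)) h" if "c \<in> {..<N}" for c
      by (rule set_integrable_subset[OF h]) (use cell_union[OF assms(1,2), of l] that in auto)
  qed auto
  then show ?thesis by (simp add: cell_union[OF assms(1,2)])
qed

lemma Lp_on_subset: "Lp_on p J f \<Longrightarrow> I \<subseteq> J \<Longrightarrow> I \<in> sets borel \<Longrightarrow> Lp_on p I f"
  unfolding Lp_on_def by (auto intro: set_integrable_subset)

lemma Lp_on_integrable:
  assumes "Lp_on p J f" "1 \<le> p" "J \<in> sets borel" "emeasure lborel J < \<infinity>"
  shows "set_integrable lborel J f"
proof -
  have [measurable]: "f \<in> borel_measurable borel" using assms by (simp add: Lp_on_def)
  have "set_integrable lborel J (\<lambda>t. cmod (f t) powr 1)"
    by (rule set_integrable_powr_le[where p=p]) (use assms in \<open>auto simp: Lp_on_def\<close>)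
  then show ?thesis unfolding set_integrable_def
    by (rule Bochner_Integration.integrable_bound) (use assms(3) in \<open>auto simp: indicator_def\<close>)
qed

lemma osc_integrable:
  fixes g :: "real \<Rightarrow> real ^ 'n::finite" and f :: "real \<Rightarrow> complex"
  assumes "g \<in> borel_measurable borel" "J \<in> sets borel" "set_integrable lborel J f" "f \<in> borel_measurable borel"
  shows "set_integrable lborel J (\<lambda>t. cis (x \<bullet> g t) * f t)"
proof -
  note [measurable] = assms(1,2,4)
  show ?thesis using assms(3) unfolding set_integrable_def
  proof (rule Bochner_Integration.integrable_bound)
    show "(\<lambda>t. indicat_real J t *\<^sub>R (cis (x \<bullet> g t) * f t)) \<in> borel_measurable lborel" by measurable
  qed (auto simp: norm_mult)
qed

lemma norm_osc_le:
  assumes "set_integrable lborel J f"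
  shows "cmod (osc g J f x) \<le> (LINT t:J|lborel. cmod (f t))"
proof -
  have "cmod (osc g J f x) \<le> (LINT t|lborel. cmod (indicat_real J t *\<^sub>R (cis (x \<bullet> g t) * f t)))"
    unfolding osc_def set_lebesgue_integral_def by (rule integral_norm_bound)
  also have "\<dots> = (LINT t:J|lborel. cmod (f t))"
    unfolding set_lebesgue_integral_def by (intro Bochner_Integration.integral_cong) (auto simp: norm_mult indicator_def)
  finally show ?thesis .
qed

lemma inverse_nat_powr: "(1 / real n) powr z = real n powr (- z)"
  using powr_divide[of 1 "real n" z] by (simp add: powr_minus divide_inverse)

lemma set_integral_subset_mono:
  fixes h :: "'a \<Rightarrow> real"
  assumes "\<And>t. 0 \<le> h t" "set_integrable M J h" "I \<subseteq> J" "I \<in> sets M"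
  shows "(LINT t:I|M. h t) \<le> (LINT t:J|M. h t)"
  using assms(2) set_integrable_subset[OF assms(2,4,3)] assms(1,3)
  unfolding set_lebesgue_integral_def set_integrable_def
  by (intro integral_mono) (auto simp: indicator_def)

section \<open>Induction on scales\<close>

definition cell_energy :: "(real \<Rightarrow> real ^ 'n::finite) \<Rightarrow> real \<Rightarrow> (real ^ 'n) measure \<Rightarrow> (real \<Rightarrow> complex) \<Rightarrow> nat \<Rightarrow> ennreal" where
  "cell_energy g q \<mu> f n = (\<Sum>l<n. \<integral>\<^sup>+x. ennreal (cmod (osc g (cell n l) f x) powr q) \<partial>\<mu>)"

lemma sum_lessThan_mult:
  fixes h :: "nat \<Rightarrow> 'a::comm_monoid_add"
  shows "(\<Sum>l<n * N. h l) = (\<Sum>l<n. \<Sum>c<N. h (l * N + c))"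
proof -
  have "(\<Sum>l<n. sum h {l * N..<l * N + N}) = sum h {..<n * N}" by (rule sum.nat_group)
  moreover have "sum h {l * N..<l * N + N} = (\<Sum>c<N. h (l * N + c))" for l
    using sum.shift_bounds_nat_ivl[of h 0 "l * N" N] by (simp add: atLeast0LessThan add.commute)
  ultimately show ?thesis by simp
qed

lemma cell_powr_sum_le:
  assumes Lp: "Lp_on p {0..<1} f" and n: "0 < n" and pq: "0 < p" "p \<le> q"
  shows "(\<Sum>l<n. (LINT t:cell n l|lborel. cmod (f t) powr p) powr (q / p)) \<le> (LINT t:{0..<1}|lborel. cmod (f t) powr p) powr (q / p)"
proof -
  have i: "set_integrable lborel (cell 1 0) (\<lambda>t. cmod (f t) powr p)" using Lp by (simp add: Lp_on_def cell_def)
  have "(\<Sum>l<n. (LINT t:cell n l|lborel. cmod (f t) powr p)) = (LINT t:{0..<1}|lborel. cmod (f t) powr p)"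
    using set_integral_cell_split[OF _ n i] by (simp add: cell_def)
  moreover have "(\<Sum>l<n. (LINT t:cell n l|lborel. cmod (f t) powr p) powr (q / p)) \<le> (\<Sum>l<n. (LINT t:cell n l|lborel. cmod (f t) powr p)) powr (q / p)"
    by (rule sum_powr_le_powr_sum) (use pq in \<open>auto simp: set_lebesgue_integral_def intro!: integral_nonneg_AE\<close>)
  ultimately show ?thesis by simp
qed

text \<open>Trivial bound at the finest scale, where the finiteness of the measure is used.\<close>

lemma cell_energy_trivial:
  fixes g :: "real \<Rightarrow> real ^ 'n::finite"
  assumes fin: "finite_measure \<mu>" and Lp: "Lp_on p {0..<1} f" and n: "0 < n" and p: "1 < p" "p \<le> q"
  shows "cell_energy g q \<mu> f n \<le> ennreal (2 powr q * measure \<mu> (space \<mu>) * real n powr (- (q * (1 - 1 / p)))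
    * (LINT t:{0..<1}|lborel. cmod (f t) powr p) powr (q / p))"
proof -
  interpret finite_measure \<mu> by fact
  let ?I = "\<lambda>l. LINT t:cell n l|lborel. cmod (f t) powr p"
  let ?m = "measure \<mu> (space \<mu>)"
  have I0: "0 \<le> ?I l" for l unfolding set_lebesgue_integral_def by (intro integral_nonneg_AE) auto
  have fm[measurable]: "f \<in> borel_measurable borel" using Lp by (simp add: Lp_on_def)
  have one: "(\<integral>\<^sup>+x. ennreal (cmod (osc g (cell n l) f x) powr q) \<partial>\<mu>) \<le> ennreal (2 powr q * ?m * real n powr (- (q * (1 - 1 / p))) * ?I l powr (q / p))"
    if l: "l < n" for l
  proof -
    have Lpl: "Lp_on p (cell n l) f" by (rule Lp_on_subset[OF Lp cell_subset[OF l] cell_borel])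
    have em: "emeasure lborel (cell n l) < \<infinity>" using n by (simp add: emeasure_cell)
    have fi: "set_integrable lborel (cell n l) f" by (rule Lp_on_integrable[OF Lpl _ cell_borel em]) (use p in simp)
    have "(LINT t:cell n l|lborel. cmod (f t) powr 1) \<le> 2 * (1 / real n) powr (1 - 1 / p) * ?I l powr (1 / p)"
      by (rule set_integral_powr_le) (use n p Lpl in \<open>auto simp: emeasure_cell Lp_on_def\<close>)
    then have b: "cmod (osc g (cell n l) f x) \<le> 2 * (1 / real n) powr (1 - 1 / p) * ?I l powr (1 / p)" for x
      using norm_osc_le[OF fi, of g x] by simp
    have "(\<integral>\<^sup>+x. ennreal (cmod (osc g (cell n l) f x) powr q) \<partial>\<mu>) \<le> (\<integral>\<^sup>+x. ennreal ((2 * (1 / real n) powr (1 - 1 / p) * ?I l powr (1 / p)) powr q) \<partial>\<mu>)"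
      by (intro nn_integral_mono ennreal_leI powr_mono2 b) (use p in auto)
    also have "\<dots> = ennreal ((2 * (1 / real n) powr (1 - 1 / p) * ?I l powr (1 / p)) powr q * ?m)"
      by (simp add: emeasure_eq_measure ennreal_mult)
    also have "(2 * (1 / real n) powr (1 - 1 / p) * ?I l powr (1 / p)) powr q * ?m = 2 powr q * ?m * real n powr (- (q * (1 - 1 / p))) * ?I l powr (q / p)"
    proof -
      have "(1 / real n) powr ((1 - 1 / p) * q) = real n powr (- (q * (1 - 1 / p)))"
        by (simp only: inverse_nat_powr mult.commute[of q])
      then show ?thesis unfolding powr_mult powr_powr by (simp add: mult_ac)
    qed
    finally show ?thesis .
  qed
  have "cell_energy g q \<mu> f n \<le> (\<Sum>l<n. ennreal (2 powr q * ?m * real n powr (- (q * (1 - 1 / p))) * ?I l powr (q / p)))"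
    unfolding cell_energy_def by (intro sum_mono one) auto
  also have "\<dots> = ennreal (2 powr q * ?m * real n powr (- (q * (1 - 1 / p))) * (\<Sum>l<n. ?I l powr (q / p)))"
    by (subst sum_ennreal) (auto simp: sum_distrib_left)
  also have "\<dots> \<le> ennreal (2 powr q * ?m * real n powr (- (q * (1 - 1 / p))) * (LINT t:{0..<1}|lborel. cmod (f t) powr p) powr (q / p))"
    by (intro ennreal_leI mult_left_mono cell_powr_sum_le[OF Lp n]) (use p in auto)
  finally show ?thesis .
qed

text \<open>An index gap of 2 leaves a whole cell of length \<open>1 / N\<close> in between.\<close>

lemma separated_cells:
  assumes "0 < N" "\<And>i. \<sigma> i < N" "\<And>i j. i \<noteq> j \<Longrightarrow> \<sigma> i + 2 \<le> \<sigma> j \<or> \<sigma> j + 2 \<le> \<sigma> i"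
  shows "separated_intervals (1 / N) (\<lambda>i. cell N (\<sigma> i))"
  unfolding separated_intervals_def
proof (intro conjI allI impI ballI)
  fix i
  show "convex (cell N (\<sigma> i))" by (simp add: cell_def)
  show "cell N (\<sigma> i) \<in> sets borel" by simp
  show "cell N (\<sigma> i) \<subseteq> {0..1}" using cell_subset[OF assms(2), of i] by force
next
  fix i j a b assume ij: "i \<noteq> j" and a: "a \<in> cell N (\<sigma> i)" and b: "b \<in> cell N (\<sigma> j)"
  have "real (\<sigma> i) \<le> a * N" "a * N < real (\<sigma> i) + 1" "real (\<sigma> j) \<le> b * N" "b * N < real (\<sigma> j) + 1"
    using a b assms(1) by (auto simp: cell_def field_simps)
  then have "1 \<le> \<bar>a * N - b * N\<bar>" using assms(3)[OF ij] by linarith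
  also have "\<bar>a * N - b * N\<bar> = \<bar>a - b\<bar> * N" by (simp add: abs_mult left_diff_distrib[symmetric])
  finally show "1 / N \<le> \<bar>a - b\<bar>" using assms(1) by (simp add: field_simps)
qed

text \<open>One step of the induction on scales of Bourgain and Guth.\<close>

lemma cell_energy_step:
  fixes rk :: "'n::finite \<Rightarrow> nat" and p q K c :: real and G :: "nat \<Rightarrow> real \<Rightarrow> real ^ 'n"
  assumes N: "0 < N" and n: "0 < n" and p: "1 < p" "p \<le> q" and D: "0 \<le> D"
    and mu: "sets \<mu> = sets borel" and g[measurable]: "g \<in> borel_measurable borel" and Lp: "Lp_on p {0..<1} f"
    and multi: "\<And>l (\<sigma> :: 'n \<Rightarrow> nat). \<lbrakk>l < n; \<And>i. \<sigma> i < N; \<And>i j. i \<noteq> j \<Longrightarrow> \<sigma> i + 2 \<le> \<sigma> j \<or> \<sigma> j + 2 \<le> \<sigma> i\<rbrakk> \<Longrightarrow>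
      (\<integral>\<^sup>+x. ennreal (\<Prod>i\<in>UNIV. cmod (osc g (cell (n * N) (l * N + \<sigma> i)) f x) powr (q / CARD('n))) \<partial>\<mu>)
        \<le> ennreal (D * (\<Prod>i\<in>UNIV. (LINT t:cell (n * N) (l * N + \<sigma> i)|lborel. cmod (f t) powr p) powr (q / (CARD('n) * p))))"
  shows "cell_energy (g :: real \<Rightarrow> real ^ 'n) q \<mu> f n \<le> ennreal ((3 * CARD('n)) powr q) * cell_energy g q \<mu> f (n * N)
    + ennreal (N powr (2 * q) * real N ^ CARD('n) * D * (LINT t:{0..<1}|lborel. cmod (f t) powr p) powr (q / p))"
proof -
  let ?d = "CARD('n)"
  let ?I = "\<lambda>l. LINT t:cell n l|lborel. cmod (f t) powr p"
  let ?c = "\<lambda>l c. cell (n * N) (l * N + c)"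
  have q: "0 < q" using p by simp
  have I0: "0 \<le> (LINT t:J|lborel. cmod (f t) powr p)" for J unfolding set_lebesgue_integral_def by (intro integral_nonneg_AE) auto
  have fm[measurable]: "f \<in> borel_measurable borel" using Lp by (simp add: Lp_on_def)
  note [measurable_cong] = mu
  \<comment> \<open>There are at most \<open>N ^ d\<close> such tuples, which is the source of this
    factor in the error term.\<close>
  define \<Sigma> where "\<Sigma> = {\<sigma> :: 'n \<Rightarrow> nat. (\<forall>i. \<sigma> i < N) \<and> (\<forall>i j. i \<noteq> j \<longrightarrow> \<sigma> i + 2 \<le> \<sigma> j \<or> \<sigma> j + 2 \<le> \<sigma> i)}"
  have sub\<Sigma>: "\<Sigma> \<subseteq> (UNIV :: 'n set) \<rightarrow>\<^sub>E {..<N}" by (auto simp: \<Sigma>_def)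
  have fin\<Sigma>: "finite \<Sigma>" by (rule finite_subset[OF sub\<Sigma>]) (auto intro: finite_PiE)
  have card\<Sigma>: "card \<Sigma> \<le> N ^ ?d"
  proof -
    have "card \<Sigma> \<le> card ((UNIV :: 'n set) \<rightarrow>\<^sub>E {..<N})" by (rule card_mono[OF _ sub\<Sigma>]) (auto intro: finite_PiE)
    also have "\<dots> = N ^ ?d" by (subst card_PiE) auto
    finally show ?thesis .
  qed
  define Pr where "Pr = (\<lambda>l (\<sigma> :: 'n \<Rightarrow> nat) x. \<Prod>i\<in>UNIV. cmod (osc g (?c l (\<sigma> i)) f x) powr (q / ?d))"
  have Pm[measurable]: "Pr l \<sigma> \<in> borel_measurable borel" for l \<sigma> unfolding Pr_def by measurable
  have P0: "0 \<le> Pr l \<sigma> x" for l \<sigma> x unfolding Pr_def by (intro prod_nonneg) auto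
  have one: "(\<integral>\<^sup>+x. ennreal (cmod (osc g (cell n l) f x) powr q) \<partial>\<mu>)
    \<le> ennreal ((3 * ?d) powr q) * (\<Sum>c<N. \<integral>\<^sup>+x. ennreal (cmod (osc g (?c l c) f x) powr q) \<partial>\<mu>)
      + ennreal (N powr (2 * q) * real N ^ ?d * D * ?I l powr (q / p))" if l: "l < n" for l
  proof -
    have Lpl: "Lp_on p (cell n l) f" by (rule Lp_on_subset[OF Lp cell_subset[OF l] cell_borel])
    have em: "emeasure lborel (cell n l) < \<infinity>" using n by (simp add: emeasure_cell)
    have fi: "set_integrable lborel (cell n l) f" by (rule Lp_on_integrable[OF Lpl _ cell_borel em]) (use p in simp)
    have split: "osc g (cell n l) f x = (\<Sum>c<N. osc g (?c l c) f x)" for x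
      unfolding osc_def by (rule set_integral_cell_split[OF n N]) (rule osc_integrable[OF g cell_borel fi fm])
    have cellsub: "?c l c \<subseteq> cell n l" if "c < N" for c using cell_union[OF n N, of l] that by blast
    have "(\<integral>\<^sup>+x. ennreal (cmod (osc g (cell n l) f x) powr q) \<partial>\<mu>)
      \<le> (\<integral>\<^sup>+x. ennreal ((3 * ?d) powr q) * (\<Sum>c<N. ennreal (cmod (osc g (?c l c) f x) powr q)) + ennreal (N powr (2 * q)) * (\<Sum>\<sigma>\<in>\<Sigma>. ennreal (Pr l \<sigma> x)) \<partial>\<mu>)"
    proof (rule nn_integral_mono)
      fix x
      have "cmod (osc g (cell n l) f x) powr q \<le> (3 * ?d) powr q * (\<Sum>c<N. cmod (osc g (?c l c) f x) powr q) + N powr (2 * q) * (\<Sum>\<sigma>\<in>\<Sigma>. Pr l \<sigma> x)"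
        unfolding split \<Sigma>_def Pr_def by (rule sum_le_linear_or_multilinear[OF q N])
      then have "ennreal (cmod (osc g (cell n l) f x) powr q) \<le> ennreal ((3 * ?d) powr q * (\<Sum>c<N. cmod (osc g (?c l c) f x) powr q) + N powr (2 * q) * (\<Sum>\<sigma>\<in>\<Sigma>. Pr l \<sigma> x))"
        by (rule ennreal_leI)
      also have "\<dots> = ennreal ((3 * ?d) powr q) * ennreal (\<Sum>c<N. cmod (osc g (?c l c) f x) powr q) + ennreal (N powr (2 * q)) * ennreal (\<Sum>\<sigma>\<in>\<Sigma>. Pr l \<sigma> x)"
        using P0 by (subst ennreal_plus) (auto simp: ennreal_mult sum_nonneg)
      also have "\<dots> = ennreal ((3 * ?d) powr q) * (\<Sum>c<N. ennreal (cmod (osc g (?c l c) f x) powr q)) + ennreal (N powr (2 * q)) * (\<Sum>\<sigma>\<in>\<Sigma>. ennreal (Pr l \<sigma> x))"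
        using P0 by (simp add: sum_ennreal)
      finally show "ennreal (cmod (osc g (cell n l) f x) powr q) \<le> ennreal ((3 * ?d) powr q) * (\<Sum>c<N. ennreal (cmod (osc g (?c l c) f x) powr q)) + ennreal (N powr (2 * q)) * (\<Sum>\<sigma>\<in>\<Sigma>. ennreal (Pr l \<sigma> x))" .
    qed
    also have "\<dots> = ennreal ((3 * ?d) powr q) * (\<Sum>c<N. \<integral>\<^sup>+x. ennreal (cmod (osc g (?c l c) f x) powr q) \<partial>\<mu>) + ennreal (N powr (2 * q)) * (\<Sum>\<sigma>\<in>\<Sigma>. \<integral>\<^sup>+x. ennreal (Pr l \<sigma> x) \<partial>\<mu>)"
      by (simp add: nn_integral_add nn_integral_cmult nn_integral_sum del: sum_ennreal)
    also have "\<dots> \<le> ennreal ((3 * ?d) powr q) * (\<Sum>c<N. \<integral>\<^sup>+x. ennreal (cmod (osc g (?c l c) f x) powr q) \<partial>\<mu>) + ennreal (N powr (2 * q)) * (\<Sum>\<sigma>\<in>\<Sigma>. ennreal (D * ?I l powr (q / p)))"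
    proof (intro add_left_mono mult_left_mono sum_mono)
      fix \<sigma> assume \<sigma>: "\<sigma> \<in> \<Sigma>"
      have "(\<integral>\<^sup>+x. ennreal (Pr l \<sigma> x) \<partial>\<mu>) \<le> ennreal (D * (\<Prod>i\<in>UNIV. (LINT t:?c l (\<sigma> i)|lborel. cmod (f t) powr p) powr (q / (?d * p))))"
        unfolding Pr_def by (rule multi[OF l]) (use \<sigma> in \<open>auto simp: \<Sigma>_def\<close>)
      also have "\<dots> \<le> ennreal (D * ?I l powr (q / p))"
      proof (intro ennreal_leI mult_left_mono D)
        \<comment> \<open>Every subcell is enlarged to the whole cell, and the \<open>d\<close>
          equal factors recombine to the power \<open>q / p\<close>.\<close>
        have "(\<Prod>i\<in>UNIV. (LINT t:?c l (\<sigma> i)|lborel. cmod (f t) powr p) powr (q / (?d * p))) \<le> (\<Prod>i\<in>(UNIV :: 'n set). ?I l powr (q / (?d * p)))"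
        proof (intro prod_mono conjI powr_mono2 I0)
          fix i :: 'n
          have "\<sigma> i < N" using \<sigma> by (simp add: \<Sigma>_def)
          then show "(LINT t:?c l (\<sigma> i)|lborel. cmod (f t) powr p) \<le> ?I l"
            by (intro set_integral_subset_mono) (use Lpl cellsub in \<open>auto simp: Lp_on_def\<close>)
        qed (use p q in auto)
        also have "\<dots> = ?I l powr (q / p)"
        proof (cases "?I l = 0")
          case False
          then have "(?I l powr (q / (?d * p))) ^ ?d = ?I l powr (q / p)"
            using I0[of "cell n l"] by (simp add: powr_realpow[symmetric] powr_powr)
          then show ?thesis by simp
        qed simp
        finally show "(\<Prod>i\<in>UNIV. (LINT t:?c l (\<sigma> i)|lborel. cmod (f t) powr p) powr (q / (?d * p))) \<le> ?I l powr (q / p)" .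
      qed
      finally show "(\<integral>\<^sup>+x. ennreal (Pr l \<sigma> x) \<partial>\<mu>) \<le> ennreal (D * ?I l powr (q / p))" .
    qed auto
    also have "ennreal (N powr (2 * q)) * (\<Sum>\<sigma>\<in>\<Sigma>. ennreal (D * ?I l powr (q / p))) \<le> ennreal (N powr (2 * q) * real N ^ ?d * D * ?I l powr (q / p))"
    proof -
      have "ennreal (N powr (2 * q)) * (\<Sum>\<sigma>\<in>\<Sigma>. ennreal (D * ?I l powr (q / p))) = ennreal (N powr (2 * q) * (real (card \<Sigma>) * (D * ?I l powr (q / p))))"
        using D by (subst sum_ennreal) (auto simp: ennreal_mult)
      also have "\<dots> \<le> ennreal (N powr (2 * q) * (real N ^ ?d * (D * ?I l powr (q / p))))"
        using D card\<Sigma> by (intro ennreal_leI mult_left_mono mult_right_mono) (auto simp flip: of_nat_power)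
      finally show ?thesis by (simp add: mult.assoc)
    qed
    finally show ?thesis by (simp add: add_left_mono)
  qed
  have "cell_energy g q \<mu> f n \<le> (\<Sum>l<n. ennreal ((3 * ?d) powr q) * (\<Sum>c<N. \<integral>\<^sup>+x. ennreal (cmod (osc g (?c l c) f x) powr q) \<partial>\<mu>)
      + ennreal (N powr (2 * q) * real N ^ ?d * D * ?I l powr (q / p)))"
    unfolding cell_energy_def by (intro sum_mono one) auto
  also have "\<dots> = ennreal ((3 * ?d) powr q) * cell_energy g q \<mu> f (n * N) + (\<Sum>l<n. ennreal (N powr (2 * q) * real N ^ ?d * D * ?I l powr (q / p)))"
    unfolding cell_energy_def sum_lessThan_mult by (simp add: sum.distrib sum_distrib_left)
  also have "(\<Sum>l<n. ennreal (N powr (2 * q) * real N ^ ?d * D * ?I l powr (q / p))) = ennreal (N powr (2 * q) * real N ^ ?d * D * (\<Sum>l<n. ?I l powr (q / p)))"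
    using D by (subst sum_ennreal) (auto simp: sum_distrib_left)
  also have "\<dots> \<le> ennreal (N powr (2 * q) * real N ^ ?d * D * (LINT t:{0..<1}|lborel. cmod (f t) powr p) powr (q / p))"
    by (intro ennreal_leI mult_left_mono cell_powr_sum_le[OF Lp n]) (use p D in auto)
  finally show ?thesis by (simp add: add_left_mono)
qed

text \<open>The total mass of the measure will enter through \<open>b\<close> and is removed in the
  limit.\<close>

lemma ennreal_le_of_halving:
  fixes X :: ennreal
  assumes a: "0 \<le> a" "0 \<le> b" and X: "\<And>k. X \<le> ennreal (a + b * (1 / 2) ^ k)"
  shows "X \<le> ennreal a"
proof -
  have "(\<lambda>k. a + b * (1 / 2) ^ k) \<longlonglongrightarrow> a + b * 0"
    by (intro tendsto_intros LIMSEQ_power_zero) auto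
  then have "(\<lambda>k. ennreal (a + b * (1 / 2) ^ k)) \<longlonglongrightarrow> ennreal a"
    by (intro tendsto_ennrealI) simp
  then show ?thesis by (rule LIMSEQ_le_const) (use X in auto)
qed

text \<open>Each subdivision costs the factor \<open>a\<close>, but the multilinear error at scale
  \<open>1 / n\<close> carries the gain \<open>n powr (- e)\<close>. Once
  \<open>a * N powr (- e) \<le> 1 / 2\<close>, the errors form a convergent geometric series. The
  total mass of \<open>\<mu>\<close> occurs only in the last term of the iteration.\<close>

lemma nondegenerate_estimate:
  fixes rk :: "'n::finite \<Rightarrow> nat" and p q K c \<alpha> :: real
  defines "\<beta> \<equiv> \<lambda>m. real (\<Sum>i\<in>UNIV. rk i - m) + real m * \<alpha>"
  assumes rk: "bij_betw rk (UNIV :: 'n set) {1..CARD('n)}" and p: "1 < p" "p \<le> q"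
    and q: "2 * real CARD('n) \<le> q" "real CARD('n) / q \<le> 1 - 1 / p" and c: "0 < c" "0 \<le> K"
    and \<alpha>: "0 \<le> \<alpha>" and \<beta>: "\<beta> m / q + 1 / p < 1"
  obtains C where "0 < C"
    "\<And>(\<mu> :: (real ^ 'n) measure) B G f. \<lbrakk>growth \<alpha> B \<mu>; nondegenerate_curve rk K c G; Lp_on p {0..<1} f\<rbrakk> \<Longrightarrow>
      (\<integral>\<^sup>+x. ennreal (cmod (osc (G 0) {0..<1} f x) powr q) \<partial>\<mu>)
        \<le> ennreal (C * B * (LINT t:{0..<1}|lborel. cmod (f t) powr p) powr (q / p))"
proof -
  let ?d = "CARD('n)"
  have q0: "0 < q" using p by simp
  \<comment> \<open>Its positivity is the hypothesis \<open>\<beta> m / q + 1 / p < 1\<close>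
    multiplied by \<open>q\<close>.\<close>
  define e where "e = q * (1 - 1 / p) - \<beta> m"
  have e: "0 < e" using \<beta> q0 by (simp add: e_def field_simps)
  have \<beta>0: "0 \<le> \<beta> m" unfolding \<beta>_def by (intro add_nonneg_nonneg mult_nonneg_nonneg of_nat_0_le_iff \<alpha>)
  define a where "a = (3 * real ?d) powr q"
  have a: "0 < a" by (simp add: a_def)
  \<comment> \<open>The number of subcells is fixed before the multilinear estimate is invoked,
    because the constant there depends on the separation \<open>1 / N\<close>.\<close>
  obtain N :: nat where N: "0 < N" "a * real N powr (- e) \<le> 1 / 2"
  proof -
    define N where "N = nat \<lceil>(2 * a) powr (1 / e)\<rceil> + 1"
    have N0: "0 < N" by (simp add: N_def)
    have "(2 * a) powr (1 / e) \<le> N" unfolding N_def by linarith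
    then have "((2 * a) powr (1 / e)) powr e \<le> real N powr e" using e by (intro powr_mono2) auto
    then have "2 * a \<le> real N powr e" using e a by (simp add: powr_powr)
    then have "a * real N powr (- e) \<le> 1 / 2" using N0 by (simp add: powr_minus field_simps)
    with N0 show ?thesis by (rule that)
  qed
  have dN: "0 < 1 / real N" using N by simp
  show ?thesis
  proof (rule local_multilinear_estimate[OF rk p(1) q dN c, of \<alpha> m], goal_cases)
    case (1 l0 C0)
    note l0 = 1(1) and C0 = 1(2) and local = 1(3)
    \<comment> \<open>Size of the first partition, whose cells are no longer than the length
      \<open>l0\<close> up to which the multilinear estimate holds.\<close>
    define R where "R = nat \<lceil>1 / l0\<rceil> + 1"
    have R0: "0 < R" by (simp add: R_def)
    have "1 / l0 \<le> R" unfolding R_def by linarith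
    then have Rl0: "1 / real R \<le> l0" using l0 R0 by (simp add: field_simps)
    define C1 where "C1 = N powr (2 * q) * real N ^ ?d * C0"
    have C1: "0 < C1" using N C0 by (simp add: C1_def)
    show ?thesis
    proof (rule that[of "real R powr q * (2 * C1)"])
      show "0 < real R powr q * (2 * C1)" using R0 C1 by simp
      fix \<mu> :: "(real ^ 'n) measure" and B G f
      assume gr: "growth \<alpha> B \<mu>" and nd: "nondegenerate_curve rk K c G" and Lp: "Lp_on p {0..<1} f"
      have mu: "sets \<mu> = sets borel" and fin: "finite_measure \<mu>" and B: "0 \<le> B" using gr by (auto simp: growth_def)
      note [measurable_cong] = mu
      have g[measurable]: "G 0 \<in> borel_measurable borel" using nd by (simp add: nondegenerate_curve_def)
      have fm[measurable]: "f \<in> borel_measurable borel" using Lp by (simp add: Lp_on_def)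
      let ?Q = "(LINT t:{0..<1}|lborel. cmod (f t) powr p) powr (q / p)"
      let ?E = "cell_energy (G 0) q \<mu> f"
      have step: "?E n \<le> ennreal a * ?E (n * N) + ennreal (C1 * B * real n powr (- e) * ?Q)" if n: "0 < n" "1 / real n \<le> l0" for n
      proof -
        have "?E n \<le> ennreal ((3 * ?d) powr q) * ?E (n * N) + ennreal (N powr (2 * q) * real N ^ ?d * (C0 * B * (1 / real n) powr e) * ?Q)"
        proof (rule cell_energy_step[OF N(1) n(1) p _ mu g Lp])
          show "0 \<le> C0 * B * (1 / real n) powr e" using C0 B by simp
          fix l and \<sigma> :: "'n \<Rightarrow> nat"
          assume l: "l < n" and \<sigma>: "\<And>i. \<sigma> i < N" "\<And>i j. i \<noteq> j \<Longrightarrow> \<sigma> i + 2 \<le> \<sigma> j \<or> \<sigma> j + 2 \<le> \<sigma> i"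
          have img: "cell (n * N) (l * N + \<sigma> i) = (\<lambda>s. real l / n + 1 / n * s) ` cell N (\<sigma> i)" for i
            by (rule cell_image[OF n(1) N(1)])
          have sub: "cell (n * N) (l * N + \<sigma> i) \<subseteq> {0..<1}" for i
            using cell_union[OF n(1) N(1), of l] cell_subset[OF l] \<sigma>(1)[of i] by blast
          have al: "real l / n + 1 / n \<le> 1" using l n by (simp add: add_divide_distrib[symmetric])
          have Lpi: "Lp_on p ((\<lambda>s. real l / n + 1 / n * s) ` cell N (\<sigma> i)) f" for i
            unfolding img[symmetric] by (rule Lp_on_subset[OF Lp sub cell_borel])
          show "(\<integral>\<^sup>+x. ennreal (\<Prod>i\<in>UNIV. cmod (osc (G 0) (cell (n * N) (l * N + \<sigma> i)) f x) powr (q / ?d)) \<partial>\<mu>)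
            \<le> ennreal (C0 * B * (1 / real n) powr e * (\<Prod>i\<in>UNIV. (LINT t:cell (n * N) (l * N + \<sigma> i)|lborel. cmod (f t) powr p) powr (q / (?d * p))))"
            unfolding img e_def \<beta>_def
            by (rule local[OF gr nd _ _ n(2) al separated_cells[OF N(1) \<sigma>] Lpi]) (use n in auto)
        qed
        also have "(1 / real n) powr e = real n powr (- e)" by (rule inverse_nat_powr)
        also have "N powr (2 * q) * real N ^ ?d * (C0 * B * real n powr (- e)) * ?Q = C1 * B * real n powr (- e) * ?Q" by (simp add: C1_def)
        also have "real (3 * ?d) powr q = a" by (simp add: a_def)
        finally show ?thesis .
      qed
      have scale: "a ^ k * real (R * N ^ k) powr (- e) \<le> (1 / 2) ^ k" for k
      proof -
        have "real (R * N ^ k) powr (- e) = real R powr (- e) * (real N powr (- e)) ^ k"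
          using R0 N by (simp add: powr_mult powr_realpow[symmetric] powr_powr mult.commute)
        also have "\<dots> \<le> 1 * (real N powr (- e)) ^ k"
          using R0 e powr_mono[of "- e" 0 "real R"] by (intro mult_right_mono) auto
        finally have "real (R * N ^ k) powr (- e) \<le> (real N powr (- e)) ^ k" by (simp only: mult_1)
        then have "a ^ k * real (R * N ^ k) powr (- e) \<le> a ^ k * (real N powr (- e)) ^ k"
          using a by (intro mult_left_mono) auto
        also have "\<dots> = (a * real N powr (- e)) ^ k" by (simp only: power_mult_distrib)
        also have "\<dots> \<le> (1 / 2) ^ k" using a N by (intro power_mono) auto
        finally show ?thesis .
      qed
      \<comment> \<open>\<open>2 - 2 * (1/2)^k\<close> is the sum of \<open>(1/2)^j\<close> over
        \<open>j < k\<close>.\<close>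
      have iter: "?E R \<le> ennreal (a ^ k) * ?E (R * N ^ k) + ennreal (C1 * B * ?Q * (2 - 2 * (1 / 2) ^ k))" for k
      proof (induction k)
        case (Suc k)
        let ?n = "R * N ^ k"
        have n: "0 < ?n" using R0 N by simp
        have "1 / real ?n \<le> 1 / real R" using R0 N by (intro divide_left_mono) auto
        then have n2: "1 / real ?n \<le> l0" using Rl0 by linarith
        note small = scale[of k]
        have "ennreal (a ^ k) * ?E ?n \<le> ennreal (a ^ k) * (ennreal a * ?E (?n * N) + ennreal (C1 * B * real ?n powr (- e) * ?Q))"
          by (intro mult_left_mono step n n2) auto
        also have "\<dots> = ennreal (a ^ Suc k) * ?E (R * N ^ Suc k) + ennreal (C1 * B * ?Q * (a ^ k * real ?n powr (- e)))"
        proof -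
          have 1: "ennreal (a ^ k) * ennreal a = ennreal (a ^ Suc k)"
            using a by (subst ennreal_mult[symmetric]) (auto simp: mult.commute)
          have 2: "ennreal (a ^ k) * ennreal (C1 * B * real ?n powr (- e) * ?Q) = ennreal (a ^ k * (C1 * B * real ?n powr (- e) * ?Q))"
            using a C1 B by (intro ennreal_mult[symmetric]) auto
          have 3: "a ^ k * (C1 * B * real ?n powr (- e) * ?Q) = C1 * B * ?Q * (a ^ k * real ?n powr (- e))" by (simp only: mult_ac)
          have 4: "?n * N = R * N ^ Suc k" by (simp only: power_Suc2 mult.assoc)
          have 5: "ennreal (a ^ k) * (ennreal a * X + Y) = (ennreal (a ^ k) * ennreal a) * X + ennreal (a ^ k) * Y" for X Y
            by (simp only: distrib_left mult.assoc)
          show ?thesis unfolding 5 1 2 3 4 ..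
        qed
        also have "\<dots> \<le> ennreal (a ^ Suc k) * ?E (R * N ^ Suc k) + ennreal (C1 * B * ?Q * (1 / 2) ^ k)"
          using C1 B by (intro add_left_mono ennreal_leI mult_left_mono small) auto
        finally have "?E R \<le> ennreal (a ^ Suc k) * ?E (R * N ^ Suc k) + ennreal (C1 * B * ?Q * (1 / 2) ^ k) + ennreal (C1 * B * ?Q * (2 - 2 * (1 / 2) ^ k))"
          using Suc.IH by (meson add_right_mono order_trans)
        also have "\<dots> = ennreal (a ^ Suc k) * ?E (R * N ^ Suc k) + ennreal (C1 * B * ?Q * (1 / 2) ^ k + C1 * B * ?Q * (2 - 2 * (1 / 2) ^ k))"
          using C1 B by (subst ennreal_plus) (auto simp: add.assoc power_le_one)
        also have "C1 * B * ?Q * (1 / 2) ^ k + C1 * B * ?Q * (2 - 2 * (1 / 2) ^ k) = C1 * B * ?Q * (2 - 2 * (1 / 2) ^ Suc k)"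
          by (simp add: algebra_simps)
        finally show ?case .
      qed simp
      have "?E R \<le> ennreal (2 * C1 * B * ?Q)"
      proof (rule ennreal_le_of_halving)
        let ?M = "2 powr q * measure \<mu> (space \<mu>) * ?Q"
        show "0 \<le> 2 * C1 * B * ?Q" "0 \<le> ?M" using C1 B by auto
        fix k
        let ?n = "R * N ^ k"
        have n: "0 < ?n" using R0 N by simp
        \<comment> \<open>The trivial bound decays at least as fast as the multilinear error, the
          growth exponent being nonnegative; therefore it also compensates
          \<open>a ^ k\<close>.\<close>
        have small: "a ^ k * real ?n powr (- (q * (1 - 1 / p))) \<le> (1 / 2) ^ k"
        proof -
          have "real ?n powr (- (q * (1 - 1 / p))) \<le> real ?n powr (- e)"
          proof (rule powr_mono)
            show "- (q * (1 - 1 / p)) \<le> - e" using \<beta>0 by (simp add: e_def)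
            have "1 \<le> ?n" using n by linarith
            then have "real 1 \<le> real ?n" by (rule of_nat_mono)
            then show "1 \<le> real ?n" by (simp only: of_nat_1)
          qed
          then have "a ^ k * real ?n powr (- (q * (1 - 1 / p))) \<le> a ^ k * real ?n powr (- e)"
            using a by (intro mult_left_mono) auto
          also note scale[of k]
          finally show ?thesis .
        qed
        have "ennreal (a ^ k) * ?E ?n \<le> ennreal (a ^ k) * ennreal (2 powr q * measure \<mu> (space \<mu>) * real ?n powr (- (q * (1 - 1 / p))) * ?Q)"
          by (intro mult_left_mono cell_energy_trivial[OF fin Lp n p]) simp
        also have "\<dots> = ennreal (?M * (a ^ k * real ?n powr (- (q * (1 - 1 / p)))))"
          using a by (subst ennreal_mult[symmetric]) (auto simp: mult_ac)
        also have "\<dots> \<le> ennreal (?M * (1 / 2) ^ k)" by (intro ennreal_leI mult_left_mono small) auto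
        finally have "?E R \<le> ennreal (?M * (1 / 2) ^ k) + ennreal (C1 * B * ?Q * (2 - 2 * (1 / 2) ^ k))"
          using iter[of k] by (meson add_right_mono order_trans)
        also have "\<dots> = ennreal (?M * (1 / 2) ^ k + C1 * B * ?Q * (2 - 2 * (1 / 2) ^ k))"
          using C1 B by (intro ennreal_plus[symmetric]) (auto simp: power_le_one)
        also have "\<dots> \<le> ennreal (2 * C1 * B * ?Q + ?M * (1 / 2) ^ k)"
        proof (rule ennreal_leI)
          have "C1 * B * ?Q * (2 - 2 * (1 / 2) ^ k) \<le> C1 * B * ?Q * 2" using C1 B by (intro mult_left_mono) auto
          then show "?M * (1 / 2) ^ k + C1 * B * ?Q * (2 - 2 * (1 / 2) ^ k) \<le> 2 * C1 * B * ?Q + ?M * (1 / 2) ^ k" by simp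
        qed
        finally show "?E R \<le> ennreal (2 * C1 * B * ?Q + ?M * (1 / 2) ^ k)" .
      qed
      have fi: "set_integrable lborel {0..<1} f" by (rule Lp_on_integrable[OF Lp]) (use p in auto)
      have split: "osc (G 0) {0..<1} f x = (\<Sum>l<R. osc (G 0) (cell R l) f x)" for x
        using set_integral_cell_split[OF _ R0, of 1 0 "\<lambda>t. cis (x \<bullet> G 0 t) * f t"] osc_integrable[OF g _ fi fm]
        by (simp add: osc_def cell_def)
      \<comment> \<open>The cells of the first partition are recombined crudely through the largest
        of the \<open>R\<close> terms; \<open>R\<close> depends only on \<open>l0\<close>.\<close>
      have "(\<integral>\<^sup>+x. ennreal (cmod (osc (G 0) {0..<1} f x) powr q) \<partial>\<mu>) \<le> (\<integral>\<^sup>+x. ennreal (real R powr q) * (\<Sum>l<R. ennreal (cmod (osc (G 0) (cell R l) f x) powr q)) \<partial>\<mu>)"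
      proof (rule nn_integral_mono)
        fix x
        let ?z = "\<lambda>l. cmod (osc (G 0) (cell R l) f x)"
        have "cmod (osc (G 0) {0..<1} f x) powr q \<le> real R powr q * (\<Sum>l<R. ?z l powr q)"
        proof -
          have "Max (?z ` {..<R}) \<in> ?z ` {..<R}" using R0 by (intro Max_in) auto
          then obtain l1 where l1R: "l1 < R" and l1M: "Max (?z ` {..<R}) = ?z l1" by auto
          have l1: "l1 < R" "\<And>l. l < R \<Longrightarrow> ?z l \<le> ?z l1"
            using l1R unfolding l1M[symmetric] by auto
          have "cmod (osc (G 0) {0..<1} f x) \<le> (\<Sum>l<R. ?z l1)"
            unfolding split by (rule sum_norm_le) (use l1 in auto)
          then have "cmod (osc (G 0) {0..<1} f x) powr q \<le> (real R * ?z l1) powr q" using q0 by (intro powr_mono2) auto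
          also have "\<dots> = real R powr q * ?z l1 powr q" by (rule powr_mult)
          also have "\<dots> \<le> real R powr q * (\<Sum>l<R. ?z l powr q)"
            by (intro mult_left_mono member_le_sum) (use l1 in auto)
          finally show ?thesis .
        qed
        then have "ennreal (cmod (osc (G 0) {0..<1} f x) powr q) \<le> ennreal (real R powr q * (\<Sum>l<R. ?z l powr q))" by (rule ennreal_leI)
        then show "ennreal (cmod (osc (G 0) {0..<1} f x) powr q) \<le> ennreal (real R powr q) * (\<Sum>l<R. ennreal (?z l powr q))"
          by (simp add: ennreal_mult sum_nonneg sum_ennreal)
      qed
      also have "\<dots> = ennreal (real R powr q) * ?E R"
        by (simp add: nn_integral_cmult nn_integral_sum cell_energy_def del: sum_ennreal)
      also have "\<dots> \<le> ennreal (real R powr q) * ennreal (2 * C1 * B * ?Q)"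
        by (intro mult_left_mono \<open>?E R \<le> ennreal (2 * C1 * B * ?Q)\<close>) simp
      also have "\<dots> = ennreal (real R powr q * (2 * C1) * B * ?Q)"
        using C1 B by (subst ennreal_mult[symmetric]) (auto simp: mult_ac)
      finally show "(\<integral>\<^sup>+x. ennreal (cmod (osc (G 0) {0..<1} f x) powr q) \<partial>\<mu>) \<le> ennreal (real R powr q * (2 * C1) * B * ?Q)" .
    qed
  qed
qed

section \<open>Arcs of finite type\<close>

text \<open>The \<open>i\<close>-th smallest of distinct positive integers is at least
  \<open>i\<close>; the induction adds the largest element last.\<close>

lemma sum_initial_segment_le:
  fixes f :: "nat \<Rightarrow> nat"
  assumes "finite A" "\<And>x. x \<in> A \<Longrightarrow> 1 \<le> x" "mono f"
  shows "(\<Sum>x\<in>{1..card A}. f x) \<le> (\<Sum>x\<in>A. f x)"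
  using assms(1,2)
proof (induction A rule: finite_linorder_max_induct)
  case (insert b A)
  have "A \<subseteq> {1..<b}" using insert by force
  then have "card A \<le> b - 1" using card_mono[of "{1..<b}" A] by simp
  then have "Suc (card A) \<le> b" using insert.prems[of b] by simp
  then have "f (Suc (card A)) \<le> f b" using \<open>mono f\<close> by (rule monoD[rotated])
  moreover have "b \<notin> A" using insert.hyps by blast
  moreover have "(\<Sum>x\<in>{1..card A}. f x) \<le> (\<Sum>x\<in>A. f x)" using insert by simp
  ultimately show ?case using insert.hyps(1) by simp
qed simp

text \<open>The growth exponent of a finite type arc exceeds that of a nondegenerate one by at most the order of vanishing
  of the torsion.\<close>

lemma growth_exponent_le:
  fixes rk a :: "'n::finite \<Rightarrow> nat"
  assumes rk: "bij_betw rk (UNIV :: 'n set) {1..CARD('n)}" and a: "inj a" "\<And>i. 0 < a i"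
  shows "real (\<Sum>i\<in>UNIV. a i - m) \<le> real (\<Sum>i\<in>UNIV. rk i - m) + (real (\<Sum>i\<in>UNIV. a i) - real (\<Sum>i\<in>UNIV. rk i))"
proof -
  \<comment> \<open>Since \<open>b = (b - m) + min b m\<close>, the claim amounts to saying that the
    ranks \<open>1, ..., d\<close> minimise the sum of \<open>min b m\<close> among distinct
    positive integers.\<close>
  have "(\<Sum>i\<in>UNIV. min (rk i) m) = (\<Sum>x\<in>{1..CARD('n)}. min x m)"
    by (rule sum.reindex_bij_betw[OF rk])
  also have "\<dots> = (\<Sum>x\<in>{1..card (range a)}. min x m)" using card_image[OF a(1)] by simp
  also have "\<dots> \<le> (\<Sum>x\<in>range a. min x m)"
    by (rule sum_initial_segment_le) (use a(2) in \<open>auto simp: Suc_le_eq mono_def\<close>)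
  also have "\<dots> = (\<Sum>i\<in>UNIV. min (a i) m)" using sum.reindex[OF a(1), of "\<lambda>x. min x m"] by (simp add: o_def)
  finally have "(\<Sum>i\<in>UNIV. min (rk i) m) \<le> (\<Sum>i\<in>UNIV. min (a i) m)" .
  moreover have split: "(\<Sum>i\<in>UNIV. b i) = (\<Sum>i\<in>UNIV. b i - m) + (\<Sum>i\<in>UNIV. min (b i) m)" for b :: "'n \<Rightarrow> nat"
    unfolding sum.distrib[symmetric] by (rule sum.cong) auto
  ultimately show ?thesis using split[of a] split[of rk] by linarith
qed

text \<open>The witness is \<open>m = j + 1\<close>. For \<open>m \<le> d\<close>, passing from
  \<open>m\<close> to \<open>m + 1\<close> changes the exponent by
  \<open>\<alpha> - (d - m)\<close>, so this \<open>m\<close> gives the best side length of cubes in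
  the covering of anisotropic boxes: \<open>\<beta>(\<alpha>)\<close> is the smallest exponent that
  this covering yields.\<close>

lemma beta_exp_eq:
  fixes rk :: "'n::finite \<Rightarrow> nat"
  assumes rk: "bij_betw rk (UNIV :: 'n set) {1..CARD('n)}" and \<alpha>: "0 < \<alpha>" "\<alpha> \<le> real CARD('n)"
  obtains m where "beta_exp CARD('n) \<alpha> = real (\<Sum>i\<in>UNIV. rk i - m) + real m * \<alpha>" "0 < beta_exp CARD('n) \<alpha>"
proof -
  let ?d = "CARD('n)"
  \<comment> \<open>The interval containing \<open>\<alpha>\<close> is determined by its
    ceiling.\<close>
  define j where "j = ?d - nat \<lceil>\<alpha>\<rceil>"
  have k: "nat \<lceil>\<alpha>\<rceil> \<le> ?d" "1 \<le> nat \<lceil>\<alpha>\<rceil>" "real (nat \<lceil>\<alpha>\<rceil>) - 1 < \<alpha>" "\<alpha> \<le> real (nat \<lceil>\<alpha>\<rceil>)"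
    using \<alpha> by (auto simp: nat_le_iff ceiling_le_iff) linarith+
  then have j: "j < ?d" "real ?d - real j - 1 < \<alpha>" "\<alpha> \<le> real ?d - real j" "real j = real ?d - real (nat \<lceil>\<alpha>\<rceil>)"
    by (auto simp: j_def of_nat_diff)
  have "(THE j::nat. j < ?d \<and> real ?d - real j - 1 < \<alpha> \<and> \<alpha> \<le> real ?d - real j) = j"
  proof (rule the_equality)
    fix i :: nat assume "i < ?d \<and> real ?d - real i - 1 < \<alpha> \<and> \<alpha> \<le> real ?d - real i"
    then have "real i < real j + 1" "real j < real i + 1" using j by linarith+
    then show "i = j" by linarith
  qed (use j in auto)
  then have b: "beta_exp ?d \<alpha> = (real j + 1) * \<alpha> + (real ?d - real j - 1) * (real ?d - real j) / 2"
    by (simp add: beta_exp_def)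
  \<comment> \<open>Ranks up to \<open>Suc j\<close> contribute 0 by truncated subtraction; the
    others give a triangular number.\<close>
  have "(\<Sum>i\<in>UNIV. rk i - Suc j) = (\<Sum>x\<in>{1..?d}. x - Suc j)" by (rule sum.reindex_bij_betw[OF rk])
  also have "\<dots> = (\<Sum>x\<in>{Suc j..?d}. x - Suc j)" by (rule sum.mono_neutral_right) auto
  also have "\<dots> = (\<Sum>y\<in>{0..?d - Suc j}. y)"
    by (rule sum.reindex_bij_witness[where i="\<lambda>y. y + Suc j" and j="\<lambda>x. x - Suc j"]) (use j in auto)
  finally have "real (\<Sum>i\<in>UNIV. rk i - Suc j) = real (\<Sum>y\<in>{0..?d - Suc j}. y)" by simp
  also have "\<dots> = (real ?d - real j - 1) * (real ?d - real j) / 2"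
    using double_gauss_sum[of "?d - Suc j", where 'a=real] j(1) by (simp add: of_nat_diff field_simps)
  finally have e: "real (\<Sum>i\<in>UNIV. rk i - Suc j) = (real ?d - real j - 1) * (real ?d - real j) / 2" .
  have "0 \<le> real (\<Sum>i\<in>UNIV. rk i - Suc j)" by (rule of_nat_0_le_iff)
  moreover have "0 < (real j + 1) * \<alpha>" using \<alpha> by simp
  ultimately have "0 < beta_exp ?d \<alpha>" unfolding b e by linarith
  then show ?thesis by (intro that[of "Suc j"]) (simp_all add: b e[symmetric] add.commute)
qed

section \<open>Power curves and minimal exponents\<close>

lemma prod_falling_eq:
  "(\<Prod>k<m. real a - real k) = (if m \<le> a then fact a / fact (a - m) else 0)"
proof (induction m)
  case (Suc m)
  show ?case
  proof (cases "Suc m \<le> a")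
    case True
    then have "a - m = Suc (a - Suc m)" by simp
    then have "fact (a - m) = (real a - real m) * fact (a - Suc m)" using True by (simp add: of_nat_diff)
    moreover have "real a - real m \<noteq> 0" using True by auto
    moreover have "(\<Prod>k<m. real a - real k) = fact a / fact (a - m)" using Suc True by simp
    ultimately show ?thesis using True by (simp del: fact_Suc)
  next
    case False
    then show ?thesis using Suc by (cases "m = a") auto
  qed
qed simp

text \<open>This is the Wronskian matrix of the functions \<open>s ^ a i / fact (a i)\<close>. A
  relation between its rows is, up to nonzero factors, a combination \<open>Q\<close> of falling
  factorials of orders 1 to \<open>d\<close> that vanishes at every \<open>a i\<close>. As
  \<open>Q\<close> also vanishes at 0 and has degree at most \<open>d\<close>, it has
  \<open>d + 1\<close> roots and is zero.\<close>

lemma det_power_curve_nonzero: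
  fixes rk a :: "'n::finite \<Rightarrow> nat"
  assumes rk: "bij_betw rk (UNIV :: 'n set) {1..CARD('n)}" and a: "inj a" "\<And>i. 0 < a i" and s: "0 < s"
  shows "det ((\<chi> j i. if rk j \<le> a i then s ^ (a i - rk j) / fact (a i - rk j) else 0) :: real ^ 'n ^ 'n) \<noteq> 0"
proof
  let ?V = "(\<chi> j i. if rk j \<le> a i then s ^ (a i - rk j) / fact (a i - rk j) else 0) :: real ^ 'n ^ 'n"
  have rk1: "1 \<le> rk i" "rk i \<le> CARD('n)" for i using bij_betwE[OF rk] by auto
  assume "det ?V = 0"
  then have "det (transpose ?V) = 0" by (simp add: det_transpose)
  then have "\<not> (\<exists>B. B ** transpose ?V = mat 1)"
    using invertible_det_nz invertible_left_inverse by blast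
  then have "\<not> (\<forall>x. transpose ?V *v x = 0 \<longrightarrow> x = 0)"
    by (simp only: matrix_left_invertible_ker) simp
  then obtain x where x: "transpose ?V *v x = 0" "x \<noteq> 0" by blast
  \<comment> \<open>Falling factorials as polynomials: the value of \<open>F m\<close> at
    \<open>b\<close> is the coefficient that appears when the power of exponent \<open>b\<close> is
    differentiated \<open>m\<close> times.\<close>
  define F where "F = (\<lambda>m. \<Prod>k<m. [:- real k, 1:])"
  have F: "poly (F m) (real b) = (if m \<le> b then fact b / fact (b - m) else 0)" for m b
    unfolding F_def poly_prod using prod_falling_eq[where m=m and a=b] by simp
  have degF: "degree (F m) \<le> m" for m
  proof -
    have "degree (F m) \<le> sum (degree \<circ> (\<lambda>k. [:- real k, 1:])) {..<m}" unfolding F_def by (rule degree_prod_sum_le) simp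
    also have "\<dots> = m" by simp
    finally show ?thesis .
  qed
  define Q where "Q = (\<Sum>j\<in>UNIV. smult (x $ j / s ^ rk j) (F (rk j)))"
  have degQ: "degree Q \<le> CARD('n)" unfolding Q_def
  proof (rule degree_sum_le)
    fix j :: 'n
    have "degree (smult (x $ j / s ^ rk j) (F (rk j))) \<le> degree (F (rk j))" by (rule degree_smult_le)
    also have "\<dots> \<le> rk j" by (rule degF)
    finally show "degree (smult (x $ j / s ^ rk j) (F (rk j))) \<le> CARD('n)" using rk1(2)[of j] by linarith
  qed simp
  have root_a: "poly Q (real (a i)) = 0" for i
  proof -
    have "0 = (transpose ?V *v x) $ i" using x by simp
    also have "\<dots> = (\<Sum>j\<in>UNIV. (if rk j \<le> a i then s ^ (a i - rk j) / fact (a i - rk j) else 0) * x $ j)"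
      unfolding matrix_vector_mult_def transpose_def by simp
    \<comment> \<open>In each entry the factor \<open>s ^ a i / fact (a i)\<close> belongs to the
      column alone; what is left is a falling factorial of \<open>a i\<close> divided by
      \<open>s ^ rk j\<close>.\<close>
    also have "\<dots> = s ^ a i / fact (a i) * poly Q (real (a i))"
      unfolding Q_def poly_sum poly_smult F sum_distrib_left
    proof (rule sum.cong[OF refl])
      fix j
      have "s ^ (a i - rk j) = s ^ a i / s ^ rk j" if "rk j \<le> a i" using that s by (simp add: power_diff)
      then show "(if rk j \<le> a i then s ^ (a i - rk j) / fact (a i - rk j) else 0) * x $ j
        = s ^ a i / fact (a i) * (x $ j / s ^ rk j * (if rk j \<le> a i then fact (a i) / fact (a i - rk j) else 0))"
        by simp
    qed
    finally show ?thesis using s by simp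
  qed
  have root_0: "poly Q (real 0) = 0"
  proof -
    have nz: "(rk j = 0) = False" for j using rk1(1)[of j] by simp
    show ?thesis unfolding Q_def poly_sum poly_smult F by (simp add: nz)
  qed
  have "Q = 0"
  proof (rule ccontr)
    assume "Q \<noteq> 0"
    have "card (insert 0 (range a)) = Suc CARD('n)"
      using a card_image[OF a(1)] by (subst card_insert_disjoint) (auto simp: image_iff)
    moreover have "card (real ` insert 0 (range a)) = card (insert 0 (range a))"
      by (rule card_image) (simp add: inj_on_def)
    moreover have "card (real ` insert 0 (range a)) \<le> card {y. poly Q y = 0}"
      by (rule card_mono[OF poly_roots_finite[OF \<open>Q \<noteq> 0\<close>]]) (use root_a root_0 in auto)
    moreover have "card {y. poly Q y = 0} \<le> degree Q" by (rule card_poly_roots_bound[OF \<open>Q \<noteq> 0\<close>])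
    ultimately show False using degQ by linarith
  qed
  \<comment> \<open>At the smallest rank that occurs in \<open>x\<close>, all falling factorials of
    higher order vanish, so the value of \<open>Q\<close> there isolates one coefficient.\<close>
  obtain j where j: "x $ j \<noteq> 0" "\<And>i. rk i < rk j \<Longrightarrow> x $ i = 0"
  proof -
    obtain j0 where "x $ j0 \<noteq> 0" using x(2) by (auto simp: vec_eq_iff)
    then have "\<exists>k j. rk j = k \<and> x $ j \<noteq> 0" by blast
    then obtain k where k: "\<exists>j. rk j = k \<and> x $ j \<noteq> 0" "\<And>k'. k' < k \<Longrightarrow> \<not> (\<exists>j. rk j = k' \<and> x $ j \<noteq> 0)"
      using exists_least_iff[of "\<lambda>k. \<exists>j. rk j = k \<and> x $ j \<noteq> 0"] by auto
    then show ?thesis using that by blast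
  qed
  have "poly Q (real (rk j)) = (\<Sum>i\<in>UNIV. if i = j then x $ j / s ^ rk j * fact (rk j) else 0)"
    unfolding Q_def poly_sum poly_smult F
  proof (rule sum.cong[OF refl])
    fix i
    have "rk i = rk j \<longleftrightarrow> i = j" using bij_betw_imp_inj_on[OF rk] by (auto simp: inj_on_def)
    then show "x $ i / s ^ rk i * (if rk i \<le> rk j then fact (rk j) / fact (rk j - rk i) else 0)
      = (if i = j then x $ j / s ^ rk j * fact (rk j) else 0)"
      using j(2)[of i] by (cases "rk i < rk j"; cases "rk i = rk j") auto
  qed
  then have "poly Q (real (rk j)) = x $ j / s ^ rk j * fact (rk j)" by simp
  then show False using \<open>Q = 0\<close> j(1) s by simp
qed

text \<open>Exponents of minimal sum: replacing a row by a derivative of lower order must annihilate the determinant,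
  which is the vanishing of a coordinate by Cramer's rule.\<close>

lemma minimal_exponents:
  fixes v :: "nat \<Rightarrow> real ^ 'n::finite" and a0 :: "'n \<Rightarrow> nat"
  assumes "\<And>i. 0 < a0 i" "det ((\<chi> i. v (a0 i)) :: real ^ 'n ^ 'n) \<noteq> 0"
  obtains a :: "'n \<Rightarrow> nat" where "\<And>i. 0 < a i" "inj a" "det ((\<chi> i. v (a i)) :: real ^ 'n ^ 'n) \<noteq> 0"
    "\<And>m i c. \<lbrakk>0 < m; m < a i; v m = (\<Sum>l\<in>UNIV. c l *\<^sub>R v (a l))\<rbrakk> \<Longrightarrow> c i = 0"
proof -
  let ?det = "\<lambda>a :: 'n \<Rightarrow> nat. det ((\<chi> i. v (a i)) :: real ^ 'n ^ 'n)"
  define P where "P = (\<lambda>a :: 'n \<Rightarrow> nat. (\<forall>i. 0 < a i) \<and> ?det a \<noteq> 0)"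
  define a where "a = (ARG_MIN (\<lambda>a. \<Sum>i\<in>UNIV. a i) a. P a)"
  have "P a0" using assms by (simp add: P_def)
  then have a: "P a" and min: "\<And>b. P b \<Longrightarrow> (\<Sum>i\<in>UNIV. a i) \<le> (\<Sum>i\<in>UNIV. b i)"
    unfolding a_def using arg_min_nat_lemma[of P a0 "\<lambda>a. \<Sum>i\<in>UNIV. a i"] by auto
  have dup: "det ((\<chi> j. if j = i then v (a l) else v (a j)) :: real ^ 'n ^ 'n) = 0" if "l \<noteq> i" for l i
    by (rule det_identical_rows[OF that]) (use that in \<open>simp add: row_def vec_eq_iff\<close>)
  show ?thesis
  proof (rule that)
    show "0 < a i" for i using a by (simp add: P_def)
    show "?det a \<noteq> 0" using a by (simp add: P_def)
    show "inj a"
    proof (rule injI, rule ccontr)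
      fix l i assume "a l = a i" "l \<noteq> i"
      then have "(\<chi> j. if j = i then v (a l) else v (a j)) = (\<chi> j. v (a j))" by (auto simp: vec_eq_iff)
      then show False using dup[OF \<open>l \<noteq> i\<close>] a by (simp add: P_def)
    qed
    fix m i c assume m: "0 < m" "m < a i" and eq: "v m = (\<Sum>l\<in>UNIV. c l *\<^sub>R v (a l))"
    interpret L: bounded_linear "\<lambda>w. det ((\<chi> j. if j = i then w else v (a j)) :: real ^ 'n ^ 'n)"
      by (rule bounded_linear_det_row)
    \<comment> \<open>Expansion in row \<open>i\<close>: only \<open>l = i\<close> survives, since
      otherwise two rows coincide.\<close>
    have "?det (a(i := m)) = det ((\<chi> j. if j = i then v m else v (a j)) :: real ^ 'n ^ 'n)"
      by (rule arg_cong[where f=det]) (auto simp: vec_eq_iff)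
    also have "\<dots> = (\<Sum>l\<in>UNIV. c l * det ((\<chi> j. if j = i then v (a l) else v (a j)) :: real ^ 'n ^ 'n))"
      unfolding eq L.sum L.scaleR by simp
    also have "\<dots> = (\<Sum>l\<in>UNIV. if l = i then c i * ?det a else 0)"
    proof (rule sum.cong[OF refl])
      fix l
      have "(\<chi> j. if j = i then v (a i) else v (a j)) = (\<chi> j. v (a j))" by (auto simp: vec_eq_iff)
      then show "c l * det ((\<chi> j. if j = i then v (a l) else v (a j)) :: real ^ 'n ^ 'n) = (if l = i then c i * ?det a else 0)"
        using dup[of l i] by auto
    qed
    finally have "?det (a(i := m)) = c i * ?det a" by simp
    moreover have "\<not> P (a(i := m))"
    proof
      assume "P (a(i := m))"
      then have "(\<Sum>j\<in>UNIV. a j) \<le> (\<Sum>j\<in>UNIV. (a(i := m)) j)" by (rule min)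
      moreover have "(\<Sum>j\<in>UNIV. (a(i := m)) j) < (\<Sum>j\<in>UNIV. a j)"
        by (rule sum_strict_mono_ex1) (use m in auto)
      ultimately show False by simp
    qed
    moreover have "\<forall>j. 0 < (a(i := m)) j" using a m by (simp add: P_def)
    ultimately have "c i * ?det a = 0" unfolding P_def by metis
    then show "c i = 0" using a by (simp add: P_def)
  qed
qed

text \<open>Encodes a smooth curve by all its derivatives on \<open>{0..1}\<close>, together with a
  Borel extension of the curve itself to the line.\<close>

definition smooth_derivs :: "(nat \<Rightarrow> real \<Rightarrow> real ^ 'n::finite) \<Rightarrow> bool" where
  "smooth_derivs D \<longleftrightarrow> D 0 \<in> borel_measurable borel \<and>
    (\<forall>k. \<forall>t\<in>{0..1}. (D k has_vector_derivative D (Suc k) t) (at t within {0..1}))"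

lemma norm_rows_le:
  fixes M :: "real ^ 'm::finite ^ 'k::finite" and b :: real
  assumes "\<And>j i. \<bar>M $ j $ i\<bar> \<le> b"
  shows "norm M \<le> CARD('k) * (CARD('m) * b)"
proof -
  have row: "norm (M $ j) \<le> CARD('m) * b" for j
  proof -
    have "norm (M $ j) \<le> (\<Sum>i\<in>UNIV. \<bar>M $ j $ i\<bar>)" by (rule norm_le_l1_cart)
    also have "\<dots> \<le> (\<Sum>i\<in>(UNIV :: 'm set). b)" by (intro sum_mono assms)
    finally show ?thesis by simp
  qed
  have "norm M \<le> (\<Sum>j\<in>UNIV. norm (M $ j))" by (rule norm_le_sum_rows)
  also have "\<dots> \<le> (\<Sum>j\<in>(UNIV :: 'k set). CARD('m) * b)" by (intro sum_mono row)
  finally show ?thesis by simp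
qed

lemma det_bounded_on_cball:
  obtains W where "0 \<le> W" "\<And>M :: real ^ 'n::finite ^ 'n. norm M \<le> r \<Longrightarrow> \<bar>det M\<bar> \<le> W"
proof -
  have "compact ((\<lambda>M :: real ^ 'n ^ 'n. det M) ` cball 0 r)"
    by (intro compact_continuous_image continuous_intros compact_cball)
  from compact_imp_bounded[OF this]
  obtain W where W: "\<forall>x\<in>(\<lambda>M :: real ^ 'n ^ 'n. det M) ` cball 0 r. norm x \<le> W" unfolding bounded_iff ..
  show ?thesis
  proof (rule that[of "max W 0"])
    fix M :: "real ^ 'n ^ 'n" assume "norm M \<le> r"
    then have "det M \<in> (\<lambda>M :: real ^ 'n ^ 'n. det M) ` cball 0 r" by (intro imageI) simp
    with W have "\<bar>det M\<bar> \<le> W" by (metis real_norm_def)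
    then show "\<bar>det M\<bar> \<le> max W 0" by simp
  qed simp
qed

text \<open>In the basis formed by the derivatives of minimal orders \<open>a i\<close>, the coordinates of the curve behave like
  \<open>(t - t0) ^ a i\<close>, so that the rescaled arcs converge to a nondegenerate power curve.\<close>

lemma finite_type_normal_form:
  fixes rk a0 :: "'n::finite \<Rightarrow> nat" and D :: "nat \<Rightarrow> real \<Rightarrow> real ^ 'n"
  assumes rk: "bij_betw rk (UNIV :: 'n set) {1..CARD('n)}" and sm: "smooth_derivs D" and t0: "t0 \<in> {0..1}"
    and a0: "\<And>i. 0 < a0 i" "det ((\<chi> i. D (a0 i) t0) :: real ^ 'n ^ 'n) \<noteq> 0"
  obtains a :: "'n \<Rightarrow> nat" and M :: "real ^ 'n ^ 'n" and \<kappa> K c \<delta> W :: real where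
    "inj a" "\<And>i. 0 < a i" "0 < \<kappa>" "\<And>x. \<kappa> * norm x \<le> norm (M *v x)" "0 \<le> K" "0 < c" "0 < \<delta>" "\<delta> \<le> 1" "0 \<le> W"
    "\<And>h. \<lbrakk>h \<noteq> 0; \<bar>h\<bar> \<le> \<delta>; t0 + h \<in> {0..1}; t0 + 2 * h \<in> {0..1}\<rbrakk> \<Longrightarrow>
      \<exists>G. nondegenerate_curve rk K c G \<and>
        (\<forall>x u. x \<bullet> D 0 (t0 + h + h * u) = x \<bullet> D 0 t0 + (\<chi> i. h ^ a i * (M *v x) $ i) \<bullet> G 0 u)"
    "\<And>h u. \<lbrakk>h \<noteq> 0; \<bar>h\<bar> \<le> \<delta>; t0 + h \<in> {0..1}; t0 + 2 * h \<in> {0..1}; u \<in> {0..1}\<rbrakk> \<Longrightarrow>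
      \<bar>det ((\<chi> i. D (rk i) (t0 + h + h * u)) :: real ^ 'n ^ 'n)\<bar> \<le> W * \<bar>h\<bar> powr (real (\<Sum>i\<in>UNIV. a i) - real (\<Sum>i\<in>UNIV. rk i))"
proof -
  let ?d = "CARD('n)"
  have rk1: "1 \<le> rk i" "rk i \<le> ?d" for i using bij_betwE[OF rk] by auto
  have D0m[measurable]: "D 0 \<in> borel_measurable borel"
    and Dd: "\<And>k t. t \<in> {0..1} \<Longrightarrow> (D k has_vector_derivative D (Suc k) t) (at t within {0..1})"
    using sm by (auto simp: smooth_derivs_def)
  obtain a :: "'n \<Rightarrow> nat" where a: "\<And>i. 0 < a i" "inj a" "det ((\<chi> i. D (a i) t0) :: real ^ 'n ^ 'n) \<noteq> 0"
    and minimal: "\<forall>m i c. 0 < m \<longrightarrow> m < a i \<longrightarrow> D m t0 = (\<Sum>l\<in>UNIV. c l *\<^sub>R D (a l) t0) \<longrightarrow> c i = 0"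
  proof (rule minimal_exponents[where v="\<lambda>k. D k t0", OF a0], goal_cases)
    case (1 a)
    show ?case by (rule 1(1)[of a, OF 1(2-4)]) (use 1(5) in blast)
  qed
  define M where "M = ((\<chi> i. D (a i) t0) :: real ^ 'n ^ 'n)"
  have detM: "det M \<noteq> 0" using a(3) by (simp add: M_def)
  then have "det (transpose M) \<noteq> 0" by (simp add: det_transpose)
  then obtain R where R: "transpose M ** R = mat 1" "R ** transpose M = mat 1"
    using invertible_det_nz[of "transpose M"] unfolding invertible_def by blast
  have MR: "transpose M *v (R *v v) = v" "R *v (transpose M *v v) = v" for v
    by (simp_all only: matrix_vector_mul_assoc R matrix_vector_mul_lid)
  have MT: "transpose M *v v = (\<Sum>l\<in>UNIV. (v $ l) *\<^sub>R D (a l) t0)" for v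
    unfolding matrix_vector_mult_def transpose_def M_def by (simp add: vec_eq_iff mult.commute)
  have bR: "bounded_linear (\<lambda>v. R *v v)" by (simp add: matrix_vector_mul_bounded_linear)
  obtain \<kappa> where \<kappa>: "0 < \<kappa>" and low: "\<And>x. \<kappa> * norm x \<le> norm (M *v x)"
    using matrix_lower_bound[of "\<bar>det M\<bar>" "norm M", where 'n='n] detM by (metis order_refl zero_less_abs_iff)
  \<comment> \<open>Coordinates of the derivatives in the basis \<open>D (a l) t0\<close>;
    \<open>R\<close> inverts \<open>transpose M\<close>.\<close>
  define y where "y = (\<lambda>k t i. (R *v D k t) $ i)"
  have y_deriv: "((\<lambda>t. y k t i) has_vector_derivative y (Suc k) t i) (at t within {0..1})" if "t \<in> {0..1}" for k t i
    unfolding y_def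
    using bounded_linear.has_vector_derivative[OF bounded_linear_vec_nth bounded_linear.has_vector_derivative[OF bR Dd[OF that]]] .
  \<comment> \<open>By minimality, coordinate \<open>i\<close> has no Taylor term of order strictly
    between 0 and \<open>a i\<close>; the term of order 0 will be removed by subtracting
    \<open>D 0 t0\<close>.\<close>
  have y0: "y k t0 i = 0" if "0 < k" "k < a i" for k i
  proof -
    have "D k t0 = (\<Sum>l\<in>UNIV. y k t0 l *\<^sub>R D (a l) t0)"
      using MR(1)[of "D k t0"] unfolding MT y_def by simp
    then show ?thesis using minimal that by blast
  qed
  have y1: "y (a i) t0 i = 1" for i
  proof -
    have "transpose M *v axis i 1 = D (a i) t0"
      unfolding MT by (simp add: axis_def if_distrib[where f="\<lambda>z. z *\<^sub>R _"] cong: if_cong)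
    then have "R *v D (a i) t0 = axis i 1" using MR(2)[of "axis i 1"] by simp
    then show ?thesis by (simp add: y_def axis_def)
  qed
  \<comment> \<open>At least as large as every order of differentiation needed below, and also an
    exponent dominating the powers of 2 that occur.\<close>
  define A where "A = (\<Sum>i\<in>UNIV. a i) + ?d + 2"
  have aA: "a i + 1 \<le> A" for i
    using member_le_sum[of i UNIV a] by (simp add: A_def)
  obtain Bd where Bd: "0 \<le> Bd" "\<And>k t i. k \<le> A \<Longrightarrow> t \<in> {0..1} \<Longrightarrow> \<bar>y k t i\<bar> \<le> Bd"
  proof -
    have "\<exists>b. \<forall>t\<in>{0..1}. \<bar>y k t i\<bar> \<le> b" for k i
    proof -
      have "continuous_on {0..1} (\<lambda>t. y k t i)"
        using y_deriv by (meson continuous_on_eq_continuous_within has_vector_derivative_continuous)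
      then have "compact ((\<lambda>t. y k t i) ` {0..1})" by (intro compact_continuous_image) auto
      then have "bounded ((\<lambda>t. y k t i) ` {0..1})" by (rule compact_imp_bounded)
      then obtain b where "\<forall>x\<in>(\<lambda>t. y k t i) ` {0..1}. norm x \<le> b" unfolding bounded_iff by blast
      then show ?thesis by (intro exI[of _ b]) auto
    qed
    then obtain b where b: "\<And>k i t. t \<in> {0..1} \<Longrightarrow> \<bar>y k t i\<bar> \<le> b k i" by metis
    have b0: "0 \<le> b k i" for k i using b[of 0 k i] abs_ge_zero order_trans by fastforce
    show ?thesis
    proof (rule that[of "\<Sum>k\<le>A. \<Sum>i\<in>UNIV. b k i"])
      show "0 \<le> (\<Sum>k\<le>A. \<Sum>i\<in>UNIV. b k i)" by (intro sum_nonneg b0)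
      fix k t i assume "k \<le> A" "t \<in> {0..1::real}"
      have "\<bar>y k t i\<bar> \<le> b k i" by (intro b \<open>t \<in> {0..1}\<close>)
      also have "\<dots> \<le> (\<Sum>i\<in>UNIV. b k i)" by (rule member_le_sum) (auto simp: b0)
      also have "\<dots> \<le> (\<Sum>k\<le>A. \<Sum>i\<in>UNIV. b k i)"
        by (rule member_le_sum[where f="\<lambda>k. \<Sum>i\<in>UNIV. b k i"]) (auto simp: b0 sum_nonneg \<open>k \<le> A\<close>)
      finally show "\<bar>y k t i\<bar> \<le> (\<Sum>k\<le>A. \<Sum>i\<in>UNIV. b k i)" .
    qed
  qed
  \<comment> \<open>The derivative of order \<open>k\<close> of
    \<open>(1 + u) ^ a i / fact (a i)\<close>, which is the limit of the rescaled coordinate as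
    \<open>h\<close> tends to 0.\<close>
  define lim where "lim = (\<lambda>k u i. if k \<le> a i then (1 + u) ^ (a i - k) / fact (a i - k) else (0 :: real))"
  define Ce where "Ce = Bd * 2 ^ A"
  have Ce: "0 \<le> Ce" using Bd by (simp add: Ce_def)
  have lim_bound: "\<bar>lim k u i\<bar> \<le> 2 ^ A" if "u \<in> {0..1}" for k u i
  proof (cases "k \<le> a i")
    case True
    have "(1 + u) ^ (a i - k) \<le> 2 ^ (a i - k)" using that by (intro power_mono) auto
    also have "\<dots> \<le> 2 ^ A" using aA[of i] by (intro power_increasing) auto
    finally have 1: "(1 + u) ^ (a i - k) \<le> 2 ^ A" .
    have "(1 + u) ^ (a i - k) / fact (a i - k) \<le> (1 + u) ^ (a i - k) / 1"
      using that fact_ge_1[of "a i - k", where 'a=real] by (intro divide_left_mono) auto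
    then show ?thesis using 1 that True by (simp add: lim_def)
  qed (simp add: lim_def)
  \<comment> \<open>For \<open>k \<le> a i\<close> this is Taylor's formula, in which only the top
    term survives; for \<open>k > a i\<close> the factor \<open>h ^ (k - a i)\<close> is itself
    small.\<close>
  have approx: "\<bar>y k (t0 + h + h * u) i * h ^ k / h ^ a i - lim k u i\<bar> \<le> Ce * \<bar>h\<bar>"
    if k: "1 \<le> k" "k \<le> Suc ?d" and h: "h \<noteq> 0" "\<bar>h\<bar> \<le> 1" and u: "u \<in> {0..1}" and z: "t0 + h + h * u \<in> {0..1}" for k h u i
  proof (cases "k \<le> a i")
    case True
    define n where "n = a i - k"
    have n: "a i = k + n" using True by (simp add: n_def)
    let ?z = "t0 + h + h * u"
    have zt: "?z - t0 = h * (1 + u)" by (simp add: algebra_simps)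
    have "norm (y k ?z i - (\<Sum>l\<le>n. y (k + l) t0 i * (?z - t0) ^ l / fact l)) \<le> Bd * norm (?z - t0) ^ Suc n / fact n"
    proof -
      have "norm ((\<lambda>l t. y (k + l) t i) 0 ?z - (\<Sum>l\<le>n. (\<lambda>l t. y (k + l) t i) l t0 * (?z - t0) ^ l / fact l)) \<le> Bd * norm (?z - t0) ^ Suc n / fact n"
      proof (rule field_Taylor[where S="{0..1}"])
        fix l t assume "t \<in> {0..1::real}"
        then show "((\<lambda>t. y (k + l) t i) has_field_derivative y (k + Suc l) t i) (at t within {0..1})"
          using y_deriv[of t "k + l" i] by (simp add: has_real_derivative_iff_has_vector_derivative)
      next
        fix t assume "t \<in> {0..1::real}"
        then show "norm (y (k + Suc n) t i) \<le> Bd" using Bd(2)[of "k + Suc n" t i] aA[of i] n by simp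
      qed (use t0 z in auto)
      then show ?thesis by simp
    qed
    moreover have "(\<Sum>l\<le>n. y (k + l) t0 i * (?z - t0) ^ l / fact l) = (\<Sum>l\<le>n. if l = n then (?z - t0) ^ n / fact n else 0)"
    proof (rule sum.cong[OF refl])
      fix l assume "l \<in> {..n}"
      then show "y (k + l) t0 i * (?z - t0) ^ l / fact l = (if l = n then (?z - t0) ^ n / fact n else 0)"
        using y0[of "k + l" i] y1[of i] k n by (cases "l = n") auto
    qed
    ultimately have T: "\<bar>y k ?z i - (h * (1 + u)) ^ n / fact n\<bar> \<le> Bd * \<bar>h * (1 + u)\<bar> ^ Suc n / fact n"
      by (simp add: zt)
    also have "\<dots> \<le> Bd * \<bar>h * (1 + u)\<bar> ^ Suc n / 1"
      using Bd(1) fact_ge_1[of n, where 'a=real] by (intro divide_left_mono) auto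
    also have "\<dots> \<le> Bd * (\<bar>h\<bar> ^ Suc n * 2 ^ A)"
    proof -
      have "(1 + u) ^ Suc n \<le> 2 ^ Suc n" using u by (intro power_mono) auto
      also have "\<dots> \<le> 2 ^ A" using aA[of i] n k by (intro power_increasing) auto
      finally have "\<bar>h\<bar> ^ Suc n * (1 + u) ^ Suc n \<le> \<bar>h\<bar> ^ Suc n * 2 ^ A" by (intro mult_left_mono) auto
      moreover have "\<bar>h * (1 + u)\<bar> ^ Suc n = \<bar>h\<bar> ^ Suc n * (1 + u) ^ Suc n"
        using u unfolding abs_mult power_mult_distrib by simp
      ultimately show ?thesis using Bd(1) by (simp del: power_Suc add: mult_left_mono)
    qed
    finally have T2: "\<bar>y k ?z i - (h * (1 + u)) ^ n / fact n\<bar> \<le> Ce * \<bar>h\<bar> * \<bar>h\<bar> ^ n" by (simp add: Ce_def mult_ac)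
    have "y k ?z i * h ^ k / h ^ a i - lim k u i = (y k ?z i - (h * (1 + u)) ^ n / fact n) / h ^ n"
      using h(1) True by (simp add: lim_def n power_add diff_divide_distrib power_mult_distrib)
    then have "\<bar>y k ?z i * h ^ k / h ^ a i - lim k u i\<bar> = \<bar>y k ?z i - (h * (1 + u)) ^ n / fact n\<bar> / \<bar>h\<bar> ^ n"
      by (simp add: abs_divide power_abs)
    also have "\<dots> \<le> (Ce * \<bar>h\<bar> * \<bar>h\<bar> ^ n) / \<bar>h\<bar> ^ n" by (intro divide_right_mono T2) auto
    finally show ?thesis using h(1) by simp
  next
    case False
    define n where "n = k - a i - 1"
    have n: "k = a i + Suc n" using False by (simp add: n_def)
    have "\<bar>y k (t0 + h + h * u) i\<bar> \<le> Bd" using k by (intro Bd(2) z) (simp add: A_def)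
    then have "\<bar>y k (t0 + h + h * u) i\<bar> * \<bar>h\<bar> ^ Suc n \<le> Bd * \<bar>h\<bar> ^ Suc n" by (intro mult_right_mono) auto
    also have "\<dots> \<le> (Bd * 2 ^ A) * \<bar>h\<bar>"
    proof -
      have "\<bar>h\<bar> ^ Suc n \<le> \<bar>h\<bar>" using h(2) by (simp add: mult_left_le power_le_one)
      moreover have "Bd * 1 \<le> Bd * 2 ^ A" using Bd(1) by (intro mult_left_mono) auto
      ultimately show ?thesis using Bd(1) by (intro mult_mono) auto
    qed
    finally show ?thesis using False h(1) by (simp add: lim_def n power_add abs_mult power_abs Ce_def)
  qed
  define V where "V = (\<lambda>u. (\<chi> j i. lim (rk j) u i) :: real ^ 'n ^ 'n)"
  have "continuous_on {0..1} (\<lambda>u. lim k u i)" for k i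
    unfolding lim_def by (cases "k \<le> a i") (auto intro!: continuous_intros)
  then have "continuous_on {0..1} V"
    unfolding V_def by (intro continuous_intros)
  then have cV: "compact (V ` {0..1})" by (intro compact_continuous_image) auto
  have nzV: "det X \<noteq> 0" if X: "X \<in> V ` {0..1}" for X
  proof -
    from X obtain u where u: "u \<in> {0..1}" "X = V u" by auto
    then have "0 < 1 + u" by auto
    from det_power_curve_nonzero[OF rk a(2,1) this] show ?thesis by (simp add: u V_def lim_def)
  qed
  obtain e c where e: "0 < e" and c: "0 < c" and near: "\<And>X M. X \<in> V ` {0..1} \<Longrightarrow> norm (M - X) < e \<Longrightarrow> c \<le> \<bar>det M\<bar>"
    using det_bound_near_compact[OF cV nzV] by metis
  define K where "K = ?d * (2 ^ A + Ce)"
  have K0: "0 \<le> K" using Ce by (simp add: K_def)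
  \<comment> \<open>The matrix error is at most \<open>d * (d * Ce) * \<bar>h\<bar>\<close>; the
    summand 1 makes it strictly less than \<open>e\<close>.\<close>
  define \<delta> where "\<delta> = min 1 (e / (?d * (?d * Ce) + 1))"
  have den: "0 < ?d * (?d * Ce) + 1" using Ce by (simp add: add_nonneg_pos)
  have \<delta>: "0 < \<delta>" "\<delta> \<le> 1" using e den by (auto simp: \<delta>_def)
  obtain W0 where W0: "0 \<le> W0" "\<And>M :: real ^ 'n ^ 'n. norm M \<le> ?d * (?d * (2 ^ A + Ce)) \<Longrightarrow> \<bar>det M\<bar> \<le> W0"
    using det_bounded_on_cball[where 'n='n] by metis
  have pt: "t0 + h + h * u \<in> {0..1}" if "t0 + h \<in> {0..1}" "t0 + 2 * h \<in> {0..1}" "u \<in> {0..1}" for h u :: real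
  proof -
    have "t0 + h + h * u = (1 - u) * (t0 + h) + u * (t0 + 2 * h)" by (simp add: algebra_simps)
    moreover have "0 \<le> (1 - u) * (t0 + h)" "0 \<le> u * (t0 + 2 * h)" using that by auto
    moreover have "(1 - u) * (t0 + h) \<le> (1 - u) * 1" "u * (t0 + 2 * h) \<le> u * 1" using that by (intro mult_left_mono; simp)+
    ultimately show ?thesis by auto
  qed
  define Gm where "Gm = (\<lambda>h u. (\<chi> j i. y (rk j) (t0 + h + h * u) i * h ^ rk j / h ^ a i) :: real ^ 'n ^ 'n)"
  have entry: "\<bar>y k (t0 + h + h * u) i * h ^ k / h ^ a i\<bar> \<le> 2 ^ A + Ce"
    if k: "1 \<le> k" "k \<le> Suc ?d" and h: "h \<noteq> 0" "\<bar>h\<bar> \<le> \<delta>" and u: "u \<in> {0..1}" and z: "t0 + h \<in> {0..1}" "t0 + 2 * h \<in> {0..1}" for k h u i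
  proof -
    have "\<bar>y k (t0 + h + h * u) i * h ^ k / h ^ a i - lim k u i\<bar> \<le> Ce * \<bar>h\<bar>"
      by (rule approx[OF k h(1) _ u pt[OF z u]]) (use h \<delta> in auto)
    moreover have "Ce * \<bar>h\<bar> \<le> Ce * 1" using h \<delta> Ce by (intro mult_left_mono) auto
    ultimately show ?thesis using lim_bound[OF u, of k i] by linarith
  qed
  show ?thesis
  proof (rule that[of a \<kappa> M K c \<delta> "W0 * \<bar>det M\<bar>"])
    show "0 \<le> W0 * \<bar>det M\<bar>" using W0 by simp
  next
    fix h :: real
    assume h: "h \<noteq> 0" "\<bar>h\<bar> \<le> \<delta>" and z: "t0 + h \<in> {0..1}" "t0 + 2 * h \<in> {0..1}"
    \<comment> \<open>The rescaled arc: the parameter runs from \<open>t0 + h\<close> to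
      \<open>t0 + 2 * h\<close>, coordinate \<open>i\<close> is divided by \<open>h ^ a i\<close>,
      and each differentiation brings a factor \<open>h\<close>.\<close>
    define G where "G = (\<lambda>k u. (\<chi> i. (R *v (if k = 0 then D 0 (t0 + h + h * u) - D 0 t0 else D k (t0 + h + h * u))) $ i * (h ^ k / h ^ a i)) :: real ^ 'n)"
    have Gy: "G k u $ i = y k (t0 + h + h * u) i * h ^ k / h ^ a i" if "1 \<le> k" for k u i
      using that by (simp add: G_def y_def)
    have key: "x \<bullet> D 0 (t0 + h + h * u) = x \<bullet> D 0 t0 + (\<chi> i. h ^ a i * (M *v x) $ i) \<bullet> G 0 u" for x u
    proof -
      have "(\<chi> i. h ^ a i * (M *v x) $ i) \<bullet> G 0 u = (M *v x) \<bullet> (R *v (D 0 (t0 + h + h * u) - D 0 t0))"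
        using h by (simp add: inner_vec_def G_def)
      also have "\<dots> = x \<bullet> (transpose M *v (R *v (D 0 (t0 + h + h * u) - D 0 t0)))"
        by (metis dot_lmul_matrix inner_commute transpose_matrix_vector)
      finally show ?thesis unfolding MR by (simp add: inner_diff_right)
    qed
    have "nondegenerate_curve rk K c G"
      unfolding nondegenerate_curve_def
    proof (intro conjI allI impI ballI)
      have RM: "(\<lambda>v. R *v v) \<in> borel_measurable borel"
        by (intro borel_measurable_continuous_onI linear_continuous_on bR)
      have "(\<lambda>u. D 0 (t0 + h + h * u) - D 0 t0) \<in> borel_measurable borel" by measurable
      from measurable_compose[OF measurable_compose[OF this RM] borel_measurable_nth]
      have "(\<lambda>u. (R *v (D 0 (t0 + h + h * u) - D 0 t0)) $ i * (h ^ 0 / h ^ a i)) \<in> borel_measurable borel" for i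
        by (rule borel_measurable_times[OF _ borel_measurable_const])
      then show "G 0 \<in> borel_measurable borel"
        unfolding G_def by (subst borel_measurable_euclidean_space) (auto simp: Basis_vec_def inner_axis)
    next
      fix k and u :: real assume u: "u \<in> {0..1}"
      have "((\<lambda>u. D k (t0 + h + h * u)) has_vector_derivative h *\<^sub>R D (Suc k) (t0 + h + h * u)) (at u within {0..1})"
      proof -
        have "((\<lambda>u. t0 + h + h * u) has_vector_derivative h) (at u within {0..1})"
          by (auto intro!: derivative_eq_intros)
        moreover have "(D k has_vector_derivative D (Suc k) (t0 + h + h * u)) (at (t0 + h + h * u) within (\<lambda>u. t0 + h + h * u) ` {0..1})"
          by (rule has_vector_derivative_within_subset[OF Dd[OF pt[OF z u]]], rule image_subsetI, rule pt[OF z])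
        ultimately show ?thesis
          using vector_diff_chain_within[of "\<lambda>u. t0 + h + h * u" h u "{0..1}" "D k"] by (simp add: o_def)
      qed
      then have "((\<lambda>u. D k (t0 + h + h * u) - (if k = 0 then D 0 t0 else 0)) has_vector_derivative h *\<^sub>R D (Suc k) (t0 + h + h * u) - 0) (at u within {0..1})"
        by (intro has_vector_derivative_diff has_vector_derivative_const)
      from bounded_linear.has_vector_derivative[OF bR this]
      have D: "((\<lambda>u. R *v (D k (t0 + h + h * u) - (if k = 0 then D 0 t0 else 0))) has_vector_derivative h *\<^sub>R (R *v D (Suc k) (t0 + h + h * u))) (at u within {0..1})"
        by (simp add: matrix_vector_mult_scaleR)
      have "bounded_linear (\<lambda>v :: real ^ 'n. \<chi> i. v $ i * (h ^ k / h ^ a i))"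
        by (intro linear_conv_bounded_linear[THEN iffD1] linearI) (auto simp: vec_eq_iff distrib_right add_divide_distrib)
      from bounded_linear.has_vector_derivative[OF this D]
      show "(G k has_vector_derivative G (Suc k) u) (at u within {0..1})"
      proof (rule has_vector_derivative_eq_rhs[THEN has_vector_derivative_transform[rotated 2]])
        show "G k u = (\<chi> i. (R *v (D k (t0 + h + h * u) - (if k = 0 then D 0 t0 else 0))) $ i * (h ^ k / h ^ a i))" for u
          by (simp add: G_def)
      qed (use u in \<open>auto simp: G_def vec_eq_iff\<close>)
    next
      fix k and u :: real assume k: "k \<in> {1..Suc ?d}" and u: "u \<in> {0..1}"
      have "norm (G k u) \<le> (\<Sum>i\<in>UNIV. \<bar>G k u $ i\<bar>)" by (rule norm_le_l1_cart)
      also have "\<dots> \<le> (\<Sum>i\<in>(UNIV :: 'n set). 2 ^ A + Ce)"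
        by (intro sum_mono) (use k entry[OF _ _ h u z] in \<open>auto simp: Gy\<close>)
      finally show "norm (G k u) \<le> K" by (simp add: K_def)
    next
      fix u :: real assume u: "u \<in> {0..1}"
      have eq: "((\<chi> i. G (rk i) u) :: real ^ 'n ^ 'n) = Gm h u"
        using rk1(1) by (simp add: Gm_def vec_eq_iff Gy)
      show "c \<le> \<bar>det ((\<chi> i. G (rk i) u) :: real ^ 'n ^ 'n)\<bar>"
        unfolding eq
      proof (rule near)
        show "V u \<in> V ` {0..1}" using u by simp
        have "\<bar>(Gm h u - V u) $ j $ i\<bar> \<le> Ce * \<bar>h\<bar>" for j i
          using approx[OF rk1(1)[of j] _ h(1) _ u pt[OF z u], of i] rk1(2)[of j] h \<delta> by (simp add: Gm_def V_def)
        from norm_rows_le[OF this] have "norm (Gm h u - V u) \<le> ?d * (?d * Ce) * \<bar>h\<bar>" by (simp add: mult_ac)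
        also have "\<dots> < (?d * (?d * Ce) + 1) * \<bar>h\<bar>" using h by (simp add: distrib_right)
        also have "\<dots> \<le> (?d * (?d * Ce) + 1) * (e / (?d * (?d * Ce) + 1))"
          using h den by (intro mult_left_mono) (auto simp: \<delta>_def)
        also have "\<dots> = e" using den by simp
        finally show "norm (Gm h u - V u) < e" .
      qed
    qed
    with key show "\<exists>G. nondegenerate_curve rk K c G \<and>
        (\<forall>x u. x \<bullet> D 0 (t0 + h + h * u) = x \<bullet> D 0 t0 + (\<chi> i. h ^ a i * (M *v x) $ i) \<bullet> G 0 u)" by blast
  next
    fix h u :: real
    assume h: "h \<noteq> 0" "\<bar>h\<bar> \<le> \<delta>" and z: "t0 + h \<in> {0..1}" "t0 + 2 * h \<in> {0..1}" and u: "u \<in> {0..1}"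
    let ?t = "t0 + h + h * u"
    define Y where "Y = (\<chi> j. R *v D (rk j) ?t :: real ^ 'n ^ 'n)"
    have "\<bar>Gm h u $ j $ i\<bar> \<le> 2 ^ A + Ce" for j i
      using entry[OF rk1(1)[of j] _ h u z, of i] rk1(2)[of j] by (simp add: Gm_def)
    from W0(2)[OF norm_rows_le[OF this]] have dG: "\<bar>det (Gm h u)\<bar> \<le> W0" .
    \<comment> \<open>The basis change \<open>M\<close> and the powers of \<open>h\<close> in rows
      and columns are split off; the remaining determinant is that of the bounded matrix
      \<open>Gm h u\<close>.\<close>
    have "((\<chi> j. D (rk j) ?t) :: real ^ 'n ^ 'n) = Y ** M"
    proof -
      have "D (rk j) ?t = transpose M *v (Y $ j)" for j by (simp only: Y_def vec_lambda_beta MR)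
      then have "D (rk j) ?t $ i = (Y ** M) $ j $ i" for j i
        by (simp only: matrix_vector_mult_def matrix_matrix_mult_def transpose_def vec_lambda_beta mult.commute)
      then show ?thesis by (simp add: vec_eq_iff)
    qed
    then have 1: "det ((\<chi> j. D (rk j) ?t) :: real ^ 'n ^ 'n) = det Y * det M" by (simp add: det_mul)
    define Y' where "Y' = ((\<chi> j i. h ^ a i * Gm h u $ j $ i) :: real ^ 'n ^ 'n)"
    have "Y = (\<chi> j. (1 / h ^ rk j) *s Y' $ j)"
      using h by (simp add: Y_def Y'_def Gm_def vec_eq_iff y_def)
    then have 2: "det Y = (\<Prod>j\<in>UNIV. 1 / h ^ rk j) * det Y'"
      using det_rows_mul[of "\<lambda>j. 1 / h ^ rk j" "\<lambda>j. Y' $ j"] by (simp add: vec_nth_inverse)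
    have "transpose Y' = (\<chi> i. h ^ a i *s transpose (Gm h u) $ i)"
      by (simp add: transpose_def Y'_def vec_eq_iff)
    then have "det (transpose Y') = (\<Prod>i\<in>UNIV. h ^ a i) * det (\<chi> i. transpose (Gm h u) $ i)"
      using det_rows_mul[of "\<lambda>i. h ^ a i" "\<lambda>i. transpose (Gm h u) $ i"] by simp
    then have 3: "det Y' = (\<Prod>i\<in>UNIV. h ^ a i) * det (Gm h u)"
      by (simp add: det_transpose)
    have "\<bar>det ((\<chi> j. D (rk j) ?t) :: real ^ 'n ^ 'n)\<bar> = (\<Prod>j\<in>UNIV. 1 / \<bar>h\<bar> ^ rk j) * (\<Prod>i\<in>UNIV. \<bar>h\<bar> ^ a i) * \<bar>det (Gm h u)\<bar> * \<bar>det M\<bar>"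
      unfolding 1 2 3 by (simp add: abs_mult abs_prod power_abs abs_divide)
    also have "(\<Prod>j\<in>UNIV. 1 / \<bar>h\<bar> ^ rk j) * (\<Prod>i\<in>UNIV. \<bar>h\<bar> ^ a i) = \<bar>h\<bar> powr (real (\<Sum>i\<in>UNIV. a i) - real (\<Sum>i\<in>UNIV. rk i))"
      using h by (simp add: prod_dividef power_sum[symmetric] powr_diff powr_realpow del: of_nat_sum)
    also have "\<bar>h\<bar> powr (real (\<Sum>i\<in>UNIV. a i) - real (\<Sum>i\<in>UNIV. rk i)) * \<bar>det (Gm h u)\<bar> * \<bar>det M\<bar>
      \<le> \<bar>h\<bar> powr (real (\<Sum>i\<in>UNIV. a i) - real (\<Sum>i\<in>UNIV. rk i)) * W0 * \<bar>det M\<bar>"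
      by (intro mult_right_mono mult_left_mono dG) auto
    finally show "\<bar>det ((\<chi> i. D (rk i) ?t) :: real ^ 'n ^ 'n)\<bar> \<le> W0 * \<bar>det M\<bar> * \<bar>h\<bar> powr (real (\<Sum>i\<in>UNIV. a i) - real (\<Sum>i\<in>UNIV. rk i))"
      by (simp add: mult_ac)
  qed (use a \<kappa> low K0 c \<delta> in auto)
qed

section \<open>Summation over arcs\<close>

text \<open>If the weighted series has the sum \<open>m\<close>, each term satisfies
  \<open>cmod (a k) \<le> m powr (1 / q) * r ^ k\<close>, and a geometric series remains.\<close>

lemma suminf_powr_le:
  fixes a :: "nat \<Rightarrow> complex" and r q :: real
  assumes r: "0 < r" "r < 1" and q: "0 < q" and s: "a sums s"
  shows "ennreal (cmod s powr q) \<le> ennreal ((1 - r) powr - q) * (\<Sum>k. ennreal ((cmod (a k) / r ^ k) powr q))"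
proof (cases "\<Sum>k. ennreal ((cmod (a k) / r ^ k) powr q)")
  case top
  then show ?thesis using r by (simp add: ennreal_mult_top)
next
  case (real m)
  have term_le: "cmod (a k) \<le> m powr (1 / q) * r ^ k" for k
  proof -
    have "ennreal ((cmod (a k) / r ^ k) powr q) \<le> ennreal m"
      using sum_le_suminf[OF summableI, of "{k}" "\<lambda>k. ennreal ((cmod (a k) / r ^ k) powr q)"] real by simp
    then have "(cmod (a k) / r ^ k) powr q \<le> m" using real by (simp add: ennreal_le_iff)
    then have "((cmod (a k) / r ^ k) powr q) powr (1 / q) \<le> m powr (1 / q)" using q by (intro powr_mono2) auto
    then have "cmod (a k) / r ^ k \<le> m powr (1 / q)" using q r by (simp add: powr_powr)
    then show ?thesis using r by (simp add: divide_le_eq)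
  qed
  have sm: "summable (\<lambda>k. m powr (1 / q) * r ^ k)" using r by (intro summable_mult summable_geometric) auto
  have "cmod s \<le> (\<Sum>k. m powr (1 / q) * r ^ k)"
    using norm_suminf_le[OF term_le sm] sums_unique[OF s] by simp
  also have "\<dots> = m powr (1 / q) / (1 - r)"
    using r by (subst suminf_mult) (auto simp: suminf_geometric summable_geometric)
  finally have "cmod s powr q \<le> (m powr (1 / q) / (1 - r)) powr q" using q by (intro powr_mono2) auto
  also have "\<dots> = (m powr (1 / q)) powr q / (1 - r) powr q" using r by (subst powr_divide) auto
  also have "(m powr (1 / q)) powr q = m" using q real(1) by (simp add: powr_powr)
  also have "m / (1 - r) powr q = (1 - r) powr - q * m" by (simp add: powr_minus_divide)
  finally have "ennreal (cmod s powr q) \<le> ennreal ((1 - r) powr - q * m)" by (rule ennreal_leI)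
  then show ?thesis using real by (simp add: ennreal_mult)
qed

text \<open>Stability under countable unions with geometrically decaying constants replaces the triangle inequality in \<open>L\<^sup>q\<close>.\<close>

definition arc_bound :: "(real \<Rightarrow> real ^ 'n::finite) \<Rightarrow> (real \<Rightarrow> real) \<Rightarrow> real \<Rightarrow> real \<Rightarrow> real \<Rightarrow> real \<Rightarrow> real set \<Rightarrow> bool" where
  "arc_bound g w \<alpha> p q C S \<longleftrightarrow> 0 \<le> C \<and> (\<forall>(\<mu> :: (real ^ 'n) measure) B f. growth \<alpha> B \<mu> \<longrightarrow> f \<in> borel_measurable borel \<longrightarrow>
    set_integrable lborel {0..1} (\<lambda>t. cmod (f t) powr p * w t) \<longrightarrow>
    (\<integral>\<^sup>+x. ennreal (cmod (osc g S (\<lambda>t. f t * of_real (w t)) x) powr q) \<partial>\<mu>)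
      \<le> ennreal (C * B * (LINT t:S|lborel. cmod (f t) powr p * w t) powr (q / p)))"

context
  fixes g :: "real \<Rightarrow> real ^ 'n::finite" and w :: "real \<Rightarrow> real" and \<alpha> p q b :: real
  assumes g[measurable]: "g \<in> borel_measurable borel" and w[measurable]: "w \<in> borel_measurable borel"
    and w0: "\<And>t. 0 \<le> w t" and wb: "\<And>t. t \<in> {0..1} \<Longrightarrow> w t \<le> b" and p: "1 \<le> p" and q: "0 < q"
begin

text \<open>A bounded weight turns the weighted \<open>L^p\<close> condition into integrability,
  through \<open>cmod z \<le> 1 + cmod z powr p\<close>.\<close>

lemma weighted_integrable:
  fixes f :: "real \<Rightarrow> complex"
  assumes f[measurable]: "f \<in> borel_measurable borel" and fi: "set_integrable lborel {0..1} (\<lambda>t. cmod (f t) powr p * w t)"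
    and S: "S \<in> sets borel" "S \<subseteq> {0..1}"
  shows "set_integrable lborel S (\<lambda>t. f t * of_real (w t))"
proof -
  have "set_integrable lborel {0..1} (\<lambda>t. f t * of_real (w t))"
  proof (rule set_integrable_bound)
    have "set_integrable lborel {0..1::real} (\<lambda>t. b)"
      unfolding set_integrable_def by (intro integrable_scaleR_left integrable_real_indicator) auto
    then show "set_integrable lborel {0..1} (\<lambda>t. b + cmod (f t) powr p * w t)"
      by (intro set_integral_add fi)
    show "set_borel_measurable lborel {0..1} (\<lambda>t. f t * of_real (w t))"
      unfolding set_borel_measurable_def by measurable
    show "AE t in lborel. t \<in> {0..1} \<longrightarrow> norm (f t * of_real (w t)) \<le> norm (b + cmod (f t) powr p * w t)"
    proof (intro AE_I2 impI)
      fix t :: real assume t: "t \<in> {0..1}"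
      have b0: "0 \<le> b" using w0[of t] wb[OF t] by linarith
      have "cmod (f t) \<le> 1 + cmod (f t) powr p"
      proof (cases "cmod (f t) \<le> 1")
        case False
        then have "cmod (f t) powr 1 \<le> cmod (f t) powr p" using p by (intro powr_mono) auto
        then show ?thesis using False by simp
      qed (use powr_ge_zero[of "cmod (f t)" p] in linarith)
      then have "cmod (f t) * w t \<le> (1 + cmod (f t) powr p) * w t" by (intro mult_right_mono w0)
      also have "\<dots> \<le> b + cmod (f t) powr p * w t" using wb[OF t] by (simp add: distrib_right)
      finally show "norm (f t * of_real (w t)) \<le> norm (b + cmod (f t) powr p * w t)"
        using w0[of t] b0 by (simp add: norm_mult)
    qed
  qed
  then show ?thesis by (rule set_integrable_subset) (use S in auto)
qed

text \<open>The bound on \<open>S\<close> is tested with \<open>f\<close> times the indicator of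
  \<open>A\<close>.\<close>

lemma arc_bound_subset:
  assumes S: "arc_bound g w \<alpha> p q C S" "S \<in> sets borel" and A: "A \<in> sets borel" "A \<subseteq> S"
  shows "arc_bound g w \<alpha> p q C A"
  unfolding arc_bound_def
proof (intro conjI allI impI)
  show "0 \<le> C" using S by (simp add: arc_bound_def)
  note [measurable] = A(1)
  fix \<mu> :: "(real ^ 'n) measure" and B f
  assume gr: "growth \<alpha> B \<mu>" and f[measurable]: "f \<in> borel_measurable borel"
    and fi: "set_integrable lborel {0..1} (\<lambda>t. cmod (f t) powr p * w t)"
  define f' where "f' = (\<lambda>t. f t * indicator A t)"
  have e: "cmod (f' t) powr p * w t = indicat_real A t * (cmod (f t) powr p * w t)" for t
    by (auto simp: f'_def indicator_def)
  have "set_integrable lborel {0..1} (\<lambda>t. cmod (f' t) powr p * w t)"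
    using integrable_mult_indicator[OF _ fi[unfolded set_integrable_def], of A]
    unfolding set_integrable_def e by (simp add: mult_ac)
  moreover have "f' \<in> borel_measurable borel" unfolding f'_def by measurable
  ultimately have "(\<integral>\<^sup>+x. ennreal (cmod (osc g S (\<lambda>t. f' t * of_real (w t)) x) powr q) \<partial>\<mu>)
      \<le> ennreal (C * B * (LINT t:S|lborel. cmod (f' t) powr p * w t) powr (q / p))"
    using S(1) gr unfolding arc_bound_def by blast
  also have "(\<lambda>x. osc g S (\<lambda>t. f' t * of_real (w t)) x) = (\<lambda>x. osc g A (\<lambda>t. f t * of_real (w t)) x)"
    unfolding osc_def set_lebesgue_integral_def
    by (intro ext Bochner_Integration.integral_cong refl) (use A(2) in \<open>auto simp: f'_def indicator_def\<close>)
  also have "(LINT t:S|lborel. cmod (f' t) powr p * w t) = (LINT t:A|lborel. cmod (f t) powr p * w t)"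
    unfolding set_lebesgue_integral_def e
    by (intro Bochner_Integration.integral_cong refl) (use A(2) in \<open>auto simp: indicator_def\<close>)
  finally show "(\<integral>\<^sup>+x. ennreal (cmod (osc g A (\<lambda>t. f t * of_real (w t)) x) powr q) \<partial>\<mu>)
      \<le> ennreal (C * B * (LINT t:A|lborel. cmod (f t) powr p * w t) powr (q / p))" .
qed

lemma arc_bound_UN:
  fixes Q :: "nat \<Rightarrow> real set"
  assumes Q: "\<And>k. arc_bound g w \<alpha> p q (C * s ^ k) (Q k)" "\<And>k. Q k \<in> sets borel" "\<And>k. Q k \<subseteq> {0..1}"
    and disj: "\<And>j k. j \<noteq> k \<Longrightarrow> Q j \<inter> Q k = {}" and s: "0 < s" "s < 1"
  shows "\<exists>C'. arc_bound g w \<alpha> p q C' (\<Union>k. Q k)"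
proof -
  \<comment> \<open>Half of the decay is spent on summing the pieces:
    \<open>r powr q = sqrt s\<close>, so the weights divide by \<open>sqrt s ^ k\<close>, and of
    \<open>s ^ k\<close> a convergent series in \<open>sqrt s ^ k\<close> is left.\<close>
  define r where "r = s powr (1 / (2 * q))"
  have r: "0 < r" "r < 1"
    using s q powr_less_mono2[of "1 / (2 * q)" s 1] by (auto simp: r_def)
  have rk: "(x / r ^ k) powr q = x powr q / sqrt s ^ k" if "0 \<le> x" for x k
  proof -
    have "(r ^ k) powr q = (r powr q) ^ k" using r by (simp add: powr_power powr_powr mult.commute flip: powr_realpow)
    also have "r powr q = sqrt s" using s q by (simp add: r_def powr_powr powr_half_sqrt)
    finally show ?thesis using that r by (simp add: powr_divide)
  qed
  have C0: "0 \<le> C" using Q(1)[of 0] by (simp add: arc_bound_def)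
  define C' where "C' = (1 - r) powr - q * (C / (1 - sqrt s))"
  have s1: "0 < sqrt s" "sqrt s < 1" using s by auto
  have C'0: "0 \<le> C'" using C0 s1 by (simp add: C'_def)
  let ?U = "\<Union>k. Q k"
  note Q(2)[measurable]
  have U[measurable]: "?U \<in> sets borel" and US: "?U \<subseteq> {0..1}" using Q(2,3) by auto
  have "arc_bound g w \<alpha> p q C' ?U"
    unfolding arc_bound_def
  proof (intro conjI allI impI)
    fix \<mu> :: "(real ^ 'n) measure" and B f
    assume gr: "growth \<alpha> B \<mu>" and f[measurable]: "f \<in> borel_measurable borel"
      and fi: "set_integrable lborel {0..1} (\<lambda>t. cmod (f t) powr p * w t)"
    have B0: "0 \<le> B" and smu[measurable_cong]: "sets \<mu> = sets borel" using gr by (auto simp: growth_def)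
    define F where "F = (\<lambda>t. f t * complex_of_real (w t))"
    have F[measurable]: "F \<in> borel_measurable borel" unfolding F_def by measurable
    have om[measurable]: "(\<lambda>x. osc g (Q k) F x) \<in> borel_measurable borel" for k
      by (rule borel_measurable_osc[OF g F Q(2)])
    define X where "X = (LINT t:?U|lborel. cmod (f t) powr p * w t)"
    define R where "R = B * X powr (q / p)"
    have R0: "0 \<le> R" using B0 by (simp add: R_def)
    have XQ: "0 \<le> (LINT t:Q k|lborel. cmod (f t) powr p * w t) \<and> (LINT t:Q k|lborel. cmod (f t) powr p * w t) \<le> X" for k
      unfolding X_def
    proof
      show "0 \<le> (LINT t:Q k|lborel. cmod (f t) powr p * w t)"
        unfolding set_lebesgue_integral_def by (intro Bochner_Integration.integral_nonneg) (simp add: w0)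
      show "(LINT t:Q k|lborel. cmod (f t) powr p * w t) \<le> (LINT t:?U|lborel. cmod (f t) powr p * w t)"
        by (rule set_integral_subset_mono[OF _ set_integrable_subset[OF fi]]) (use Q(2) U US w0 in auto)
    qed
    have piece: "(\<integral>\<^sup>+x. ennreal (cmod (osc g (Q k) F x) powr q) \<partial>\<mu>) \<le> ennreal (C * R * s ^ k)" for k
    proof -
      have "(\<integral>\<^sup>+x. ennreal (cmod (osc g (Q k) F x) powr q) \<partial>\<mu>)
        \<le> ennreal (C * s ^ k * B * (LINT t:Q k|lborel. cmod (f t) powr p * w t) powr (q / p))"
        using Q(1)[of k] gr f fi unfolding arc_bound_def F_def by blast
      also have "\<dots> \<le> ennreal (C * s ^ k * B * X powr (q / p))"
        using XQ[of k] C0 s B0 q p by (intro ennreal_leI mult_left_mono powr_mono2) auto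
      finally show ?thesis by (simp add: R_def mult_ac)
    qed
    \<comment> \<open>Dominated convergence, since the weighted function is integrable on the
      union.\<close>
    have sums: "(\<lambda>k. osc g (Q k) F x) sums osc g ?U F x" for x
    proof -
      have i: "set_integrable lborel ?U (\<lambda>t. cis (x \<bullet> g t) * F t)"
        by (rule osc_integrable[OF g U _ F]) (use weighted_integrable[OF f fi U US] in \<open>simp add: F_def\<close>)
      have cov: "(\<lambda>n. indicat_real (\<Union>k<n. Q k) t *\<^sub>R (cis (x \<bullet> g t) * F t)) \<longlonglongrightarrow> indicat_real ?U t *\<^sub>R (cis (x \<bullet> g t) * F t)" for t
        by (intro tendsto_scaleR tendsto_const LIMSEQ_indicator_UN)
      have lim: "(\<lambda>n. LINT t|lborel. indicat_real (\<Union>k<n. Q k) t *\<^sub>R (cis (x \<bullet> g t) * F t)) \<longlonglongrightarrow> (LINT t|lborel. indicat_real ?U t *\<^sub>R (cis (x \<bullet> g t) * F t))"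
      proof (rule integral_dominated_convergence[where w="\<lambda>t. norm (indicat_real ?U t *\<^sub>R (cis (x \<bullet> g t) * F t))"])
        show "integrable lborel (\<lambda>t. norm (indicat_real ?U t *\<^sub>R (cis (x \<bullet> g t) * F t)))"
          using i unfolding set_integrable_def by (rule integrable_norm)
        show "AE t in lborel. norm (indicat_real (\<Union>k<n. Q k) t *\<^sub>R (cis (x \<bullet> g t) * F t)) \<le> norm (indicat_real ?U t *\<^sub>R (cis (x \<bullet> g t) * F t))" for n
          by (intro AE_I2) (auto simp: indicator_def)
      qed (use cov Q(2) in \<open>auto intro!: borel_measurable_scaleR borel_measurable_indicator sets.finite_UN\<close>)
      have "(LINT t|lborel. indicat_real (\<Union>k<n. Q k) t *\<^sub>R (cis (x \<bullet> g t) * F t)) = (\<Sum>k<n. osc g (Q k) F x)" for n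
        unfolding osc_def
        by (subst set_lebesgue_integral_def[symmetric], rule set_integral_finite_Union)
           (use Q(2) disj in \<open>auto simp: disjoint_family_on_def intro!: set_integrable_subset[OF i]\<close>)
      with lim show ?thesis by (simp add: sums_def osc_def set_lebesgue_integral_def)
    qed
    have "(\<integral>\<^sup>+x. ennreal (cmod (osc g ?U F x) powr q) \<partial>\<mu>)
      \<le> (\<integral>\<^sup>+x. ennreal ((1 - r) powr - q) * (\<Sum>k. ennreal ((cmod (osc g (Q k) F x) / r ^ k) powr q)) \<partial>\<mu>)"
      by (intro nn_integral_mono suminf_powr_le r q sums)
    also have "\<dots> = ennreal ((1 - r) powr - q) * (\<Sum>k. \<integral>\<^sup>+x. ennreal ((cmod (osc g (Q k) F x) / r ^ k) powr q) \<partial>\<mu>)"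
      by (subst nn_integral_cmult, measurable) (subst nn_integral_suminf, measurable)
    also have "\<dots> \<le> ennreal ((1 - r) powr - q) * (\<Sum>k. ennreal (C * R * sqrt s ^ k))"
    proof (intro mult_left_mono suminf_le summableI)
      fix k
      have "(\<integral>\<^sup>+x. ennreal ((cmod (osc g (Q k) F x) / r ^ k) powr q) \<partial>\<mu>)
        = (\<integral>\<^sup>+x. ennreal (1 / sqrt s ^ k) * ennreal (cmod (osc g (Q k) F x) powr q) \<partial>\<mu>)"
        using s1 by (intro nn_integral_cong) (simp add: rk flip: ennreal_mult)
      also have "\<dots> = ennreal (1 / sqrt s ^ k) * (\<integral>\<^sup>+x. ennreal (cmod (osc g (Q k) F x) powr q) \<partial>\<mu>)"
        by (intro nn_integral_cmult) measurable
      also have "\<dots> \<le> ennreal (1 / sqrt s ^ k) * ennreal (C * R * s ^ k)" by (intro mult_left_mono piece) auto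
      also have "\<dots> = ennreal (C * R * sqrt s ^ k)"
      proof -
        have "1 / sqrt s ^ k * (C * R * s ^ k) = C * R * ((sqrt s * sqrt s) ^ k / sqrt s ^ k)" using s by simp
        also have "\<dots> = C * R * sqrt s ^ k" using s1 by (simp only: power_mult_distrib) simp
        finally show ?thesis using s1 C0 R0 s by (simp flip: ennreal_mult)
      qed
      finally show "(\<integral>\<^sup>+x. ennreal ((cmod (osc g (Q k) F x) / r ^ k) powr q) \<partial>\<mu>) \<le> ennreal (C * R * sqrt s ^ k)" .
    qed auto
    also have "(\<Sum>k. ennreal (C * R * sqrt s ^ k)) = ennreal (C * R * (1 / (1 - sqrt s)))"
    proof (rule suminf_ennreal_eq)
      show "(\<lambda>k. C * R * sqrt s ^ k) sums (C * R * (1 / (1 - sqrt s)))"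
        using s1 by (intro sums_mult geometric_sums) auto
    qed (use C0 R0 s1 in auto)
    also have "ennreal ((1 - r) powr - q) * ennreal (C * R * (1 / (1 - sqrt s))) = ennreal (C' * B * X powr (q / p))"
    proof -
      have "(1 - r) powr - q * (C * R * (1 / (1 - sqrt s))) = C' * B * X powr (q / p)"
        by (simp add: C'_def R_def)
      moreover have "0 \<le> C * R * (1 / (1 - sqrt s))" using s1 C0 R0 by simp
      ultimately show ?thesis by (metis ennreal_mult powr_ge_zero)
    qed
    finally show "(\<integral>\<^sup>+x. ennreal (cmod (osc g ?U (\<lambda>t. f t * of_real (w t)) x) powr q) \<partial>\<mu>)
      \<le> ennreal (C' * B * (LINT t:?U|lborel. cmod (f t) powr p * w t) powr (q / p))"
      unfolding F_def X_def .
  qed (rule C'0)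
  then show ?thesis ..
qed

lemma arc_bound_null:
  assumes S: "S \<in> sets borel" "emeasure lborel S = 0"
  shows "arc_bound g w \<alpha> p q 0 S"
proof -
  have "osc g S F x = 0" for F x
  proof -
    have "AE t in lborel. t \<notin> S" using S by (simp add: AE_iff_measurable[OF _ refl] AE_not_in null_sets_def)
    then have "AE t in lborel. indicat_real S t *\<^sub>R (cis (x \<bullet> g t) * F t) = 0" by eventually_elim auto
    then show ?thesis unfolding osc_def set_lebesgue_integral_def by (rule integral_eq_zero_AE)
  qed
  then show ?thesis using q by (simp add: arc_bound_def)
qed

lemma arc_bound_Un:
  assumes S: "arc_bound g w \<alpha> p q C S" "S \<in> sets borel" "S \<subseteq> {0..1}"
    and T: "arc_bound g w \<alpha> p q C' T" "T \<in> sets borel" "T \<subseteq> {0..1}"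
  shows "\<exists>C. arc_bound g w \<alpha> p q C (S \<union> T)"
proof -
  define Q where "Q = (\<lambda>k :: nat. if k = 0 then S else if k = 1 then T - S else {})"
  have [measurable]: "Q k \<in> sets borel" for k using S T by (simp add: Q_def)
  have T': "arc_bound g w \<alpha> p q C' (T - S)" by (rule arc_bound_subset[OF T(1,2)]) (use S T in auto)
  have CC: "0 \<le> C" "0 \<le> C'" using S(1) T(1) by (auto simp: arc_bound_def)
  have mono: "arc_bound g w \<alpha> p q c' A" if "arc_bound g w \<alpha> p q c A" "c \<le> c'" for c c' A
    unfolding arc_bound_def
  proof (intro conjI allI impI)
    show "0 \<le> c'" using that by (simp add: arc_bound_def)
    fix \<mu> :: "(real ^ 'n) measure" and B f
    assume gr: "growth \<alpha> B \<mu>" and f: "f \<in> borel_measurable borel" "set_integrable lborel {0..1} (\<lambda>t. cmod (f t) powr p * w t)"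
    let ?X = "(LINT t:A|lborel. cmod (f t) powr p * w t) powr (q / p)"
    have "(\<integral>\<^sup>+x. ennreal (cmod (osc g A (\<lambda>t. f t * of_real (w t)) x) powr q) \<partial>\<mu>) \<le> ennreal (c * B * ?X)"
      using that(1) gr f by (simp add: arc_bound_def)
    also have "\<dots> \<le> ennreal (c' * B * ?X)"
      using gr that(2) by (intro ennreal_leI mult_right_mono) (auto simp: growth_def)
    finally show "(\<integral>\<^sup>+x. ennreal (cmod (osc g A (\<lambda>t. f t * of_real (w t)) x) powr q) \<partial>\<mu>) \<le> ennreal (c' * B * ?X)" .
  qed
  \<comment> \<open>Two sets form a sequence padded with empty pieces; the factor 2 compensates
    \<open>(1 / 2) ^ 1\<close> at the second one.\<close>
  have "arc_bound g w \<alpha> p q (2 * (C + C') * (1 / 2) ^ k) (Q k)" for k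
  proof -
    consider "k = 0" | "k = 1" | "1 < k" by linarith
    then show ?thesis
    proof cases
      case 1
      then show ?thesis using mono[OF S(1), of "2 * (C + C')"] CC by (simp add: Q_def)
    next
      case 2
      have e: "2 * (C + C') * (1 / 2) ^ k = C + C'" "Q k = T - S" using 2 by (simp_all add: Q_def)
      show ?thesis unfolding e by (rule mono[OF T']) (use CC in simp)
    next
      case 3
      then have e: "Q k = {}" by (simp add: Q_def)
      show ?thesis unfolding e by (rule mono[OF arc_bound_null]) (use CC in simp_all)
    qed
  qed
  then have "\<exists>C. arc_bound g w \<alpha> p q C (\<Union>k. Q k)"
  proof (rule arc_bound_UN)
    show "Q k \<subseteq> {0..1}" for k using S(3) T(3) by (auto simp: Q_def)
    show "Q j \<inter> Q k = {}" if "j \<noteq> k" for j k using that by (auto simp: Q_def)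
  qed auto
  moreover have "(\<Union>k. Q k) = S \<union> T"
  proof -
    have "S = Q 0" "T - S = Q 1" by (simp_all add: Q_def)
    then have "S \<union> T \<subseteq> (\<Union>k. Q k)" by blast
    moreover have "(\<Union>k. Q k) \<subseteq> S \<union> T" by (auto simp: Q_def split: if_splits)
    ultimately show ?thesis by blast
  qed
  ultimately show ?thesis by simp
qed

text \<open>The sets belonging to \<open>h = h0 / 2 ^ k\<close> tile the arc from \<open>t0\<close>
  to \<open>t0 + 2 * h0\<close> without its end points, with constants in the ratio
  \<open>2 powr - \<theta>\<close>. The sign of \<open>h0\<close> selects the side of
  \<open>t0\<close>.\<close>

lemma arc_bound_dyadic:
  assumes h: "h0 \<noteq> 0" "t0 \<in> {0..1}" "t0 + 2 * h0 \<in> {0..1}" and \<theta>: "0 < \<theta>"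
    and Q: "\<And>h. h \<noteq> 0 \<Longrightarrow> \<bar>h\<bar> \<le> \<bar>h0\<bar> \<Longrightarrow> t0 + h \<in> {0..1} \<Longrightarrow> t0 + 2 * h \<in> {0..1} \<Longrightarrow>
      arc_bound g w \<alpha> p q (C * \<bar>h\<bar> powr \<theta>) {t. (t - t0) / h \<in> {1..<2}}"
  shows "\<exists>C'. arc_bound g w \<alpha> p q C' {t. (t - t0) / h0 \<in> {0<..<2}}"
proof -
  define Qk where "Qk = (\<lambda>k :: nat. {t. (t - t0) / (h0 / 2 ^ k) \<in> {1..<2}})"
  have Qk: "t \<in> Qk k \<longleftrightarrow> 1 \<le> (t - t0) / h0 * 2 ^ k \<and> (t - t0) / h0 * 2 ^ k < 2" for t k
    by (simp add: Qk_def)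
  have cvx: "t0 + v * h0 \<in> {0..1}" if "0 \<le> v" "v \<le> 2" for v
  proof -
    have e: "t0 + v * h0 = (1 - v / 2) * t0 + (v / 2) * (t0 + 2 * h0)" by (simp add: field_simps)
    have "0 \<le> (1 - v / 2) * t0" "0 \<le> (v / 2) * (t0 + 2 * h0)" using that h by auto
    moreover have "(1 - v / 2) * t0 \<le> (1 - v / 2) * 1" "(v / 2) * (t0 + 2 * h0) \<le> (v / 2) * 1"
      using that h by (intro mult_left_mono; simp)+
    ultimately show ?thesis unfolding e by auto
  qed
  have "\<exists>C'. arc_bound g w \<alpha> p q C' (\<Union>k. Qk k)"
  proof (rule arc_bound_UN[where C="C * \<bar>h0\<bar> powr \<theta>" and s="2 powr - \<theta>"])
    fix k
    have "(2 powr - \<theta>) ^ k = (2 ^ k) powr - \<theta>" by (simp add: powr_power powr_powr mult.commute flip: powr_realpow)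
    then have e: "C * \<bar>h0\<bar> powr \<theta> * (2 powr - \<theta>) ^ k = C * \<bar>h0 / 2 ^ k\<bar> powr \<theta>"
      unfolding abs_divide by (subst powr_divide) (auto simp: powr_minus divide_inverse)
    have 1: "1 / 2 ^ k \<le> (1 :: real)" by simp
    have "t0 + h0 / 2 ^ k \<in> {0..1}" using cvx[of "1 / 2 ^ k"] 1 by simp
    moreover have "t0 + 2 * (h0 / 2 ^ k) \<in> {0..1}" using cvx[of "2 / 2 ^ k"] 1 by simp
    moreover have "\<bar>h0 / 2 ^ k\<bar> \<le> \<bar>h0\<bar>" using mult_left_mono[OF 1, of "\<bar>h0\<bar>"] by (simp add: abs_divide)
    ultimately show "arc_bound g w \<alpha> p q (C * \<bar>h0\<bar> powr \<theta> * (2 powr - \<theta>) ^ k) (Qk k)"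
      unfolding e Qk_def using h(1) by (intro Q) auto
    show "Qk k \<in> sets borel" unfolding Qk_def by measurable
    show "Qk k \<subseteq> {0..1}"
    proof
      fix t assume "t \<in> Qk k"
      then have v: "1 \<le> (t - t0) / h0 * 2 ^ k" "(t - t0) / h0 * 2 ^ k < 2" by (simp_all add: Qk)
      have "0 < (t - t0) / h0 * 2 ^ k" using v by linarith
      then have "0 < (t - t0) / h0" by (rule zero_less_mult_pos2) simp
      moreover have "(t - t0) / h0 * 1 \<le> (t - t0) / h0 * 2 ^ k"
        using \<open>0 < (t - t0) / h0\<close> by (intro mult_left_mono) auto
      ultimately show "t \<in> {0..1}" using cvx[of "(t - t0) / h0"] v h(1) by simp
    qed
  next
    have "Qk j \<inter> Qk k = {}" if "j < k" for j k
    proof -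
      have False if "t \<in> Qk j" "t \<in> Qk k" for t
      proof -
        define v where "v = (t - t0) / h0"
        have v: "1 \<le> v * 2 ^ j" "v * 2 ^ k < 2" using that by (simp_all add: Qk v_def)
        have "2 * 2 ^ j \<le> (2 :: real) ^ k" using \<open>j < k\<close> power_increasing[of "Suc j" k "2 :: real"] by simp
        moreover have "0 < v * 2 ^ j" using v by linarith
        then have "0 < v" by (rule zero_less_mult_pos2) simp
        ultimately have "v * (2 * 2 ^ j) \<le> v * 2 ^ k" by (intro mult_left_mono) auto
        then show False using v by simp
      qed
      then show ?thesis by blast
    qed
    then show "Qk j \<inter> Qk k = {}" if "j \<noteq> k" for j k using that by (metis Int_commute linorder_neqE_nat)
  qed (use \<theta> in \<open>auto simp: powr_less_one\<close>)
  moreover have "(\<Union>k. Qk k) = {t. (t - t0) / h0 \<in> {0<..<2}}"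
  proof (intro set_eqI iffI)
    fix t assume "t \<in> (\<Union>k. Qk k)"
    then obtain k where v: "1 \<le> (t - t0) / h0 * 2 ^ k" "(t - t0) / h0 * 2 ^ k < 2" by (auto simp: Qk)
    have "0 < (t - t0) / h0 * 2 ^ k" using v by linarith
    then have "0 < (t - t0) / h0" by (rule zero_less_mult_pos2) simp
    moreover have "(t - t0) / h0 * 1 \<le> (t - t0) / h0 * 2 ^ k"
      using \<open>0 < (t - t0) / h0\<close> by (intro mult_left_mono) auto
    ultimately show "t \<in> {t. (t - t0) / h0 \<in> {0<..<2}}" using v by simp
  next
    fix t assume t: "t \<in> {t. (t - t0) / h0 \<in> {0<..<2}}"
    define v where "v = (t - t0) / h0"
    have v: "0 < v" "v < 2" using t by (auto simp: v_def)
    obtain n where n: "1 / v < 2 ^ n" using real_arch_pow[of 2 "1 / v"] by auto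
    then have n: "1 \<le> v * 2 ^ n" using v by (simp add: field_simps)
    \<comment> \<open>Minimality gives \<open>v * 2 ^ k < 2\<close>: either one halving falls below
      1, or \<open>k = 0\<close> and \<open>v < 2\<close> is used.\<close>
    define k where "k = (LEAST n. 1 \<le> v * 2 ^ n)"
    have k: "1 \<le> v * 2 ^ k" unfolding k_def by (rule LeastI[of _ n]) (rule n)
    have "v * 2 ^ k < 2"
    proof (cases k)
      case (Suc j)
      then have "\<not> 1 \<le> v * 2 ^ j" using not_less_Least[of j "\<lambda>n. 1 \<le> v * 2 ^ n"] by (simp add: k_def)
      then show ?thesis using Suc by simp
    qed (use v in simp)
    with k have "t \<in> Qk k" by (simp add: Qk v_def)
    then show "t \<in> (\<Union>k. Qk k)" by blast
  qed
  ultimately show ?thesis by simp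
qed

text \<open>Bisection takes the place of a finite subcover. Having a bound passes from two adjacent
  open intervals to their union, the common end point being a null set, and it holds near every
  point by summing dyadic arcs on both sides.\<close>

lemma arc_bound_compact:
  assumes local: "\<And>t0. t0 \<in> {0..1} \<Longrightarrow> \<exists>C \<theta> \<delta>. 0 < \<theta> \<and> 0 < \<delta> \<and> (\<forall>h. h \<noteq> 0 \<longrightarrow> \<bar>h\<bar> \<le> \<delta> \<longrightarrow> t0 + h \<in> {0..1} \<longrightarrow> t0 + 2 * h \<in> {0..1} \<longrightarrow>
      arc_bound g w \<alpha> p q (C * \<bar>h\<bar> powr \<theta>) {t. (t - t0) / h \<in> {1..<2}})"
  shows "\<exists>C. arc_bound g w \<alpha> p q C {0..1}"
proof -
  have sub: "{a<..<b} \<subseteq> {0..1}" if "0 \<le> a" "b \<le> 1" for a b :: real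
    using that by (intro subsetI) auto
  have pt: "\<exists>C. arc_bound g w \<alpha> p q C {t}" for t
    using arc_bound_null[of "{t}"] by auto
  \<comment> \<open>One side of \<open>t0\<close>: \<open>\<sigma>\<close> is the direction and
    \<open>t1\<close> the end point of \<open>{0..1}\<close> in that direction.\<close>
  have side: "\<exists>d>0. \<forall>a b. a \<in> {0..1} \<longrightarrow> b \<in> {0..1} \<longrightarrow> (\<forall>t\<in>{a<..<b}. 0 < \<sigma> * (t - t0)) \<longrightarrow> \<bar>a - t0\<bar> < d \<longrightarrow> \<bar>b - t0\<bar> < d \<longrightarrow>
      (\<exists>C. arc_bound g w \<alpha> p q C {a<..<b})"
    if t0: "t0 \<in> {0..1}" and \<sigma>: "\<sigma> = 1 \<and> t1 = 1 \<or> \<sigma> = -1 \<and> t1 = 0" for t0 \<sigma> t1 :: real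
  proof (cases "t0 = t1")
    case True
    \<comment> \<open>Beyond an end point of \<open>{0..1}\<close> there is no arc to
      estimate.\<close>
    have empty: "{a<..<b} = {}" if "a \<in> {0..1}" "b \<in> {0..1}" "\<forall>t\<in>{a<..<b}. 0 < \<sigma> * (t - t0)" for a b
    proof (rule equals0I)
      fix t assume t: "t \<in> {a<..<b}"
      with that have "0 < \<sigma> * (t - t0)" by blast
      with that(1,2) t \<sigma> True show False by auto
    qed
    have "arc_bound g w \<alpha> p q 0 {}" by (rule arc_bound_null) auto
    then have "\<exists>C. arc_bound g w \<alpha> p q C {a<..<b}" if "a \<in> {0..1}" "b \<in> {0..1}" "\<forall>t\<in>{a<..<b}. 0 < \<sigma> * (t - t0)" for a b
      unfolding empty[OF that] ..
    then show ?thesis by (intro exI[of _ 1]) simp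
  next
    case False
    from local[OF t0] obtain C \<theta> \<delta> where \<theta>: "0 < \<theta>" "0 < \<delta>"
      and loc: "\<And>h. h \<noteq> 0 \<Longrightarrow> \<bar>h\<bar> \<le> \<delta> \<Longrightarrow> t0 + h \<in> {0..1} \<Longrightarrow> t0 + 2 * h \<in> {0..1} \<Longrightarrow>
      arc_bound g w \<alpha> p q (C * \<bar>h\<bar> powr \<theta>) {t. (t - t0) / h \<in> {1..<2}}" by blast
    \<comment> \<open>At most half the distance to \<open>t1\<close>, so that the arc of length
      \<open>2 * h\<close> stays in \<open>{0..1}\<close>.\<close>
    define h where "h = min \<delta> (\<bar>t1 - t0\<bar> / 2)"
    have h: "0 < h" "h \<le> \<delta>" "2 * h \<le> \<bar>t1 - t0\<bar>" using False \<theta> by (auto simp: h_def min_def)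
    have "\<exists>C'. arc_bound g w \<alpha> p q C' {t. (t - t0) / (\<sigma> * h) \<in> {0<..<2}}"
    proof (rule arc_bound_dyadic[OF _ t0 _ \<theta>(1), where C=C])
      show "t0 + 2 * (\<sigma> * h) \<in> {0..1}" using h \<sigma> t0 by auto
      fix h' assume h': "h' \<noteq> 0" "\<bar>h'\<bar> \<le> \<bar>\<sigma> * h\<bar>" "t0 + h' \<in> {0..1}" "t0 + 2 * h' \<in> {0..1}"
      have "\<bar>h'\<bar> \<le> \<delta>" using h h'(2) \<sigma> by auto
      with h' show "arc_bound g w \<alpha> p q (C * \<bar>h'\<bar> powr \<theta>) {t. (t - t0) / h' \<in> {1..<2}}" by (intro loc)
    qed (use h \<sigma> in auto)
    then obtain C' where C': "arc_bound g w \<alpha> p q C' {t. (t - t0) / (\<sigma> * h) \<in> {0<..<2}}" ..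
    show ?thesis
    proof (rule exI[of _ "2 * h"], intro conjI allI impI)
      fix a b :: real assume ab: "\<forall>t\<in>{a<..<b}. 0 < \<sigma> * (t - t0)" "\<bar>a - t0\<bar> < 2 * h" "\<bar>b - t0\<bar> < 2 * h"
      have "arc_bound g w \<alpha> p q C' {a<..<b}"
      proof (rule arc_bound_subset[OF C'])
        show "{t. (t - t0) / (\<sigma> * h) \<in> {0<..<2}} \<in> sets borel" by measurable
        show "{a<..<b} \<subseteq> {t. (t - t0) / (\<sigma> * h) \<in> {0<..<2}}"
        proof
          fix t assume t: "t \<in> {a<..<b}"
          have "\<bar>t - t0\<bar> < 2 * h" using t ab(2,3) by auto
          moreover have "0 < \<sigma> * (t - t0)" using ab(1) t by blast
          ultimately have t': "0 < \<sigma> * (t - t0)" "\<sigma> * (t - t0) < 2 * h" using \<sigma> by auto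
          have "(t - t0) / (\<sigma> * h) = \<sigma> * (t - t0) / h" using \<sigma> by (auto simp: divide_simps)
          then show "t \<in> {t. (t - t0) / (\<sigma> * h) \<in> {0<..<2}}"
            using t' h(1) by (simp add: pos_divide_less_eq)
        qed
      qed simp
      then show "\<exists>C. arc_bound g w \<alpha> p q C {a<..<b}" ..
    qed (use h in simp)
  qed
  have join: "\<exists>C. arc_bound g w \<alpha> p q C {a<..<c}"
    if ab: "\<exists>C. arc_bound g w \<alpha> p q C {a<..<b}" and bc: "\<exists>C. arc_bound g w \<alpha> p q C {b<..<c}"
      and le: "a \<le> b" "b \<le> c" and 01: "a \<in> {0..1}" "c \<in> {0..1}" for a b c
  proof -
    obtain C1 C2 C3 where "arc_bound g w \<alpha> p q C1 {a<..<b}" "arc_bound g w \<alpha> p q C2 {b<..<c}" "arc_bound g w \<alpha> p q C3 {b}"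
      using ab bc pt[of b] by blast
    note C = this
    have s: "{a<..<b} \<subseteq> {0..1}" "{b<..<c} \<subseteq> {0..1}" "b \<in> {0..1}" using 01 le by (auto intro!: sub)
    have m: "{a<..<b} \<in> sets borel" "{b<..<c} \<in> sets borel" "{b} \<in> sets borel" "{b} \<subseteq> {0..1}" using s(3) by auto
    obtain C4 where C4: "arc_bound g w \<alpha> p q C4 ({a<..<b} \<union> {b})"
      using arc_bound_Un[OF C(1) m(1) s(1) C(3) m(3,4)] ..
    obtain C5 where C5: "arc_bound g w \<alpha> p q C5 ({a<..<b} \<union> {b} \<union> {b<..<c})"
      using arc_bound_Un[OF C4 sets.Un[OF m(1,3)] Un_least[OF s(1) m(4)] C(2) m(2) s(2)] ..
    have "arc_bound g w \<alpha> p q C5 {a<..<c}" by (rule arc_bound_subset[OF C5]) auto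
    then show ?thesis ..
  qed
  have "0 \<in> {0..1::real} \<longrightarrow> 1 \<in> {0..1::real} \<longrightarrow> (\<exists>C. arc_bound g w \<alpha> p q C {0<..<1})"
  proof (rule Bolzano[where P="\<lambda>a b. a \<in> {0..1} \<longrightarrow> b \<in> {0..1} \<longrightarrow> (\<exists>C. arc_bound g w \<alpha> p q C {a<..<b})"])
    fix a b c :: real
    assume 1: "a \<in> {0..1} \<longrightarrow> b \<in> {0..1} \<longrightarrow> (\<exists>C. arc_bound g w \<alpha> p q C {a<..<b})"
      and 2: "b \<in> {0..1} \<longrightarrow> c \<in> {0..1} \<longrightarrow> (\<exists>C. arc_bound g w \<alpha> p q C {b<..<c})" and le: "a \<le> b" "b \<le> c"
    show "a \<in> {0..1} \<longrightarrow> c \<in> {0..1} \<longrightarrow> (\<exists>C. arc_bound g w \<alpha> p q C {a<..<c})"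
    proof (intro impI)
      assume ac: "a \<in> {0..1}" "c \<in> {0..1}"
      then have "b \<in> {0..1}" using le by auto
      with 1 2 ac le show "\<exists>C. arc_bound g w \<alpha> p q C {a<..<c}" by (intro join[of a b c]) blast+
    qed
  next
    fix x :: real assume "0 \<le> x" "x \<le> 1"
    then have x: "x \<in> {0..1}" by simp
    from side[OF x, of 1 1] obtain d1 where d1: "0 < d1" and s1: "\<And>a b. a \<in> {0..1} \<Longrightarrow> b \<in> {0..1} \<Longrightarrow> (\<forall>t\<in>{a<..<b}. 0 < 1 * (t - x)) \<Longrightarrow> \<bar>a - x\<bar> < d1 \<Longrightarrow> \<bar>b - x\<bar> < d1 \<Longrightarrow>
      (\<exists>C. arc_bound g w \<alpha> p q C {a<..<b})" by auto
    from side[OF x, of "-1" 0] obtain d2 where d2: "0 < d2" and s2: "\<And>a b. a \<in> {0..1} \<Longrightarrow> b \<in> {0..1} \<Longrightarrow> (\<forall>t\<in>{a<..<b}. 0 < (-1) * (t - x)) \<Longrightarrow> \<bar>a - x\<bar> < d2 \<Longrightarrow> \<bar>b - x\<bar> < d2 \<Longrightarrow>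
      (\<exists>C. arc_bound g w \<alpha> p q C {a<..<b})" by auto
    show "\<exists>d>0. \<forall>a b. a \<le> x \<and> x \<le> b \<and> b - a < d \<longrightarrow> (a \<in> {0..1} \<longrightarrow> b \<in> {0..1} \<longrightarrow> (\<exists>C. arc_bound g w \<alpha> p q C {a<..<b}))"
    proof (rule exI[of _ "min d1 d2"], intro conjI allI impI)
      fix a b :: real assume ab: "a \<le> x \<and> x \<le> b \<and> b - a < min d1 d2" "a \<in> {0..1}" "b \<in> {0..1}"
      have "\<exists>C. arc_bound g w \<alpha> p q C {a<..<x}" by (rule s2) (use ab x d2 in auto)
      moreover have "\<exists>C. arc_bound g w \<alpha> p q C {x<..<b}" by (rule s1) (use ab x d1 in auto)
      ultimately show "\<exists>C. arc_bound g w \<alpha> p q C {a<..<b}" using ab by (intro join[of a x b]) auto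
    qed (use d1 d2 in simp)
  qed simp
  then obtain C0 where C0: "arc_bound g w \<alpha> p q C0 {0<..<1}" by auto
  from pt[of 0] obtain C1 where C1: "arc_bound g w \<alpha> p q C1 {0}" ..
  from pt[of 1] obtain C2 where C2: "arc_bound g w \<alpha> p q C2 {1}" ..
  have m: "{0<..<1 :: real} \<in> sets borel" "{0 :: real} \<in> sets borel" "{1 :: real} \<in> sets borel"
    and s: "{0<..<1} \<subseteq> {0..1 :: real}" "{0} \<subseteq> {0..1 :: real}" "{1} \<subseteq> {0..1 :: real}" by (auto intro!: sub)
  obtain C3 where C3: "arc_bound g w \<alpha> p q C3 ({0<..<1} \<union> {0})"
    using arc_bound_Un[OF C0 m(1) s(1) C1 m(2) s(2)] ..
  obtain C4 where "arc_bound g w \<alpha> p q C4 ({0<..<1} \<union> {0} \<union> {1})"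
    using arc_bound_Un[OF C3 sets.Un[OF m(1,2)] Un_least[OF s(1,2)] C2 m(3) s(3)] ..
  moreover have "{0<..<1} \<union> {0} \<union> {1} = {0..1::real}" by auto
  ultimately show ?thesis by auto
qed

end

section \<open>The local estimate at a point of finite type\<close>

lemma growth_distr_anisotropic:
  fixes M :: "real ^ 'n::finite ^ 'n" and a :: "'n \<Rightarrow> nat"
  assumes gr: "growth \<alpha> B \<mu>" and \<kappa>: "0 < \<kappa>" "\<And>x. \<kappa> * norm x \<le> norm (M *v x)" and h: "h \<noteq> 0" "\<bar>h\<bar> \<le> 1"
  shows "growth \<alpha> ((2 ^ CARD('n) * (CARD('n) / \<kappa>) powr \<alpha>) * B * \<bar>h\<bar> powr (- (real (\<Sum>i\<in>UNIV. a i - m) + m * \<alpha>)))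
    (distr \<mu> borel (\<lambda>x. \<chi> i. h ^ a i * (M *v x) $ i))"
proof -
  let ?L = "\<lambda>x. (\<chi> i. h ^ a i * (M *v x) $ i) :: real ^ 'n"
  have smu[measurable_cong]: "sets \<mu> = sets borel" and fin: "finite_measure \<mu>" and B0: "0 \<le> B"
    using gr by (auto simp: growth_def)
  have "bounded_linear ?L"
    by (intro linear_conv_bounded_linear[THEN iffD1] linearI)
       (auto simp: vec_eq_iff matrix_vector_right_distrib matrix_vector_mult_scaleR distrib_left)
  then have L[measurable]: "?L \<in> borel_measurable borel"
    by (intro borel_measurable_continuous_onI linear_continuous_on)
  have linM: "linear (\<lambda>x. M *v x)" by (rule matrix_vector_mul_linear)
  have "emeasure (distr \<mu> borel ?L) (ball y \<rho>)
    \<le> ennreal ((2 ^ CARD('n) * (CARD('n) / \<kappa>) powr \<alpha>) * B * \<bar>h\<bar> powr (- (real (\<Sum>i\<in>UNIV. a i - m) + m * \<alpha>)) * \<rho> powr \<alpha>)"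
    if \<rho>: "0 < \<rho>" for y \<rho>
  proof -
    have "emeasure (distr \<mu> borel ?L) (ball y \<rho>) = emeasure \<mu> (?L -` ball y \<rho> \<inter> space \<mu>)"
      by (rule emeasure_distr) measurable
    also have "\<dots> \<le> emeasure \<mu> {x. \<forall>i. \<bar>\<bar>h\<bar> ^ a i * (M *v x) $ i - sgn h ^ a i * y $ i\<bar> < \<rho>}"
    proof (rule emeasure_mono)
      show "?L -` ball y \<rho> \<inter> space \<mu> \<subseteq> {x. \<forall>i. \<bar>\<bar>h\<bar> ^ a i * (M *v x) $ i - sgn h ^ a i * y $ i\<bar> < \<rho>}"
      proof (intro subsetI CollectI allI)
        fix x i assume "x \<in> ?L -` ball y \<rho> \<inter> space \<mu>"
        then have "norm (?L x - y) < \<rho>" by (simp add: dist_norm norm_minus_commute)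
        moreover have "\<bar>(?L x - y) $ i\<bar> \<le> norm (?L x - y)" by (rule component_le_norm_cart)
        ultimately have "\<bar>h ^ a i * (M *v x) $ i - y $ i\<bar> < \<rho>" by simp
        \<comment> \<open>For negative \<open>h\<close> the signs \<open>sgn h ^ a i\<close> are
          moved to the centre \<open>y\<close>, which reduces the box to a positive scale.\<close>
        moreover have "\<bar>\<bar>h\<bar> ^ a i * (M *v x) $ i - sgn h ^ a i * y $ i\<bar> = \<bar>h ^ a i * (M *v x) $ i - y $ i\<bar>"
        proof -
          have "\<bar>h\<bar> = sgn h * h" by (simp add: abs_sgn mult.commute)
          then have "\<bar>h\<bar> ^ a i * (M *v x) $ i - sgn h ^ a i * y $ i = sgn h ^ a i * (h ^ a i * (M *v x) $ i - y $ i)"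
            by (simp add: power_mult_distrib right_diff_distrib mult.assoc)
          moreover have "\<bar>sgn h ^ a i\<bar> = 1" using h(1) by (simp add: power_abs)
          ultimately show ?thesis by (simp add: abs_mult)
        qed
        ultimately show "\<bar>\<bar>h\<bar> ^ a i * (M *v x) $ i - sgn h ^ a i * y $ i\<bar> < \<rho>" by simp
      qed
      have [measurable]: "(\<lambda>x. M *v x) \<in> borel_measurable borel"
        by (intro borel_measurable_continuous_onI linear_continuous_on) (simp add: matrix_vector_mul_bounded_linear)
      have "(\<lambda>x. (M *v x) $ i) \<in> borel_measurable borel" for i
        using measurable_compose[OF _ borel_measurable_nth] by measurable
      then have "(\<Inter>i. {x. \<bar>\<bar>h\<bar> ^ a i * (M *v x) $ i - sgn h ^ a i * y $ i\<bar> < \<rho>}) \<in> sets borel"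
        by (intro sets.finite_INT) (auto intro!: borel_measurable_pred_less simp: pred_def)
      moreover have "(\<Inter>i. {x. \<bar>\<bar>h\<bar> ^ a i * (M *v x) $ i - sgn h ^ a i * y $ i\<bar> < \<rho>})
        = {x. \<forall>i. \<bar>\<bar>h\<bar> ^ a i * (M *v x) $ i - sgn h ^ a i * y $ i\<bar> < \<rho>}" by auto
      ultimately show "{x. \<forall>i. \<bar>\<bar>h\<bar> ^ a i * (M *v x) $ i - sgn h ^ a i * y $ i\<bar> < \<rho>} \<in> sets \<mu>" by (simp add: smu)
    qed
    also have "\<dots> \<le> ennreal ((2 ^ CARD('n) * (CARD('n) / \<kappa>) powr \<alpha>) * B * \<rho> powr \<alpha> * \<bar>h\<bar> powr (- (real (\<Sum>i\<in>UNIV. a i - m) + m * \<alpha>)))"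
      by (rule growth_anisotropic_box[OF gr linM \<kappa> _ h(2) \<rho>]) (use h in simp)
    finally show ?thesis by (simp add: mult_ac)
  qed
  moreover have "finite_measure (distr \<mu> borel ?L)"
    using fin by (rule finite_measure.finite_measure_distr) measurable
  ultimately show ?thesis using B0 by (simp add: growth_def)
qed

text \<open>With \<open>T = q - q / p\<close> the total power of \<open>\<bar>h\<bar>\<close> is
  \<open>\<theta> = T - Ba + S / \<beta> * T\<close>. Since \<open>Ba \<le> \<beta> + S\<close> and
  \<open>\<beta> < T\<close>, this is at least \<open>T - \<beta> > 0\<close>: the exponent
  \<open>1 / \<beta>\<close> of the weight is what repays the increase \<open>S\<close> of the
  growth exponent.\<close>

lemma finite_type_local_bound:
  fixes rk a0 :: "'n::finite \<Rightarrow> nat" and D :: "nat \<Rightarrow> real \<Rightarrow> real ^ 'n" and p q \<alpha> \<beta> :: real and w :: "real \<Rightarrow> real"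
  assumes rk: "bij_betw rk (UNIV :: 'n set) {1..CARD('n)}" and sm: "smooth_derivs D" and t0: "t0 \<in> {0..1}"
    and a0: "\<And>i. 0 < a0 i" "det ((\<chi> i. D (a0 i) t0) :: real ^ 'n ^ 'n) \<noteq> 0"
    and p: "1 < p" "p \<le> q" and q: "2 * real CARD('n) \<le> q" "real CARD('n) / q \<le> 1 - 1 / p"
    and \<alpha>: "0 \<le> \<alpha>" and \<beta>: "\<beta> = real (\<Sum>i\<in>UNIV. rk i - m) + real m * \<alpha>" "0 < \<beta>" "\<beta> / q + 1 / p < 1"
    and w[measurable]: "w \<in> borel_measurable borel"
    and wD: "\<And>t. t \<in> {0..1} \<Longrightarrow> w t = \<bar>det ((\<chi> i. D (rk i) t) :: real ^ 'n ^ 'n)\<bar> powr (1 / \<beta>)"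
  shows "\<exists>C \<theta> \<delta>. 0 < \<theta> \<and> 0 < \<delta> \<and> (\<forall>h. h \<noteq> 0 \<longrightarrow> \<bar>h\<bar> \<le> \<delta> \<longrightarrow> t0 + h \<in> {0..1} \<longrightarrow> t0 + 2 * h \<in> {0..1} \<longrightarrow>
      arc_bound (D 0) w \<alpha> p q (C * \<bar>h\<bar> powr \<theta>) {t. (t - t0) / h \<in> {1..<2}})"
proof -
  have q0: "0 < q" using p by simp
  obtain a :: "'n \<Rightarrow> nat" and M :: "real ^ 'n ^ 'n" and \<kappa> K c \<delta> W :: real where a: "inj a" "\<And>i. 0 < a i"
    and \<kappa>: "0 < \<kappa>" "\<And>x. \<kappa> * norm x \<le> norm (M *v x)" and K: "0 \<le> K" and c: "0 < c" and \<delta>: "0 < \<delta>" "\<delta> \<le> 1" and W: "0 \<le> W"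
    and nf: "\<And>h. \<lbrakk>h \<noteq> 0; \<bar>h\<bar> \<le> \<delta>; t0 + h \<in> {0..1}; t0 + 2 * h \<in> {0..1}\<rbrakk> \<Longrightarrow>
      \<exists>G. nondegenerate_curve rk K c G \<and>
        (\<forall>x u. x \<bullet> D 0 (t0 + h + h * u) = x \<bullet> D 0 t0 + (\<chi> i. h ^ a i * (M *v x) $ i) \<bullet> G 0 u)"
    and dW: "\<And>h u. \<lbrakk>h \<noteq> 0; \<bar>h\<bar> \<le> \<delta>; t0 + h \<in> {0..1}; t0 + 2 * h \<in> {0..1}; u \<in> {0..1}\<rbrakk> \<Longrightarrow>
      \<bar>det ((\<chi> i. D (rk i) (t0 + h + h * u)) :: real ^ 'n ^ 'n)\<bar> \<le> W * \<bar>h\<bar> powr (real (\<Sum>i\<in>UNIV. a i) - real (\<Sum>i\<in>UNIV. rk i))"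
  proof (rule finite_type_normal_form[OF rk sm t0 a0], goal_cases)
    case (1 a M \<kappa> K c \<delta> W)
    show ?case by (rule 1(1)[OF 1(2-)])
  qed
  \<comment> \<open>The power of \<open>\<bar>h\<bar>\<close> that bounds the torsion on the arc at
    distance \<open>\<bar>h\<bar>\<close>; \<open>growth_exponent_le\<close> with a large
    \<open>m\<close> shows that it is nonnegative.\<close>
  define S where "S = real (\<Sum>i\<in>UNIV. a i) - real (\<Sum>i\<in>UNIV. rk i)"
  have S0: "0 \<le> S"
  proof -
    have "(\<Sum>i\<in>UNIV. rk i - (\<Sum>i\<in>UNIV. rk i)) = 0" by (simp add: member_le_sum)
    then show ?thesis
      using growth_exponent_le[OF rk a, of "\<Sum>i\<in>UNIV. rk i"] of_nat_0_le_iff[of "\<Sum>i\<in>UNIV. a i - (\<Sum>i\<in>UNIV. rk i)"]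
      unfolding S_def by linarith
  qed
  define Ba where "Ba = real (\<Sum>i\<in>UNIV. a i - m) + m * \<alpha>"
  have Ba: "Ba \<le> \<beta> + S" using growth_exponent_le[OF rk a, of m] by (simp add: Ba_def S_def \<beta>(1))
  \<comment> \<open>Of the \<open>p\<close> powers of the weight, \<open>p - 1\<close> are estimated
    by their maximum on the arc, giving \<open>S / \<beta> * (p - 1)\<close>; the \<open>- 1\<close>
    comes from the substitution that rescales the arc.\<close>
  define e1 where "e1 = S / \<beta> * (p - 1) - 1"
  define \<theta> where "\<theta> = q - Ba + e1 * (q / p)"
  have \<theta>: "0 < \<theta>"
  proof -
    define T where "T = q - q / p"
    have "\<beta> = (\<beta> / q) * q" using q0 by simp
    also have "\<dots> < (1 - 1 / p) * q" using \<beta>(3) q0 by (intro mult_strict_right_mono) auto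
    also have "\<dots> = T" by (simp add: T_def left_diff_distrib)
    finally have T: "\<beta> < T" .
    have "S = S / \<beta> * \<beta>" using \<beta>(2) by simp
    also have "\<dots> \<le> S / \<beta> * T" using T S0 \<beta>(2) by (intro mult_left_mono) auto
    finally have "S \<le> S / \<beta> * T" .
    moreover have "e1 * (q / p) = S / \<beta> * T - q / p"
    proof -
      have "(p - 1) * (q / p) = T" using p by (simp add: T_def field_simps)
      then have "S / \<beta> * (p - 1) * (q / p) = S / \<beta> * T" by (metis mult.assoc)
      then show ?thesis by (simp only: e1_def left_diff_distrib mult_1)
    qed
    ultimately show ?thesis using T Ba by (simp add: \<theta>_def T_def)
  qed
  obtain C0 where C0: "0 < C0" and est: "\<forall>(\<mu> :: (real ^ 'n) measure) B G f. growth \<alpha> B \<mu> \<longrightarrow> nondegenerate_curve rk K c G \<longrightarrow> Lp_on p {0..<1} f \<longrightarrow>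
      (\<integral>\<^sup>+x. ennreal (cmod (osc (G 0) {0..<1} f x) powr q) \<partial>\<mu>)
        \<le> ennreal (C0 * B * (LINT t:{0..<1}|lborel. cmod (f t) powr p) powr (q / p))"
  proof (rule nondegenerate_estimate[OF rk p q c K \<alpha>, of m], goal_cases)
    case 1
    show ?case using \<beta>(3) by (simp add: \<beta>(1))
  next
    case (2 C)
    show ?case by (rule 2(1)[OF 2(2)]) (use 2(3) in blast)
  qed
  define Cg where "Cg = (2 ^ CARD('n) * (CARD('n) / \<kappa>) powr \<alpha>)"
  have Cg: "0 \<le> Cg" by (simp add: Cg_def)
  define V where "V = W powr (1 / \<beta>)"
  define E where "E = V powr (p - 1)"
  have E: "0 \<le> E" by (simp add: E_def)
  define C where "C = C0 * Cg * E powr (q / p)"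
  have C: "0 \<le> C" using C0 Cg by (simp add: C_def)
  have "arc_bound (D 0) w \<alpha> p q (C * \<bar>h\<bar> powr \<theta>) {t. (t - t0) / h \<in> {1..<2}}"
    if h: "h \<noteq> 0" "\<bar>h\<bar> \<le> \<delta>" and z: "t0 + h \<in> {0..1}" "t0 + 2 * h \<in> {0..1}" for h
    unfolding arc_bound_def
  proof (intro conjI allI impI)
    show "0 \<le> C * \<bar>h\<bar> powr \<theta>" using C by simp
    fix \<mu> :: "(real ^ 'n) measure" and B f
    assume gr: "growth \<alpha> B \<mu>" and f[measurable]: "f \<in> borel_measurable borel"
      and fi: "set_integrable lborel {0..1} (\<lambda>t. cmod (f t) powr p * w t)"
    have smu[measurable_cong]: "sets \<mu> = sets borel" and B0: "0 \<le> B" using gr by (auto simp: growth_def)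
    obtain G where G: "nondegenerate_curve rk K c G"
      and Geq: "\<And>x u. x \<bullet> D 0 (t0 + h + h * u) = x \<bullet> D 0 t0 + (\<chi> i. h ^ a i * (M *v x) $ i) \<bullet> G 0 u"
      using nf[OF h z] by blast
    have G0[measurable]: "G 0 \<in> borel_measurable borel" using G by (simp add: nondegenerate_curve_def)
    let ?Q = "{t. (t - t0) / h \<in> {1..<2}}"
    let ?L = "\<lambda>x. (\<chi> i. h ^ a i * (M *v x) $ i) :: real ^ 'n"
    have Q: "(\<lambda>u. (t0 + h) + h * u) ` {0..<1} = ?Q"
    proof (intro set_eqI iffI)
      fix t assume "t \<in> (\<lambda>u. (t0 + h) + h * u) ` {0..<1}"
      then obtain u where "0 \<le> u" "u < 1" "t = t0 + h + h * u" by auto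
      moreover from this have "(t - t0) / h = 1 + u" using h(1) by (simp add: field_simps)
      ultimately show "t \<in> ?Q" by simp
    next
      fix t assume t: "t \<in> ?Q"
      have "t = (t0 + h) + h * ((t - t0) / h - 1)" using h(1) by (simp add: field_simps)
      then show "t \<in> (\<lambda>u. (t0 + h) + h * u) ` {0..<1}" by (rule image_eqI) (use t in auto)
    qed
    have Qm[measurable]: "?Q \<in> sets borel" by measurable
    have Q01: "?Q \<subseteq> {0..1}"
      unfolding Q[symmetric]
    proof (rule image_subsetI)
      fix u :: real assume u: "u \<in> {0..<1}"
      have "(t0 + h) + h * u = (1 - u) * (t0 + h) + u * (t0 + 2 * h)" by (simp add: algebra_simps)
      moreover have "0 \<le> (1 - u) * (t0 + h)" "0 \<le> u * (t0 + 2 * h)" using u z by auto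
      moreover have "(1 - u) * (t0 + h) \<le> (1 - u) * 1" "u * (t0 + 2 * h) \<le> u * 1" using u z by (intro mult_left_mono; simp)+
      ultimately show "(t0 + h) + h * u \<in> {0..1}" by auto
    qed
    have wV: "w t \<le> V * \<bar>h\<bar> powr (S / \<beta>)" if t: "t \<in> ?Q" for t
    proof -
      from t obtain u where u: "u \<in> {0..<1}" "t = t0 + h + h * u" unfolding Q[symmetric] by auto
      have "w t = \<bar>det ((\<chi> i. D (rk i) (t0 + h + h * u)) :: real ^ 'n ^ 'n)\<bar> powr (1 / \<beta>)"
        using wD[of t] t Q01 u(2) by blast
      also have "\<dots> \<le> (W * \<bar>h\<bar> powr S) powr (1 / \<beta>)"
        using dW[OF h z, of u] u(1) \<beta>(2) by (intro powr_mono2) (auto simp: S_def)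
      also have "\<dots> = V * \<bar>h\<bar> powr (S / \<beta>)" using W by (simp add: powr_mult powr_powr V_def)
      finally show ?thesis .
    qed
    have w0: "0 \<le> w t" if "t \<in> ?Q" for t using wD[of t] that Q01 by auto
    define F where "F = (\<lambda>t. f t * complex_of_real (w t))"
    have F[measurable]: "F \<in> borel_measurable borel" unfolding F_def by measurable
    define X where "X = (LINT t:?Q|lborel. cmod (f t) powr p * w t)"
    have fQ: "set_integrable lborel ?Q (\<lambda>t. cmod (f t) powr p * w t)"
      by (rule set_integrable_subset[OF fi]) (use Q01 in auto)
    define H where "H = (V * \<bar>h\<bar> powr (S / \<beta>)) powr (p - 1)"
    have Fp: "cmod (F t) powr p \<le> H * (cmod (f t) powr p * w t)" if t: "t \<in> ?Q" for t
    proof -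
      have "cmod (F t) powr p = cmod (f t) powr p * w t powr p"
        using w0[OF t] by (simp add: F_def norm_mult powr_mult)
      also have "w t powr p = w t * w t powr (p - 1)" using w0[OF t] by (simp add: powr_mult_base)
      also have "cmod (f t) powr p * (w t * w t powr (p - 1)) \<le> cmod (f t) powr p * (w t * H)"
        unfolding H_def using w0[OF t] wV[OF t] p by (intro mult_left_mono powr_mono2) auto
      finally show ?thesis by (simp only: mult_ac)
    qed
    have H0: "0 \<le> H" by (simp add: H_def)
    have HfQ: "set_integrable lborel ?Q (\<lambda>t. H * (cmod (f t) powr p * w t))"
      using fQ by (rule set_integrable_mult_right[rotated]) 
    have LF: "Lp_on p ?Q F"
      unfolding Lp_on_def
    proof (intro conjI F set_integrable_bound[OF HfQ])
      show "set_borel_measurable lborel ?Q (\<lambda>t. cmod (F t) powr p)"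
        unfolding set_borel_measurable_def by measurable
      show "AE t in lborel. t \<in> ?Q \<longrightarrow> norm (cmod (F t) powr p) \<le> norm (H * (cmod (f t) powr p * w t))"
        using Fp w0 H0 by (intro AE_I2) auto
    qed
    have LFQ: "Lp_on p ((\<lambda>u. (t0 + h) + h * u) ` {0..<1}) F" unfolding Q by (rule LF)
    define Y where "Y = (LINT s:{0..<1}|lborel. cmod (F ((t0 + h) + h * s)) powr p)"
    have X0: "0 \<le> X" unfolding X_def set_lebesgue_integral_def
      by (intro Bochner_Integration.integral_nonneg) (auto simp: indicator_def w0)
    have Y0: "0 \<le> Y" unfolding Y_def set_lebesgue_integral_def
      by (intro Bochner_Integration.integral_nonneg) auto
    have YX: "Y \<le> E * \<bar>h\<bar> powr e1 * X"
    proof -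
      have "(LINT t:?Q|lborel. cmod (F t) powr p) \<le> (LINT t:?Q|lborel. H * (cmod (f t) powr p * w t))"
        by (intro set_integral_mono HfQ Fp) (use LF in \<open>auto simp: Lp_on_def\<close>)
      also have "\<dots> = H * X" by (simp add: X_def)
      finally have "Y \<le> H * X / \<bar>h\<bar>"
        unfolding Y_def Lp_on_affine(2)[OF h(1) LFQ] Q by (intro divide_right_mono) auto
      also have "H / \<bar>h\<bar> = E * \<bar>h\<bar> powr e1"
      proof -
        have "H = E * \<bar>h\<bar> powr (S / \<beta> * (p - 1))"
          by (simp add: H_def E_def V_def powr_mult powr_powr)
        then show ?thesis using h(1) by (simp only: e1_def powr_diff[of _ "S / \<beta> * (p - 1)"]) simp
      qed
      then have "H * X / \<bar>h\<bar> = E * \<bar>h\<bar> powr e1 * X" by (metis times_divide_eq_left)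
      finally show ?thesis .
    qed
    have osc_eq: "cmod (osc (D 0) ?Q F x) powr q = \<bar>h\<bar> powr q * cmod (osc (G 0) {0..<1} (\<lambda>s. F ((t0 + h) + h * s)) (?L x)) powr q" for x
      using osc_affine[OF h(1), of "{0..<1}" x "D 0" "t0 + h" "x \<bullet> D 0 t0" "?L x" "G 0" F] Geq
      unfolding Q by (simp add: norm_mult powr_mult)
    have [measurable]: "osc (G 0) {0..<1} (\<lambda>s. F ((t0 + h) + h * s)) \<in> borel_measurable borel"
      by (rule borel_measurable_osc) measurable
    have "bounded_linear ?L"
      by (intro linear_conv_bounded_linear[THEN iffD1] linearI)
         (auto simp: vec_eq_iff matrix_vector_right_distrib matrix_vector_mult_scaleR distrib_left)
    then have L[measurable]: "?L \<in> borel_measurable borel"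
      by (intro borel_measurable_continuous_onI linear_continuous_on)
    have "(\<integral>\<^sup>+x. ennreal (cmod (osc (D 0) ?Q F x) powr q) \<partial>\<mu>)
      = (\<integral>\<^sup>+x. ennreal (\<bar>h\<bar> powr q) * ennreal (cmod (osc (G 0) {0..<1} (\<lambda>s. F ((t0 + h) + h * s)) (?L x)) powr q) \<partial>\<mu>)"
      by (simp only: osc_eq ennreal_mult powr_ge_zero)
    also have "\<dots> = ennreal (\<bar>h\<bar> powr q) * (\<integral>\<^sup>+x. ennreal (cmod (osc (G 0) {0..<1} (\<lambda>s. F ((t0 + h) + h * s)) (?L x)) powr q) \<partial>\<mu>)"
      by (intro nn_integral_cmult) measurable
    also have "(\<integral>\<^sup>+x. ennreal (cmod (osc (G 0) {0..<1} (\<lambda>s. F ((t0 + h) + h * s)) (?L x)) powr q) \<partial>\<mu>)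
      = (\<integral>\<^sup>+y. ennreal (cmod (osc (G 0) {0..<1} (\<lambda>s. F ((t0 + h) + h * s)) y) powr q) \<partial>distr \<mu> borel ?L)"
      by (subst nn_integral_distr) measurable
    also have "\<dots> \<le> ennreal (C0 * (Cg * B * \<bar>h\<bar> powr (- Ba)) * Y powr (q / p))"
    proof -
      have "growth \<alpha> (Cg * B * \<bar>h\<bar> powr (- Ba)) (distr \<mu> borel ?L)"
        unfolding Cg_def Ba_def by (rule growth_distr_anisotropic[OF gr \<kappa> h(1)]) (use h \<delta> in simp)
      with est G Lp_on_affine(1)[OF h(1) LFQ] show ?thesis unfolding Y_def by blast
    qed
    also have "ennreal (\<bar>h\<bar> powr q) * ennreal (C0 * (Cg * B * \<bar>h\<bar> powr (- Ba)) * Y powr (q / p))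
      \<le> ennreal (C * \<bar>h\<bar> powr \<theta> * B * X powr (q / p))"
    proof -
      have "Y powr (q / p) \<le> (E * \<bar>h\<bar> powr e1 * X) powr (q / p)"
        using YX Y0 p q0 by (intro powr_mono2) auto
      also have "\<dots> = E powr (q / p) * \<bar>h\<bar> powr (e1 * (q / p)) * X powr (q / p)"
        using E X0 by (simp add: powr_mult powr_powr)
      finally have "\<bar>h\<bar> powr q * (C0 * (Cg * B * \<bar>h\<bar> powr (- Ba)) * Y powr (q / p))
        \<le> \<bar>h\<bar> powr q * (C0 * (Cg * B * \<bar>h\<bar> powr (- Ba)) * (E powr (q / p) * \<bar>h\<bar> powr (e1 * (q / p)) * X powr (q / p)))"
        using C0 Cg B0 by (intro mult_left_mono) auto
      also have "\<dots> = C * (\<bar>h\<bar> powr q * \<bar>h\<bar> powr (- Ba) * \<bar>h\<bar> powr (e1 * (q / p))) * B * X powr (q / p)"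
        by (simp add: C_def)
      also have "\<bar>h\<bar> powr q * \<bar>h\<bar> powr (- Ba) * \<bar>h\<bar> powr (e1 * (q / p)) = \<bar>h\<bar> powr \<theta>"
        by (simp add: \<theta>_def powr_add[symmetric])
      finally show ?thesis
        using C0 Cg B0 by (subst ennreal_mult[symmetric]) (auto intro!: ennreal_leI)
    qed
    finally show "(\<integral>\<^sup>+x. ennreal (cmod (osc (D 0) ?Q (\<lambda>t. f t * of_real (w t)) x) powr q) \<partial>\<mu>)
      \<le> ennreal (C * \<bar>h\<bar> powr \<theta> * B * (LINT t:?Q|lborel. cmod (f t) powr p * w t) powr (q / p))"
      by (simp add: F_def X_def mult_left_mono)
  qed
  with \<theta> \<delta>(1) show ?thesis by blast
qed

section \<open>Weighted spaces and dilations\<close>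

text \<open>Truncation at the level \<open>c\<close> of the larger norm: below it the power is at
  most \<open>c powr r\<close>, above it the exponent may be raised to \<open>s\<close>. An infinite
  norm on the right is trivial because its factor is positive.\<close>

lemma Lp_norm_le_of_le:
  fixes f :: "'a \<Rightarrow> complex" and r A :: real and s :: ereal
  assumes A: "0 \<le> A" "emeasure N (space N) \<le> ennreal A" and f[measurable]: "f \<in> borel_measurable N"
    and r: "0 < r" "ereal r \<le> s"
  shows "Lp_norm (ereal r) N f \<le> ennreal ((1 + A) powr (1 / r)) * Lp_norm s N f"
proof (cases "Lp_norm s N f")
  case top
  then show ?thesis using A(1) by (simp add: ennreal_mult_top)
next
  case (real c)
  define I where "I = (\<integral>\<^sup>+x. ennreal (norm (f x) powr r) \<partial>N)"
  have I_le: "I \<le> ennreal ((1 + A) * c powr r)"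
  proof (cases s)
    case (real s')
    have s': "0 < s'" "r \<le> s'" using r real by auto
    define J where "J = (\<integral>\<^sup>+x. ennreal (norm (f x) powr s') \<partial>N)"
    have Jf: "J \<noteq> \<infinity>" and cJ: "ennreal c = ennreal (enn2real J powr (1 / s'))"
      using \<open>Lp_norm s N f = ennreal c\<close> by (auto simp: Lp_norm_def real J_def Let_def split: if_splits)
    then obtain j where j: "J = ennreal j" "0 \<le> j" by (cases J) auto
    have c: "c = j powr (1 / s')" using cJ \<open>0 \<le> c\<close> j by simp
    show ?thesis
    \<comment> \<open>The level has to be positive, so a vanishing norm is treated apart.\<close>
    proof (cases "j = 0")
      case True
      then have "J = 0" using j(1) by simp
      then have "AE x in N. ennreal (norm (f x) powr s') = 0"
        unfolding J_def by (rule nn_integral_0_iff_AE[THEN iffD1, rotated]) measurable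
      then have "AE x in N. ennreal (norm (f x) powr r) = 0" by eventually_elim (auto simp: ennreal_eq_0_iff)
      then have "I = 0" unfolding I_def by (rule nn_integral_0_iff_AE[THEN iffD2, rotated]) measurable
      then show ?thesis by simp
    next
      case False
      then have c0: "0 < c" using c j by simp
      have "norm (f x) powr r \<le> c powr r + c powr (r - s') * norm (f x) powr s'" for x
      proof (cases "norm (f x) \<le> c")
        case True
        then have "norm (f x) powr r \<le> c powr r" using r by (intro powr_mono2) auto
        then show ?thesis by (intro add_increasing2) auto
      next
        case False
        then have "norm (f x) powr (r - s') \<le> c powr (r - s')" using c0 s' by (intro powr_mono2') auto
        then have "norm (f x) powr (r - s') * norm (f x) powr s' \<le> c powr (r - s') * norm (f x) powr s'"
          by (intro mult_right_mono) auto
        then have "norm (f x) powr r \<le> c powr (r - s') * norm (f x) powr s'" by (simp add: powr_add[symmetric])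
        then show ?thesis by (intro add_increasing) auto
      qed
      then have "I \<le> (\<integral>\<^sup>+x. ennreal (c powr r) + ennreal (c powr (r - s')) * ennreal (norm (f x) powr s') \<partial>N)"
        unfolding I_def by (intro nn_integral_mono) (simp flip: ennreal_mult ennreal_plus)
      also have "\<dots> = ennreal (c powr r) * emeasure N (space N) + ennreal (c powr (r - s')) * J"
        unfolding J_def by (subst nn_integral_add) (auto simp: nn_integral_cmult)
      also have "\<dots> \<le> ennreal (c powr r) * ennreal A + ennreal (c powr (r - s')) * ennreal j"
        using A(2) j(1) by (intro add_mono mult_left_mono) auto
      also have "\<dots> = ennreal (c powr r * A + c powr (r - s') * j)" using A(1) j(2) by (simp add: ennreal_mult)
      also have "j = c powr s'" using s' j(2) by (simp add: c powr_powr)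
      also have "c powr r * A + c powr (r - s') * c powr s' = (1 + A) * c powr r"
        by (simp add: powr_add[symmetric] distrib_right)
      finally show ?thesis .
    qed
  next
    case PInf
    then have "esssup N (\<lambda>x. ennreal (norm (f x))) = ennreal c"
      using \<open>Lp_norm s N f = ennreal c\<close> by (simp add: Lp_norm_def)
    then have "AE x in N. ennreal (norm (f x)) \<le> ennreal c" using esssup_AE[where M=N and f="\<lambda>x. ennreal (norm (f x))"] by simp
    then have "AE x in N. ennreal (norm (f x) powr r) \<le> ennreal (c powr r)"
      by eventually_elim (use r \<open>0 \<le> c\<close> in \<open>auto intro!: ennreal_leI powr_mono2\<close>)
    then have "I \<le> (\<integral>\<^sup>+x. ennreal (c powr r) \<partial>N)" unfolding I_def by (rule nn_integral_mono_AE)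
    also have "\<dots> \<le> ennreal (c powr r) * ennreal A" using A(2) by (simp add: mult_left_mono)
    also have "\<dots> = ennreal (c powr r * A)" using A(1) by (simp add: ennreal_mult)
    also have "\<dots> \<le> ennreal ((1 + A) * c powr r)" by (intro ennreal_leI) (simp add: distrib_right mult.commute)
    finally show ?thesis .
  qed (use r in simp)
  then have If: "I \<noteq> \<infinity>" by (auto simp: top_unique)
  have "enn2real I \<le> (1 + A) * c powr r" using I_le A by (intro enn2real_leI) auto
  then have "enn2real I powr (1 / r) \<le> ((1 + A) * c powr r) powr (1 / r)" using r by (intro powr_mono2) auto
  also have "\<dots> = (1 + A) powr (1 / r) * c" using A r \<open>0 \<le> c\<close> by (simp add: powr_mult powr_powr)
  finally have "ennreal (enn2real I powr (1 / r)) \<le> ennreal ((1 + A) powr (1 / r)) * ennreal c"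
    using \<open>0 \<le> c\<close> by (simp add: ennreal_leI flip: ennreal_mult)
  then show ?thesis using If real by (simp add: Lp_norm_def I_def)
qed

section \<open>Borel representatives and the dilated operator\<close>

lemma borel_measurable_completion_lborel:
  "h \<in> borel_measurable borel \<Longrightarrow> h \<in> borel_measurable (completion lborel)"
  by (intro measurable_completion) simp

context
  fixes \<gamma> g :: "real \<Rightarrow> real ^ 'n::finite" and w v :: "real \<Rightarrow> real"
  assumes g[measurable]: "g \<in> borel_measurable borel" and v[measurable]: "v \<in> borel_measurable borel"
    and \<gamma>g: "\<And>t. t \<in> {0..1} \<Longrightarrow> \<gamma> t = g t" and wv: "\<And>t. t \<in> {0..1} \<Longrightarrow> w t = v t" and v0: "\<And>t. 0 \<le> v t"
begin

text \<open>Membership in the weighted space gives Lebesgue measurability on \<open>{0..1}\<close>,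
  whereas the preceding estimates concern Borel functions on the line; real and imaginary parts are
  therefore changed on a null set.\<close>

lemma borel_representative:
  assumes f: "f \<in> borel_measurable (weighted_measure w)"
  obtains f' where "f' \<in> borel_measurable borel"
    "\<And>\<phi>. \<phi> \<in> borel_measurable borel \<Longrightarrow>
      (\<integral>\<^sup>+t. \<phi> (f t) \<partial>weighted_measure w) = (\<integral>\<^sup>+t. \<phi> (f' t) * ennreal (v t) * indicator {0..1} t \<partial>lborel)"
    "\<And>lam x. osc_op \<gamma> lam w f x = osc g {0..1} (\<lambda>t. f' t * of_real (v t)) (lam *\<^sub>R x)"
proof -
  define f0 where "f0 = (\<lambda>t. if t \<in> {0..1} then f t else 0)"
  have fm: "f \<in> borel_measurable (lebesgue_on {0..1})"
    using f by (simp add: weighted_measure_def cong: measurable_cong_sets)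
  then have f0m[measurable]: "f0 \<in> borel_measurable (completion lborel)"
    unfolding f0_def by (subst borel_measurable_if) auto
  have "(\<lambda>t. Re (f0 t)) \<in> borel_measurable (completion lborel)" by measurable
  from completion_ex_borel_measurable_real[OF this]
  obtain a where a: "a \<in> borel_measurable lborel" "AE t in lborel. Re (f0 t) = a t" by blast
  have "(\<lambda>t. Im (f0 t)) \<in> borel_measurable (completion lborel)" by measurable
  from completion_ex_borel_measurable_real[OF this]
  obtain b where b: "b \<in> borel_measurable lborel" "AE t in lborel. Im (f0 t) = b t" by blast
  define f' where "f' = (\<lambda>t. complex_of_real (a t) + \<i> * complex_of_real (b t))"
  have f'[measurable]: "f' \<in> borel_measurable borel" using a(1) b(1) unfolding f'_def by simp
  have ae: "AE t in lborel. f0 t = f' t"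
    using a(2) b(2) by eventually_elim (simp add: f'_def complex_eq_iff)
  show ?thesis
  proof (rule that[of f', OF f'])
    fix \<phi> :: "complex \<Rightarrow> ennreal" assume [measurable]: "\<phi> \<in> borel_measurable borel"
    have "(\<lambda>t. ennreal (v t)) \<in> borel_measurable (lebesgue_on {0..1})"
      by (rule measurable_restrict_space1[OF borel_measurable_completion_lborel]) measurable
    then have wm: "(\<lambda>t. ennreal (w t)) \<in> borel_measurable (lebesgue_on {0..1})"
      by (subst measurable_cong[where g="\<lambda>t. ennreal (v t)"]) (auto simp: wv)
    have "(\<integral>\<^sup>+t. \<phi> (f t) \<partial>weighted_measure w) = (\<integral>\<^sup>+t. ennreal (w t) * \<phi> (f t) \<partial>lebesgue_on {0..1})"
      unfolding weighted_measure_def by (rule nn_integral_density[OF wm measurable_compose[OF fm]]) measurable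
    also have "\<dots> = (\<integral>\<^sup>+t. ennreal (w t) * \<phi> (f t) * indicator {0..1} t \<partial>completion lborel)"
      by (rule nn_integral_restrict_space) simp
    also have "\<dots> = (\<integral>\<^sup>+t. \<phi> (f0 t) * ennreal (v t) * indicator {0..1} t \<partial>completion lborel)"
      by (intro nn_integral_cong) (auto simp: f0_def wv indicator_def mult.commute)
    also have "\<dots> = (\<integral>\<^sup>+t. \<phi> (f' t) * ennreal (v t) * indicator {0..1} t \<partial>completion lborel)"
      by (intro nn_integral_cong_AE) (use AE_completion[OF ae] in \<open>eventually_elim, simp\<close>)
    finally show "(\<integral>\<^sup>+t. \<phi> (f t) \<partial>weighted_measure w) = (\<integral>\<^sup>+t. \<phi> (f' t) * ennreal (v t) * indicator {0..1} t \<partial>lborel)"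
      by (simp add: nn_integral_completion)
  next
    fix lam x
    define k where "k = (\<lambda>t. indicator {0..1} t * cis ((lam *\<^sub>R x) \<bullet> g t) * complex_of_real (v t))"
    have k: "k \<in> borel_measurable borel" unfolding k_def by measurable
    have "osc_op \<gamma> lam w f x = (LINT t|completion lborel. k t * f0 t)"
      unfolding osc_op_def set_lebesgue_integral_def
      by (intro Bochner_Integration.integral_cong refl) (auto simp: k_def f0_def wv \<gamma>g indicator_def cis_conv_exp)
    also have "\<dots> = (LINT t|completion lborel. k t * f' t)"
    proof (rule integral_cong_AE)
      note b = borel_measurable_completion_lborel
      show "(\<lambda>t. k t * f0 t) \<in> borel_measurable (completion lborel)" by (rule borel_measurable_times[OF b[OF k] f0m])
      show "(\<lambda>t. k t * f' t) \<in> borel_measurable (completion lborel)" by (rule borel_measurable_times[OF b[OF k] b[OF f']])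
      show "AE t in completion lborel. k t * f0 t = k t * f' t"
        using AE_completion[OF ae] by eventually_elim simp
    qed
    also have "\<dots> = (LINT t|lborel. k t * f' t)"
      by (rule integral_completion) (use k f' in simp)
    also have "\<dots> = osc g {0..1} (\<lambda>t. f' t * of_real (v t)) (lam *\<^sub>R x)"
      unfolding osc_def set_lebesgue_integral_def
      by (intro Bochner_Integration.integral_cong refl) (auto simp: k_def indicator_def)
    finally show "osc_op \<gamma> lam w f x = osc g {0..1} (\<lambda>t. f' t * of_real (v t)) (lam *\<^sub>R x)" .
  qed
qed

lemma emeasure_weighted_measure_le:
  assumes vb: "\<And>t. t \<in> {0..1} \<Longrightarrow> v t \<le> b" and b: "0 \<le> b"
  shows "emeasure (weighted_measure w) (space (weighted_measure w)) \<le> ennreal b"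
proof -
  have eq: "(\<integral>\<^sup>+t. 1 \<partial>weighted_measure w) = (\<integral>\<^sup>+t. 1 * ennreal (v t) * indicator {0..1} t \<partial>lborel)"
  proof (rule borel_representative[of "\<lambda>_. 0"], goal_cases)
    case (2 f')
    show ?case by (rule 2(2)) simp
  qed simp
  have "emeasure (weighted_measure w) (space (weighted_measure w)) = (\<integral>\<^sup>+t. 1 \<partial>weighted_measure w)" by simp
  also have "\<dots> \<le> (\<integral>\<^sup>+t. ennreal b * indicator {0..1::real} t \<partial>lborel)"
    unfolding eq by (intro nn_integral_mono) (auto simp: indicator_def vb ennreal_leI)
  also have "\<dots> = ennreal b" by (simp add: nn_integral_cmult)
  finally show ?thesis .
qed

lemma Lp_norm_representative:
  fixes f' :: "real \<Rightarrow> complex"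
  assumes r: "0 < r" and f'[measurable]: "f' \<in> borel_measurable borel"
    and eq: "(\<integral>\<^sup>+t. ennreal (norm (f t) powr r) \<partial>weighted_measure w)
      = (\<integral>\<^sup>+t. ennreal (norm (f' t) powr r) * ennreal (v t) * indicator {0..1} t \<partial>lborel)"
    and fin: "Lp_norm (ereal r) (weighted_measure w) f < \<infinity>"
  shows "set_integrable lborel {0..1} (\<lambda>t. cmod (f' t) powr r * v t)"
    and "Lp_norm (ereal r) (weighted_measure w) f = ennreal ((LINT t:{0..1}|lborel. cmod (f' t) powr r * v t) powr (1 / r))"
    and "0 \<le> (LINT t:{0..1}|lborel. cmod (f' t) powr r * v t)"
proof -
  let ?h = "\<lambda>t. indicat_real {0..1} t *\<^sub>R (cmod (f' t) powr r * v t)"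
  have eq': "(\<integral>\<^sup>+t. ennreal (norm (f t) powr r) \<partial>weighted_measure w) = (\<integral>\<^sup>+t. ennreal (?h t) \<partial>lborel)"
    unfolding eq by (intro nn_integral_cong) (auto simp: indicator_def ennreal_mult v0)
  then have f1: "(\<integral>\<^sup>+t. ennreal (?h t) \<partial>lborel) < \<infinity>"
    using fin by (auto simp: Lp_norm_def Let_def less_top split: if_splits)
  have h0: "0 \<le> ?h t" for t by (simp add: v0)
  have i: "integrable lborel ?h" using f1 h0 by (intro integrableI_nonneg) (auto simp: less_top)
  then show "set_integrable lborel {0..1} (\<lambda>t. cmod (f' t) powr r * v t)" by (simp add: set_integrable_def)
  show X0: "0 \<le> (LINT t:{0..1}|lborel. cmod (f' t) powr r * v t)"
    unfolding set_lebesgue_integral_def by (intro Bochner_Integration.integral_nonneg h0)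
  have "(\<integral>\<^sup>+t. ennreal (?h t) \<partial>lborel) = ennreal (LINT t:{0..1}|lborel. cmod (f' t) powr r * v t)"
    unfolding set_lebesgue_integral_def by (rule nn_integral_eq_integral[OF i]) (rule AE_I2, rule h0)
  with X0 eq' show "Lp_norm (ereal r) (weighted_measure w) f = ennreal ((LINT t:{0..1}|lborel. cmod (f' t) powr r * v t) powr (1 / r))"
    by (simp add: Lp_norm_def)
qed

text \<open>Dilation by \<open>lam\<close> turns the growth constant \<open>B\<close> into
  \<open>B * lam powr - \<alpha>\<close>, which is the whole dependence on the parameter.
  Restriction to balls supplies the finite mass that \<open>growth\<close> demands; monotone
  convergence removes it, since the bound is the same for all balls.\<close>

lemma osc_scaled_bound:
  fixes \<mu> :: "(real ^ 'n) measure" and f :: "real \<Rightarrow> complex"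
  assumes ab: "arc_bound g v \<alpha> r q C {0..1}" and smu: "sets \<mu> = sets borel"
    and B: "0 \<le> B" "\<And>x \<rho>. 0 < \<rho> \<Longrightarrow> emeasure \<mu> (ball x \<rho>) \<le> ennreal (B * \<rho> powr \<alpha>)" and lam: "0 < lam"
    and f[measurable]: "f \<in> borel_measurable borel" and fi: "set_integrable lborel {0..1} (\<lambda>t. cmod (f t) powr r * v t)"
  shows "(\<integral>\<^sup>+x. ennreal (cmod (osc g {0..1} (\<lambda>t. f t * of_real (v t)) (lam *\<^sub>R x)) powr q) \<partial>\<mu>)
    \<le> ennreal (C * (B * lam powr - \<alpha>) * (LINT t:{0..1}|lborel. cmod (f t) powr r * v t) powr (q / r))"
proof -
  note [measurable_cong] = smu
  define H where "H = (\<lambda>y. ennreal (cmod (osc g {0..1} (\<lambda>t. f t * of_real (v t)) y) powr q))"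
  let ?Y = "ennreal (C * (B * lam powr - \<alpha>) * (LINT t:{0..1}|lborel. cmod (f t) powr r * v t) powr (q / r))"
  have "osc g {0..1} (\<lambda>t. f t * of_real (v t)) \<in> borel_measurable borel" by (rule borel_measurable_osc) measurable
  then have [measurable]: "H \<in> borel_measurable borel" unfolding H_def by measurable
  have lm[measurable]: "(\<lambda>x. lam *\<^sub>R x) \<in> borel_measurable (borel :: (real ^ 'n) measure)" by measurable
  have Hm: "(\<lambda>x. H (lam *\<^sub>R x)) \<in> borel_measurable borel" by (rule measurable_compose[OF lm]) measurable
  have ball[measurable]: "ball 0 R \<in> sets (borel :: (real ^ 'n) measure)" for R by simp
  have lm\<mu>: "(\<lambda>x. lam *\<^sub>R x) \<in> borel_measurable \<mu>" and Hm\<mu>[measurable]: "(\<lambda>x. H (lam *\<^sub>R x)) \<in> borel_measurable \<mu>"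
    and ball\<mu>[measurable]: "\<And>R. (indicator (ball 0 R) :: _ \<Rightarrow> ennreal) \<in> borel_measurable \<mu>"
    using lm Hm borel_measurable_indicator[OF ball] by (simp_all cong: measurable_cong_sets add: smu)
  have piece: "(\<integral>\<^sup>+x. indicator (ball 0 (Suc n)) x * H (lam *\<^sub>R x) \<partial>\<mu>) \<le> ?Y" for n
  proof -
    let ?S = "ball 0 (real (Suc n)) :: (real ^ 'n) set"
    define \<nu> where "\<nu> = distr (density \<mu> (indicator ?S)) borel (\<lambda>x. lam *\<^sub>R x)"
    have em: "emeasure \<nu> A = emeasure \<mu> (?S \<inter> (\<lambda>x. lam *\<^sub>R x) -` A)" if A: "A \<in> sets borel" for A
    proof -
      have pre: "(\<lambda>x. lam *\<^sub>R x) -` A \<in> sets \<mu>"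
        using measurable_sets[of "\<lambda>x. lam *\<^sub>R x" borel borel A] A by (simp add: smu)
      have "emeasure \<nu> A = emeasure (density \<mu> (indicator ?S)) ((\<lambda>x. lam *\<^sub>R x) -` A \<inter> space (density \<mu> (indicator ?S)))"
        unfolding \<nu>_def using A by (intro emeasure_distr) auto
      also have "(\<lambda>x. lam *\<^sub>R x) -` A \<inter> space (density \<mu> (indicator ?S)) = (\<lambda>x. lam *\<^sub>R x) -` A"
        using sets_eq_imp_space_eq[OF smu] by simp
      also have "emeasure (density \<mu> (indicator ?S)) ((\<lambda>x. lam *\<^sub>R x) -` A) = emeasure \<mu> (?S \<inter> (\<lambda>x. lam *\<^sub>R x) -` A)"
        by (rule emeasure_restricted) (use pre smu in auto)
      finally show ?thesis .
    qed
    have "growth \<alpha> (B * lam powr - \<alpha>) \<nu>"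
      unfolding growth_def
    proof (intro conjI allI impI)
      show "sets \<nu> = sets borel" by (simp add: \<nu>_def)
      show "0 \<le> B * lam powr - \<alpha>" using B by simp
      show "finite_measure \<nu>"
      proof
        have "emeasure \<nu> (space \<nu>) \<le> emeasure \<mu> ?S"
          by (subst em) (auto simp: \<nu>_def smu intro!: emeasure_mono)
        also have "\<dots> \<le> ennreal (B * real (Suc n) powr \<alpha>)" by (rule B(2)) simp
        finally show "emeasure \<nu> (space \<nu>) \<noteq> \<infinity>" by (auto simp: top_unique)
      qed
      fix x :: "real ^ 'n" and \<rho> :: real assume \<rho>: "0 < \<rho>"
      have "emeasure \<nu> (ball x \<rho>) \<le> emeasure \<mu> (ball (x /\<^sub>R lam) (\<rho> / lam))"
      proof (subst em)
        show "emeasure \<mu> (?S \<inter> (\<lambda>x. lam *\<^sub>R x) -` ball x \<rho>) \<le> emeasure \<mu> (ball (x /\<^sub>R lam) (\<rho> / lam))"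
        proof (rule emeasure_mono)
          show "?S \<inter> (\<lambda>x. lam *\<^sub>R x) -` ball x \<rho> \<subseteq> ball (x /\<^sub>R lam) (\<rho> / lam)"
          proof
            fix y assume "y \<in> ?S \<inter> (\<lambda>x. lam *\<^sub>R x) -` ball x \<rho>"
            then have "norm (x - lam *\<^sub>R y) < \<rho>" by (simp add: dist_norm)
            moreover have "x - lam *\<^sub>R y = lam *\<^sub>R (x /\<^sub>R lam - y)" using lam by (simp add: scaleR_right_diff_distrib)
            ultimately have "lam * norm (x /\<^sub>R lam - y) < \<rho>" using lam by simp
            then show "y \<in> ball (x /\<^sub>R lam) (\<rho> / lam)" using lam by (simp add: dist_norm pos_less_divide_eq mult.commute)
          qed
        qed (simp add: smu)
      qed simp
      also have "\<dots> \<le> ennreal (B * (\<rho> / lam) powr \<alpha>)" using lam \<rho> by (intro B(2)) simp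
      also have "B * (\<rho> / lam) powr \<alpha> = B * lam powr - \<alpha> * \<rho> powr \<alpha>"
        using lam \<rho> by (simp add: powr_divide powr_minus_divide)
      finally show "emeasure \<nu> (ball x \<rho>) \<le> ennreal (B * lam powr - \<alpha> * \<rho> powr \<alpha>)" .
    qed
    then have "(\<integral>\<^sup>+y. H y \<partial>\<nu>) \<le> ?Y" using ab f fi unfolding arc_bound_def H_def by blast
    moreover have "(\<integral>\<^sup>+y. H y \<partial>\<nu>) = (\<integral>\<^sup>+x. indicator ?S x * H (lam *\<^sub>R x) \<partial>\<mu>)"
    proof -
      have "(\<lambda>x. lam *\<^sub>R x) \<in> borel_measurable (density \<mu> (indicator ?S))" using lm\<mu> by simp
      then have "(\<integral>\<^sup>+y. H y \<partial>\<nu>) = (\<integral>\<^sup>+x. H (lam *\<^sub>R x) \<partial>density \<mu> (indicator ?S))"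
        unfolding \<nu>_def by (rule nn_integral_distr) measurable
      also have "\<dots> = (\<integral>\<^sup>+x. indicator ?S x * H (lam *\<^sub>R x) \<partial>\<mu>)"
        by (rule nn_integral_density) (rule ball\<mu> Hm\<mu>)+
      finally show ?thesis .
    qed
    ultimately show ?thesis by simp
  qed
  have "(\<integral>\<^sup>+x. H (lam *\<^sub>R x) \<partial>\<mu>) = (\<integral>\<^sup>+x. (SUP n. indicator (ball 0 (Suc n)) x * H (lam *\<^sub>R x)) \<partial>\<mu>)"
  proof (intro nn_integral_cong antisym)
    fix x :: "real ^ 'n"
    obtain n where "norm x < real (Suc n)" using reals_Archimedean2[of "norm x"] by (metis less_Suc_eq of_nat_less_iff order_less_trans lessI)
    then show "H (lam *\<^sub>R x) \<le> (SUP n. indicator (ball 0 (Suc n)) x * H (lam *\<^sub>R x))"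
      by (intro SUP_upper2[of n]) auto
    show "(SUP n. indicator (ball 0 (Suc n)) x * H (lam *\<^sub>R x)) \<le> H (lam *\<^sub>R x)"
      by (intro SUP_least) (auto simp: indicator_def)
  qed
  also have "\<dots> = (SUP n. \<integral>\<^sup>+x. indicator (ball 0 (Suc n)) x * H (lam *\<^sub>R x) \<partial>\<mu>)"
  proof (rule nn_integral_monotone_convergence_SUP)
    show "incseq (\<lambda>n x. indicator (ball 0 (Suc n)) x * H (lam *\<^sub>R x))"
      by (intro incseq_SucI le_funI) (auto simp: indicator_def)
  qed (rule borel_measurable_times_ennreal[OF ball\<mu> Hm\<mu>])
  also have "\<dots> \<le> ?Y" by (intro SUP_least piece)
  finally show ?thesis by (simp add: H_def)
qed

lemma osc_op_Lp_bound:
  fixes \<mu> :: "(real ^ 'n) measure"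
  assumes ab: "arc_bound g v \<alpha> r q C {0..1}" and smu: "sets \<mu> = sets borel"
    and B: "0 \<le> B" "\<And>x \<rho>. 0 < \<rho> \<Longrightarrow> emeasure \<mu> (ball x \<rho>) \<le> ennreal (B * \<rho> powr \<alpha>)" and lam: "0 < lam"
    and rq: "0 < r" "0 < q" and f: "f \<in> borel_measurable (weighted_measure w)"
    and fin: "Lp_norm (ereal r) (weighted_measure w) f < \<infinity>"
  shows "Lp_norm (ereal q) \<mu> (osc_op \<gamma> lam w f)
    \<le> ennreal ((C * B) powr (1 / q) * lam powr (- (\<alpha> / q))) * Lp_norm (ereal r) (weighted_measure w) f"
proof -
  have C0: "0 \<le> C" using ab by (simp add: arc_bound_def)
  obtain f' where f': "f' \<in> borel_measurable borel"
    and nn: "\<And>\<phi>. \<phi> \<in> borel_measurable borel \<Longrightarrow>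
      (\<integral>\<^sup>+t. \<phi> (f t) \<partial>weighted_measure w) = (\<integral>\<^sup>+t. \<phi> (f' t) * ennreal (v t) * indicator {0..1} t \<partial>lborel)"
    and op: "\<And>lam x. osc_op \<gamma> lam w f x = osc g {0..1} (\<lambda>t. f' t * of_real (v t)) (lam *\<^sub>R x)"
  proof (rule borel_representative[OF f], goal_cases)
    case (1 f')
    show ?case by (rule 1(1)[OF 1(2-4)])
  qed
  have eq: "(\<integral>\<^sup>+t. ennreal (norm (f t) powr r) \<partial>weighted_measure w)
      = (\<integral>\<^sup>+t. ennreal (norm (f' t) powr r) * ennreal (v t) * indicator {0..1} t \<partial>lborel)"
    by (rule nn) measurable
  note rep = Lp_norm_representative[OF rq(1) f' eq fin]
  define X where "X = (LINT t:{0..1}|lborel. cmod (f' t) powr r * v t)"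
  define J where "J = (\<integral>\<^sup>+x. ennreal (norm (osc_op \<gamma> lam w f x) powr q) \<partial>\<mu>)"
  have J: "J \<le> ennreal (C * (B * lam powr - \<alpha>) * X powr (q / r))"
    unfolding J_def op X_def by (rule osc_scaled_bound[OF ab smu B lam f' rep(1)])
  then have "J \<noteq> \<infinity>" by (auto simp: top_unique)
  have "enn2real J \<le> C * (B * lam powr - \<alpha>) * X powr (q / r)" using J C0 B by (intro enn2real_leI) auto
  then have "enn2real J powr (1 / q) \<le> (C * B * lam powr - \<alpha> * X powr (q / r)) powr (1 / q)"
    using rq by (intro powr_mono2) (auto simp: mult.assoc)
  also have "\<dots> = (C * B) powr (1 / q) * lam powr (- (\<alpha> / q)) * X powr (1 / r)"
    using C0 B rq rep(3) by (simp add: powr_mult powr_powr X_def)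
  finally have "ennreal (enn2real J powr (1 / q)) \<le> ennreal ((C * B) powr (1 / q) * lam powr (- (\<alpha> / q)) * X powr (1 / r))"
    by (rule ennreal_leI)
  then show ?thesis using \<open>J \<noteq> \<infinity>\<close> unfolding rep(2)
    by (simp add: Lp_norm_def J_def[symmetric] X_def ennreal_mult)
qed

text \<open>Serves the case \<open>q = \<infinity>\<close>, in which there is no decay in
  \<open>lam\<close> to prove: the phase has modulus 1.\<close>

lemma osc_op_sup_bound:
  fixes \<mu> :: "(real ^ 'n) measure"
  assumes smu: "sets \<mu> = sets borel" and f: "f \<in> borel_measurable (weighted_measure w)"
    and vb: "\<And>t. t \<in> {0..1} \<Longrightarrow> v t \<le> b"
    and fin: "Lp_norm (ereal 1) (weighted_measure w) f < \<infinity>"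
  shows "Lp_norm \<infinity> \<mu> (osc_op \<gamma> lam w f) \<le> Lp_norm (ereal 1) (weighted_measure w) f"
proof -
  note [measurable_cong] = smu
  obtain f' where f'[measurable]: "f' \<in> borel_measurable borel"
    and nn: "\<And>\<phi>. \<phi> \<in> borel_measurable borel \<Longrightarrow>
      (\<integral>\<^sup>+t. \<phi> (f t) \<partial>weighted_measure w) = (\<integral>\<^sup>+t. \<phi> (f' t) * ennreal (v t) * indicator {0..1} t \<partial>lborel)"
    and op: "\<And>lam x. osc_op \<gamma> lam w f x = osc g {0..1} (\<lambda>t. f' t * of_real (v t)) (lam *\<^sub>R x)"
  proof (rule borel_representative[OF f], goal_cases)
    case (1 f')
    show ?case by (rule 1(1)[OF 1(2-4)])
  qed
  have eq: "(\<integral>\<^sup>+t. ennreal (norm (f t) powr 1) \<partial>weighted_measure w)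
      = (\<integral>\<^sup>+t. ennreal (norm (f' t) powr 1) * ennreal (v t) * indicator {0..1} t \<partial>lborel)"
    by (rule nn) measurable
  note rep = Lp_norm_representative[OF zero_less_one f' eq fin]
  have i: "set_integrable lborel {0..1} (\<lambda>t. f' t * of_real (v t))"
    by (rule weighted_integrable[OF g v v0 vb order_refl zero_less_one f' rep(1)]) auto
  have om: "osc g {0..1} (\<lambda>t. f' t * of_real (v t)) \<in> borel_measurable borel" by (rule borel_measurable_osc) measurable
  have "esssup \<mu> (\<lambda>x. ennreal (norm (osc_op \<gamma> lam w f x))) \<le> ennreal (LINT t:{0..1}|lborel. cmod (f' t * of_real (v t)))"
  proof (rule esssup_I)
    show "(\<lambda>x. ennreal (norm (osc_op \<gamma> lam w f x))) \<in> borel_measurable \<mu>"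
    proof -
      have "(\<lambda>x. ennreal (norm (osc_op \<gamma> lam w f x))) \<in> borel_measurable borel"
        unfolding op
        by (rule measurable_compose[OF measurable_compose[OF _ om]]) measurable
      then show ?thesis by (simp cong: measurable_cong_sets add: smu)
    qed
    show "AE x in \<mu>. ennreal (norm (osc_op \<gamma> lam w f x)) \<le> ennreal (LINT t:{0..1}|lborel. cmod (f' t * of_real (v t)))"
      unfolding op by (intro AE_I2 ennreal_leI norm_osc_le i)
  qed
  also have "(LINT t:{0..1}|lborel. cmod (f' t * of_real (v t))) = (LINT t:{0..1}|lborel. cmod (f' t) powr 1 * v t)"
    by (simp add: norm_mult v0)
  finally show ?thesis using rep(3) unfolding rep(2) by (simp add: Lp_norm_def)
qed

end

theorem theorem1p3:
  fixes \<gamma> :: "real \<Rightarrow> real ^ 'n" and \<alpha> :: real and \<mu> :: "(real ^ 'n) measure" and p q :: ereal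
  assumes "CARD('n) \<ge> 2"
    and "smooth_curve \<gamma>"
    and "0 < \<alpha>" and "\<alpha> \<le> real CARD('n)"
    and "sets \<mu> = sets borel"
    and "\<exists>C::real. \<forall>x. \<forall>\<rho>>0. emeasure \<mu> (ball x \<rho>) \<le> ennreal (C * \<rho> powr \<alpha>)"
    and "finite_type \<gamma>"
    and "1 \<le> p" and "1 \<le> q"
    and "ereal (real CARD('n)) / q \<le> 1 - 1 / p"
    and "q \<ge> ereal (2 * real CARD('n))"
    and "ereal (beta_exp CARD('n) \<alpha>) / q + 1 / p < 1"
    and "q > ereal (beta_exp CARD('n) \<alpha> + 1)"
  shows "\<exists>C::real. C \<ge> 0 \<and> (\<forall>lam::real. lam \<ge> 1 \<longrightarrow>
    (\<forall>f \<in> Lp_space p (weighted_measure (curve_weight \<gamma> \<alpha>)).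
      Lp_norm q \<mu> (osc_op \<gamma> lam (curve_weight \<gamma> \<alpha>) f)
        \<le> ennreal (C * lam powr (- real_of_ereal (ereal \<alpha> / q)))
          * Lp_norm p (weighted_measure (curve_weight \<gamma> \<alpha>)) f))"
proof -
  let ?d = "CARD('n)"
  let ?\<beta> = "beta_exp ?d \<alpha>"
  let ?w = "curve_weight \<gamma> \<alpha>"
  let ?N = "weighted_measure ?w"
  note d2 = assms(1) and smooth = assms(2) and \<alpha> = assms(3,4) and smu = assms(5) and p1 = assms(8)
  \<comment> \<open>The enumeration inside \<open>curve_det\<close>, so that the two determinants
    differ by a transposition of the matrix.\<close>
  define rk :: "'n \<Rightarrow> nat" where "rk = (\<lambda>j. Suc (to_nat_on UNIV j))"
  have rk: "bij_betw rk UNIV {1..?d}"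
  proof -
    have "bij_betw (to_nat_on (UNIV :: 'n set)) UNIV {..<?d}" by (rule to_nat_on_finite) simp
    moreover have "bij_betw Suc {..<?d} {1..?d}" by (rule bij_betw_imageI) (auto simp: image_Suc_lessThan)
    ultimately have "bij_betw (Suc \<circ> to_nat_on (UNIV :: 'n set)) UNIV {1..?d}" by (rule bij_betw_trans)
    then show ?thesis by (simp add: rk_def o_def)
  qed
  \<comment> \<open>Clamping the parameter extends the derivatives continuously, hence Borel
    measurably, to the line without changing them on \<open>{0..1}\<close>.\<close>
  define D where "D = (\<lambda>k t. curve_deriv k \<gamma> (max 0 (min 1 t)))"
  have D_eq: "D k t = curve_deriv k \<gamma> t" if "t \<in> {0..1}" for k t using that by (simp add: D_def)
  have deriv: "(curve_deriv k \<gamma> has_vector_derivative curve_deriv (Suc k) \<gamma> t) (at t within {0..1})" if "t \<in> {0..1}" for k t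
  proof -
    have "curve_deriv k \<gamma> differentiable (at t within {0..1})"
      using smooth that by (auto simp: smooth_curve_def differentiable_on_def)
    then show ?thesis by (simp add: vector_derivative_works curve_deriv_def)
  qed
  have D_deriv: "(D k has_vector_derivative D (Suc k) t) (at t within {0..1})" if "t \<in> {0..1}" for k t
    unfolding D_eq[OF that] by (rule has_vector_derivative_transform[OF that D_eq deriv[OF that]])
  have D_cont: "continuous_on UNIV (D k)" for k
    unfolding D_def
  proof (rule continuous_on_compose2[of "{0..1}" "curve_deriv k \<gamma>"])
    show "continuous_on {0..1} (curve_deriv k \<gamma>)"
      using deriv by (meson continuous_on_eq_continuous_within has_vector_derivative_continuous)
  qed (auto intro!: continuous_intros)
  have D0: "D 0 \<in> borel_measurable borel" by (rule borel_measurable_continuous_onI[OF D_cont])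
  have sm: "smooth_derivs D" using D0 D_deriv by (simp add: smooth_derivs_def)
  have D0_eq: "\<gamma> t = D 0 t" if "t \<in> {0..1}" for t using D_eq[OF that, of 0] by (simp add: curve_deriv_def)
  have curve_det_eq: "curve_det a \<gamma> t = det ((\<chi> i. D (a (rk i)) t) :: real ^ 'n ^ 'n)" if "t \<in> {0..1}" for a t
  proof -
    have "(\<chi> i j. curve_deriv (a (rk j)) \<gamma> t $ i) = transpose ((\<chi> i. D (a (rk i)) t) :: real ^ 'n ^ 'n)"
      by (simp add: transpose_def D_eq[OF that])
    then show ?thesis by (simp add: curve_det_def rk_def det_transpose)
  qed
  obtain m where m: "?\<beta> = real (\<Sum>i\<in>UNIV. rk i - m) + real m * \<alpha>" and \<beta>0: "0 < ?\<beta>"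
    using beta_exp_eq[OF rk \<alpha>] by blast
  define v where "v = (\<lambda>t. \<bar>det ((\<chi> i. D (rk i) t) :: real ^ 'n ^ 'n)\<bar> powr (1 / ?\<beta>))"
  have det_cont: "continuous_on UNIV (\<lambda>t. \<bar>det ((\<chi> i. D (rk i) t) :: real ^ 'n ^ 'n)\<bar>)"
    by (intro continuous_intros D_cont)
  have v: "v \<in> borel_measurable borel"
  proof -
    have "(\<lambda>t. \<bar>det ((\<chi> i. D (rk i) t) :: real ^ 'n ^ 'n)\<bar>) \<in> borel_measurable borel"
      by (rule borel_measurable_continuous_onI[OF det_cont])
    then show ?thesis unfolding v_def by measurable
  qed
  have v0: "0 \<le> v t" for t by (simp add: v_def)
  obtain b where b: "0 \<le> b" and vb: "\<And>t. t \<in> {0..1} \<Longrightarrow> v t \<le> b"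
  proof -
    have "compact ((\<lambda>t. \<bar>det ((\<chi> i. D (rk i) t) :: real ^ 'n ^ 'n)\<bar>) ` {0..1})"
      by (intro compact_continuous_image continuous_on_subset[OF det_cont]) auto
    from compact_imp_bounded[OF this]
    obtain b0 where "\<forall>x\<in>(\<lambda>t. \<bar>det ((\<chi> i. D (rk i) t) :: real ^ 'n ^ 'n)\<bar>) ` {0..1}. norm x \<le> b0" unfolding bounded_iff ..
    then have "v t \<le> b0 powr (1 / ?\<beta>)" if "t \<in> {0..1}" for t
      using that \<beta>0 unfolding v_def by (intro powr_mono2) auto
    then show ?thesis by (intro that[of "b0 powr (1 / ?\<beta>)"]) auto
  qed
  have wv: "?w t = v t" if "t \<in> {0..1}" for t
    using curve_det_eq[OF that, of "\<lambda>i. i"] by (simp add: curve_weight_def v_def)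
  obtain B where B: "0 \<le> B" "\<And>x \<rho>. 0 < \<rho> \<Longrightarrow> emeasure \<mu> (ball x \<rho>) \<le> ennreal (B * \<rho> powr \<alpha>)"
  proof -
    from assms(6) obtain B0 where B0: "\<And>x \<rho>. 0 < \<rho> \<Longrightarrow> emeasure \<mu> (ball x \<rho>) \<le> ennreal (B0 * \<rho> powr \<alpha>)" by blast
    \<comment> \<open>\<open>ennreal\<close> sends negative numbers to 0, so the constant may be
      taken nonnegative.\<close>
    have "emeasure \<mu> (ball x \<rho>) \<le> ennreal (max B0 0 * \<rho> powr \<alpha>)" if "0 < \<rho>" for x \<rho>
      using B0[OF that, of x] by (rule order_trans) (intro ennreal_leI mult_right_mono, auto)
    then show ?thesis by (intro that[of "max B0 0"]) auto
  qed
  have N_fin: "emeasure ?N (space ?N) \<le> ennreal b"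
    by (rule emeasure_weighted_measure_le[OF D0 v D0_eq wv v0 vb b])
  show ?thesis
  proof (cases q)
    case PInf
    \<comment> \<open>Here \<open>\<alpha> / q = 0\<close>, and the trivial bound follows after
      passing from \<open>p\<close> to exponent 1.\<close>
    have sup: "Lp_norm q \<mu> (osc_op \<gamma> lam ?w f) \<le> ennreal ((1 + b) powr (1 / 1) * lam powr (- real_of_ereal (ereal \<alpha> / q))) * Lp_norm p ?N f"
      if lam: "1 \<le> lam" and f: "f \<in> Lp_space p ?N" for lam f
    proof -
      have fm: "f \<in> borel_measurable ?N" and ff: "Lp_norm p ?N f < \<infinity>" using f by (auto simp: Lp_space_def)
      have le: "Lp_norm (ereal 1) ?N f \<le> ennreal ((1 + b) powr (1 / 1)) * Lp_norm p ?N f"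
        by (rule Lp_norm_le_of_le[OF b N_fin fm]) (use p1 in \<open>simp_all add: one_ereal_def\<close>)
      then have fin: "Lp_norm (ereal 1) ?N f < \<infinity>" using ff by (auto simp: ennreal_mult_less_top intro: le_less_trans)
      have "Lp_norm q \<mu> (osc_op \<gamma> lam ?w f) \<le> Lp_norm (ereal 1) ?N f"
        unfolding PInf by (rule osc_op_sup_bound[OF D0 v D0_eq wv v0 smu fm vb fin])
      also note le
      finally show ?thesis using lam PInf by simp
    qed
    show ?thesis by (rule exI[of _ "(1 + b) powr (1 / 1)"]) (use sup in auto)
  next
    case (real q')
    have q2: "2 * real ?d \<le> q'" and q\<beta>: "?\<beta> + 1 < q'" using assms(11,13) real by simp_all
    have q0: "0 < q'" using q\<beta> \<beta>0 by simp
    \<comment> \<open>The exponent for which the estimate is proved: \<open>p\<close> if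
      \<open>p \<le> q\<close>, otherwise \<open>q\<close>. In the second case the two conditions on
      \<open>r\<close> follow from \<open>2 * d \<le> q\<close> and
      \<open>\<beta> + 1 < q\<close>.\<close>
    obtain r where r: "ereal r \<le> p" "1 < r" "r \<le> q'" "real ?d / q' \<le> 1 - 1 / r" "?\<beta> / q' + 1 / r < 1"
    proof (cases "p \<le> q")
      case True
      then obtain p' where p': "p = ereal p'" using p1 real by (cases p) auto
      have "1 \<le> p'" "p' \<le> q'" using p1 True real p' by (simp_all add: one_ereal_def)
      moreover have "real ?d / q' \<le> 1 - 1 / p'" "?\<beta> / q' + 1 / p' < 1"
        using assms(10,12) \<open>1 \<le> p'\<close> q0 by (simp_all add: real p' one_ereal_def)
      \<comment> \<open>Positivity of \<open>\<beta> / q\<close> excludes the end point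
        \<open>p = 1\<close>.\<close>
      moreover have "0 < ?\<beta> / q'" using \<beta>0 q0 by simp
      then have "1 / p' < 1" using \<open>?\<beta> / q' + 1 / p' < 1\<close> by linarith
      then have "1 < p'" using \<open>1 \<le> p'\<close> by simp
      ultimately show ?thesis by (intro that[of p']) (auto simp: p')
    next
      case False
      show ?thesis
      proof (rule that[of q'])
        show "ereal q' \<le> p" using False real by simp
        show "1 < q'" using q\<beta> \<beta>0 by simp
        have "real ?d + 1 \<le> q'" using q2 d2 by simp
        then show "real ?d / q' \<le> 1 - 1 / q'" using q0 by (simp add: field_simps)
        show "?\<beta> / q' + 1 / q' < 1" using q\<beta> q0 by (simp add: field_simps)
      qed simp
    qed
    have "\<exists>C. arc_bound (D 0) v \<alpha> r q' C {0..1}"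
    proof (rule arc_bound_compact[OF D0 v v0 vb _ q0])
      show "1 \<le> r" using r by simp
      fix t0 :: real assume t0: "t0 \<in> {0..1}"
      from assms(7) t0 obtain a :: "nat \<Rightarrow> nat" where a: "\<forall>i\<in>{1..?d}. 0 < a i" "curve_det a \<gamma> t0 \<noteq> 0"
        unfolding finite_type_def finite_type_at_def by blast
      have "0 < a (rk i)" for i using a(1) bij_betwE[OF rk] by blast
      moreover have "det ((\<chi> i. D (a (rk i)) t0) :: real ^ 'n ^ 'n) \<noteq> 0" using a(2) by (simp add: curve_det_eq[OF t0])
      moreover have "v t = \<bar>det ((\<chi> i. D (rk i) t) :: real ^ 'n ^ 'n)\<bar> powr (1 / ?\<beta>)" for t by (simp add: v_def)
      ultimately show "\<exists>C \<theta> \<delta>. 0 < \<theta> \<and> 0 < \<delta> \<and> (\<forall>h. h \<noteq> 0 \<longrightarrow> \<bar>h\<bar> \<le> \<delta> \<longrightarrow> t0 + h \<in> {0..1} \<longrightarrow> t0 + 2 * h \<in> {0..1} \<longrightarrow>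
          arc_bound (D 0) v \<alpha> r q' (C * \<bar>h\<bar> powr \<theta>) {t. (t - t0) / h \<in> {1..<2}})"
        using r q2 \<alpha> \<beta>0 by (intro finite_type_local_bound[OF rk sm t0 _ _ _ _ _ _ _ m _ _ v]) auto
    qed
    then obtain C where C: "arc_bound (D 0) v \<alpha> r q' C {0..1}" ..
    \<comment> \<open>The second factor pays for passing from exponent \<open>p\<close> to
      \<open>r\<close> on a measure of total mass at most \<open>b\<close>.\<close>
    define K where "K = (C * B) powr (1 / q') * (1 + b) powr (1 / r)"
    have bound: "Lp_norm q \<mu> (osc_op \<gamma> lam ?w f) \<le> ennreal (K * lam powr (- real_of_ereal (ereal \<alpha> / q))) * Lp_norm p ?N f"
      if lam: "1 \<le> lam" and f: "f \<in> Lp_space p ?N" for lam f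
    proof -
      have fm: "f \<in> borel_measurable ?N" and ff: "Lp_norm p ?N f < \<infinity>" using f by (auto simp: Lp_space_def)
      have le: "Lp_norm (ereal r) ?N f \<le> ennreal ((1 + b) powr (1 / r)) * Lp_norm p ?N f"
        by (rule Lp_norm_le_of_le[OF b N_fin fm _ r(1)]) (use r in simp)
      then have fin: "Lp_norm (ereal r) ?N f < \<infinity>" using ff by (auto simp: ennreal_mult_less_top intro: le_less_trans)
      have "Lp_norm q \<mu> (osc_op \<gamma> lam ?w f) \<le> ennreal ((C * B) powr (1 / q') * lam powr (- (\<alpha> / q'))) * Lp_norm (ereal r) ?N f"
        unfolding real by (rule osc_op_Lp_bound[OF D0 v D0_eq wv v0 C smu B _ _ q0 fm fin]) (use lam r in simp_all)
      also have "\<dots> \<le> ennreal ((C * B) powr (1 / q') * lam powr (- (\<alpha> / q'))) * (ennreal ((1 + b) powr (1 / r)) * Lp_norm p ?N f)"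
        by (intro mult_left_mono le) simp
      also have "\<dots> = ennreal (K * lam powr (- (\<alpha> / q'))) * Lp_norm p ?N f"
      proof -
        have e: "K * lam powr (- (\<alpha> / q')) = (C * B) powr (1 / q') * lam powr (- (\<alpha> / q')) * (1 + b) powr (1 / r)" by (simp add: K_def)
        show ?thesis unfolding e by (simp add: ennreal_mult mult.assoc)
      qed
      finally show ?thesis using real q0 by simp
    qed
    show ?thesis by (rule exI[of _ K]) (use bound in \<open>auto simp: K_def\<close>)
  qed (use assms(9) in simp)
qed

end
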